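(* Let $A$ be a local Noetherian domain, not a DVR, that is tightly dominated by a DVR $V$. Let $F$ denote the quotient field of $A$, and let $P$ be the kernel of the canonical homomorphism $\widehat A\to\widehat V$. Then $P\cap A=0$ and the following statements are equivalent for any ring $R$ properly between $A$ and $V$. (1) $R$ is a bad stable ring (necessarily Noetherian) tightly dominating $A$. (2) $R=F\cap(\widehat A/J)$ for some $P$-primary ideal $J$ of $\widehat A$ containing $P^2$. Moreover, every bad stable domain between $A$ and $V$ tightly dominating $A$ contains the bad Noetherian stable domain $F\cap(\widehat A/P^{(2)})$, where $P^{(2)}$ is the second symbolic power of $P$.
   Context: All rings are commutative with identity. A quasilocal ring is a ring with a unique maximal ideal (not necessarily Noetherian). $\widehat A$ and $\widehat V$ denote the completions of $A$ and $V$ in the topologies given by powers of their maximal ideals, and $A$ is identified with its image in $\widehat A$. With $\mathfrak m$ the maximal ideal of $A$ and $A\subseteq R$ an extension of quasilocal domains: $R$ birationally dominates $A$ if $A$ and $R$ have the same quotient field and $\mathfrak m$ is contained in the maximal ideal of $R$; $R$ finitely dominates $A$ if $R$ birationally dominates $A$ and $R/\mathfrak mR$ is a finite $A$-module; $R$ tightly dominates $A$ if $R$ finitely dominates $A$ and $R=A+\mathfrak mR$. If $I$ is an ideal of $\widehat A$ every associated prime of which contracts to $0$ in $A$, then $A$ embeds in $\widehat A/I$, $F$ embeds in the total quotient ring of $\widehat A/I$, and $F\cap(\widehat A/I)=\{a/b\in F: a,b\in A,\ b\neq 0,\ a\in b\widehat A+I\}$. An ideal is stable if it is projective over its ring of endomorphisms;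 a domain is stable if every nonzero ideal is stable. A ring has finite normalization if its integral closure in its total ring of quotients is a finite module over it. A bad stable domain (bad stable ring) is a quasilocal stable domain of Krull dimension $1$ that does not have finite normalization; it is a bad Noetherian stable domain if it is also Noetherian. *)

theory Defs
  imports "HOL-Algebra.Polynomials" "HOL-Algebra.Ideal_Product" "HOL-Algebra.Module"
    "HOL-Library.Extended_Nat"
begin

text \<open>
  A subring \<open>A\<close> of an ambient field \<open>K\<close> is given by its carrier set; as a ring in its own
  right it is \<open>sub K A\<close>.
\<close>

abbreviation sub :: "('a, 'm) ring_scheme \<Rightarrow> 'a set \<Rightarrow> ('a, 'm) ring_scheme"
  where "sub K A \<equiv> K\<lparr>carrier := A\<rparr>"


section \<open>Local rings, dimension, discrete valuation rings\<close>

definition quasilocal :: "('a, 'm) ring_scheme \<Rightarrow> bool"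
  where "quasilocal R \<longleftrightarrow> cring R \<and> (\<exists>!M. maximalideal M R)"

definition max_ideal :: "('a, 'm) ring_scheme \<Rightarrow> 'a set"
  where "max_ideal R = (THE M. maximalideal M R)"

definition local_noetherian_domain :: "('a, 'm) ring_scheme \<Rightarrow> bool"
  where "local_noetherian_domain R \<longleftrightarrow> noetherian_domain R \<and> quasilocal R"

definition DVR :: "('a, 'm) ring_scheme \<Rightarrow> bool"
  where "DVR R \<longleftrightarrow> principal_domain R \<and> quasilocal R \<and> \<not> field R"

definition krull_dim :: "('a, 'm) ring_scheme \<Rightarrow> enat"
  where "krull_dim R = Sup {enat n | n.
    \<exists>p. (\<forall>i\<le>n. primeideal (p i) R) \<and> (\<forall>i<n. p i \<subset> p (Suc i))}"


section \<open>Powers of ideals, primary ideals, symbolic powers\<close>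

definition ideal_power :: "('a, 'm) ring_scheme \<Rightarrow> 'a set \<Rightarrow> nat \<Rightarrow> 'a set"
  where "ideal_power R I n = I [^]\<^bsub>ideals_set R\<^esub> n"

definition ideal_radical :: "('a, 'm) ring_scheme \<Rightarrow> 'a set \<Rightarrow> 'a set"
  where "ideal_radical R I = {x \<in> carrier R. \<exists>n::nat. x [^]\<^bsub>R\<^esub> n \<in> I}"

definition primary_ideal :: "('a, 'm) ring_scheme \<Rightarrow> 'a set \<Rightarrow> bool"
  where "primary_ideal R Q \<longleftrightarrow> ideal Q R \<and> Q \<noteq> carrier R \<and>
    (\<forall>x\<in>carrier R. \<forall>y\<in>carrier R. x \<otimes>\<^bsub>R\<^esub> y \<in> Q \<longrightarrow> x \<in> Q \<or> y \<in> ideal_radical R Q)"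

definition P_primary :: "('a, 'm) ring_scheme \<Rightarrow> 'a set \<Rightarrow> 'a set \<Rightarrow> bool"
  where "P_primary R P Q \<longleftrightarrow> primary_ideal R Q \<and> ideal_radical R Q = P"

text \<open>The contraction to \<open>R\<close> of the \<open>n\<close>-th power of the extension of \<open>P\<close> to the
  localization of \<open>R\<close> at \<open>P\<close>.\<close>

definition symbolic_power :: "('a, 'm) ring_scheme \<Rightarrow> 'a set \<Rightarrow> nat \<Rightarrow> 'a set"
  where "symbolic_power R P n =
    {x \<in> carrier R. \<exists>s \<in> carrier R - P. s \<otimes>\<^bsub>R\<^esub> x \<in> ideal_power R P n}"


section \<open>Modules\<close>

text \<open>
  The record \<open>module\<close> extends \<open>ring\<close>, so a module carries fields \<open>mult\<close> and \<open>one\<close>; they play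
  no role below.
\<close>

definition finitely_generated_module ::
    "('r, 'm) ring_scheme \<Rightarrow> ('r, 'b, 'n) module_scheme \<Rightarrow> bool"
  where "finitely_generated_module R M \<longleftrightarrow>
    (\<exists>S. finite S \<and> S \<subseteq> carrier M \<and>
      carrier M = {\<Oplus>\<^bsub>M\<^esub>s\<in>S. c s \<odot>\<^bsub>M\<^esub> s | c. c \<in> S \<rightarrow> carrier R})"

definition linear_maps ::
    "('r, 'm) ring_scheme \<Rightarrow> ('r, 'b, 'n) module_scheme \<Rightarrow> ('r, 'c, 'o) module_scheme \<Rightarrow> ('b \<Rightarrow> 'c) set"
  where "linear_maps R M N = {f \<in> carrier M \<rightarrow> carrier N.
    (\<forall>x\<in>carrier M. \<forall>y\<in>carrier M. f (x \<oplus>\<^bsub>M\<^esub> y) = f x \<oplus>\<^bsub>N\<^esub> f y) \<and>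
    (\<forall>a\<in>carrier R. \<forall>x\<in>carrier M. f (a \<odot>\<^bsub>M\<^esub> x) = a \<odot>\<^bsub>N\<^esub> f x)}"

definition free_module :: "('r, 'm) ring_scheme \<Rightarrow> 'i set \<Rightarrow> ('r, 'i \<Rightarrow> 'r) module"
  where "free_module R B =
    \<lparr>carrier = {f \<in> B \<rightarrow>\<^sub>E carrier R. finite {x \<in> B. f x \<noteq> \<zero>\<^bsub>R\<^esub>}},
     monoid.mult = undefined, one = undefined,
     zero = (\<lambda>x\<in>B. \<zero>\<^bsub>R\<^esub>),
     add = (\<lambda>f g. \<lambda>x\<in>B. f x \<oplus>\<^bsub>R\<^esub> g x),
     smult = (\<lambda>a f. \<lambda>x\<in>B. a \<otimes>\<^bsub>R\<^esub> f x)\<rparr>"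

text \<open>
  Projective means: a direct summand of a free module, i.e. \<open>p \<circ> i = id\<close> for linear maps
  \<open>i : M \<rightarrow> F\<close> and \<open>p : F \<rightarrow> M\<close> with \<open>F\<close> free. Indexing the basis by a subset of the type of
  \<open>M\<close> is no restriction: \<open>M\<close> is a quotient of the free module on \<open>carrier M\<close>, and a projective
  \<open>M\<close> is a direct summand of every module of which it is a quotient.
\<close>

definition projective_module :: "('r, 'm) ring_scheme \<Rightarrow> ('r, 'b, 'n) module_scheme \<Rightarrow> bool"
  where "projective_module R M \<longleftrightarrow>
    (\<exists>(B :: 'b set). \<exists>i \<in> linear_maps R M (free_module R B).
      \<exists>p \<in> linear_maps R (free_module R B) M. \<forall>x\<in>carrier M. p (i x) = x)"

definition endomorphism_ring ::
    "('r, 'm) ring_scheme \<Rightarrow> ('r, 'b, 'n) module_scheme \<Rightarrow> ('b \<Rightarrow> 'b) ring"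
  where "endomorphism_ring R M =
    \<lparr>carrier = linear_maps R M M \<inter> extensional (carrier M),
     monoid.mult = (\<lambda>f g. compose (carrier M) f g),
     one = (\<lambda>x\<in>carrier M. x),
     zero = (\<lambda>x\<in>carrier M. \<zero>\<^bsub>M\<^esub>),
     add = (\<lambda>f g. \<lambda>x\<in>carrier M. f x \<oplus>\<^bsub>M\<^esub> g x)\<rparr>"

definition restrict_scalars ::
    "('r \<Rightarrow> 'b) \<Rightarrow> ('b, 'n) ring_scheme \<Rightarrow> ('r, 'b) module"
  where "restrict_scalars h S =
    \<lparr>carrier = carrier S, monoid.mult = monoid.mult S, one = \<one>\<^bsub>S\<^esub>, zero = \<zero>\<^bsub>S\<^esub>, add = add S,
     smult = (\<lambda>a x. h a \<otimes>\<^bsub>S\<^esub> x)\<rparr>"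


section \<open>Stable ideals and stable domains\<close>

definition ideal_module :: "('a, 'm) ring_scheme \<Rightarrow> 'a set \<Rightarrow> ('a, 'a) module"
  where "ideal_module R I =
    \<lparr>carrier = I, monoid.mult = monoid.mult R, one = \<one>\<^bsub>R\<^esub>, zero = \<zero>\<^bsub>R\<^esub>, add = add R, smult = monoid.mult R\<rparr>"

definition ideal_module_End :: "('a, 'm) ring_scheme \<Rightarrow> 'a set \<Rightarrow> ('a \<Rightarrow> 'a, 'a) module"
  where "ideal_module_End R I =
    \<lparr>carrier = I, monoid.mult = monoid.mult R, one = \<one>\<^bsub>R\<^esub>, zero = \<zero>\<^bsub>R\<^esub>, add = add R, smult = (\<lambda>f x. f x)\<rparr>"

definition stable_ideal :: "('a, 'm) ring_scheme \<Rightarrow> 'a set \<Rightarrow> bool"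
  where "stable_ideal R I \<longleftrightarrow> ideal I R \<and>
    projective_module (endomorphism_ring R (ideal_module R I)) (ideal_module_End R I)"

definition stable_domain :: "('a, 'm) ring_scheme \<Rightarrow> bool"
  where "stable_domain R \<longleftrightarrow> domain R \<and> (\<forall>I. ideal I R \<and> I \<noteq> {\<zero>\<^bsub>R\<^esub>} \<longrightarrow> stable_ideal R I)"


section \<open>Normalization\<close>

definition quot_field :: "('a, 'm) ring_scheme \<Rightarrow> 'a set \<Rightarrow> 'a set"
  where "quot_field K A = {a \<otimes>\<^bsub>K\<^esub> inv\<^bsub>K\<^esub> b | a b. a \<in> A \<and> b \<in> A \<and> b \<noteq> \<zero>\<^bsub>K\<^esub>}"

definition integral_closure :: "('a, 'm) ring_scheme \<Rightarrow> 'a set \<Rightarrow> 'a set \<Rightarrow> 'a set"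
  where "integral_closure K A L = {x \<in> L.
    \<exists>p. polynomial\<^bsub>K\<^esub> A p \<and> p \<noteq> [] \<and> lead_coeff p = \<one>\<^bsub>K\<^esub> \<and> ring.eval K p x = \<zero>\<^bsub>K\<^esub>}"

text \<open>The total ring of quotients of a domain is its quotient field.\<close>

definition finite_normalization :: "('a, 'm) ring_scheme \<Rightarrow> 'a set \<Rightarrow> bool"
  where "finite_normalization K A \<longleftrightarrow>
    finitely_generated_module (sub K A)
      (restrict_scalars (\<lambda>a. a) (sub K (integral_closure K A (quot_field K A))))"

definition bad_stable_domain :: "('a, 'm) ring_scheme \<Rightarrow> 'a set \<Rightarrow> bool"
  where "bad_stable_domain K R \<longleftrightarrow> subdomain R K \<and> quasilocal (sub K R) \<and>
    stable_domain (sub K R) \<and> krull_dim (sub K R) = 1 \<and> \<not> finite_normalization K R"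

definition bad_noetherian_stable_domain :: "('a, 'm) ring_scheme \<Rightarrow> 'a set \<Rightarrow> bool"
  where "bad_noetherian_stable_domain K R \<longleftrightarrow> bad_stable_domain K R \<and> noetherian_ring (sub K R)"


section \<open>Domination\<close>

text \<open>\<open>birationally_dominates K R A\<close>: the ring \<open>R\<close> birationally dominates its subring \<open>A\<close>.\<close>

definition birationally_dominates :: "('a, 'm) ring_scheme \<Rightarrow> 'a set \<Rightarrow> 'a set \<Rightarrow> bool"
  where "birationally_dominates K R A \<longleftrightarrow>
    subdomain A K \<and> subdomain R K \<and> A \<subseteq> R \<and>
    quasilocal (sub K A) \<and> quasilocal (sub K R) \<and>
    quot_field K A = quot_field K R \<and>
    max_ideal (sub K A) \<subseteq> max_ideal (sub K R)"

definition extended_max_ideal :: "('a, 'm) ring_scheme \<Rightarrow> 'a set \<Rightarrow> 'a set \<Rightarrow> 'a set"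
  where "extended_max_ideal K A R = Idl\<^bsub>sub K R\<^esub> (max_ideal (sub K A))"

definition finitely_dominates :: "('a, 'm) ring_scheme \<Rightarrow> 'a set \<Rightarrow> 'a set \<Rightarrow> bool"
  where "finitely_dominates K R A \<longleftrightarrow> birationally_dominates K R A \<and>
    finitely_generated_module (sub K A)
      (restrict_scalars (\<lambda>a. extended_max_ideal K A R +>\<^bsub>sub K R\<^esub> a)
        (sub K R Quot extended_max_ideal K A R))"

definition tightly_dominates :: "('a, 'm) ring_scheme \<Rightarrow> 'a set \<Rightarrow> 'a set \<Rightarrow> bool"
  where "tightly_dominates K R A \<longleftrightarrow> finitely_dominates K R A \<and>
    R = A <+>\<^bsub>K\<^esub> extended_max_ideal K A R"


section \<open>Completions\<close>

text \<open>
  The completion of a quasilocal ring with maximal ideal \<open>\<mm>\<close> is the inverse limit of the rings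
  \<open>R/\<mm>\<^sup>n\<close>. Its elements are sequences of cosets; the inclusion \<open>f (Suc n) \<subseteq> f n\<close> says that the
  coset \<open>f (Suc n)\<close> is mapped to \<open>f n\<close> by the projection from \<open>R/\<mm>\<^sup>n\<^sup>+\<^sup>1\<close> to \<open>R/\<mm>\<^sup>n\<close>.
\<close>

definition residue_ring_power :: "('a, 'm) ring_scheme \<Rightarrow> nat \<Rightarrow> 'a set ring"
  where "residue_ring_power R n = R Quot ideal_power R (max_ideal R) n"

definition completion :: "('a, 'm) ring_scheme \<Rightarrow> (nat \<Rightarrow> 'a set) ring"
  where "completion R =
    \<lparr>carrier = {f. \<forall>n. f n \<in> carrier (residue_ring_power R n) \<and> f (Suc n) \<subseteq> f n},
     monoid.mult = (\<lambda>f g n. f n \<otimes>\<^bsub>residue_ring_power R n\<^esub> g n),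
     one = (\<lambda>n. \<one>\<^bsub>residue_ring_power R n\<^esub>),
     zero = (\<lambda>n. \<zero>\<^bsub>residue_ring_power R n\<^esub>),
     add = (\<lambda>f g n. f n \<oplus>\<^bsub>residue_ring_power R n\<^esub> g n)\<rparr>"

definition to_completion :: "('a, 'm) ring_scheme \<Rightarrow> 'a \<Rightarrow> nat \<Rightarrow> 'a set"
  where "to_completion R a = (\<lambda>n. ideal_power R (max_ideal R) n +>\<^bsub>R\<^esub> a)"

text \<open>
  For \<open>V\<close> dominating \<open>A\<close>, with maximal ideals \<open>\<nn>\<close> and \<open>\<mm>\<close>, the canonical map from the completion
  of \<open>A\<close> to that of \<open>V\<close> sends \<open>(a\<^sub>n + \<mm>\<^sup>n)\<^sub>n\<close> to \<open>(a\<^sub>n + \<nn>\<^sup>n)\<^sub>n\<close>, and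
  \<open>a\<^sub>n + \<nn>\<^sup>n = \<nn>\<^sup>n + (a\<^sub>n + \<mm>\<^sup>n)\<close> because \<open>\<mm>\<^sup>n \<subseteq> \<nn>\<^sup>n\<close>.
\<close>

definition completion_map ::
    "('a, 'm) ring_scheme \<Rightarrow> 'a set \<Rightarrow> (nat \<Rightarrow> 'a set) \<Rightarrow> (nat \<Rightarrow> 'a set)"
  where "completion_map K V f = (\<lambda>n. ideal_power (sub K V) (max_ideal (sub K V)) n <+>\<^bsub>K\<^esub> f n)"

definition completion_kernel ::
    "('a, 'm) ring_scheme \<Rightarrow> 'a set \<Rightarrow> 'a set \<Rightarrow> (nat \<Rightarrow> 'a set) set"
  where "completion_kernel K A V =
    a_kernel (completion (sub K A)) (completion (sub K V)) (completion_map K V)"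

text \<open>
  \<open>fraction_trace K A I\<close> is \<open>F \<inter> (B/I)\<close>, where \<open>F\<close> is the quotient field of \<open>A\<close> and
  \<open>I\<close> an ideal of the completion \<open>B\<close> of \<open>A\<close>: the set of \<open>a/b\<close> with \<open>a \<in> bB + I\<close>.
  It is used for ideals \<open>I\<close> all of whose associated primes contract to \<open>0\<close> in \<open>A\<close>, so that
  \<open>F\<close> embeds in the total quotient ring of \<open>B/I\<close>.
\<close>

definition fraction_trace :: "('a, 'm) ring_scheme \<Rightarrow> 'a set \<Rightarrow> (nat \<Rightarrow> 'a set) set \<Rightarrow> 'a set"
  where "fraction_trace K A I =
    {a \<otimes>\<^bsub>K\<^esub> inv\<^bsub>K\<^esub> b | a b. a \<in> A \<and> b \<in> A \<and> b \<noteq> \<zero>\<^bsub>K\<^esub> \<and>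
      to_completion (sub K A) a \<in>
        PIdl\<^bsub>completion (sub K A)\<^esub> (to_completion (sub K A) b) <+>\<^bsub>completion (sub K A)\<^esub> I}"

end

(* Tightness puts a uniformizer t of V into A and gives V = A + tV, so elements of V and of the
   completions are Cauchy sequences in A, and P consists of the sequences tending to 0 in V.

   Call a ring R between A and V quadratic if xy \<in> R + Rx + Ry for all x, y \<in> V. If R is quadratic
   and i is an element of least value in an ideal I, then I^2 = iI, so I = i(I : I) is stable.
   Conversely, let R be bad, stable and tight over A, and let R_n = {x \<in> V. t^n x \<in> R}. For the maximal
   ideal M of R_n, badness makes (M : M)/M non-reduced; stability then shows that (M : M) is local and
   M = t(M : M), so R_(n+1) = (M : M). The union of the R_n is V, and stability of the R-module
   R + Rx + Ry yields xy \<in> R + Rx + Ry.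

   Quadraticity translates into P^2 \<subseteq> J. If P^2 \<subseteq> J, then uw \<in> t^k R for u, w \<in> R \<inter> t^k V, because u and w
   agree with elements of P modulo t^k. Approximating x and y by c, d \<in> A turns this into
   (x - c)(y - d) \<in> R. Conversely, for quadratic R the sequences in A that tend to 0 in R form a
   P-primary J containing P^2, and R is its trace. *)

theory Submission
  imports "HOL-Decision_Procs.Algebra_Aux" Defs
begin

section \<open>Ideals of subrings and quasilocal rings\<close>

text \<open>The uniformizer in \<open>A\<close> exists because tightness makes the maximal ideal of
  \<open>V\<close> the extension of that of \<open>A\<close>; hence the latter is not contained in
  the square of the former, and any element outside that square serves as \<open>t\<close>.
  Stability enters only through one consequence of projectivity that assumes no finiteness: some
  product of a dual basis is a unit of \<open>V\<close>. It becomes a unit of an endomorphism ring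
  only if that ring is local, and locality is the obstacle in the tower. With S = R_n, stability
  makes every element of (M : M)/M quadratic over the field S/M, and a quadratic algebra with a
  nonzero nilpotent has no nontrivial idempotent. A bad stable ring is not assumed to be Noetherian.
  Dimension one and tightness give R = A + cR for every nonzero \<open>c\<close> in
  \<open>R\<close>, so finite generation of ideals descends to \<open>A\<close>. The same equality
  makes \<open>A\<close> dense in \<open>R\<close>, which is why \<open>R\<close> can be recovered
  from sequences in \<open>A\<close>. For traces, the inclusion of P^2 in \<open>J\<close> is used
  by multiplying two relations that hold modulo P, for instance in a Newton step for
  inverses.\<close>

lemma (in ring) ex_maximal_ideal_avoiding:
  assumes "ideal I R" "I \<inter> D = {}"
  obtains P where "ideal P R" "I \<subseteq> P" "P \<inter> D = {}"
    "\<And>Q. ideal Q R \<Longrightarrow> P \<subseteq> Q \<Longrightarrow> Q \<inter> D = {} \<Longrightarrow> Q = P"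
proof -
  \<comment> \<open>\<open>D\<close> is {1} when a maximal ideal is wanted, and the set of powers of
    an element when a prime ideal is.\<close>
  define Z where "Z = {J. ideal J R \<and> I \<subseteq> J \<and> J \<inter> D = {}}"
  have "\<exists>M\<in>Z. \<forall>J\<in>Z. M \<subseteq> J \<longrightarrow> J = M"
  proof (rule subset_Zorn)
    fix C assume C: "subset.chain Z C"
    show "\<exists>U\<in>Z. \<forall>J\<in>C. J \<subseteq> U"
    proof (cases "C = {}")
      case True
      then show ?thesis using assms by (intro bexI[of _ I]) (auto simp: Z_def)
    next
      case False
      have CZ: "C \<subseteq> Z" using C unfolding pred_on.chain_def by blast
      then have "subset.chain {J. ideal J R} C"
        using C unfolding pred_on.chain_def Z_def by blast
      then have "ideal (\<Union>C) R" using chain_Union_is_ideal[of C] False by simp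
      moreover have "I \<subseteq> \<Union>C" using CZ False unfolding Z_def by blast
      moreover have "\<Union>C \<inter> D = {}" using CZ unfolding Z_def by blast
      ultimately show ?thesis by (intro bexI[of _ "\<Union>C"]) (auto simp: Z_def)
    qed
  qed
  then obtain P where P: "P \<in> Z" "\<And>J. J \<in> Z \<Longrightarrow> P \<subseteq> J \<Longrightarrow> J = P" by blast
  have P1: "ideal P R" "I \<subseteq> P" "P \<inter> D = {}" using P(1) by (auto simp: Z_def)
  moreover have "Q = P" if "ideal Q R" "P \<subseteq> Q" "Q \<inter> D = {}" for Q
    using P(2)[of Q] that P1(2) by (auto simp: Z_def)
  ultimately show ?thesis using that by blast
qed

text \<open>Negatives need no clause of their own, being multiples by \<ominus> \<one>. Ideals of
  all subrings of the ambient field are handled through this criterion, so that every computation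
  takes place in one ring.\<close>

lemma (in field) ideal_sub_iff:
  assumes S: "subring S R"
  shows "ideal I (sub R S) \<longleftrightarrow>
    I \<subseteq> S \<and> \<zero> \<in> I \<and> (\<forall>x\<in>I. \<forall>y\<in>I. x \<oplus> y \<in> I) \<and> (\<forall>s\<in>S. \<forall>x\<in>I. s \<otimes> x \<in> I)"
    (is "?L \<longleftrightarrow> ?R")
proof
  assume I: ?L
  show ?R
    using additive_subgroup.a_subset[OF ideal.axioms(1)[OF I]]
      additive_subgroup.zero_closed[OF ideal.axioms(1)[OF I]]
      additive_subgroup.a_closed[OF ideal.axioms(1)[OF I]] ideal.I_l_closed[OF I] by auto
next
  assume r: ?R
  note SE = subringE[OF S]
  have neg: "\<ominus> x \<in> I" if "x \<in> I" for x
  proof -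
    have x: "x \<in> carrier R" using that r SE(1) by auto
    have "\<ominus> \<one> \<in> S" using SE by auto
    then have "\<ominus> \<one> \<otimes> x \<in> I" using r that by blast
    then show ?thesis using x l_minus[of \<one> x] by simp
  qed
  have rS: "ring (sub R S)" by (rule subring_is_ring[OF S])
  have inv: "inv\<^bsub>add_monoid (sub R S)\<^esub> x = \<ominus> x" if "x \<in> I" for x
  proof -
    have xS: "x \<in> S" "x \<in> carrier R" using that r SE(1) by auto
    have e: "\<ominus>\<^bsub>sub R S\<^esub> x = \<ominus> x"
      by (rule abelian_group.minus_equality[OF ring.is_abelian_group[OF rS]]) (use xS SE in \<open>auto simp: l_neg\<close>)
    show ?thesis using e unfolding a_inv_def[of "sub R S"] .
  qed
  show ?L
  proof (rule idealI)
    show "ring (sub R S)" by (rule rS)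
    show "subgroup I (add_monoid (sub R S))"
      unfolding subgroup_def using r neg inv by auto
    fix a x assume "a \<in> I" "x \<in> carrier (sub R S)"
    then have "a \<in> I" "x \<in> S" "a \<in> carrier R" "x \<in> carrier R" using r SE(1) by auto
    then show "x \<otimes>\<^bsub>sub R S\<^esub> a \<in> I" "a \<otimes>\<^bsub>sub R S\<^esub> x \<in> I"
      using r m_comm[of a x] by auto
  qed
qed

lemma (in field) subring_cring:
  assumes "subring S R" shows "cring (sub R S)"
  using subcringI'[OF assms] subcring_iff subringE(1)[OF assms] by auto

lemma (in field) max_ideal_maximal:
  assumes "quasilocal T" shows "maximalideal (max_ideal T) T"
  using assms unfolding quasilocal_def max_ideal_def by (metis theI')

text \<open>Otherwise the multiples of \<open>x\<close> avoid \<one> and lie in a maximal ideal;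
  this is the only one, and it does not contain \<open>x\<close>.\<close>

lemma (in field) quasilocal_unit:
  assumes S: "subring S R" and q: "quasilocal (sub R S)" and x: "x \<in> S" "x \<notin> max_ideal (sub R S)"
  shows "x \<noteq> \<zero>" "inv x \<in> S"
proof -
  note SE = subringE[OF S]
  let ?M = "max_ideal (sub R S)"
  have M: "maximalideal ?M (sub R S)" by (rule max_ideal_maximal[OF q])
  have xc: "x \<in> carrier R" using x SE by auto
  let ?I = "{s \<otimes> x |s. s \<in> S}"
  have I: "ideal ?I (sub R S)"
    unfolding ideal_sub_iff[OF S]
  proof (intro conjI ballI)
    show "?I \<subseteq> S" using SE x by auto
    show "\<zero> \<in> ?I" using SE xc by (auto intro!: exI[of _ \<zero>])
    fix a b assume "a \<in> ?I" "b \<in> ?I"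
    then obtain s s' where "s \<in> S" "s' \<in> S" "a = s \<otimes> x" "b = s' \<otimes> x" by auto
    moreover from this have "s \<in> carrier R" "s' \<in> carrier R" using SE(1) by auto
    ultimately have "s \<oplus> s' \<in> S" "a \<oplus> b = (s \<oplus> s') \<otimes> x" using SE(7) xc by (simp_all add: l_distr)
    then show "a \<oplus> b \<in> ?I" by blast
  next
    fix s a assume "s \<in> S" "a \<in> ?I"
    then obtain s' where "s' \<in> S" "a = s' \<otimes> x" by auto
    moreover from this \<open>s \<in> S\<close> have "s \<in> carrier R" "s' \<in> carrier R" using SE(1) by auto
    ultimately have "s \<otimes> s' \<in> S" "s \<otimes> a = (s \<otimes> s') \<otimes> x" using SE(6) xc \<open>s \<in> S\<close> by (simp_all add: m_assoc)
    then show "s \<otimes> a \<in> ?I" by blast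
  qed
  have "\<one> \<in> ?I"
  proof (rule ccontr)
    assume "\<one> \<notin> ?I"
    then obtain P where P: "ideal P (sub R S)" "?I \<subseteq> P" "P \<inter> {\<one>} = {}"
      "\<And>Q. ideal Q (sub R S) \<Longrightarrow> P \<subseteq> Q \<Longrightarrow> Q \<inter> {\<one>} = {} \<Longrightarrow> Q = P"
      using ring.ex_maximal_ideal_avoiding[OF subring_is_ring[OF S] I, of "{\<one>}"] by auto
    have "maximalideal P (sub R S)"
    proof (rule maximalidealI[OF P(1)])
      show "carrier (sub R S) \<noteq> P" using P(3) SE by auto
      fix J assume J: "ideal J (sub R S)" "P \<subseteq> J" "J \<subseteq> carrier (sub R S)"
      show "J = P \<or> J = carrier (sub R S)"
        using P(4)[OF J(1,2)] ideal.one_imp_carrier[OF J(1)] by auto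
    qed
    then have "P = ?M" using q M unfolding quasilocal_def by auto
    moreover have "x \<in> ?I" using SE xc by (auto intro!: exI[of _ \<one>])
    ultimately show False using P x by auto
  qed
  then obtain s where s: "s \<in> S" "s \<otimes> x = \<one>" by auto
  then show "x \<noteq> \<zero>" using SE by (auto simp: subset_iff)
  have sc: "s \<in> carrier R" using s SE by auto
  have "inv x = s" by (rule comm_inv_char) (use s xc sc m_comm[of x s] in auto)
  then show "inv x \<in> S" using s by simp
qed

text \<open>The data on \<open>A\<close> and \<open>V\<close> reduced to statements about elements
  of \<open>K\<close>: \<open>t_nonunit\<close> and \<open>V_val\<close> make \<open>V\<close> a
  discrete valuation ring with uniformizer \<open>t\<close>, \<open>V_split\<close> is tightness,
  \<open>A_unit\<close> expresses that \<open>V\<close> dominates the local ring \<open>A\<close>,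
  and \<open>V_frac\<close> that the quotient fields coincide.\<close>

locale tight_pair = field K for K (structure) +
  fixes A V :: "'a set" and t :: 'a
  assumes A: "subring A K" and V: "subring V K" and AV: "A \<subseteq> V"
    and tA: "t \<in> A" and t_nz: "t \<noteq> \<zero>" and t_nonunit: "x \<in> V \<Longrightarrow> t \<otimes> x \<noteq> \<one>"
    and V_split: "x \<in> V \<Longrightarrow> \<exists>a\<in>A. \<exists>y\<in>V. x = a \<oplus> t \<otimes> y"
    and V_val: "x \<in> V \<Longrightarrow> x \<noteq> \<zero> \<Longrightarrow> \<exists>h::nat. \<exists>u\<in>V. x = t [^] h \<otimes> u \<and> u \<noteq> \<zero> \<and> inv u \<in> V"
    and A_unit: "a \<in> A \<Longrightarrow> a \<noteq> \<zero> \<Longrightarrow> inv a \<in> V \<Longrightarrow> inv a \<in> A"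
    and V_frac: "x \<in> V \<Longrightarrow> \<exists>a\<in>A. \<exists>b\<in>A. b \<noteq> \<zero> \<and> b \<otimes> x = a"
    and A_noeth: "noetherian_ring (sub K A)"
begin

text \<open>The powers of the maximal ideal of \<open>V\<close>. Units of \<open>V\<close> appear
  below as the elements of \<open>V\<close> outside \<open>nV 1\<close>.\<close>

definition nV :: "nat \<Rightarrow> 'a set" where "nV n = (\<lambda>x. t [^] n \<otimes> x) ` V"

section \<open>Arithmetic in the valuation ring \<open>V\<close>\<close>

lemma V_K [simp]: "x \<in> V \<Longrightarrow> x \<in> carrier K" using subringE(1)[OF V] by auto
lemma A_V: "x \<in> A \<Longrightarrow> x \<in> V" using AV by auto
lemma A_K [simp]: "x \<in> A \<Longrightarrow> x \<in> carrier K" using AV by auto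
lemma t_K [simp]: "t \<in> carrier K" using tA by simp
lemma tV [simp]: "t \<in> V" using tA A_V by simp

lemma V_closed [simp]:
  "\<zero> \<in> V" "\<one> \<in> V" "x \<in> V \<Longrightarrow> y \<in> V \<Longrightarrow> x \<oplus> y \<in> V" "x \<in> V \<Longrightarrow> y \<in> V \<Longrightarrow> x \<otimes> y \<in> V"
  "x \<in> V \<Longrightarrow> \<ominus> x \<in> V" "x \<in> V \<Longrightarrow> y \<in> V \<Longrightarrow> x \<ominus> y \<in> V"
  using subringE[OF V] by (auto simp: minus_eq)

lemma A_closed [simp]:
  "\<zero> \<in> A" "\<one> \<in> A" "x \<in> A \<Longrightarrow> y \<in> A \<Longrightarrow> x \<oplus> y \<in> A" "x \<in> A \<Longrightarrow> y \<in> A \<Longrightarrow> x \<otimes> y \<in> A"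
  "x \<in> A \<Longrightarrow> \<ominus> x \<in> A" "x \<in> A \<Longrightarrow> y \<in> A \<Longrightarrow> x \<ominus> y \<in> A"
  using subringE[OF A] by (auto simp: minus_eq)

lemma V_pow [simp]: "x \<in> V \<Longrightarrow> x [^] (n::nat) \<in> V"
  by (induct n) auto
lemma A_pow [simp]: "x \<in> A \<Longrightarrow> x [^] (n::nat) \<in> A"
  by (induct n) auto

lemma tpow_nz [simp]: "t [^] (n::nat) \<noteq> \<zero>" using t_nz by simp

lemma cancel: "c \<in> carrier K \<Longrightarrow> c \<noteq> \<zero> \<Longrightarrow> x \<in> carrier K \<Longrightarrow> y \<in> carrier K \<Longrightarrow> c \<otimes> x = c \<otimes> y \<Longrightarrow> x = y"
  using m_lcancel by blast

lemma tpow_add: "x \<in> carrier K \<Longrightarrow> t [^] (i + j) \<otimes> x = t [^] (i::nat) \<otimes> (t [^] (j::nat) \<otimes> x)"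
  by (simp only: nat_pow_mult[symmetric] t_K m_assoc nat_pow_closed)

lemma nV_I: "x \<in> V \<Longrightarrow> t [^] n \<otimes> x \<in> nV n" unfolding nV_def by auto
lemma nV_E: "x \<in> nV n \<Longrightarrow> (\<And>y. y \<in> V \<Longrightarrow> x = t [^] n \<otimes> y \<Longrightarrow> thesis) \<Longrightarrow> thesis" unfolding nV_def by auto
lemma nV_V: "x \<in> nV n \<Longrightarrow> x \<in> V" by (erule nV_E) simp
lemma nV_K [simp]: "x \<in> nV n \<Longrightarrow> x \<in> carrier K" using nV_V by auto
lemma nV_0 [simp]: "nV 0 = V" unfolding nV_def by (auto intro!: image_eqI)
lemma nV1_I: "x \<in> V \<Longrightarrow> t \<otimes> x \<in> nV 1" using nV_I[of x 1] by simp
lemma nV1_E: "x \<in> nV 1 \<Longrightarrow> (\<And>y. y \<in> V \<Longrightarrow> x = t \<otimes> y \<Longrightarrow> thesis) \<Longrightarrow> thesis" by (erule nV_E) simp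
lemma nV_zero [simp]: "\<zero> \<in> nV n" using nV_I[of \<zero> n] by simp
lemma nV_tpow [simp]: "t [^] n \<in> nV n" using nV_I[of \<one> n] by simp
lemma nV_t [simp]: "t \<in> nV (Suc 0)" using nV_tpow[of 1] by simp

lemma nV_add: "x \<in> nV n \<Longrightarrow> y \<in> nV n \<Longrightarrow> x \<oplus> y \<in> nV n"
  by (elim nV_E) (simp add: r_distr[symmetric] nV_I)
lemma nV_neg: "x \<in> nV n \<Longrightarrow> \<ominus> x \<in> nV n"
  by (elim nV_E) (simp add: r_minus[symmetric] nV_I)
lemma nV_minus: "x \<in> nV n \<Longrightarrow> y \<in> nV n \<Longrightarrow> x \<ominus> y \<in> nV n"
  by (simp add: minus_eq nV_add nV_neg)
lemma nV_mult: "x \<in> V \<Longrightarrow> y \<in> nV n \<Longrightarrow> x \<otimes> y \<in> nV n"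
proof (elim nV_E)
  fix y' assume *: "x \<in> V" "y' \<in> V" "y = t [^] n \<otimes> y'"
  then have "x \<otimes> y = t [^] n \<otimes> (x \<otimes> y')" by (simp add: m_lcomm)
  then show ?thesis using * nV_I by simp
qed
lemma nV_mult': "y \<in> nV n \<Longrightarrow> x \<in> V \<Longrightarrow> y \<otimes> x \<in> nV n"
  using nV_mult[of x y n] by (simp add: m_comm)

lemma nV_tmult: "x \<in> nV j \<Longrightarrow> t [^] i \<otimes> x \<in> nV (i + j)"
proof (elim nV_E)
  fix y assume y: "y \<in> V" and x: "x = t [^] j \<otimes> y"
  have "t [^] i \<otimes> x = t [^] (i + j) \<otimes> y" using y x tpow_add[of y i j] by simp
  then show ?thesis using y nV_I by simp
qed

lemma nV_mult2: "x \<in> nV i \<Longrightarrow> y \<in> nV j \<Longrightarrow> x \<otimes> y \<in> nV (i + j)"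
proof (elim nV_E)
  fix x' y' assume *: "x' \<in> V" "x = t [^] i \<otimes> x'" "y' \<in> V" "y = t [^] j \<otimes> y'"
  have "x \<otimes> y = t [^] (i + j) \<otimes> (x' \<otimes> y')"
    using * by (simp add: nat_pow_mult[symmetric] m_ac)
  then show ?thesis using * nV_I by simp
qed

lemma nV_mono: "i \<le> j \<Longrightarrow> x \<in> nV j \<Longrightarrow> x \<in> nV i"
proof (elim nV_E)
  fix y assume *: "i \<le> j" "y \<in> V" "x = t [^] j \<otimes> y"
  have "x = t [^] i \<otimes> (t [^] (j - i) \<otimes> y)"
    using * tpow_add[of y i "j - i"] by simp
  then show ?thesis using * nV_I[of "t [^] (j - i) \<otimes> y" i] by simp
qed

lemma nV_cancel: "t [^] i \<otimes> x \<in> nV (i + j) \<Longrightarrow> x \<in> carrier K \<Longrightarrow> x \<in> nV j"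
proof (erule nV_E)
  fix y assume *: "x \<in> carrier K" "y \<in> V" "t [^] i \<otimes> x = t [^] (i + j) \<otimes> y"
  then have "t [^] i \<otimes> x = t [^] i \<otimes> (t [^] j \<otimes> y)"
    using tpow_add[of y i j] by simp
  then have "x = t [^] j \<otimes> y" by (rule cancel[rotated 4]) (use * in simp_all)
  then show ?thesis using * nV_I by simp
qed

text \<open>Phrased with \<open>Suc 0\<close>, the form into which the simplifier brings 1.\<close>

lemma one_nV1 [simp]: "\<one> \<notin> nV (Suc 0)"
  using t_nonunit by (metis One_nat_def nV1_E)

text \<open>A positive exponent in \<open>V_val\<close> would put \<open>x\<close> into
  \<open>nV 1\<close>, so \<open>x\<close> is the unit factor itself.\<close>

lemma V_unit:
  assumes "x \<in> V" "x \<notin> nV 1"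
  shows "x \<noteq> \<zero>" "inv x \<in> V" "inv x \<notin> nV 1" "x \<otimes> inv x = \<one>" "inv x \<in> carrier K"
proof -
  show nz: "x \<noteq> \<zero>" using assms(2) by auto
  obtain h u where u: "u \<in> V" "x = t [^] (h::nat) \<otimes> u" "u \<noteq> \<zero>" "inv u \<in> V"
    using V_val[OF assms(1) nz] by blast
  have "h = 0"
  proof (rule ccontr)
    assume "h \<noteq> 0"
    then have "x \<in> nV 1" using nV_mono[of 1 h x] nV_I[OF u(1), of h] u(2) by simp
    then show False using assms(2) by simp
  qed
  then show inv: "inv x \<in> V" using u by simp
  show one: "x \<otimes> inv x = \<one>" using nz assms(1) by simp
  show "inv x \<notin> nV 1"
    using nV_mult[OF assms(1), of "inv x" 1] one by auto
  show "inv x \<in> carrier K" using inv by simp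
qed

lemma nV1_prime: "x \<in> V \<Longrightarrow> y \<in> V \<Longrightarrow> x \<otimes> y \<in> nV 1 \<Longrightarrow> x \<in> nV 1 \<or> y \<in> nV 1"
proof (rule ccontr)
  assume *: "x \<in> V" "y \<in> V" "x \<otimes> y \<in> nV 1" "\<not> (x \<in> nV 1 \<or> y \<in> nV 1)"
  have "inv x \<otimes> (x \<otimes> y) \<in> nV 1" using nV_mult[of "inv x"] V_unit[of x] * by auto
  moreover have "inv x \<otimes> (x \<otimes> y) = y" using * V_unit[of x] by (simp add: m_assoc[symmetric])
  ultimately show False using * by simp
qed

lemma nV1_pow: "x \<in> V \<Longrightarrow> x [^] (n::nat) \<in> nV 1 \<Longrightarrow> x \<in> nV 1"
proof (induct n)
  case (Suc n)
  then show ?case using nV1_prime[of "x [^] n" x] by auto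
qed auto

lemma V_dec:
  assumes "x \<in> V" "x \<noteq> \<zero>"
  obtains h u where "u \<in> V" "u \<notin> nV 1" "x = t [^] (h::nat) \<otimes> u"
proof -
  obtain h u where u: "u \<in> V" "x = t [^] (h::nat) \<otimes> u" "u \<noteq> \<zero>" "inv u \<in> V"
    using V_val[OF assms] by blast
  have "u \<notin> nV 1"
    using u nV_mult'[of u 1 "inv u"] by auto
  then show ?thesis using that u by blast
qed

lemma nV_unit_cancel: "u \<in> V \<Longrightarrow> u \<notin> nV 1 \<Longrightarrow> x \<in> carrier K \<Longrightarrow> u \<otimes> x \<in> nV n \<Longrightarrow> x \<in> nV n"
proof -
  assume *: "u \<in> V" "u \<notin> nV 1" "x \<in> carrier K" "u \<otimes> x \<in> nV n"
  have "inv u \<otimes> (u \<otimes> x) \<in> nV n" using nV_mult[of "inv u"] V_unit[of u] * by auto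
  moreover have "inv u \<otimes> (u \<otimes> x) = x" using * V_unit[of u] by (simp add: m_assoc[symmetric])
  ultimately show ?thesis using * by simp
qed

lemma nV_bound: "u \<in> V \<Longrightarrow> u \<notin> nV 1 \<Longrightarrow> t [^] (h::nat) \<otimes> u \<in> nV n \<Longrightarrow> n \<le> h"
proof (rule ccontr)
  assume *: "u \<in> V" "u \<notin> nV 1" "t [^] (h::nat) \<otimes> u \<in> nV n" "\<not> n \<le> h"
  then have "t [^] h \<otimes> u \<in> nV (h + 1)" using nV_mono[of "h + 1" n] by simp
  then show False using nV_cancel[of h u 1] * by simp
qed

lemma nV_sep: "x \<in> V \<Longrightarrow> (\<And>n. x \<in> nV n) \<Longrightarrow> x = \<zero>"
proof (rule ccontr)
  assume *: "x \<in> V" "\<And>n. x \<in> nV n" "x \<noteq> \<zero>"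
  then obtain h u where u: "u \<in> V" "u \<notin> nV 1" "x = t [^] (h::nat) \<otimes> u" using V_dec by blast
  then show False using nV_bound[of u h "h + 1"] *(2) by auto
qed

text \<open>Iterates V = A + tV; the approximations stay in \<open>A\<close> because
  \<open>t\<close> does.\<close>

lemma V_dense:
  assumes "x \<in> V"
  obtains a where "a \<in> A" "x \<ominus> a \<in> nV n"
proof (induct n arbitrary: thesis)
  case 0
  have "x \<ominus> \<zero> \<in> nV 0" using assms by simp
  then show ?case using 0[of \<zero>] by simp
next
  case (Suc n)
  obtain a where a: "a \<in> A" "x \<ominus> a \<in> nV n" using Suc(1) by blast
  then obtain y where y: "y \<in> V" "x \<ominus> a = t [^] n \<otimes> y" using nV_E by blast
  obtain b z where b: "b \<in> A" "z \<in> V" "y = b \<oplus> t \<otimes> z" using V_split[OF y(1)] by blast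
  define T where "T = t [^] n"
  have c: "T \<in> carrier K" "a \<in> carrier K" "b \<in> carrier K" "z \<in> carrier K" "t \<in> carrier K" "x \<in> carrier K"
    using a b assms by (auto simp: T_def)
  have "x = a \<oplus> (x \<ominus> a)" using c by algebra
  then have "x = a \<oplus> T \<otimes> (b \<oplus> t \<otimes> z)" using y b by (simp add: T_def)
  then have "x \<ominus> (a \<oplus> T \<otimes> b) = (a \<oplus> T \<otimes> (b \<oplus> t \<otimes> z)) \<ominus> (a \<oplus> T \<otimes> b)" by simp
  also have "\<dots> = T \<otimes> t \<otimes> z" using c by algebra
  also have "\<dots> \<in> nV (Suc n)" using nV_I[OF b(2), of "Suc n"] by (simp add: T_def)
  finally show ?case using Suc(2)[of "a \<oplus> T \<otimes> b"] a b tA by (simp add: T_def)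
qed

end

section \<open>Rings between \<open>A\<close> and \<open>V\<close>\<close>

context tight_pair
begin

text \<open>\<open>V\<close> is completely integrally closed: if \<open>x\<close> has a pole, the
  poles of its powers grow without bound, and no single \<open>d\<close> cancels them all. The
  element \<open>b\<close> places \<open>x\<close> in the quotient field of \<open>V\<close>, since
  \<open>K\<close> may be larger.\<close>

lemma V_almost_closed:
  assumes d: "d \<in> V" "d \<noteq> \<zero>" and x: "x \<in> carrier K" and b: "b \<in> V" "b \<noteq> \<zero>" "b \<otimes> x \<in> V"
    and pow: "\<And>k::nat. d \<otimes> x [^] k \<in> V"
  shows "x \<in> V"
proof (cases "b \<otimes> x = \<zero>")
  case True
  then have "x = \<zero>" using b x integral[of b x] by simp
  then show ?thesis by simp
next
  case False
  obtain h u where u: "u \<in> V" "u \<notin> nV 1" "b \<otimes> x = t [^] (h::nat) \<otimes> u" using V_dec[OF b(3) False] .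
  obtain l w where w: "w \<in> V" "w \<notin> nV 1" "b = t [^] (l::nat) \<otimes> w" using V_dec[OF b(1,2)] .
  obtain g c where c: "c \<in> V" "c \<notin> nV 1" "d = t [^] (g::nat) \<otimes> c" using V_dec[OF d] .
  show ?thesis
  proof (cases "l \<le> h")
    case True
    have "t [^] l \<otimes> (w \<otimes> x) = t [^] l \<otimes> (t [^] (h - l) \<otimes> u)"
      using u w x True tpow_add[of u l "h - l"] m_assoc[of "t [^] l" w x] by simp
    then have wx: "w \<otimes> x = t [^] (h - l) \<otimes> u" by (rule cancel[rotated 4]) (use x u w in simp_all)
    have "w \<otimes> x \<in> nV 0" using wx u by simp
    then have "x \<in> nV 0" using nV_unit_cancel[of w x 0] w x by blast
    then show ?thesis by simp
  next
    case False
    define e where "e = l - h"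
    have e: "l = h + e" "e \<ge> 1" using False by (auto simp: e_def)
    have "t [^] h \<otimes> (t [^] e \<otimes> (w \<otimes> x)) = t [^] h \<otimes> u"
      using u(3) w x tpow_add[of "w \<otimes> x" h e] m_assoc[of "t [^] l" w x] unfolding e by simp
    then have tx: "t [^] e \<otimes> (w \<otimes> x) = u" by (rule cancel[rotated 4]) (use x u w in simp_all)
    \<comment> \<open>One more than the valuation g of \<open>d\<close>: the element d u^k has
      valuation g, yet turns out to be divisible by t^k.\<close>
    define k where "k = g + 1"
    have "u [^] k = (t [^] e) [^] k \<otimes> (w [^] k \<otimes> x [^] k)"
      unfolding tx[symmetric] using w x by (simp add: nat_pow_distrib)
    then have "d \<otimes> u [^] k = (t [^] e) [^] k \<otimes> (w [^] k \<otimes> (d \<otimes> x [^] k))"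
      using w x d by (simp add: m_lcomm)
    also have "\<dots> = t [^] (e * k) \<otimes> (w [^] k \<otimes> (d \<otimes> x [^] k))" by (simp add: nat_pow_pow)
    also have "\<dots> \<in> nV (e * k)" using pow[of k] w by (intro nV_I) simp
    finally have "d \<otimes> u [^] k \<in> nV k" using e(2) nV_mono[of k "e * k"] by simp
    then have "t [^] g \<otimes> (c \<otimes> u [^] k) \<in> nV k" using c u by (simp add: m_assoc)
    moreover have "c \<otimes> u [^] k \<notin> nV 1" using nV1_prime nV1_pow c u by (meson V_pow)
    ultimately have "k \<le> g" using nV_bound[of "c \<otimes> u [^] k"] c u by simp
    then show ?thesis by (simp add: k_def)
  qed
qed

definition mid :: "'a set \<Rightarrow> bool" where "mid R \<longleftrightarrow> subring R K \<and> A \<subseteq> R \<and> R \<subseteq> V"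
text \<open>For a ring between \<open>A\<close> and \<open>V\<close> this amounts to being local
  with maximal ideal \<open>R \<inter> nV 1\<close>. In this form it is verified by computing
  inverses, without looking at ideals.\<close>

definition vlocal :: "'a set \<Rightarrow> bool" where "vlocal R \<longleftrightarrow> (\<forall>x\<in>R. x \<notin> nV 1 \<longrightarrow> inv x \<in> R)"

lemma mid_subring: "mid R \<Longrightarrow> subring R K" by (simp add: mid_def)

lemma mid_closed:
  assumes "mid R"
  shows "x \<in> A \<Longrightarrow> x \<in> R" "x \<in> R \<Longrightarrow> x \<in> V" "x \<in> R \<Longrightarrow> x \<in> carrier K" "\<zero> \<in> R" "\<one> \<in> R" "t \<in> R"
    "x \<in> R \<Longrightarrow> y \<in> R \<Longrightarrow> x \<oplus> y \<in> R" "x \<in> R \<Longrightarrow> y \<in> R \<Longrightarrow> x \<otimes> y \<in> R"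
    "x \<in> R \<Longrightarrow> \<ominus> x \<in> R" "x \<in> R \<Longrightarrow> y \<in> R \<Longrightarrow> x \<ominus> y \<in> R" "x \<in> R \<Longrightarrow> x [^] (n::nat) \<in> R"
proof -
  note E = subringE[OF mid_subring[OF assms]]
  show "x \<in> A \<Longrightarrow> x \<in> R" "x \<in> R \<Longrightarrow> x \<in> V" "x \<in> R \<Longrightarrow> x \<in> carrier K" "\<zero> \<in> R" "\<one> \<in> R" "t \<in> R"
    "x \<in> R \<Longrightarrow> y \<in> R \<Longrightarrow> x \<oplus> y \<in> R" "x \<in> R \<Longrightarrow> y \<in> R \<Longrightarrow> x \<otimes> y \<in> R"
    "x \<in> R \<Longrightarrow> \<ominus> x \<in> R" "x \<in> R \<Longrightarrow> y \<in> R \<Longrightarrow> x \<ominus> y \<in> R"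
    using E assms tA by (auto simp: mid_def minus_eq)
  show "x \<in> R \<Longrightarrow> x [^] (n::nat) \<in> R" by (induct n) (use E in auto)
qed

lemma mid_idealD:
  assumes R: "mid R" and I: "ideal I (sub K R)"
  shows "x \<in> I \<Longrightarrow> x \<in> R" "x \<in> I \<Longrightarrow> x \<in> carrier K" "\<zero> \<in> I" "x \<in> I \<Longrightarrow> y \<in> I \<Longrightarrow> x \<oplus> y \<in> I"
    "s \<in> R \<Longrightarrow> x \<in> I \<Longrightarrow> s \<otimes> x \<in> I" "s \<in> R \<Longrightarrow> x \<in> I \<Longrightarrow> x \<otimes> s \<in> I"
    "x \<in> I \<Longrightarrow> \<ominus> x \<in> I" "x \<in> I \<Longrightarrow> y \<in> I \<Longrightarrow> x \<ominus> y \<in> I"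
proof -
  note RE = mid_closed[OF R]
  note IE = I[unfolded ideal_sub_iff[OF mid_subring[OF R]]]
  show 1: "x \<in> I \<Longrightarrow> x \<in> R" for x using IE by auto
  then show 2: "x \<in> I \<Longrightarrow> x \<in> carrier K" for x using RE by auto
  show "\<zero> \<in> I" using IE by simp
  show 3: "x \<in> I \<Longrightarrow> y \<in> I \<Longrightarrow> x \<oplus> y \<in> I" for x y using IE by simp
  show 4: "s \<in> R \<Longrightarrow> x \<in> I \<Longrightarrow> s \<otimes> x \<in> I" for s x using IE by simp
  show "s \<in> R \<Longrightarrow> x \<in> I \<Longrightarrow> x \<otimes> s \<in> I" using 4[of s x] 2[of x] RE by (simp add: m_comm)
  show 5: "x \<in> I \<Longrightarrow> \<ominus> x \<in> I" for x using 4[of "\<ominus> \<one>" x] 2[of x] RE by (simp add: l_minus)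
  show "x \<in> I \<Longrightarrow> y \<in> I \<Longrightarrow> x \<ominus> y \<in> I" using 3 5 by (simp add: minus_eq)
qed

lemma mid_A: "mid A" using A AV by (simp add: mid_def)
lemma mid_V: "mid V" using V AV by (simp add: mid_def)

lemma vlocal_A: "vlocal A"
  using A_unit V_unit A_V by (auto simp: vlocal_def)
lemma vlocal_V: "vlocal V"
  using V_unit by (auto simp: vlocal_def)

lemma mid_nV_ideal: "mid R \<Longrightarrow> ideal (R \<inter> nV n) (sub K R)"
  using ideal_sub_iff[OF mid_subring] nV_add nV_mult by (auto simp: mid_closed)

lemma vlocal_quasilocal:
  assumes R: "mid R" and loc: "vlocal R"
  shows "quasilocal (sub K R)" "max_ideal (sub K R) = R \<inter> nV 1"
proof -
  note RE = mid_closed[OF R]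
  let ?M = "R \<inter> nV 1"
  have big: "J = R" if J: "ideal J (sub K R)" and x: "x \<in> J" "x \<notin> nV 1" for J x
  proof -
    note JE = J[unfolded ideal_sub_iff[OF mid_subring[OF R]]]
    have xR: "x \<in> R" using JE x by auto
    then have "inv x \<in> R" using loc x by (auto simp: vlocal_def)
    then have "inv x \<otimes> x \<in> J" using JE x by auto
    moreover have "inv x \<otimes> x = \<one>" using V_unit[of x] xR RE x by simp
    ultimately have "\<one> \<in> J" by simp
    then show ?thesis using ideal.one_imp_carrier[OF J] by simp
  qed
  have MM: "maximalideal ?M (sub K R)"
  proof (rule maximalidealI[OF mid_nV_ideal[OF R]])
    show "carrier (sub K R) \<noteq> ?M" using RE(5) one_nV1 unfolding One_nat_def by force
    fix J assume "ideal J (sub K R)" "?M \<subseteq> J" "J \<subseteq> carrier (sub K R)"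
    then show "J = ?M \<or> J = carrier (sub K R)" using big[of J] by auto
  qed
  have uniq: "J = ?M" if J: "maximalideal J (sub K R)" for J
  proof -
    have Ji: "ideal J (sub K R)" using J by (rule maximalideal.axioms)
    have ne: "J \<noteq> R" using maximalideal.I_notcarr[OF J] by auto
    have "J \<subseteq> ?M" 
    proof
      fix x assume "x \<in> J"
      moreover have "J \<subseteq> R" using Ji[unfolded ideal_sub_iff[OF mid_subring[OF R]]] by simp
      ultimately show "x \<in> ?M" using big[OF Ji, of x] ne by blast
    qed
    moreover have "?M \<noteq> R" using RE(5) one_nV1 unfolding One_nat_def by force
    ultimately show ?thesis
      using maximalideal.I_maximal[OF J mid_nV_ideal[OF R, of 1]] by auto
  qed
  show q: "quasilocal (sub K R)"
    unfolding quasilocal_def using subring_cring[OF mid_subring[OF R]] MM uniq by blast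
  show "max_ideal (sub K R) = ?M" using uniq[OF max_ideal_maximal[OF q]] .
qed

section \<open>Noetherian property and quotient fields of intermediate rings\<close>

definition maxA :: "'a set" where "maxA = A \<inter> nV 1"

lemma max_ideal_A: "quasilocal (sub K A)" "max_ideal (sub K A) = maxA"
  using vlocal_quasilocal[OF mid_A vlocal_A] by (simp_all add: maxA_def)

text \<open>Clearing denominators, a nonzero ideal \<open>I\<close> contains a nonzero
  \<open>c\<close> of \<open>A\<close>. As R = A + cR, every element of \<open>I\<close> differs
  from an element of \<open>I \<inter> A\<close> by a multiple of \<open>c\<close>, so finitely many
  generators of this ideal of \<open>A\<close> generate \<open>I\<close>.\<close>

lemma noetherian_of_divisible:
  assumes R: "mid R"
    and div: "\<And>c x. c \<in> R \<Longrightarrow> c \<noteq> \<zero> \<Longrightarrow> x \<in> R \<Longrightarrow> \<exists>a\<in>A. \<exists>r\<in>R. x = a \<oplus> c \<otimes> r"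
  shows "noetherian_ring (sub K R)"
proof (rule ring.noetherian_ringI[OF subring_is_ring[OF mid_subring[OF R]]])
  note RE = mid_closed[OF R]
  let ?T = "sub K R"
  have rR: "ring ?T" by (rule subring_is_ring[OF mid_subring[OF R]])
  have rA: "ring (sub K A)" by (rule subring_is_ring[OF A])
  fix I assume I: "ideal I ?T"
  note IE = mid_idealD[OF R I]
  show "\<exists>S\<subseteq>carrier ?T. finite S \<and> I = Idl\<^bsub>?T\<^esub> S"
  proof (cases "I = {\<zero>}")
    case True
    then show ?thesis using ring.genideal_zero[OF rR] RE by (intro exI[of _ "{\<zero>}"]) auto
  next
    case False
    moreover have "\<zero> \<in> I" by (rule IE(3))
    ultimately obtain c' where c': "c' \<in> I" "c' \<noteq> \<zero>" by blast
    have "c' \<in> V" using c' IE(1) RE(2) by blast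
    then obtain b where b: "b \<in> A" "b \<noteq> \<zero>" "b \<otimes> c' \<in> A" using V_frac by blast
    define c where "c = b \<otimes> c'"
    have c: "c \<in> I" "c \<in> A" "c \<noteq> \<zero>"
      using b c' IE RE \<open>c' \<in> V\<close> integral[of b c'] by (auto simp: c_def)
    have IA: "ideal (I \<inter> A) (sub K A)"
      unfolding ideal_sub_iff[OF A] using IE RE by auto
    then obtain S where S: "S \<subseteq> A" "finite S" "I \<inter> A = Idl\<^bsub>sub K A\<^esub> S"
      using noetherian_ring.finetely_gen[OF A_noeth IA] by auto
    have SI: "S \<subseteq> I" using ring.genideal_self[OF rA, of S] S by auto
    have SR: "S \<subseteq> carrier ?T" using S RE by auto
    let ?J = "Idl\<^bsub>?T\<^esub> S"
    have J: "ideal ?J ?T" by (rule ring.genideal_ideal[OF rR SR])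
    note JE = mid_idealD[OF R J]
    have SJ: "S \<subseteq> ?J" by (rule ring.genideal_self[OF rR SR])
    have JI: "?J \<subseteq> I" by (rule ring.genideal_minimal[OF rR I SI])
    have "ideal (?J \<inter> A) (sub K A)" unfolding ideal_sub_iff[OF A] using JE RE by auto
    then have AJ: "I \<inter> A \<subseteq> ?J" using ring.genideal_minimal[OF rA, of "?J \<inter> A" S] S SJ by auto
    have "I \<subseteq> ?J"
    proof
      fix x assume x: "x \<in> I"
      then have xR: "x \<in> R" by (rule IE(1))
      obtain a r where a: "a \<in> A" "r \<in> R" "x = a \<oplus> c \<otimes> r"
        using div[of c x] c xR RE(1) by blast
      have cJ: "c \<in> ?J" using AJ c by auto
      have cr: "r \<otimes> c \<in> ?J" "r \<otimes> c \<in> I" using JE(5)[OF a(2) cJ] IE(5)[OF a(2) c(1)] .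
      have K: "a \<in> carrier K" "r \<in> carrier K" "c \<in> carrier K" using a c RE by auto
      have "x \<ominus> r \<otimes> c \<in> I" by (rule IE(8)[OF x cr(2)])
      moreover have "a \<oplus> c \<otimes> r \<ominus> r \<otimes> c = a" using K by algebra
      ultimately have "a \<in> I" using a K by simp
      then have "a \<in> ?J" using AJ a by auto
      then have "a \<oplus> r \<otimes> c \<in> ?J" using JE(4) cr(1) by blast
      then show "x \<in> ?J" using a K by (simp add: m_comm)
    qed
    then show ?thesis using JI S SR by (intro exI[of _ S]) auto
  qed
qed

lemma mult_frac:
  assumes "x \<in> V" "x \<noteq> \<zero>"
  obtains b where "b \<in> A" "b \<noteq> \<zero>" "b \<otimes> x \<in> A" "b \<otimes> x \<noteq> \<zero>"
  using V_frac[OF assms(1)] assms integral by (metis A_K V_K)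

lemma quot_field_eq:
  assumes R: "mid R"
  shows "quot_field K A = quot_field K R"
proof
  note RE = mid_closed[OF R]
  show "quot_field K A \<subseteq> quot_field K R" unfolding quot_field_def using RE by blast
  show "quot_field K R \<subseteq> quot_field K A"
  proof
    fix x assume "x \<in> quot_field K R"
    then obtain p q where pq: "p \<in> R" "q \<in> R" "q \<noteq> \<zero>" "x = p \<otimes> inv q"
      unfolding quot_field_def by blast
    then obtain b where b: "b \<in> A" "b \<noteq> \<zero>" "b \<otimes> p \<in> A" using V_frac[of p] RE by blast
    have pV: "q \<in> V" "p \<in> V" using pq RE by auto
    have "b \<otimes> q \<in> V" "b \<otimes> q \<noteq> \<zero>" using b pq pV A_V integral[of b q] by auto
    then obtain d where d: "d \<in> A" "d \<noteq> \<zero>" "d \<otimes> (b \<otimes> q) \<in> A" "d \<otimes> (b \<otimes> q) \<noteq> \<zero>" using mult_frac by blast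
    define c where "c = d \<otimes> (b \<otimes> q)"
    have K: "p \<in> carrier K" "q \<in> carrier K" "b \<in> carrier K" "d \<in> carrier K" "inv q \<in> carrier K" "c \<in> carrier K" "inv c \<in> carrier K"
      using pq RE b d by (auto simp: c_def)
    have "c \<otimes> x = d \<otimes> (b \<otimes> p) \<otimes> (inv q \<otimes> q)" unfolding pq(4) c_def using K by (simp add: m_ac)
    then have "c \<otimes> x = d \<otimes> (b \<otimes> p)" using K pq by simp
    then have "inv c \<otimes> (c \<otimes> x) = inv c \<otimes> (d \<otimes> (b \<otimes> p))" by simp
    then have "inv c \<otimes> c \<otimes> x = d \<otimes> (b \<otimes> p) \<otimes> inv c" using K pq by (simp add: m_ac)
    then have "x = d \<otimes> (b \<otimes> p) \<otimes> inv c" using K pq d by (simp add: c_def)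
    then show "x \<in> quot_field K A" unfolding quot_field_def using d b c_def by fastforce
  qed
qed

lemma quot_field_I:
  assumes "mid R" "x \<in> carrier K" "b \<in> R" "b \<noteq> \<zero>" "b \<otimes> x \<in> R"
  shows "x \<in> quot_field K R"
proof -
  have bK: "b \<in> carrier K" "inv b \<in> carrier K" using assms mid_closed by auto
  have "b \<otimes> x \<otimes> inv b = (inv b \<otimes> b) \<otimes> x" using bK assms(2) by (simp only: m_ac m_closed)
  then have "x = b \<otimes> x \<otimes> inv b" using assms(2,4) bK by simp
  then show ?thesis unfolding quot_field_def using assms by blast
qed

lemma quot_field_E:
  assumes "mid R" "x \<in> quot_field K R"
  obtains b where "b \<in> R" "b \<noteq> \<zero>" "b \<otimes> x \<in> R" "x \<in> carrier K"
proof -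
  obtain p q where pq: "p \<in> R" "q \<in> R" "q \<noteq> \<zero>" "x = p \<otimes> inv q"
    using assms(2) unfolding quot_field_def by blast
  have K: "p \<in> carrier K" "q \<in> carrier K" "inv q \<in> carrier K" using pq mid_closed[OF assms(1)] by auto
  have "q \<otimes> x = p \<otimes> (inv q \<otimes> q)" using pq(4) K by (simp only: m_ac m_closed)
  then have "q \<otimes> x = p" using K pq by simp
  then show ?thesis using that[of q] pq K by simp
qed

end

section \<open>Finite modules and integrality\<close>

lemma abelian_monoid_restrict_scalars:
  assumes "ring S"
  shows "abelian_monoid (restrict_scalars h S)"
proof -
  interpret abelian_monoid S using assms by (simp add: ring_def abelian_group_def)
  show ?thesis
    by (rule abelian_monoidI) (simp_all add: restrict_scalars_def a_ac)
qed

lemma restrict_scalars_simps [simp]: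
  "carrier (restrict_scalars h S) = carrier S" "add (restrict_scalars h S) = add S"
  "\<zero>\<^bsub>restrict_scalars h S\<^esub> = \<zero>\<^bsub>S\<^esub>" "a \<odot>\<^bsub>restrict_scalars h S\<^esub> x = h a \<otimes>\<^bsub>S\<^esub> x"
  by (simp_all add: restrict_scalars_def)

lemma finitely_generated_singletonI:
  assumes S: "ring S" and g: "g \<in> carrier S" and h: "h ` carrier R \<subseteq> carrier S"
    and gen: "\<And>x. x \<in> carrier S \<Longrightarrow> \<exists>a\<in>carrier R. x = h a \<otimes>\<^bsub>S\<^esub> g"
  shows "finitely_generated_module R (restrict_scalars h S)"
proof -
  let ?M = "restrict_scalars h S"
  interpret M: abelian_monoid ?M by (rule abelian_monoid_restrict_scalars[OF S])
  have cl: "h a \<otimes>\<^bsub>S\<^esub> g \<in> carrier S" if "a \<in> carrier R" for a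
    using monoid.m_closed[OF ring.is_monoid[OF S], of "h a" g] g h that by auto
  have eq: "(\<Oplus>\<^bsub>?M\<^esub>s\<in>{g}. c s \<odot>\<^bsub>?M\<^esub> s) = h (c g) \<otimes>\<^bsub>S\<^esub> g" if "c \<in> {g} \<rightarrow> carrier R" for c
    using M.finsum_insert[of "{}" g "\<lambda>s. c s \<odot>\<^bsub>?M\<^esub> s"] that cl[of "c g"]
      M.finsum_empty M.r_zero[of "h (c g) \<otimes>\<^bsub>S\<^esub> g"] by (simp add: Pi_def)
  define R' where "R' = {\<Oplus>\<^bsub>?M\<^esub>s\<in>{g}. c s \<odot>\<^bsub>?M\<^esub> s |c. c \<in> {g} \<rightarrow> carrier R}"
  have "x \<in> R'" if x: "x \<in> carrier S" for x
  proof -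
    obtain a where a: "a \<in> carrier R" "x = h a \<otimes>\<^bsub>S\<^esub> g" using gen[OF x] by auto
    have c: "(\<lambda>_. a) \<in> {g} \<rightarrow> carrier R" using a by simp
    show ?thesis using eq[OF c] a(2) c unfolding R'_def by (intro CollectI exI[of _ "\<lambda>_. a"] conjI) simp_all
  qed
  moreover have "x \<in> carrier S" if "x \<in> R'" for x using that eq cl unfolding R'_def by (auto simp: Pi_def)
  ultimately have eqR: "carrier ?M = R'" by auto
  have g': "finite {g}" "{g} \<subseteq> carrier ?M" using g by simp_all
  show ?thesis
    unfolding finitely_generated_module_def
    by (rule exI[of _ "{g}"], intro conjI g', rule eqR[unfolded R'_def])
qed

context tight_pair
begin

text \<open>The \<open>R\<close>-module spanned by the powers of \<open>x\<close> below
  \<open>l\<close>. The highest power comes first, as in the coefficient lists that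
  \<open>eval\<close> reads.\<close>

primrec pspan :: "'a set \<Rightarrow> 'a \<Rightarrow> nat \<Rightarrow> 'a set" where
  "pspan R x 0 = {\<zero>}"
| "pspan R x (Suc l) = {r \<otimes> x [^] l \<oplus> g |r g. r \<in> R \<and> g \<in> pspan R x l}"

lemma pspan_closed:
  assumes R: "mid R" and x: "x \<in> carrier K"
  shows "g \<in> pspan R x l \<Longrightarrow> g \<in> carrier K" "\<zero> \<in> pspan R x l"
    "g \<in> pspan R x l \<Longrightarrow> g' \<in> pspan R x l \<Longrightarrow> g \<oplus> g' \<in> pspan R x l"
    "r \<in> R \<Longrightarrow> g \<in> pspan R x l \<Longrightarrow> r \<otimes> g \<in> pspan R x l"
    "g \<in> pspan R x l \<Longrightarrow> x \<otimes> g \<in> pspan R x (Suc l)"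
    "g \<in> pspan R x l \<Longrightarrow> g \<in> pspan R x (Suc l)"
    "x [^] l \<in> pspan R x (Suc l)"
proof -
  note RE = mid_closed[OF R]
  show c: "g \<in> pspan R x l \<Longrightarrow> g \<in> carrier K" for g l
    by (induct l arbitrary: g) (use RE x in auto)
  show z: "\<zero> \<in> pspan R x l" for l
  proof (induct l)
    case (Suc l)
    have "\<zero> = \<zero> \<otimes> x [^] l \<oplus> \<zero>" using x by simp
    then show ?case using Suc RE(4) unfolding pspan.simps by blast
  qed simp
  show "g \<in> pspan R x l \<Longrightarrow> g' \<in> pspan R x l \<Longrightarrow> g \<oplus> g' \<in> pspan R x l" for g g'
  proof (induct l arbitrary: g g')
    case (Suc l)
    then obtain r h r' h' where h: "g = r \<otimes> x [^] l \<oplus> h" "r \<in> R" "h \<in> pspan R x l"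
      "g' = r' \<otimes> x [^] l \<oplus> h'" "r' \<in> R" "h' \<in> pspan R x l" by auto
    define z where "z = x [^] l"
    have K: "r \<in> carrier K" "r' \<in> carrier K" "h \<in> carrier K" "h' \<in> carrier K" "z \<in> carrier K"
      using h RE c x by (auto simp: z_def)
    have "g \<oplus> g' = (r \<oplus> r') \<otimes> z \<oplus> (h \<oplus> h')"
      unfolding h z_def[symmetric] by (use K in algebra)
    then show ?case using Suc(1)[of h h'] h RE(7)[of r r'] unfolding pspan.simps z_def by blast
  qed simp
  show "r \<in> R \<Longrightarrow> g \<in> pspan R x l \<Longrightarrow> r \<otimes> g \<in> pspan R x l" for g
  proof (induct l arbitrary: g)
    case (Suc l)
    then obtain r' h where h: "g = r' \<otimes> x [^] l \<oplus> h" "r' \<in> R" "h \<in> pspan R x l" by auto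
    define z where "z = x [^] l"
    have K: "r \<in> carrier K" "r' \<in> carrier K" "h \<in> carrier K" "z \<in> carrier K"
      using h RE c x Suc by (auto simp: z_def)
    have "r \<otimes> g = (r \<otimes> r') \<otimes> z \<oplus> r \<otimes> h"
      unfolding h z_def[symmetric] by (use K in algebra)
    then show ?case using Suc(1)[of h] Suc(2) h RE(8)[of r r'] unfolding pspan.simps z_def by blast
  qed (use RE in simp)
  show "g \<in> pspan R x l \<Longrightarrow> x \<otimes> g \<in> pspan R x (Suc l)" for g
  proof (induct l arbitrary: g)
    case 0
    then show ?case using z[of "Suc 0"] x by simp
  next
    case (Suc l)
    then obtain r h where h: "g = r \<otimes> x [^] l \<oplus> h" "r \<in> R" "h \<in> pspan R x l" by auto
    define z where "z = x [^] l"
    have K: "r \<in> carrier K" "h \<in> carrier K" "z \<in> carrier K"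
      using h RE c x Suc by (auto simp: z_def)
    have "x \<otimes> g = r \<otimes> (z \<otimes> x) \<oplus> x \<otimes> h"
      unfolding h z_def[symmetric] by (use K x in algebra)
    then have "x \<otimes> g = r \<otimes> x [^] Suc l \<oplus> x \<otimes> h" by (simp add: z_def)
    then show ?case using Suc(1)[OF h(3)] h(2) unfolding pspan.simps(2)[of _ _ "Suc l"] by blast
  qed
  show "g \<in> pspan R x l \<Longrightarrow> g \<in> pspan R x (Suc l)" for g
  proof -
    assume g: "g \<in> pspan R x l"
    have "g = \<zero> \<otimes> x [^] l \<oplus> g" using c[OF g] x by simp
    then show ?thesis using g RE(4) unfolding pspan.simps by blast
  qed
  have "x [^] l = \<one> \<otimes> x [^] l \<oplus> \<zero>" using x by simp
  then show "x [^] l \<in> pspan R x (Suc l)" using z[of l] RE(5) unfolding pspan.simps by blast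
qed

lemma pspan_mono: "mid R \<Longrightarrow> x \<in> carrier K \<Longrightarrow> i \<le> j \<Longrightarrow> pspan R x i \<subseteq> pspan R x j"
proof -
  assume *: "mid R" "x \<in> carrier K" "i \<le> j"
  from *(3) show ?thesis
    by (induct j rule: dec_induct) (use pspan_closed(6)[OF *(1,2)] in blast)+
qed

lemma eval_pspan: "set ps \<subseteq> R \<Longrightarrow> eval ps x \<in> pspan R x (length ps)"
  by (induct ps) auto

lemma pspan_eval: "g \<in> pspan R x l \<Longrightarrow> \<exists>ps. set ps \<subseteq> R \<and> length ps = l \<and> g = eval ps x"
proof (induct l arbitrary: g)
  case (Suc l)
  then obtain r h where h: "g = r \<otimes> x [^] l \<oplus> h" "r \<in> R" "h \<in> pspan R x l" by auto
  then obtain ps where "set ps \<subseteq> R" "length ps = l" "h = eval ps x" using Suc(1) by blast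
  then show ?case using h by (intro exI[of _ "r # ps"]) simp
qed simp

lemma pspan_denominator:
  assumes R: "mid R" and x: "x \<in> carrier K" and b: "b \<in> R" "b \<otimes> x \<in> R"
  shows "g \<in> pspan R x l \<Longrightarrow> b [^] l \<otimes> g \<in> R"
proof (induct l arbitrary: g)
  case 0
  then show ?case using mid_closed[OF R] by simp
next
  case (Suc l)
  note RE = mid_closed[OF R]
  obtain r h where h: "g = r \<otimes> x [^] l \<oplus> h" "r \<in> R" "h \<in> pspan R x l" using Suc by auto
  define z B where "z = x [^] l" "B = b [^] l"
  have K: "r \<in> carrier K" "h \<in> carrier K" "z \<in> carrier K" "B \<in> carrier K" "b \<in> carrier K"
    using h RE pspan_closed(1)[OF R x] x b by (auto simp: z_B_def)
  have "B \<otimes> b \<otimes> g = r \<otimes> b \<otimes> (B \<otimes> z) \<oplus> b \<otimes> (B \<otimes> h)"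
    unfolding h z_B_def[symmetric] by (use K in algebra)
  moreover have "B \<otimes> z = (b \<otimes> x) [^] l" using b RE x by (simp add: z_B_def nat_pow_distrib)
  ultimately show ?case using Suc(1)[OF h(3)] b h(2) RE by (simp add: z_B_def)
qed

text \<open>A monic equation of degree m puts all powers of \<open>x\<close> into the span of the
  first m of them. If \<open>b\<close> is a denominator of \<open>x\<close>, then b^m clears the
  denominators of that span.\<close>

lemma integral_imp_almost:
  assumes R: "mid R" and x: "x \<in> integral_closure K R (quot_field K R)"
  obtains d where "d \<in> R" "d \<noteq> \<zero>" "\<And>k::nat. d \<otimes> x [^] k \<in> R"
proof -
  note RE = mid_closed[OF R]
  obtain p where p: "polynomial\<^bsub>K\<^esub> R p" "p \<noteq> []" "lead_coeff p = \<one>" "eval p x = \<zero>"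
    and xq: "x \<in> quot_field K R" using x unfolding integral_closure_def by blast
  obtain b where b: "b \<in> R" "b \<noteq> \<zero>" "b \<otimes> x \<in> R" and xK: "x \<in> carrier K"
    using quot_field_E[OF R xq] by blast
  obtain q where q: "p = \<one> # q" using p by (cases p) auto
  have qR: "set q \<subseteq> R" using p q by (auto simp: polynomial_def)
  define m where "m = length q"
  note PC = pspan_closed[OF R xK]
  have ev: "eval q x \<in> pspan R x m" using eval_pspan[OF qR] by (simp add: m_def)
  have "x [^] m \<oplus> eval q x = \<zero>" using p(4) q xK by (simp add: m_def)
  then have "x [^] m = \<ominus> eval q x" using xK PC(1)[OF ev] by (simp add: minus_equality)
  also have "\<dots> = \<ominus> \<one> \<otimes> eval q x" using PC(1)[OF ev] by (simp add: l_minus)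
  also have "\<dots> \<in> pspan R x m" using PC(4)[OF _ ev] RE by simp
  finally have xm: "x [^] m \<in> pspan R x m" .
  have mult: "x \<otimes> g \<in> pspan R x m" if g: "g \<in> pspan R x m" for g
  proof -
    obtain r h where "x \<otimes> g = r \<otimes> x [^] m \<oplus> h" "r \<in> R" "h \<in> pspan R x m" using PC(5)[OF g] by auto
    then show ?thesis using PC(3,4) xm by simp
  qed
  have pow: "x [^] k \<in> pspan R x m" for k :: nat
  proof (cases "k < m")
    case True
    then show ?thesis using PC(7)[of k] pspan_mono[OF R xK, of "Suc k" m] by auto
  next
    case False
    then have "m \<le> k" by simp
    then show ?thesis
    proof (induct k rule: dec_induct)
      case (step n)
      then show ?case using mult[of "x [^] n"] xK by (simp add: m_comm)
    qed (use xm in simp)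
  qed
  have "b [^] m \<noteq> \<zero>" using b RE by simp
  then show ?thesis using that[of "b [^] m"] b RE pspan_denominator[OF R xK b(1,3) pow] by simp
qed

text \<open>Multiplied by \<open>d\<close>, the spans of the first l powers of \<open>x\<close> form
  an ascending chain of ideals of \<open>R\<close>. Where it becomes stationary, a power of
  \<open>x\<close> is a combination of lower ones.\<close>

lemma almost_imp_integral:
  assumes R: "mid R" and noeth: "noetherian_ring (sub K R)" and x: "x \<in> carrier K"
    and d: "d \<in> R" "d \<noteq> \<zero>" "\<And>k::nat. d \<otimes> x [^] k \<in> R"
  shows "x \<in> integral_closure K R (quot_field K R)"
proof -
  note RE = mid_closed[OF R]
  note PC = pspan_closed[OF R x]
  have dK: "d \<in> carrier K" using d RE by simp
  define I where "I l = {d \<otimes> g |g. g \<in> pspan R x l}" for l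
  have dR: "d \<otimes> g \<in> R" if "g \<in> pspan R x l" for g l
    using that
  proof (induct l arbitrary: g)
    case 0
    then show ?case using dK RE by simp
  next
    case (Suc l)
    then obtain r h where h: "g = r \<otimes> x [^] l \<oplus> h" "r \<in> R" "h \<in> pspan R x l" by auto
    have K: "r \<in> carrier K" "h \<in> carrier K" "x [^] l \<in> carrier K" using h RE PC x by auto
    have "d \<otimes> g = r \<otimes> (d \<otimes> x [^] l) \<oplus> d \<otimes> h"
      unfolding h using K dK by (simp add: r_distr m_lcomm)
    then show ?case using Suc(1)[OF h(3)] h(2) d RE by simp
  qed
  have idl: "ideal (I l) (sub K R)" for l
    unfolding ideal_sub_iff[OF mid_subring[OF R]]
  proof (intro conjI ballI)
    show "I l \<subseteq> R" using dR by (auto simp: I_def)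
    show "\<zero> \<in> I l" unfolding I_def using PC(2)[of l] r_null[OF dK] by force
  next
    fix u v assume "u \<in> I l" "v \<in> I l"
    then obtain g h where gh: "u = d \<otimes> g" "v = d \<otimes> h" "g \<in> pspan R x l" "h \<in> pspan R x l" by (auto simp: I_def)
    then have "u \<oplus> v = d \<otimes> (g \<oplus> h)" using dK PC(1) by (simp add: r_distr)
    then show "u \<oplus> v \<in> I l" using PC(3) gh by (auto simp: I_def)
  next
    fix r u assume r: "r \<in> R" and "u \<in> I l"
    then obtain g where g: "u = d \<otimes> g" "g \<in> pspan R x l" by (auto simp: I_def)
    then have "r \<otimes> u = d \<otimes> (r \<otimes> g)" using dK PC(1) r RE by (simp add: m_lcomm)
    then show "r \<otimes> u \<in> I l" using PC(4) g r by (auto simp: I_def)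
  qed
  have mono: "i \<le> j \<Longrightarrow> I i \<subseteq> I j" for i j using pspan_mono[OF R x, of i j] by (auto simp: I_def)
  have "I i \<subset> I j \<or> I j \<subset> I i \<or> I i = I j" for i j
    using mono[of i j] mono[of j i] by (cases "i \<le> j") auto
  then have "subset.chain {I. ideal I (sub K R)} (range I)"
    unfolding pred_on.chain_def using idl by blast
  then have "\<Union>(range I) \<in> range I"
    using noetherian_ring.ideal_chain_is_trivial[OF noeth, of "range I"] by simp
  then obtain N where "\<Union>(range I) = I N" by auto
  moreover have "d \<otimes> x [^] N \<in> I (Suc N)" using PC(7)[of N] by (auto simp: I_def simp del: pspan.simps)
  ultimately have "d \<otimes> x [^] N \<in> I N" by blast
  then obtain g where g: "g \<in> pspan R x N" "d \<otimes> x [^] N = d \<otimes> g" by (auto simp: I_def)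
  have "x [^] N = g" by (rule cancel[OF _ _ _ _ g(2)]) (use dK d x PC(1)[OF g(1)] in auto)
  \<comment> \<open>The monic polynomial is \<open>\<one> # ps\<close>, so \<open>ps\<close> has to
    evaluate to the negative of x^N.\<close>
  then have "\<ominus> \<one> \<otimes> x [^] N \<in> pspan R x N" using PC(4)[OF _ g(1)] RE by simp
  then obtain ps where ps: "set ps \<subseteq> R" "length ps = N" "\<ominus> \<one> \<otimes> x [^] N = eval ps x"
    using pspan_eval by blast
  have "eval (\<one> # ps) x = \<zero>" using ps x ps(3)[symmetric] by (simp add: l_minus r_neg)
  moreover have "polynomial\<^bsub>K\<^esub> R (\<one> # ps)" using ps RE by (simp add: polynomial_def)
  moreover have "x \<in> quot_field K R"
    using quot_field_I[OF R x d(1,2)] d(3)[of 1] x by simp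
  ultimately show ?thesis unfolding integral_closure_def
    by (intro CollectI conjI exI[of _ "\<one> # ps"]) simp_all
qed

text \<open>Multiplication by \<open>d\<close> embeds \<open>E\<close> into \<open>R\<close> as an
  ideal; the generators of this ideal, divided by \<open>d\<close>, generate \<open>E\<close>. The
  sums are formed in the record of the module, not in \<open>K\<close>, so their laws have to be
  derived for that record.\<close>

lemma finite_moduleI:
  assumes R: "mid R" and noeth: "noetherian_ring (sub K R)" and E: "subring E K"
    and mult: "\<And>r x. r \<in> R \<Longrightarrow> x \<in> E \<Longrightarrow> r \<otimes> x \<in> E"
    and d: "d \<in> R" "d \<noteq> \<zero>" "\<And>x. x \<in> E \<Longrightarrow> d \<otimes> x \<in> R"
  shows "finitely_generated_module (sub K R) (restrict_scalars (\<lambda>a. a) (sub K E))"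
proof -
  note RE = mid_closed[OF R]
  note EE = subringE[OF E]
  have EK: "x \<in> E \<Longrightarrow> x \<in> carrier K" for x using EE(1) by auto
  have dK: "d \<in> carrier K" using d RE by simp
  let ?M = "restrict_scalars (\<lambda>a. a) (sub K E)"
  have rE: "ring (sub K E)" by (rule subring_is_ring[OF E])
  interpret M: abelian_monoid ?M by (rule abelian_monoid_restrict_scalars[OF rE])
  let ?I = "(\<lambda>x. d \<otimes> x) ` E"
  have I: "ideal ?I (sub K R)"
    unfolding ideal_sub_iff[OF mid_subring[OF R]]
  proof (intro conjI ballI)
    show "?I \<subseteq> R" using d by auto
    show "\<zero> \<in> ?I" using EE(2) dK by (intro image_eqI[of _ _ \<zero>]) auto
  next
    fix x y assume "x \<in> ?I" "y \<in> ?I"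
    then obtain a b where "a \<in> E" "b \<in> E" "x = d \<otimes> a" "y = d \<otimes> b" by auto
    then show "x \<oplus> y \<in> ?I" using EE(7)[of a b] EK dK by (intro image_eqI[of _ _ "a \<oplus> b"]) (auto simp: r_distr)
  next
    fix r x assume "r \<in> R" "x \<in> ?I"
    then obtain a where "a \<in> E" "x = d \<otimes> a" by auto
    then show "r \<otimes> x \<in> ?I" using mult[of r a] EK dK RE \<open>r \<in> R\<close>
      by (intro image_eqI[of _ _ "r \<otimes> a"]) (auto simp: m_lcomm)
  qed
  then obtain S' where S': "S' \<subseteq> R" "finite S'" "?I = Idl\<^bsub>sub K R\<^esub> S'"
    using noetherian_ring.finetely_gen[OF noeth I] by auto
  have rR: "ring (sub K R)" by (rule subring_is_ring[OF mid_subring[OF R]])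
  have "S' \<subseteq> ?I" using ring.genideal_self[OF rR, of S'] S' by auto
  then obtain S where S: "S \<subseteq> E" "finite S" "S' = (\<lambda>x. d \<otimes> x) ` S"
    using finite_subset_image[OF S'(2)] by blast
  define f where "f c = (\<Oplus>\<^bsub>?M\<^esub>s\<in>S. c s \<odot>\<^bsub>?M\<^esub> s)" for c
  have tm: "c s \<odot>\<^bsub>?M\<^esub> s \<in> carrier ?M" if "c \<in> S \<rightarrow> R" "s \<in> S" for c s
    using that S mult by (auto simp: Pi_def)
  have fE: "f c \<in> E" if "c \<in> S \<rightarrow> R" for c
    using M.finsum_closed[of "\<lambda>s. c s \<odot>\<^bsub>?M\<^esub> s" S] tm[OF that] by (auto simp: f_def)
  define G where "G = {f c |c. c \<in> S \<rightarrow> R}"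
  have add: "f c \<oplus> f c' = f (\<lambda>s. c s \<oplus> c' s)" if "c \<in> S \<rightarrow> R" "c' \<in> S \<rightarrow> R" for c c'
  proof -
    have "f (\<lambda>s. c s \<oplus> c' s) = (\<Oplus>\<^bsub>?M\<^esub>s\<in>S. (c s \<odot>\<^bsub>?M\<^esub> s) \<oplus>\<^bsub>?M\<^esub> (c' s \<odot>\<^bsub>?M\<^esub> s))"
      unfolding f_def by (rule M.finsum_cong') (use that tm[OF that(1)] tm[OF that(2)] EE(7) S EK RE(3) in \<open>auto simp: l_distr Pi_def subset_iff\<close>)
    also have "\<dots> = f c \<oplus>\<^bsub>?M\<^esub> f c'" unfolding f_def by (rule M.finsum_addf) (use tm that in auto)
    finally show ?thesis by simp
  qed
  have smul: "r \<otimes> (\<Oplus>\<^bsub>?M\<^esub>s\<in>T. c s \<odot>\<^bsub>?M\<^esub> s) = (\<Oplus>\<^bsub>?M\<^esub>s\<in>T. (r \<otimes> c s) \<odot>\<^bsub>?M\<^esub> s)"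
    if r: "r \<in> R" and "c \<in> S \<rightarrow> R" "T \<subseteq> S" for r c T
  proof -
    have "finite T" using that(3) S finite_subset by auto
    then show ?thesis using that(3)
    proof (induct T)
      case empty
      then show ?case using r RE M.finsum_empty by simp
    next
      case (insert s T)
      have cl: "(\<lambda>s. c s \<odot>\<^bsub>?M\<^esub> s) \<in> insert s T \<rightarrow> carrier ?M"
        "(\<lambda>s. (r \<otimes> c s) \<odot>\<^bsub>?M\<^esub> s) \<in> insert s T \<rightarrow> carrier ?M"
        using tm[of c] tm[of "\<lambda>s. r \<otimes> c s"] that insert RE by (auto simp: Pi_def)
      then have c2: "(\<Oplus>\<^bsub>?M\<^esub>s\<in>T. c s \<odot>\<^bsub>?M\<^esub> s) \<in> E"
        using M.finsum_closed[of "\<lambda>s. c s \<odot>\<^bsub>?M\<^esub> s" T] by auto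
      have K: "c s \<in> carrier K" "s \<in> carrier K" "r \<in> carrier K" "(\<Oplus>\<^bsub>?M\<^esub>s\<in>T. c s \<odot>\<^bsub>?M\<^esub> s) \<in> carrier K"
        using c2 that(1) funcset_mem[OF that(2), of s] insert(4) RE(3) EK S(1) by auto
      have "(\<Oplus>\<^bsub>?M\<^esub>s\<in>insert s T. c s \<odot>\<^bsub>?M\<^esub> s) = c s \<otimes> s \<oplus> (\<Oplus>\<^bsub>?M\<^esub>s\<in>T. c s \<odot>\<^bsub>?M\<^esub> s)"
        using M.finsum_insert[of T s "\<lambda>s. c s \<odot>\<^bsub>?M\<^esub> s"] insert cl by simp
      moreover have "(\<Oplus>\<^bsub>?M\<^esub>s\<in>insert s T. (r \<otimes> c s) \<odot>\<^bsub>?M\<^esub> s) = r \<otimes> c s \<otimes> s \<oplus> (\<Oplus>\<^bsub>?M\<^esub>s\<in>T. (r \<otimes> c s) \<odot>\<^bsub>?M\<^esub> s)"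
        using M.finsum_insert[of T s "\<lambda>s. (r \<otimes> c s) \<odot>\<^bsub>?M\<^esub> s"] insert cl by simp
      ultimately show ?case using insert K by (simp add: r_distr m_assoc)
    qed
  qed
  have SG: "s \<in> G" if s: "s \<in> S" for s
  proof -
    let ?c = "\<lambda>u. if u = s then \<one> else \<zero>"
    have "f ?c = (\<Oplus>\<^bsub>?M\<^esub>u\<in>S. if s = u then u else \<zero>\<^bsub>?M\<^esub>)"
      unfolding f_def by (rule M.finsum_cong') (use S EK EE(2,3) in \<open>auto simp: subset_iff\<close>)
    also have "\<dots> = s" using M.add.finprod_singleton[OF s S(2), of "\<lambda>u. u"] S by (auto simp: finsum_def)
    finally show ?thesis unfolding G_def using RE by (intro CollectI exI[of _ ?c]) auto
  qed
  have GE: "G \<subseteq> E" using fE by (auto simp: G_def)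
  \<comment> \<open>The multiples by \<open>d\<close> of all combinations of \<open>S\<close> form
    an ideal that contains the generators \<open>S'\<close>, hence all of dE.\<close>
  have J: "ideal ((\<lambda>x. d \<otimes> x) ` G) (sub K R)"
    unfolding ideal_sub_iff[OF mid_subring[OF R]]
  proof (intro conjI ballI)
    show "(\<lambda>x. d \<otimes> x) ` G \<subseteq> R" using d GE by auto
    have "f (\<lambda>_. \<zero>) = \<zero> \<otimes> f (\<lambda>_. \<zero>)" using smul[of \<zero> "\<lambda>_. \<zero>" S] RE by (simp add: f_def)
    then have "f (\<lambda>_. \<zero>) = \<zero>" using fE[of "\<lambda>_. \<zero>"] RE EK by simp
    then have "\<zero> \<in> G" unfolding G_def using RE by (intro CollectI exI[of _ "\<lambda>_. \<zero>"]) auto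
    then show "\<zero> \<in> (\<lambda>x. d \<otimes> x) ` G" using dK by (intro image_eqI[of _ _ \<zero>]) auto
  next
    fix x y assume "x \<in> (\<lambda>x. d \<otimes> x) ` G" "y \<in> (\<lambda>x. d \<otimes> x) ` G"
    then obtain c c' where c: "c \<in> S \<rightarrow> R" "c' \<in> S \<rightarrow> R" "x = d \<otimes> f c" "y = d \<otimes> f c'" by (auto simp: G_def)
    have "x \<oplus> y = d \<otimes> f (\<lambda>s. c s \<oplus> c' s)"
      unfolding c add[OF c(1,2), symmetric] using fE c EK dK by (simp add: r_distr)
    moreover have "(\<lambda>s. c s \<oplus> c' s) \<in> S \<rightarrow> R" using c RE by (auto simp: Pi_def)
    ultimately show "x \<oplus> y \<in> (\<lambda>x. d \<otimes> x) ` G" unfolding G_def by blast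
  next
    fix r x assume r: "r \<in> R" and "x \<in> (\<lambda>x. d \<otimes> x) ` G"
    then obtain c where c: "c \<in> S \<rightarrow> R" "x = d \<otimes> f c" by (auto simp: G_def)
    have "r \<otimes> x = d \<otimes> f (\<lambda>s. r \<otimes> c s)"
      unfolding c f_def smul[OF r c(1) order_refl, symmetric] unfolding f_def[symmetric] using fE[OF c(1)] EK dK RE r by (simp add: m_lcomm)
    moreover have "(\<lambda>s. r \<otimes> c s) \<in> S \<rightarrow> R" using c r RE by (auto simp: Pi_def)
    ultimately show "r \<otimes> x \<in> (\<lambda>x. d \<otimes> x) ` G" unfolding G_def by blast
  qed
  have "S' \<subseteq> (\<lambda>x. d \<otimes> x) ` G" using S(3) SG by blast
  then have "?I \<subseteq> (\<lambda>x. d \<otimes> x) ` G" using ring.genideal_minimal[OF rR J] S'(3) by simp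
  have "E \<subseteq> G"
  proof
    fix x assume x: "x \<in> E"
    then obtain g where g: "g \<in> G" "d \<otimes> x = d \<otimes> g" using \<open>?I \<subseteq> (\<lambda>x. d \<otimes> x) ` G\<close> by blast
    have "x = g" by (rule cancel[OF _ _ _ _ g(2)]) (use dK d x EK GE g in auto)
    then show "x \<in> G" using g by simp
  qed
  then have "carrier ?M = G" using GE by simp
  moreover have "G = {f c |c. c \<in> S \<rightarrow> carrier (sub K R)}" by (simp add: G_def)
  ultimately have eqG: "carrier ?M = {f c |c. c \<in> S \<rightarrow> carrier (sub K R)}" by simp
  have S'': "finite S" "S \<subseteq> carrier ?M" using S by simp_all
  show ?thesis
    unfolding finitely_generated_module_def
    by (rule exI[of _ S], intro conjI S'', rule eqG[unfolded f_def])
qed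

text \<open>Finitely many generators have a common denominator t^N, which then serves for the whole
  module.\<close>

lemma finite_moduleD:
  assumes R: "mid R" and E: "subring E K"
    and mult: "\<And>r x. r \<in> R \<Longrightarrow> x \<in> E \<Longrightarrow> r \<otimes> x \<in> E"
    and fg: "finitely_generated_module (sub K R) (restrict_scalars (\<lambda>a. a) (sub K E))"
    and loc: "\<And>x. x \<in> E \<Longrightarrow> \<exists>N. t [^] (N::nat) \<otimes> x \<in> R"
  shows "\<exists>N. \<forall>x\<in>E. t [^] (N::nat) \<otimes> x \<in> R"
proof -
  note RE = mid_closed[OF R]
  note EE = subringE[OF E]
  have EK: "x \<in> E \<Longrightarrow> x \<in> carrier K" for x using EE(1) by auto
  let ?M = "restrict_scalars (\<lambda>a. a) (sub K E)"
  interpret M: abelian_monoid ?M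
    by (rule abelian_monoid_restrict_scalars[OF subring_is_ring[OF E]])
  obtain S where S: "finite S" "S \<subseteq> E"
    "E = {\<Oplus>\<^bsub>?M\<^esub>s\<in>S. c s \<odot>\<^bsub>?M\<^esub> s |c. c \<in> S \<rightarrow> R}"
    using fg unfolding finitely_generated_module_def by auto
  define f where "f c = (\<Oplus>\<^bsub>?M\<^esub>s\<in>S. c s \<odot>\<^bsub>?M\<^esub> s)" for c
  have Ef: "E = {f c |c. c \<in> S \<rightarrow> R}" unfolding f_def by (rule S(3))
  obtain n where n: "\<And>s. s \<in> S \<Longrightarrow> t [^] (n s :: nat) \<otimes> s \<in> R" using loc S(2) by (metis subsetD)
  define N where "N = Max (insert 0 (n ` S))"
  have nN: "n s \<le> N" if "s \<in> S" for s using that S(1) by (simp add: N_def)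
  have sN: "t [^] N \<otimes> s \<in> R" if s: "s \<in> S" for s
  proof -
    have "t [^] N \<otimes> s = t [^] (N - n s) \<otimes> (t [^] n s \<otimes> s)"
      using tpow_add[of s "N - n s" "n s"] nN[OF s] s S EK by auto
    then show ?thesis using n[OF s] RE by simp
  qed
  have "t [^] N \<otimes> (\<Oplus>\<^bsub>?M\<^esub>s\<in>T. c s \<odot>\<^bsub>?M\<^esub> s) \<in> R" if c: "c \<in> S \<rightarrow> R" and "T \<subseteq> S" for c T
  proof -
    have "finite T" using that(2) S finite_subset by auto
    then show ?thesis using that(2)
    proof (induct T)
      case empty
      then show ?case using RE M.finsum_empty by simp
    next
      case (insert s T)
      have cl: "(\<lambda>s. c s \<odot>\<^bsub>?M\<^esub> s) \<in> insert s T \<rightarrow> carrier ?M"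
        using mult c insert S by (auto simp: Pi_def subset_iff)
      have c2: "(\<Oplus>\<^bsub>?M\<^esub>s\<in>T. c s \<odot>\<^bsub>?M\<^esub> s) \<in> E"
        using M.finsum_closed[of "\<lambda>s. c s \<odot>\<^bsub>?M\<^esub> s" T] cl by auto
      have cs: "c s \<in> R" "s \<in> E" "s \<in> S" using c insert S by auto
      have K: "c s \<in> carrier K" "s \<in> carrier K" "(\<Oplus>\<^bsub>?M\<^esub>s\<in>T. c s \<odot>\<^bsub>?M\<^esub> s) \<in> carrier K"
        using cs c2 RE EK by auto
      have "(\<Oplus>\<^bsub>?M\<^esub>s\<in>insert s T. c s \<odot>\<^bsub>?M\<^esub> s) = c s \<otimes> s \<oplus> (\<Oplus>\<^bsub>?M\<^esub>s\<in>T. c s \<odot>\<^bsub>?M\<^esub> s)"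
        using M.finsum_insert[of T s "\<lambda>s. c s \<odot>\<^bsub>?M\<^esub> s"] insert cl by simp
      then have "t [^] N \<otimes> (\<Oplus>\<^bsub>?M\<^esub>s\<in>insert s T. c s \<odot>\<^bsub>?M\<^esub> s)
          = c s \<otimes> (t [^] N \<otimes> s) \<oplus> t [^] N \<otimes> (\<Oplus>\<^bsub>?M\<^esub>s\<in>T. c s \<odot>\<^bsub>?M\<^esub> s)"
        using K by (simp add: r_distr m_lcomm)
      then show ?case using insert sN[OF cs(3)] cs(1) RE by simp
    qed
  qed
  from this[OF _ order_refl] have "t [^] N \<otimes> f c \<in> R" if "c \<in> S \<rightarrow> R" for c
    unfolding f_def using that .
  then have "\<forall>x\<in>E. t [^] N \<otimes> x \<in> R" unfolding Ef by blast
  then show ?thesis by blast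
qed

end

section \<open>A criterion for bad stability\<close>

lemma krull_dim_eq_1I:
  assumes "primeideal q T" "primeideal M T" "q \<subset> M" "\<And>p. primeideal p T \<Longrightarrow> p = q \<or> p = M"
  shows "krull_dim T = 1"
  unfolding krull_dim_def
proof (rule antisym)
  let ?C = "{enat n |n. \<exists>p. (\<forall>i\<le>n. primeideal (p i) T) \<and> (\<forall>i<n. p i \<subset> p (Suc i))}"
  show "Sup ?C \<le> 1"
  proof (rule Sup_least)
    fix e assume "e \<in> ?C"
    then obtain n p where n: "e = enat n" "\<forall>i\<le>n. primeideal (p i) T" "\<forall>i<n. p i \<subset> p (Suc i)" by blast
    have "n \<le> 1"
    proof (rule ccontr)
      assume "\<not> n \<le> 1"
      then have "p 0 \<subset> p 1" "p 1 \<subset> p 2" "primeideal (p 0) T" "primeideal (p 1) T" "primeideal (p 2) T"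
        using n(2) n(3)[rule_format, of 0] n(3)[rule_format, of 1] by (auto simp: numeral_2_eq_2)
      then show False using assms(3) assms(4)[of "p 0"] assms(4)[of "p 1"] assms(4)[of "p 2"] by blast
    qed
    then show "e \<le> 1" using n(1) by (simp add: one_enat_def)
  qed
  have "\<exists>p. (\<forall>i\<le>(1::nat). primeideal (p i) T) \<and> (\<forall>i<1. p i \<subset> p (Suc i))"
    by (rule exI[of _ "\<lambda>i. if i = 0 then q else M"]) (use assms in auto)
  then have "enat 1 \<in> ?C" by blast
  then show "1 \<le> Sup ?C" by (simp add: one_enat_def Sup_upper)
qed

lemma krull_dim_eq_1D:
  assumes "krull_dim T = 1" "primeideal p T" "primeideal q T" "primeideal r T" "p \<subset> q" "q \<subset> r"
  shows False
proof -
  let ?C = "{enat n |n. \<exists>p. (\<forall>i\<le>n. primeideal (p i) T) \<and> (\<forall>i<n. p i \<subset> p (Suc i))}"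
  have "\<exists>p. (\<forall>i\<le>(2::nat). primeideal (p i) T) \<and> (\<forall>i<2. p i \<subset> p (Suc i))"
    by (rule exI[of _ "\<lambda>i::nat. if i = 0 then p else if i = 1 then q else r"])
      (use assms in \<open>auto simp: less_2_cases_iff\<close>)
  then have "enat 2 \<in> ?C" by blast
  then have "enat 2 \<le> krull_dim T" unfolding krull_dim_def by (rule Sup_upper)
  then show False using assms(1) by (simp add: one_enat_def)
qed

context tight_pair
begin

text \<open>A coset depends only on the addition of \<open>K\<close>, so one notion serves all
  subrings.\<close>

definition coset :: "'a set \<Rightarrow> 'a \<Rightarrow> 'a set" where "coset J x = (\<lambda>j. j \<oplus> x) ` J"

lemma a_r_coset_sub: "J +>\<^bsub>sub K R\<^esub> x = coset J x"
  by (auto simp: coset_def a_r_coset_def' image_def)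

lemma mem_coset_iff:
  assumes "J \<subseteq> carrier K" "x \<in> carrier K" "y \<in> carrier K"
  shows "y \<in> coset J x \<longleftrightarrow> y \<ominus> x \<in> J"
proof
  assume "y \<in> coset J x"
  then obtain j where j: "j \<in> J" "y = j \<oplus> x" by (auto simp: coset_def)
  have jK: "j \<in> carrier K" using j assms by auto
  have "j \<oplus> x \<ominus> x = j" by (use jK assms in algebra)
  then show "y \<ominus> x \<in> J" using j by simp
next
  assume j: "y \<ominus> x \<in> J"
  have "y = (y \<ominus> x) \<oplus> x" by (use assms in algebra)
  then show "y \<in> coset J x" unfolding coset_def using j by blast
qed

lemma coset_eq_iff:
  assumes R: "mid R" and J: "ideal J (sub K R)" and x: "x \<in> carrier K" "y \<in> carrier K"
  shows "coset J x = coset J y \<longleftrightarrow> x \<ominus> y \<in> J"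
proof -
  note JE = mid_idealD[OF R J]
  have JK: "J \<subseteq> carrier K" using JE by blast
  have self: "x \<in> coset J x" if "x \<in> carrier K" for x
    using mem_coset_iff[OF JK that that] that JE(3) by (simp add: minus_eq r_neg)
  have sub: "coset J x \<subseteq> coset J y" if d: "x \<ominus> y \<in> J" and x: "x \<in> carrier K" "y \<in> carrier K" for x y
  proof
    fix z assume z: "z \<in> coset J x"
    then have zK: "z \<in> carrier K" using JK x by (auto simp: coset_def)
    have "z \<ominus> x \<in> J" using z mem_coset_iff[OF JK x(1) zK] by simp
    then have "(z \<ominus> x) \<oplus> (x \<ominus> y) \<in> J" using JE(4) d by blast
    moreover have "(z \<ominus> x) \<oplus> (x \<ominus> y) = z \<ominus> y" by (use zK x in algebra)
    ultimately show "z \<in> coset J y" using mem_coset_iff[OF JK x(2) zK] by simp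
  qed
  show ?thesis
  proof
    assume "coset J x = coset J y"
    then show "x \<ominus> y \<in> J" using self[OF x(1)] mem_coset_iff[OF JK x(2,1)] by simp
  next
    assume d: "x \<ominus> y \<in> J"
    have "\<ominus> (x \<ominus> y) = y \<ominus> x" by (use x in algebra)
    then have "y \<ominus> x \<in> J" using JE(7)[OF d] by simp
    then show "coset J x = coset J y" using sub d x by blast
  qed
qed

text \<open>\<open>I\<close> is free of rank one over its endomorphism ring: \<open>x\<close>
  corresponds to multiplication by x/i, which maps \<open>I\<close> into itself by
  \<open>sq\<close>.\<close>

lemma stable_idealI:
  assumes R: "mid R" and I: "ideal I (sub K R)" and i: "i \<in> I" "i \<noteq> \<zero>"
    and sq: "\<And>x y. x \<in> I \<Longrightarrow> y \<in> I \<Longrightarrow> \<exists>z\<in>I. x \<otimes> y = i \<otimes> z"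
  shows "stable_ideal (sub K R) I"
proof -
  note RE = mid_closed[OF R]
  note IE = mid_idealD[OF R I]
  define M where "M = ideal_module_End (sub K R) I"
  define E where "E = endomorphism_ring (sub K R) (ideal_module (sub K R) I)"
  define F where "F = free_module E {i}"
  define \<mu> where "\<mu> x = (\<lambda>z\<in>I. inv i \<otimes> (x \<otimes> z))" for x
  \<comment> \<open>The basis {i} has one element, so a vector is a single endomorphism;
    \<open>p\<close> applies it to \<open>i\<close>, and \<open>e\<close> sends \<open>x\<close> to
    multiplication by x/i.\<close>
  define p where "p f = f i i" for f :: "'a \<Rightarrow> 'a \<Rightarrow> 'a"
  define e where "e x = (\<lambda>b\<in>{i}. \<mu> x)" for x
  have iK: "i \<in> carrier K" "inv i \<in> carrier K" using i IE by auto
  have ii: "inv i \<otimes> (i \<otimes> z) = z" if "z \<in> carrier K" for z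
    using that i iK by (simp add: m_assoc[symmetric])
  have mu: "inv i \<otimes> (x \<otimes> z) \<in> I" if xz: "x \<in> I" "z \<in> I" for x z
  proof -
    obtain w where "w \<in> I" "x \<otimes> z = i \<otimes> w" using sq[OF xz] by blast
    then show ?thesis using ii IE by simp
  qed
  have Ec: "f \<in> carrier E \<longleftrightarrow> f \<in> extensional I \<and> (\<forall>x\<in>I. f x \<in> I) \<and>
      (\<forall>x\<in>I. \<forall>y\<in>I. f (x \<oplus> y) = f x \<oplus> f y) \<and> (\<forall>a\<in>R. \<forall>x\<in>I. f (a \<otimes> x) = a \<otimes> f x)" for f
    by (auto simp: E_def endomorphism_ring_def linear_maps_def ideal_module_def)
  have muE: "\<mu> x \<in> carrier E" if x: "x \<in> I" for x
    unfolding Ec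
  proof (intro conjI ballI)
    show "\<mu> x \<in> extensional I" by (simp add: \<mu>_def)
    show "\<mu> x y \<in> I" if "y \<in> I" for y using mu x that by (simp add: \<mu>_def)
    show "\<mu> x (y \<oplus> z) = \<mu> x y \<oplus> \<mu> x z" if "y \<in> I" "z \<in> I" for y z
      using that IE(2) x iK IE(4) by (simp add: \<mu>_def r_distr)
    show "\<mu> x (a \<otimes> y) = a \<otimes> \<mu> x y" if "a \<in> R" "y \<in> I" for a y
      using that IE(2) x iK IE(5) RE(3) by (simp add: \<mu>_def m_lcomm)
  qed
  have Fc: "f \<in> carrier F \<longleftrightarrow> f \<in> extensional {i} \<and> f i \<in> carrier E" for f
    by (auto simp: F_def free_module_def PiE_def)
  have pL: "p \<in> linear_maps E F M"
    unfolding linear_maps_def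
  proof (intro CollectI conjI ballI Pi_I)
    fix f assume "f \<in> carrier F"
    then show "p f \<in> carrier M" using Fc Ec i by (simp add: p_def M_def ideal_module_End_def)
  next
    fix f g assume "f \<in> carrier F" "g \<in> carrier F"
    show "p (f \<oplus>\<^bsub>F\<^esub> g) = p f \<oplus>\<^bsub>M\<^esub> p g"
      using i by (simp add: p_def F_def free_module_def M_def ideal_module_End_def E_def endomorphism_ring_def ideal_module_def)
  next
    fix a f assume "a \<in> carrier E" "f \<in> carrier F"
    show "p (a \<odot>\<^bsub>F\<^esub> f) = a \<odot>\<^bsub>M\<^esub> p f"
      using i by (simp add: p_def F_def free_module_def M_def ideal_module_End_def E_def
          endomorphism_ring_def ideal_module_def compose_def)
  qed
  have mu_add: "\<mu> (x \<oplus> y) = (\<lambda>z\<in>I. \<mu> x z \<oplus> \<mu> y z)" if "x \<in> I" "y \<in> I" for x y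
    unfolding \<mu>_def by (rule restrict_ext) (use that IE(2) iK in \<open>simp add: l_distr r_distr\<close>)
  \<comment> \<open>Endomorphisms of \<open>I\<close> are linear over \<open>R\<close>, hence over
    \<open>I\<close>: a(zx) is z a(x), and also i a(xz/i). Cancelling \<open>i\<close> shows that
    \<open>a\<close> commutes with multiplication by z/i.\<close>
  have mu_smult: "\<mu> (a x) = compose I a (\<mu> x)" if a: "a \<in> carrier E" and x: "x \<in> I" for a x
  proof -
    have aE: "\<And>x. x \<in> I \<Longrightarrow> a x \<in> I" "\<And>r x. r \<in> R \<Longrightarrow> x \<in> I \<Longrightarrow> a (r \<otimes> x) = r \<otimes> a x"
      using a Ec by auto
    have "inv i \<otimes> (a x \<otimes> z) = a (inv i \<otimes> (x \<otimes> z))" if z: "z \<in> I" for z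
    proof -
      have w: "inv i \<otimes> (x \<otimes> z) \<in> I" using mu x z by simp
      have K: "x \<in> carrier K" "z \<in> carrier K" "a x \<in> carrier K" "a (inv i \<otimes> (x \<otimes> z)) \<in> carrier K"
        using x z aE w IE by auto
      have "i \<otimes> (inv i \<otimes> (x \<otimes> z)) = (i \<otimes> inv i) \<otimes> (x \<otimes> z)" using K iK by (simp only: m_assoc m_closed)
      also have "\<dots> = z \<otimes> x" using K i iK by (simp add: m_comm[of x z])
      finally have "i \<otimes> a (inv i \<otimes> (x \<otimes> z)) = z \<otimes> a x"
        using aE(2)[of i "inv i \<otimes> (x \<otimes> z)"] aE(2)[of z x] w x z i IE(1) by simp
      then have "inv i \<otimes> (i \<otimes> a (inv i \<otimes> (x \<otimes> z))) = inv i \<otimes> (a x \<otimes> z)" using K by (simp add: m_comm)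
      then show ?thesis using ii K by simp
    qed
    then show ?thesis unfolding \<mu>_def compose_def by (intro restrict_ext) simp
  qed
  have eL: "e \<in> linear_maps E M F"
    unfolding linear_maps_def
  proof (intro CollectI conjI ballI Pi_I)
    fix x assume "x \<in> carrier M"
    then show "e x \<in> carrier F" using Fc muE by (simp add: e_def M_def ideal_module_End_def)
  next
    fix x y assume "x \<in> carrier M" "y \<in> carrier M"
    then have "x \<in> I" "y \<in> I" by (simp_all add: M_def ideal_module_End_def)
    then show "e (x \<oplus>\<^bsub>M\<^esub> y) = e x \<oplus>\<^bsub>F\<^esub> e y"
      using mu_add by (simp add: e_def F_def free_module_def M_def ideal_module_End_def E_def
          endomorphism_ring_def ideal_module_def cong: restrict_cong)
  next
    fix a x assume "a \<in> carrier E" "x \<in> carrier M"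
    then have "a \<in> carrier E" "x \<in> I" by (simp_all add: M_def ideal_module_End_def)
    then show "e (a \<odot>\<^bsub>M\<^esub> x) = a \<odot>\<^bsub>F\<^esub> e x"
      using mu_smult by (simp add: e_def F_def free_module_def M_def ideal_module_End_def E_def
          endomorphism_ring_def ideal_module_def cong: restrict_cong)
  qed
  have pe: "p (e x) = x" if "x \<in> carrier M" for x
  proof -
    have x: "x \<in> I" "x \<in> carrier K" using that IE by (simp_all add: M_def ideal_module_End_def)
    then show ?thesis using i ii iK by (simp add: p_def e_def \<mu>_def m_comm[of x i])
  qed
  have "projective_module E M"
    unfolding projective_module_def F_def[symmetric]
    using eL pL pe unfolding F_def by blast
  then show ?thesis using I by (simp add: stable_ideal_def E_def M_def)
qed

lemma nonzero_min_element:
  assumes I: "I \<subseteq> V" "I \<noteq> {\<zero>}" "\<zero> \<in> I"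
  obtains h u where "u \<in> V" "u \<notin> nV 1" "t [^] (h::nat) \<otimes> u \<in> I" "I \<subseteq> nV h"
proof -
  define Pr where "Pr h \<longleftrightarrow> (\<exists>u\<in>V. u \<notin> nV 1 \<and> t [^] (h::nat) \<otimes> u \<in> I)" for h
  obtain x where x: "x \<in> I" "x \<noteq> \<zero>" using I by blast
  then have "\<exists>h. Pr h" using V_dec[of x] I unfolding Pr_def by (metis subsetD)
  then have L: "Pr (LEAST h. Pr h)" by (rule LeastI_ex)
  define h where "h = (LEAST h. Pr h)"
  obtain u where u: "u \<in> V" "u \<notin> nV 1" "t [^] h \<otimes> u \<in> I" using L unfolding Pr_def h_def by blast
  have "I \<subseteq> nV h"
  proof
    fix y assume y: "y \<in> I"
    show "y \<in> nV h"
    proof (cases "y = \<zero>")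
      case False
      obtain l w where w: "w \<in> V" "w \<notin> nV 1" "y = t [^] (l::nat) \<otimes> w" 
        by (rule V_dec[OF subsetD[OF I(1) y] False])
      then have "Pr l" using y unfolding Pr_def by blast
      then have "h \<le> l" unfolding h_def by (rule Least_le)
      then show ?thesis using nV_mono[of h l] nV_I w by simp
    qed simp
  qed
  then show ?thesis using that u by blast
qed

section \<open>Quadratic rings are bad stable\<close>

definition quadratic :: "'a set \<Rightarrow> bool" where
  "quadratic R \<longleftrightarrow> (\<forall>x\<in>V. \<forall>y\<in>V. \<exists>r\<in>R. \<exists>s\<in>R. \<exists>s'\<in>R. x \<otimes> y = r \<oplus> s \<otimes> x \<oplus> s' \<otimes> y)"

text \<open>Multiplying the relation for xy by i^2 leaves \<open>i\<close> times an
  \<open>R\<close>-combination of \<open>i\<close>, ix and iy. The quantification over ideals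
  records that the second factor is such a combination.\<close>

lemma quadratic_mult:
  assumes R: "mid R" and q: "quadratic R" and i: "i \<in> R" and xy: "x \<in> V" "y \<in> V" "i \<otimes> x \<in> R" "i \<otimes> y \<in> R"
  obtains z where "(i \<otimes> x) \<otimes> (i \<otimes> y) = i \<otimes> z" "z \<in> R" "\<And>I. ideal I (sub K R) \<Longrightarrow> i \<in> I \<Longrightarrow> i \<otimes> x \<in> I \<Longrightarrow> i \<otimes> y \<in> I \<Longrightarrow> z \<in> I"
proof -
  note RE = mid_closed[OF R]
  obtain r s s' where r: "r \<in> R" "s \<in> R" "s' \<in> R" "x \<otimes> y = r \<oplus> s \<otimes> x \<oplus> s' \<otimes> y"
    using q xy unfolding quadratic_def by blast
  have K: "i \<in> carrier K" "x \<in> carrier K" "y \<in> carrier K" "r \<in> carrier K" "s \<in> carrier K" "s' \<in> carrier K"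
    using i xy r RE by auto
  let ?z = "r \<otimes> i \<oplus> s \<otimes> (i \<otimes> x) \<oplus> s' \<otimes> (i \<otimes> y)"
  have "(i \<otimes> x) \<otimes> (i \<otimes> y) = i \<otimes> (i \<otimes> (x \<otimes> y))" using K by (simp add: m_ac)
  also have "i \<otimes> (x \<otimes> y) = ?z" unfolding r(4) by (use K in algebra)
  finally show ?thesis
    using that[of ?z] i xy r RE mid_idealD(4,5)[OF R] by simp
qed

text \<open>If x = a + tr lies in \<open>nV 1\<close>, then so does \<open>a\<close>, and both
  \<open>a\<close> and \<open>t\<close> belong to \<open>maxA\<close>.\<close>

lemma extended_max_ideal_eq:
  assumes R: "mid R" and loc: "vlocal R"
    and RA: "\<And>x. x \<in> R \<Longrightarrow> \<exists>a\<in>A. \<exists>r\<in>R. x = a \<oplus> t \<otimes> r"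
  shows "extended_max_ideal K A R = R \<inter> nV 1"
proof -
  note RE = mid_closed[OF R]
  have rR: "ring (sub K R)" by (rule subring_is_ring[OF mid_subring[OF R]])
  have mA: "maxA \<subseteq> carrier (sub K R)" using RE by (auto simp: maxA_def)
  have e: "extended_max_ideal K A R = Idl\<^bsub>sub K R\<^esub> maxA"
    by (simp add: extended_max_ideal_def max_ideal_A)
  note JE = mid_idealD[OF R ring.genideal_ideal[OF rR mA]]
  have sub: "maxA \<subseteq> Idl\<^bsub>sub K R\<^esub> maxA" by (rule ring.genideal_self[OF rR mA])
  show ?thesis
  proof
    show "extended_max_ideal K A R \<subseteq> R \<inter> nV 1" unfolding e
      by (rule ring.genideal_minimal[OF rR mid_nV_ideal[OF R]]) (use RE in \<open>auto simp: maxA_def\<close>)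
    show "R \<inter> nV 1 \<subseteq> extended_max_ideal K A R" unfolding e
    proof
      fix x assume x: "x \<in> R \<inter> nV 1"
      then obtain a r where a: "a \<in> A" "r \<in> R" "x = a \<oplus> t \<otimes> r" using RA by blast
      have K: "a \<in> carrier K" "t \<in> carrier K" "r \<in> carrier K" using a RE by auto
      have "t \<otimes> r \<in> nV 1" using nV1_I a RE by simp
      then have "x \<ominus> t \<otimes> r \<in> nV 1" using nV_minus x by blast
      moreover have "a \<oplus> t \<otimes> r \<ominus> t \<otimes> r = a" by (use K in algebra)
      ultimately have "a \<in> maxA" using a by (simp add: maxA_def)
      moreover have "t \<in> maxA" using tA nV_t by (simp add: maxA_def)
      ultimately show "x \<in> Idl\<^bsub>sub K R\<^esub> maxA"
        unfolding a(3) using JE(4)[OF subsetD[OF sub] JE(6)[OF a(2) subsetD[OF sub]]] by blast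
    qed
  qed
qed

text \<open>Since R = A + tR, the residue ring is generated by its identity as an
  \<open>A\<close>-module.\<close>

lemma tightly_dominatesI:
  assumes R: "mid R" and loc: "vlocal R"
    and RA: "\<And>x. x \<in> R \<Longrightarrow> \<exists>a\<in>A. \<exists>r\<in>R. x = a \<oplus> t \<otimes> r"
  shows "tightly_dominates K R A"
proof -
  note RE = mid_closed[OF R]
  let ?M = "R \<inter> nV 1"
  let ?T = "sub K R"
  have e: "extended_max_ideal K A R = ?M" by (rule extended_max_ideal_eq[OF assms])
  have tr: "t \<otimes> r \<in> ?M" if "r \<in> R" for r using that RE nV1_I by auto
  have M: "ideal ?M ?T" by (rule mid_nV_ideal[OF R])
  have bir: "birationally_dominates K R A"
    unfolding birationally_dominates_def
    using subdomainI'[OF A] subdomainI'[OF mid_subring[OF R]] RE max_ideal_A vlocal_quasilocal[OF R loc]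
      quot_field_eq[OF R] by (auto simp: maxA_def)
  have sum: "R = A <+>\<^bsub>K\<^esub> ?M"
  proof
    show "R \<subseteq> A <+>\<^bsub>K\<^esub> ?M"
    proof
      fix x assume "x \<in> R"
      then obtain a r where "a \<in> A" "r \<in> R" "x = a \<oplus> t \<otimes> r" using RA by blast
      then show "x \<in> A <+>\<^bsub>K\<^esub> ?M" using tr[of r] unfolding set_add_def' by blast
    qed
    show "A <+>\<^bsub>K\<^esub> ?M \<subseteq> R" using RE unfolding set_add_def' by auto
  qed
  have Q: "ring (?T Quot ?M)" by (rule ideal.quotient_is_ring[OF M])
  have one: "\<one>\<^bsub>?T Quot ?M\<^esub> \<in> carrier (?T Quot ?M)" using ring.ring_simprules(6)[OF Q] .
  have hc: "?M +>\<^bsub>?T\<^esub> y \<in> carrier (?T Quot ?M)" if "y \<in> R" for y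
    using that by (auto simp: FactRing_def A_RCOSETS_def')
  have fg: "finitely_generated_module (sub K A) (restrict_scalars (\<lambda>a. ?M +>\<^bsub>?T\<^esub> a) (?T Quot ?M))"
  proof (rule finitely_generated_singletonI[OF Q one])
    show "(\<lambda>a. ?M +>\<^bsub>?T\<^esub> a) ` carrier (sub K A) \<subseteq> carrier (?T Quot ?M)" using hc RE by auto
    fix Y assume "Y \<in> carrier (?T Quot ?M)"
    then obtain y where y: "y \<in> R" "Y = ?M +>\<^bsub>?T\<^esub> y"
      by (auto simp: FactRing_def A_RCOSETS_def')
    obtain a r where a: "a \<in> A" "r \<in> R" "y = a \<oplus> t \<otimes> r" using RA[OF y(1)] by blast
    have K: "a \<in> carrier K" "t \<in> carrier K" "r \<in> carrier K" using a RE by auto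
    have "a \<oplus> t \<otimes> r \<ominus> a = t \<otimes> r" by (use K in algebra)
    then have "?M +>\<^bsub>?T\<^esub> y = ?M +>\<^bsub>?T\<^esub> a"
      unfolding a_r_coset_sub using coset_eq_iff[OF R M, of y a] K a tr by simp
    then have "Y = (?M +>\<^bsub>?T\<^esub> a) \<otimes>\<^bsub>?T Quot ?M\<^esub> \<one>\<^bsub>?T Quot ?M\<^esub>"
      using monoid.r_one[OF ring.is_monoid[OF Q] hc[of a]] y a RE by simp
    then show "\<exists>a\<in>carrier (sub K A). Y = (?M +>\<^bsub>?T\<^esub> a) \<otimes>\<^bsub>?T Quot ?M\<^esub> \<one>\<^bsub>?T Quot ?M\<^esub>"
      using a by auto
  qed
  show ?thesis unfolding tightly_dominates_def finitely_dominates_def e using bir fg sum by blast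
qed

text \<open>By \<open>pw\<close>, \<open>t\<close> is nilpotent modulo every nonzero element of
  \<open>A\<close>, and after clearing denominators modulo every nonzero element of
  \<open>R\<close>. Together with \<open>RA\<close> this gives R = A + cR; it also leaves only two
  prime ideals, and it shows that every element of \<open>V\<close> is brought into \<open>R\<close>
  by a power of \<open>t\<close>.\<close>

theorem bad_noetherian_stableI:
  assumes R: "mid R" and loc: "vlocal R" and q: "quadratic R"
    and RA: "\<And>x. x \<in> R \<Longrightarrow> \<exists>a\<in>A. \<exists>r\<in>R. x = a \<oplus> t \<otimes> r"
    and pw: "\<And>c. c \<in> A \<Longrightarrow> c \<noteq> \<zero> \<Longrightarrow> \<exists>N. \<exists>r\<in>R. t [^] (N::nat) = c \<otimes> r"
    and ne: "R \<noteq> V"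
  shows "bad_noetherian_stable_domain K R"
proof -
  note RE = mid_closed[OF R]
  let ?T = "sub K R"
  let ?M = "R \<inter> nV 1"
  have RAk: "\<exists>a\<in>A. \<exists>r\<in>R. x = a \<oplus> t [^] k \<otimes> r" if "x \<in> R" for x and k :: nat
    using that
  proof (induct k arbitrary: x)
    case 0
    then show ?case using RE(3) by (intro bexI[of _ \<zero>] bexI[of _ x]) auto
  next
    case (Suc k)
    obtain a r where a: "a \<in> A" "r \<in> R" "x = a \<oplus> t [^] k \<otimes> r" using Suc by blast
    obtain b s where b: "b \<in> A" "s \<in> R" "r = b \<oplus> t \<otimes> s" using RA[OF a(2)] by blast
    define w where "w = t [^] k"
    have K: "a \<in> carrier K" "b \<in> carrier K" "t \<in> carrier K" "s \<in> carrier K" "w \<in> carrier K"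
      using a b RE by (auto simp: w_def)
    have "x = (a \<oplus> w \<otimes> b) \<oplus> w \<otimes> t \<otimes> s" unfolding a(3) b(3) w_def[symmetric]
      by (use K in algebra)
    moreover have "a \<oplus> w \<otimes> b \<in> A" using a b tA by (simp add: w_def)
    ultimately show ?case using b(2) by (auto simp: w_def)
  qed
  have pwR: "\<exists>N. \<exists>r\<in>R. t [^] (N::nat) = c \<otimes> r" if c: "c \<in> R" "c \<noteq> \<zero>" for c
  proof -
    obtain b where b: "b \<in> A" "b \<otimes> c \<in> A" "b \<otimes> c \<noteq> \<zero>" using mult_frac[of c] c RE by metis
    obtain N r where r: "r \<in> R" "t [^] (N::nat) = b \<otimes> c \<otimes> r" using pw[OF b(2,3)] by blast
    have "t [^] N = c \<otimes> (b \<otimes> r)" using r b c RE(3) by (simp add: m_ac)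
    then show ?thesis using r b RE(1,8) by blast
  qed
  have div: "\<exists>a\<in>A. \<exists>r\<in>R. x = a \<oplus> c \<otimes> r" if c: "c \<in> R" "c \<noteq> \<zero>" and x: "x \<in> R" for c x
  proof -
    obtain N r where r: "r \<in> R" "t [^] (N::nat) = c \<otimes> r" using pwR[OF c] by blast
    obtain a s where a: "a \<in> A" "s \<in> R" "x = a \<oplus> t [^] N \<otimes> s" using RAk[OF x] by blast
    have "x = a \<oplus> c \<otimes> (r \<otimes> s)" using a r c RE(3) by (simp add: m_assoc)
    then show ?thesis using a r RE(8) by blast
  qed
  have noeth: "noetherian_ring ?T" by (rule noetherian_of_divisible[OF R div])
  have dom: "domain ?T" by (rule subring_is_domain[OF mid_subring[OF R]])
  have ql: "quasilocal ?T" "max_ideal ?T = ?M" using vlocal_quasilocal[OF R loc] by auto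
  have stable: "stable_domain ?T"
    unfolding stable_domain_def
  proof (intro conjI allI impI dom)
    fix I assume "ideal I ?T \<and> I \<noteq> {\<zero>\<^bsub>?T\<^esub>}"
    then have I: "ideal I ?T" "I \<noteq> {\<zero>}" by auto
    note IE = mid_idealD[OF R I(1)]
    have IV: "I \<subseteq> V" using IE(1) RE(2) by blast
    obtain h u where u: "u \<in> V" "u \<notin> nV 1" "t [^] (h::nat) \<otimes> u \<in> I" "I \<subseteq> nV h"
      by (rule nonzero_min_element[OF IV I(2) IE(3)])
    define i where "i = t [^] h \<otimes> u"
    have iI: "i \<in> I" "i \<in> R" using u IE by (auto simp: i_def)
    have inz: "i \<noteq> \<zero>" using u V_unit(1)[OF u(1,2)] integral[of "t [^] h" u] by (auto simp: i_def)
    have frac: "\<exists>x'\<in>V. x = i \<otimes> x'" if x: "x \<in> I" for x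
    proof -
      obtain y where y: "y \<in> V" "x = t [^] h \<otimes> y" using u(4) x nV_E by blast
      define w T where "w = inv u" and "T = t [^] h"
      have K: "w \<in> carrier K" "T \<in> carrier K" "u \<in> carrier K" "y \<in> carrier K"
        using y u V_unit[OF u(1,2)] by (simp_all add: w_def T_def)
      have "(T \<otimes> u) \<otimes> (w \<otimes> y) = T \<otimes> ((u \<otimes> w) \<otimes> y)"
        by (use K in algebra)
      then have "i \<otimes> (inv u \<otimes> y) = t [^] h \<otimes> ((u \<otimes> inv u) \<otimes> y)"
        by (simp only: i_def w_def T_def)
      then have "x = i \<otimes> (inv u \<otimes> y)" using y V_unit(4)[OF u(1,2)] by simp
      then show ?thesis using y V_unit[OF u(1,2)] V_closed(4) by blast
    qed
    show "stable_ideal ?T I"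
    proof (rule stable_idealI[OF R I(1) iI(1) inz])
      fix x y assume xy: "x \<in> I" "y \<in> I"
      obtain x' y' where x': "x' \<in> V" "x = i \<otimes> x'" "y' \<in> V" "y = i \<otimes> y'" using frac xy by meson
      obtain z where "x \<otimes> y = i \<otimes> z" "z \<in> I"
        using quadratic_mult[OF R q iI(2) x'(1,3)] xy IE(1) x' I(1) iI by metis
      then show "\<exists>z\<in>I. x \<otimes> y = i \<otimes> z" by blast
    qed
  qed
  have tM: "t \<in> ?M" using RE(6) nV_t by simp
  have krull: "krull_dim ?T = 1"
  proof (rule krull_dim_eq_1I)
    show "primeideal {\<zero>} ?T" using domain.zeroprimeideal[OF dom] by simp
    show "primeideal ?M ?T"
      using cring.maximalideal_prime[OF subring_cring[OF mid_subring[OF R]] max_ideal_maximal[OF ql(1)]] ql(2) by simp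
    have "\<zero> \<in> ?M" using RE(4) nV_zero by blast
    then show "{\<zero>} \<subset> ?M" using tM t_nz by blast
    fix p assume p: "primeideal p ?T"
    then have pI: "ideal p ?T" by (rule primeideal.axioms)
    note pE = mid_idealD[OF R pI]
    note prime = primeideal.I_prime[OF p, simplified]
    have np: "\<one> \<notin> p" using primeideal.I_notcarr[OF p] ideal.one_imp_carrier[OF pI] by auto
    show "p = {\<zero>} \<or> p = ?M"
    proof (rule disjCI)
      assume "p \<noteq> ?M"
      show "p = {\<zero>}"
      proof (rule ccontr)
        assume "p \<noteq> {\<zero>}"
        then obtain c where c: "c \<in> p" "c \<noteq> \<zero>" using pE(3) by blast
        then obtain N r where r: "r \<in> R" "t [^] (N::nat) = c \<otimes> r" using pwR[of c] pE(1) by blast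
        then have "t [^] N \<in> p" using pE(6)[OF r(1) c(1)] by simp
        then have tp: "t \<in> p"
        proof (induct N)
          case 0
          then show ?case using np by simp
        next
          case (Suc N)
          then show ?case using prime[of "t [^] N" t] RE(6,11) by auto
        qed
        have "p \<subseteq> ?M"
        proof
          fix x assume x: "x \<in> p"
          have "x \<in> nV 1"
          proof (rule ccontr)
            assume n: "x \<notin> nV 1"
            then have "inv x \<in> R" using loc pE(1)[OF x] by (auto simp: vlocal_def)
            then have "x \<otimes> inv x \<in> p" using pE(6) x by blast
            then show False using np V_unit(4)[of x] n pE(1)[OF x] RE(2) by simp
          qed
          then show "x \<in> ?M" using pE(1)[OF x] by simp
        qed
        \<comment> \<open>An element of the maximal ideal is x = ty with \<open>y\<close> in
          \<open>V\<close>; quadraticity puts x^2 into tR, although \<open>y\<close> need not be in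
          \<open>R\<close>.\<close>
        moreover have "?M \<subseteq> p"
        proof
          fix x assume x: "x \<in> ?M"
          then obtain y where y: "y \<in> V" "x = t \<otimes> y" using nV1_E by blast
          obtain z where "x \<otimes> x = t \<otimes> z" "z \<in> R"
            using quadratic_mult[OF R q RE(6) y(1) y(1)] x y by blast
          then have "x \<otimes> x \<in> p" using pE(6) tp by simp
          then show "x \<in> p" using prime[of x x] x by simp
        qed
        ultimately show False using \<open>p \<noteq> ?M\<close> by blast
      qed
    qed
  qed
  have tV: "\<exists>N. t [^] (N::nat) \<otimes> x \<in> R" if x: "x \<in> V" for x
  proof -
    obtain a b where b: "a \<in> A" "b \<in> A" "b \<noteq> \<zero>" "b \<otimes> x = a" using V_frac[OF x] by blast
    obtain N r where r: "r \<in> R" "t [^] (N::nat) = b \<otimes> r" using pw[OF b(2,3)] by blast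
    have K: "b \<in> carrier K" "r \<in> carrier K" "x \<in> carrier K" using r b x RE(3) by auto
    have "t [^] N \<otimes> x = r \<otimes> a" unfolding b(4)[symmetric] r(2)
      by (use K in algebra)
    moreover have "r \<otimes> a \<in> R" using r b RE(1,8) by blast
    ultimately show ?thesis by (intro exI[of _ N]) simp
  qed
  \<comment> \<open>The normalization is \<open>V\<close>: integral elements lie in \<open>V\<close>
    because \<open>V\<close> is completely integrally closed. Conversely, the powers of
    \<open>x\<close> in \<open>V\<close> stay in R + Rx by the relation for xx, so a single power of
    \<open>t\<close> clears them.\<close>
  have IC: "integral_closure K R (quot_field K R) = V"
  proof
    show "integral_closure K R (quot_field K R) \<subseteq> V"
    proof
      fix x assume x: "x \<in> integral_closure K R (quot_field K R)"
      then obtain d where d: "d \<in> R" "d \<noteq> \<zero>" "\<And>k::nat. d \<otimes> x [^] k \<in> R"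
        using integral_imp_almost[OF R x] by blast
      have "x \<in> quot_field K R" using x by (simp add: integral_closure_def)
      then obtain b where "b \<in> R" "b \<noteq> \<zero>" "b \<otimes> x \<in> R" "x \<in> carrier K" using quot_field_E[OF R] by blast
      then show "x \<in> V" using V_almost_closed[of d x b] d RE(2) by blast
    qed
    show "V \<subseteq> integral_closure K R (quot_field K R)"
    proof
      fix x assume x: "x \<in> V"
      obtain N where N: "t [^] (N::nat) \<otimes> x \<in> R" using tV[OF x] by blast
      obtain r s s' where r: "r \<in> R" "s \<in> R" "s' \<in> R" "x \<otimes> x = r \<oplus> s \<otimes> x \<oplus> s' \<otimes> x"
        using q x unfolding quadratic_def by blast
      have "\<exists>p\<in>R. \<exists>q\<in>R. x [^] k = p \<oplus> q \<otimes> x" for k :: nat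
      proof (induct k)
        case 0
        show ?case using RE(4,5) x by (intro bexI[of _ \<one>] bexI[of _ \<zero>]) auto
      next
        case (Suc k)
        then obtain p q where pq: "p \<in> R" "q \<in> R" "x [^] k = p \<oplus> q \<otimes> x" by blast
        have K: "p \<in> carrier K" "q \<in> carrier K" "r \<in> carrier K" "s \<in> carrier K" "s' \<in> carrier K" "x \<in> carrier K"
          using pq r x RE by auto
        have "x [^] Suc k = p \<otimes> x \<oplus> q \<otimes> (x \<otimes> x)" using pq K by (simp add: l_distr m_assoc)
        also have "\<dots> = q \<otimes> r \<oplus> (p \<oplus> q \<otimes> s \<oplus> q \<otimes> s') \<otimes> x" unfolding r(4)
          by (use K in algebra)
        finally have e: "x [^] Suc k = q \<otimes> r \<oplus> (p \<oplus> q \<otimes> s \<oplus> q \<otimes> s') \<otimes> x" .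
        have "q \<otimes> r \<in> R" "p \<oplus> q \<otimes> s \<oplus> q \<otimes> s' \<in> R" using pq r RE(7,8) by simp_all
        then show ?case using e by blast
      qed
      then have "t [^] N \<otimes> x [^] k \<in> R" for k :: nat
      proof -
        assume "\<And>k::nat. \<exists>p\<in>R. \<exists>q\<in>R. x [^] k = p \<oplus> q \<otimes> x"
        then obtain p q where pq: "p \<in> R" "q \<in> R" "x [^] k = p \<oplus> q \<otimes> x" by blast
        then have "t [^] N \<otimes> x [^] k = t [^] N \<otimes> p \<oplus> q \<otimes> (t [^] N \<otimes> x)"
          using x RE(3) by (simp add: r_distr m_lcomm)
        then show ?thesis using pq N RE by simp
      qed
      then show "x \<in> integral_closure K R (quot_field K R)"
        using almost_imp_integral[OF R noeth, of x "t [^] N"] x RE(6,11) by simp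
    qed
  qed
  have nfin: "\<not> finite_normalization K R"
  proof
    assume "finite_normalization K R"
    then have fg: "finitely_generated_module ?T (restrict_scalars (\<lambda>a. a) (sub K V))"
      unfolding finite_normalization_def IC .
    obtain N where N: "\<forall>x\<in>V. t [^] (N::nat) \<otimes> x \<in> R"
      using finite_moduleD[OF R V _ fg tV] RE(2) by auto
    \<comment> \<open>Finiteness puts t^N V into \<open>R\<close>, and V = A + t^N V.\<close>
    have "V \<subseteq> R"
    proof
      fix x assume x: "x \<in> V"
      obtain a where a: "a \<in> A" "x \<ominus> a \<in> nV N" using V_dense[OF x] by blast
      then have "x \<ominus> a \<in> R" using N by (auto elim!: nV_E)
      then have xa: "(x \<ominus> a) \<oplus> a \<in> R" using a RE by blast
      have K: "x \<in> carrier K" "a \<in> carrier K" using x a by simp_all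
      have "(x \<ominus> a) \<oplus> a = x" by (use K in algebra)
      then show "x \<in> R" using xa by simp
    qed
    then show False using ne RE(2) by blast
  qed
  show ?thesis
    unfolding bad_noetherian_stable_domain_def bad_stable_domain_def
    using subdomainI'[OF mid_subring[OF R]] ql stable krull nfin noeth by blast
qed

end

section \<open>Consequences of stability\<close>

context tight_pair
begin

text \<open>Dual bases give \<open>1 = \<Sum> x\<^sub>b y\<^sub>b\<close> with \<open>x\<^sub>b \<in> I\<close> and \<open>y\<^sub>b I \<subseteq> (I : I)\<close>; as \<open>1\<close> is a unit of
  the valuation ring, so is one of the summands.\<close>

lemma stable_ideal_unit:
  assumes R: "mid R" and I: "I \<noteq> {\<zero>}" and st: "stable_ideal (sub K R) I"
  shows "\<exists>x\<in>I. \<exists>y\<in>carrier K. (\<forall>z\<in>I. \<forall>w\<in>I. y \<otimes> (z \<otimes> w) \<in> I) \<and> x \<otimes> y \<notin> nV 1"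
proof (rule ccontr)
  assume "\<not> ?thesis"
  then have contra: "\<And>x y. x \<in> I \<Longrightarrow> y \<in> carrier K \<Longrightarrow> (\<And>z w. z \<in> I \<Longrightarrow> w \<in> I \<Longrightarrow> y \<otimes> (z \<otimes> w) \<in> I) \<Longrightarrow> x \<otimes> y \<in> nV 1"
    by blast
  have I1: "ideal I (sub K R)" using st by (simp add: stable_ideal_def)
  note RE = mid_closed[OF R]
  note IE = mid_idealD[OF R I1]
  define M where "M = ideal_module_End (sub K R) I"
  define E where "E = endomorphism_ring (sub K R) (ideal_module (sub K R) I)"
  obtain B :: "'a set" and e p where
    eL: "e \<in> linear_maps E M (free_module E B)" and pL: "p \<in> linear_maps E (free_module E B) M"
    and pe: "\<And>x. x \<in> carrier M \<Longrightarrow> p (e x) = x"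
    using st unfolding stable_ideal_def projective_module_def M_def E_def by blast
  define F where "F = free_module E B"
  have Mc: "carrier M = I" by (simp add: M_def ideal_module_End_def)
  have Ec: "f \<in> carrier E \<longleftrightarrow> f \<in> extensional I \<and> (\<forall>x\<in>I. f x \<in> I) \<and>
      (\<forall>x\<in>I. \<forall>y\<in>I. f (x \<oplus> y) = f x \<oplus> f y) \<and> (\<forall>a\<in>R. \<forall>x\<in>I. f (a \<otimes> x) = a \<otimes> f x)" for f
    by (auto simp: E_def endomorphism_ring_def linear_maps_def ideal_module_def)
  have Es: "\<zero>\<^bsub>E\<^esub> = (\<lambda>x\<in>I. \<zero>)" "\<one>\<^bsub>E\<^esub> = (\<lambda>x\<in>I. x)" "f \<otimes>\<^bsub>E\<^esub> g = compose I f g"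
    "f \<oplus>\<^bsub>E\<^esub> g = (\<lambda>x\<in>I. f x \<oplus> g x)" for f g
    by (simp_all add: E_def endomorphism_ring_def ideal_module_def)
  have Fc: "f \<in> carrier F \<longleftrightarrow> f \<in> extensional B \<and> (\<forall>b\<in>B. f b \<in> carrier E) \<and> finite {b\<in>B. f b \<noteq> \<zero>\<^bsub>E\<^esub>}" for f
    by (auto simp: F_def free_module_def PiE_def)
  have Fs: "f \<oplus>\<^bsub>F\<^esub> g = (\<lambda>b\<in>B. f b \<oplus>\<^bsub>E\<^esub> g b)" "a \<odot>\<^bsub>F\<^esub> f = (\<lambda>b\<in>B. a \<otimes>\<^bsub>E\<^esub> f b)" for f g a
    by (simp_all add: F_def free_module_def)
  have Ms: "a \<odot>\<^bsub>M\<^esub> x = a x" "x \<oplus>\<^bsub>M\<^esub> y = x \<oplus> y" for a x y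
    by (simp_all add: M_def ideal_module_End_def)
  have e1: "e x \<in> carrier F" if "x \<in> I" for x using eL that by (auto simp: linear_maps_def Mc F_def)
  have e2: "e (a x) = a \<odot>\<^bsub>F\<^esub> e x" if "x \<in> I" "a \<in> carrier E" for a x
    using eL that by (auto simp: linear_maps_def Mc F_def Ms)
  have p1: "p f \<in> I" if "f \<in> carrier F" for f using pL that by (auto simp: linear_maps_def Mc F_def)
  have p2: "p (f \<oplus>\<^bsub>F\<^esub> g) = p f \<oplus> p g" if "f \<in> carrier F" "g \<in> carrier F" for f g
    using pL that by (auto simp: linear_maps_def Mc F_def Ms)
  have p3: "p (a \<odot>\<^bsub>F\<^esub> f) = a (p f)" if "f \<in> carrier F" "a \<in> carrier E" for a f
    using pL that by (auto simp: linear_maps_def Mc F_def Ms)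
  obtain z where z: "z \<in> I" "z \<noteq> \<zero>" using I IE(3) by blast
  have zK: "z \<in> carrier K" "inv z \<in> carrier K" using z IE by auto
  \<comment> \<open>A dual basis: \<open>x b\<close> is the image of the unit vector at
    \<open>b\<close>. The coordinate of w at \<open>b\<close> is an endomorphism, in fact
    multiplication by w times \<open>y b\<close>. This is read off at w = z, where the coordinate
    sends z to z^2 times \<open>y b\<close>.\<close>
  define x where "x b = p (\<lambda>c\<in>B. if c = b then \<one>\<^bsub>E\<^esub> else \<zero>\<^bsub>E\<^esub>)" for b
  define y where "y b = inv z \<otimes> (inv z \<otimes> e z b z)" for b
  have zeroE: "\<zero>\<^bsub>E\<^esub> \<in> carrier E" unfolding Ec Es using IE RE by auto
  have oneE: "\<one>\<^bsub>E\<^esub> \<in> carrier E" unfolding Ec Es using IE by auto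
  have E0: "f \<zero> = \<zero>" if "f \<in> carrier E" for f
  proof -
    have "f (\<zero> \<otimes> z) = \<zero> \<otimes> f z" using that Ec z RE by auto
    moreover have "f z \<in> carrier K" using that Ec z IE by auto
    ultimately show ?thesis using zK by simp
  qed
  have delta: "(\<lambda>c\<in>B. if c = b then \<one>\<^bsub>E\<^esub> else \<zero>\<^bsub>E\<^esub>) \<in> carrier F" for b
    unfolding Fc
  proof (intro conjI ballI)
    show "finite {c \<in> B. (\<lambda>c\<in>B. if c = b then \<one>\<^bsub>E\<^esub> else \<zero>\<^bsub>E\<^esub>) c \<noteq> \<zero>\<^bsub>E\<^esub>}"
      by (rule finite_subset[of _ "{b}"]) auto
  qed (use zeroE oneE in auto)
  have xI: "x b \<in> I" for b unfolding x_def by (rule p1[OF delta])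
  have mulE: "(\<lambda>u\<in>I. w \<otimes> u) \<in> carrier E" if w: "w \<in> I" for w
    unfolding Ec
  proof (intro conjI ballI)
    show "(\<lambda>u\<in>I. w \<otimes> u) v \<in> I" if "v \<in> I" for v using that w IE(1,5) by simp
    show "(\<lambda>u\<in>I. w \<otimes> u) (v \<oplus> v') = (\<lambda>u\<in>I. w \<otimes> u) v \<oplus> (\<lambda>u\<in>I. w \<otimes> u) v'" if "v \<in> I" "v' \<in> I" for v v'
      using that w IE(2,4) by (simp add: r_distr)
    show "(\<lambda>u\<in>I. w \<otimes> u) (a \<otimes> v) = a \<otimes> (\<lambda>u\<in>I. w \<otimes> u) v" if "a \<in> R" "v \<in> I" for a v
      using that w IE(2,5) RE(3) by (simp add: m_lcomm)
  qed simp
  have eval_e: "e (w \<otimes> v) b u = w \<otimes> e v b u" if "w \<in> I" "v \<in> I" "b \<in> B" "u \<in> I" for w v b u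
  proof -
    have "e ((\<lambda>u\<in>I. w \<otimes> u) v) = (\<lambda>u\<in>I. w \<otimes> u) \<odot>\<^bsub>F\<^esub> e v" by (rule e2[OF that(2) mulE[OF that(1)]])
    then have "e (w \<otimes> v) b = compose I (\<lambda>u\<in>I. w \<otimes> u) (e v b)" using that by (simp add: Fs Es)
    moreover have "e v b u \<in> I" using e1[OF that(2)] that Fc Ec by auto
    ultimately show ?thesis using that by (simp add: compose_def)
  qed
  \<comment> \<open>Both sides are values of the coordinate of wz, by linearity of \<open>e\<close>
    over multiplication by \<open>w\<close> and over multiplication by \<open>z\<close>.\<close>
  have swap: "w \<otimes> e z b u = z \<otimes> e w b u" if "w \<in> I" "b \<in> B" "u \<in> I" for w b u
    using eval_e[OF that(1) z(1) that(2,3)] eval_e[OF z(1) that] that IE(2) zK by (simp add: m_comm)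
  have eI: "e w b u \<in> I" if "w \<in> I" "b \<in> B" "u \<in> I" for w b u
    using e1[OF that(1)] that Fc Ec by auto
  have lin: "e z b u = z \<otimes> (y b \<otimes> u)" if "b \<in> B" "u \<in> I" for b u
  proof -
    have K: "e z b u \<in> carrier K" "e z b z \<in> carrier K" "u \<in> carrier K" using eI that z IE by auto
    have 1: "e z b (z \<otimes> u) = z \<otimes> e z b u" using e1[OF z(1)] that Fc Ec IE z by auto
    have "e z b (u \<otimes> z) = u \<otimes> e z b z" using e1[OF z(1)] that Fc Ec IE z by auto
    then have "z \<otimes> e z b u = u \<otimes> e z b z" using 1 K zK by (simp add: m_comm)
    then have "inv z \<otimes> (z \<otimes> e z b u) = inv z \<otimes> (u \<otimes> e z b z)" by simp
    then have "(inv z \<otimes> z) \<otimes> e z b u = inv z \<otimes> (u \<otimes> e z b z)" using K zK by (simp only: m_assoc)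
    then have eq: "e z b u = inv z \<otimes> (u \<otimes> e z b z)" using K zK z by simp
    define i g where "i = inv z" and "g = e z b z"
    have K2: "i \<in> carrier K" "g \<in> carrier K" "z \<in> carrier K" using zK K by (auto simp: i_def g_def)
    have "z \<otimes> ((i \<otimes> (i \<otimes> g)) \<otimes> u) = (z \<otimes> i) \<otimes> (i \<otimes> (u \<otimes> g))"
      by (use K2 K in algebra)
    then have "z \<otimes> (y b \<otimes> u) = inv z \<otimes> (u \<otimes> e z b z)"
      using z zK K by (simp add: y_def i_def g_def)
    then show ?thesis using eq by simp
  qed
  have yK: "y b \<in> carrier K" if "b \<in> B" for b using eI[OF z(1) that z(1)] IE(2) zK by (simp add: y_def)
  have yI: "y b \<otimes> (w \<otimes> u) \<in> I" if "b \<in> B" "w \<in> I" "u \<in> I" for b w u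
  proof -
    have K: "w \<in> carrier K" "u \<in> carrier K" "y b \<in> carrier K" "e w b u \<in> carrier K"
      using that IE yK eI by auto
    have "z \<otimes> (y b \<otimes> (w \<otimes> u)) = w \<otimes> (z \<otimes> (y b \<otimes> u))"
      using K zK by (simp add: m_lcomm)
    also have "\<dots> = z \<otimes> e w b u" using lin[OF that(1,3)] swap[OF that(2,1,3)] by simp
    finally have "y b \<otimes> (w \<otimes> u) = e w b u" by (rule cancel[rotated 4]) (use z zK K in simp_all)
    then show ?thesis using eI that by simp
  qed
  \<comment> \<open>If every product of \<open>x b\<close> with \<open>y b\<close> lay in
    \<open>nV 1\<close>, then z, the sum of the values \<open>e z b (x b)\<close>, would lie in z
    times \<open>nV 1\<close>. \<open>L\<close> is this set, and z is not in it.\<close>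
  define L where "L = (\<lambda>w. z \<otimes> w) ` nV 1"
  have L0: "\<zero> \<in> L" unfolding L_def using zK by (intro image_eqI[of _ _ \<zero>]) auto
  have Ladd: "a \<oplus> b \<in> L" if ab: "a \<in> L" "b \<in> L" for a b
  proof -
    obtain a' b' where "a' \<in> nV 1" "b' \<in> nV 1" "a = z \<otimes> a'" "b = z \<otimes> b'"
      using ab unfolding L_def by blast
    then have "a \<oplus> b = z \<otimes> (a' \<oplus> b')" "a' \<oplus> b' \<in> nV 1" using nV_add zK by (simp_all add: r_distr)
    then show ?thesis unfolding L_def by blast
  qed
  \<comment> \<open>Here \<open>p f\<close> is the sum of the values \<open>f b (x b)\<close> over
    the support of \<open>f\<close>; the induction splits off one coordinate at a time, and
    \<open>L\<close> is closed under addition.\<close>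
  have main: "p f \<in> L" if "finite S" "f \<in> carrier F" "{b\<in>B. f b \<noteq> \<zero>\<^bsub>E\<^esub>} \<subseteq> S" "\<forall>b\<in>B. f b (x b) \<in> L" for f S
    using that
  proof (induct S arbitrary: f)
    case empty
    then have f0: "f b = \<zero>\<^bsub>E\<^esub>" if "b \<in> B" for b using that by blast
    have fe: "f \<in> extensional B" using empty(1) unfolding Fc by blast
    have z0: "\<zero>\<^bsub>E\<^esub> \<otimes>\<^bsub>E\<^esub> \<zero>\<^bsub>E\<^esub> = \<zero>\<^bsub>E\<^esub>" unfolding Es compose_def by (rule restrict_ext) (use IE(3) in simp)
    have "\<zero>\<^bsub>E\<^esub> \<odot>\<^bsub>F\<^esub> f = f" unfolding Fs
      by (rule extensionalityI[of _ B]) (use z0 f0 fe in simp_all)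
    then have "p f = p (\<zero>\<^bsub>E\<^esub> \<odot>\<^bsub>F\<^esub> f)" by (rule arg_cong[OF sym])
    also have "\<dots> = \<zero>\<^bsub>E\<^esub> (p f)" by (rule p3[OF empty(1) zeroE])
    also have "\<dots> = \<zero>" using p1[OF empty(1)] by (simp add: Es)
    finally show ?case using L0 by simp
  next
    case (insert b S)
    show ?case
    proof (cases "b \<in> B")
      case False
      then show ?thesis using insert by blast
    next
      case True
      define g where "g = (\<lambda>c\<in>B. if c = b then \<zero>\<^bsub>E\<^esub> else f c)"
      define d where "d = (\<lambda>c\<in>B. if c = b then \<one>\<^bsub>E\<^esub> else \<zero>\<^bsub>E\<^esub>)"
      have fE: "f c \<in> carrier E" if "c \<in> B" for c using insert(4) that unfolding Fc by blast
      have gF: "g \<in> carrier F"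
        unfolding Fc
      proof (intro conjI ballI)
        have "{c \<in> B. g c \<noteq> \<zero>\<^bsub>E\<^esub>} \<subseteq> {c \<in> B. f c \<noteq> \<zero>\<^bsub>E\<^esub>}" by (auto simp: g_def)
        then show "finite {c \<in> B. g c \<noteq> \<zero>\<^bsub>E\<^esub>}" using insert(4) finite_subset unfolding Fc by blast
      qed (use zeroE fE in \<open>auto simp: g_def\<close>)
      have dF: "d \<in> carrier F" unfolding d_def by (rule delta)
      have gL: "p g \<in> L"
      proof (rule insert(3)[OF gF])
        show "{c \<in> B. g c \<noteq> \<zero>\<^bsub>E\<^esub>} \<subseteq> S" using insert(5) by (auto simp: g_def)
        show "\<forall>c\<in>B. g c (x c) \<in> L" using insert(6) xI L0 by (auto simp: g_def Es)
      qed
      have fb: "f b \<odot>\<^bsub>F\<^esub> d \<in> carrier F"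
        unfolding Fc
      proof (intro conjI ballI)
        have comp: "f b \<otimes>\<^bsub>E\<^esub> d c = (if c = b then f b else \<zero>\<^bsub>E\<^esub>)" if "c \<in> B" for c
          using fE[OF True] E0[OF fE[OF True]] that
          by (auto simp: Es d_def compose_def Ec intro!: restrict_ext intro: extensionalityI)
        show "(f b \<odot>\<^bsub>F\<^esub> d) c \<in> carrier E" if "c \<in> B" for c
          using comp[OF that] that fE[OF True] zeroE by (simp add: Fs)
        show "finite {c \<in> B. (f b \<odot>\<^bsub>F\<^esub> d) c \<noteq> \<zero>\<^bsub>E\<^esub>}"
          by (rule finite_subset[of _ "{b}"]) (use comp in \<open>auto simp: Fs\<close>)
      qed (simp add: Fs)
      have dec: "f = (f b \<odot>\<^bsub>F\<^esub> d) \<oplus>\<^bsub>F\<^esub> g"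
      proof (rule extensionalityI[of _ B])
        show "f \<in> extensional B" using insert(4) unfolding Fc by blast
        show "(f b \<odot>\<^bsub>F\<^esub> d) \<oplus>\<^bsub>F\<^esub> g \<in> extensional B" by (simp add: Fs)
        fix c assume c: "c \<in> B"
        have fx: "f c \<in> extensional I" "\<And>u. u \<in> I \<Longrightarrow> f c u \<in> carrier K" "\<And>u. u \<in> I \<Longrightarrow> f b u \<in> carrier K"
          using fE[OF c] fE[OF True] IE(2) by (auto simp: Ec)
        show "f c = ((f b \<odot>\<^bsub>F\<^esub> d) \<oplus>\<^bsub>F\<^esub> g) c"
          by (rule extensionalityI[of _ I])
            (use c fx E0[OF fE[OF True]] in \<open>auto simp: Fs Es d_def g_def compose_def\<close>)
      qed
      have "p f = p (f b \<odot>\<^bsub>F\<^esub> d) \<oplus> p g" using p2[OF fb gF] dec by simp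
      also have "p (f b \<odot>\<^bsub>F\<^esub> d) = f b (x b)" using p3[OF dF fE[OF True]] by (simp add: x_def d_def)
      finally show ?thesis using Ladd gL insert(6) True by simp
    qed
  qed
  have ez: "e z b (x b) \<in> L" if b: "b \<in> B" for b
  proof -
    have "x b \<otimes> y b \<in> nV 1" using contra[OF xI yK[OF b]] yI[OF b] by blast
    then have "y b \<otimes> x b \<in> nV 1" using xI[of b] IE(2) yK[OF b] by (simp add: m_comm)
    then show ?thesis using lin[OF b xI] by (simp add: L_def)
  qed
  have "finite {b\<in>B. e z b \<noteq> \<zero>\<^bsub>E\<^esub>}" using e1[OF z(1)] Fc by blast
  then have "p (e z) \<in> L" using main[OF _ e1[OF z(1)] order_refl] ez by blast
  then have "z \<in> L" using pe[of z] z Mc by simp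
  then obtain w where w: "w \<in> nV 1" "z = z \<otimes> w" by (auto simp: L_def)
  then have "z \<otimes> \<one> = z \<otimes> w" using zK by simp
  then have "\<one> = w" by (rule cancel[rotated 4]) (use zK z w in simp_all)
  then have "w = \<one>" by (rule sym)
  then show False using w(1) by simp
qed

section \<open>Units in rings between \<open>R\<close> and \<open>V\<close>\<close>

lemma ex_geometric:
  fixes k :: nat
  assumes T: "subring T K" and ab: "a \<in> T" "b \<in> T"
  shows "\<exists>g\<in>T. a [^] k \<ominus> b [^] k = (a \<ominus> b) \<otimes> g"
proof (induct k)
  note TE = subringE[OF T]
  case 0
  have "a [^] (0::nat) \<ominus> b [^] (0::nat) = (a \<ominus> b) \<otimes> \<zero>" using ab TE by (simp add: minus_eq r_neg subset_iff)
  then show ?case using TE by blast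
next
  case (Suc k)
  note TE = subringE[OF T]
  obtain g where g: "g \<in> T" "a [^] k \<ominus> b [^] k = (a \<ominus> b) \<otimes> g" using Suc by blast
  define p q where "p = a [^] k" and "q = b [^] k"
  have pT: "c [^] k \<in> T" if "c \<in> T" for c
    by (induct k) (use TE that in auto)
  have K: "a \<in> carrier K" "b \<in> carrier K" "g \<in> carrier K" "p \<in> carrier K" "q \<in> carrier K"
    using subringE(1)[OF T] ab g(1) pT[OF ab(1)] pT[OF ab(2)] unfolding p_def q_def by blast+
  have "p \<otimes> a \<ominus> q \<otimes> b = (a \<ominus> b) \<otimes> p \<oplus> b \<otimes> (p \<ominus> q)"
    by (use K in algebra)
  also have "p \<ominus> q = (a \<ominus> b) \<otimes> g" using g by (simp add: p_def q_def)
  also have "(a \<ominus> b) \<otimes> p \<oplus> b \<otimes> ((a \<ominus> b) \<otimes> g) = (a \<ominus> b) \<otimes> (p \<oplus> b \<otimes> g)"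
    by (use K in algebra)
  finally have "a [^] Suc k \<ominus> b [^] Suc k = (a \<ominus> b) \<otimes> (p \<oplus> b \<otimes> g)" by (simp add: p_def q_def)
  moreover have "p \<oplus> b \<otimes> g \<in> T" using TE ab g pT[OF ab(1)] by (simp add: p_def)
  ultimately show ?case by blast
qed

lemma unit_split:
  assumes "e \<in> V" "e \<notin> nV 1"
  obtains a b where "a \<in> A" "a \<notin> nV 1" "b \<in> nV 1" "e = a \<ominus> b" "b = a \<ominus> e"
proof -
  obtain a where a: "a \<in> A" "e \<ominus> a \<in> nV 1" using V_dense[OF assms(1)] by blast
  have K: "a \<in> carrier K" "e \<in> carrier K" using a assms by simp_all
  have n: "a \<ominus> e \<in> nV 1"
  proof -
    have "\<ominus> (e \<ominus> a) = a \<ominus> e" by (use K in algebra)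
    then show ?thesis using nV_neg[OF a(2)] by simp
  qed
  have e: "e = a \<ominus> (a \<ominus> e)" by (use K in algebra)
  have "a \<notin> nV 1" using nV_minus[of a 1 "a \<ominus> e"] n e assms(2) by auto
  then show ?thesis using that a n e by blast
qed

text \<open>If \<open>e = a - b\<close> with \<open>a \<in> A\<close> a unit and \<open>b\<^sup>k \<in> R\<close>, then \<open>e\<close> divides the unit \<open>a\<^sup>k - b\<^sup>k\<close> of \<open>R\<close>.\<close>

lemma inverse_of_root:
  assumes R: "mid R" "vlocal R" and T: "mid T" "R \<subseteq> T" and e: "e \<in> T" "e \<notin> nV 1"
    and root: "\<And>b. b \<in> T \<Longrightarrow> b \<in> nV 1 \<Longrightarrow> \<exists>k\<ge>(1::nat). b [^] k \<in> R"
  shows "inv e \<in> T"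
proof -
  note RE = mid_closed[OF R(1)]
  note TE = mid_closed[OF T(1)]
  obtain a b where ab: "a \<in> A" "a \<notin> nV 1" "b \<in> nV 1" "e = a \<ominus> b" "b = a \<ominus> e"
    using unit_split[of e] e TE(2) by blast
  have bT: "b \<in> T" "a \<in> T" using ab(1,5) e TE(1,10) by auto
  obtain k where k: "k \<ge> 1" "b [^] (k::nat) \<in> R" using root bT ab(3) by blast
  obtain g where g: "g \<in> T" "a [^] k \<ominus> b [^] k = e \<otimes> g"
    using ex_geometric[OF mid_subring[OF T(1)] bT(2,1), of k] ab(4) by auto
  define f where "f = a [^] k \<ominus> b [^] k"
  have fR: "f \<in> R" using k ab(1) RE by (simp add: f_def)
  have bk: "b [^] k \<in> nV 1"
  proof -
    obtain j where "k = Suc j" using k(1) by (cases k) auto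
    then show ?thesis using nV_mult[of "b [^] j" b 1] ab(3) nV_V[OF ab(3)] by simp
  qed
  have "f \<notin> nV 1"
  proof
    assume "f \<in> nV 1"
    then have "f \<oplus> b [^] k \<in> nV 1" using nV_add bk by blast
    moreover have "f \<oplus> b [^] k = a [^] k"
    proof -
      have K: "a [^] k \<in> carrier K" "b [^] k \<in> carrier K" using ab(1) bT TE by simp_all
      then show ?thesis by (simp add: f_def minus_eq a_assoc l_neg)
    qed
    ultimately show False using nV1_pow[of a k] ab(1,2) A_V by auto
  qed
  then have f: "inv f \<in> R" "f \<otimes> inv f = \<one>" using R(2) fR V_unit(4)[of f] RE(2) by (auto simp: vlocal_def)
  have K: "e \<in> carrier K" "g \<in> carrier K" "inv f \<in> carrier K" using e g f TE(3) RE(3) by auto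
  have "e \<otimes> (g \<otimes> inv f) = \<one>" using f(2) g(2) K unfolding f_def[symmetric] by (simp add: m_assoc)
  then have "inv e = g \<otimes> inv f" using comm_inv_char[of e "g \<otimes> inv f"] K by simp
  then show ?thesis using g f T TE by auto
qed

end

section \<open>Bad stable rings are quadratic\<close>

text \<open>The properties of a bad stable ring from which quadraticity is deduced.
  \<open>R_power\<close> is the form taken by dimension one: every element of the maximal ideal is
  nilpotent modulo every nonzero principal ideal.\<close>

locale stable_mid = tight_pair +
  fixes R :: "'a set"
  assumes R: "mid R" and R_local: "vlocal R"
    and R_stable: "\<And>I. ideal I (sub K R) \<Longrightarrow> I \<noteq> {\<zero>} \<Longrightarrow> stable_ideal (sub K R) I"
    and R_power: "\<And>c b. c \<in> R \<Longrightarrow> c \<noteq> \<zero> \<Longrightarrow> b \<in> R \<Longrightarrow> b \<in> nV 1 \<Longrightarrow> \<exists>N::nat. \<exists>r\<in>R. b [^] N = c \<otimes> r"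
    and R_noeth: "noetherian_ring (sub K R)"
    and R_bad: "\<not> finite_normalization K R"
begin

lemmas RE = mid_closed[OF R]

text \<open>Scaling \<open>U\<close> by a denominator \<open>d\<close> gives an ideal with the same
  endomorphisms, and y turns into yd. The conclusion reads: Uy is contained in (U : U) and contains
  a unit of \<open>V\<close>.\<close>

lemma fractional_stable:
  assumes U: "U \<subseteq> carrier K" "\<And>x y. x \<in> U \<Longrightarrow> y \<in> U \<Longrightarrow> x \<oplus> y \<in> U" "\<And>r x. r \<in> R \<Longrightarrow> x \<in> U \<Longrightarrow> r \<otimes> x \<in> U"
    and d: "d \<in> R" "d \<noteq> \<zero>" "\<And>x. x \<in> U \<Longrightarrow> d \<otimes> x \<in> R" and nz: "x0 \<in> U" "x0 \<noteq> \<zero>"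
  shows "\<exists>u\<in>U. \<exists>y\<in>carrier K. (\<forall>z\<in>U. \<forall>w\<in>U. y \<otimes> (z \<otimes> w) \<in> U) \<and> u \<otimes> y \<notin> nV 1"
proof -
  have dK: "d \<in> carrier K" using d RE by blast
  let ?I = "(\<lambda>x. d \<otimes> x) ` U"
  have UK: "x \<in> U \<Longrightarrow> x \<in> carrier K" for x using U(1) by blast
  have "\<zero> = \<zero> \<otimes> x0" using nz UK by simp
  then have zU: "\<zero> \<in> U" using U(3)[OF RE(4) nz(1)] by simp
  have I: "ideal ?I (sub K R)"
    unfolding ideal_sub_iff[OF mid_subring[OF R]]
  proof (intro conjI ballI)
    show "?I \<subseteq> R" using d by auto
    show "\<zero> \<in> ?I" using zU dK by (intro image_eqI[of _ _ \<zero>]) auto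
  next
    fix x y assume "x \<in> ?I" "y \<in> ?I"
    then obtain a b where "a \<in> U" "b \<in> U" "x = d \<otimes> a" "y = d \<otimes> b" by blast
    then show "x \<oplus> y \<in> ?I" using U(2)[of a b] UK dK by (intro image_eqI[of _ _ "a \<oplus> b"]) (simp_all add: r_distr)
  next
    fix r x assume r: "r \<in> R" and "x \<in> ?I"
    then obtain a where "a \<in> U" "x = d \<otimes> a" by blast
    then show "r \<otimes> x \<in> ?I" using U(3)[OF r, of a] UK dK RE(3)[OF r]
      by (intro image_eqI[of _ _ "r \<otimes> a"]) (simp_all add: m_lcomm)
  qed
  have "d \<otimes> x0 \<noteq> \<zero>" using integral[of d x0] dK d nz UK by blast
  then have "?I \<noteq> {\<zero>}" using nz by blast
  from stable_ideal_unit[OF R this R_stable[OF I this]]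
  obtain x y where xy: "x \<in> ?I" "y \<in> carrier K" "\<And>z w. z \<in> ?I \<Longrightarrow> w \<in> ?I \<Longrightarrow> y \<otimes> (z \<otimes> w) \<in> ?I" "x \<otimes> y \<notin> nV 1"
    by blast
  obtain u where u: "u \<in> U" "x = d \<otimes> u" using xy(1) by blast
  have "y \<otimes> d \<otimes> (z \<otimes> w) \<in> U" if zw: "z \<in> U" "w \<in> U" for z w
  proof -
    have K: "z \<in> carrier K" "w \<in> carrier K" "y \<in> carrier K" "d \<in> carrier K" using zw UK xy dK by auto
    obtain v where v: "v \<in> U" "y \<otimes> ((d \<otimes> z) \<otimes> (d \<otimes> w)) = d \<otimes> v" using xy(3)[of "d \<otimes> z" "d \<otimes> w"] zw by blast
    have "d \<otimes> (y \<otimes> d \<otimes> (z \<otimes> w)) = y \<otimes> ((d \<otimes> z) \<otimes> (d \<otimes> w))"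
      by (use K in algebra)
    then have "d \<otimes> (y \<otimes> d \<otimes> (z \<otimes> w)) = d \<otimes> v" using v by simp
    then have "y \<otimes> d \<otimes> (z \<otimes> w) = v" by (rule cancel[rotated 4]) (use K d v UK in simp_all)
    then show ?thesis using v by simp
  qed
  moreover have "u \<otimes> (y \<otimes> d) = x \<otimes> y" unfolding u(2) using UK[OF u(1)] dK xy(2) by (simp add: m_ac)
  ultimately show ?thesis using u(1) xy(2,4) dK by (intro bexI[of _ u] bexI[of _ "y \<otimes> d"]) auto
qed

end

text \<open>One step of the tower \<open>R = R\<^sub>0 \<subseteq> R\<^sub>1 \<subseteq> \<dots>\<close>: \<open>E = (M : M)\<close> for the maximal ideal \<open>M\<close> of \<open>S = R\<^sub>n\<close>.\<close>

locale stable_step = stable_mid +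
  fixes S :: "'a set" and c :: 'a
  assumes S: "mid S" and RS: "R \<subseteq> S" and S_local: "vlocal S"
    and c: "c \<in> R" "c \<noteq> \<zero>" "\<And>x. x \<in> S \<Longrightarrow> c \<otimes> x \<in> R"
    and S_root: "\<And>b. b \<in> S \<Longrightarrow> b \<in> nV 1 \<Longrightarrow> \<exists>k\<ge>(1::nat). b [^] k \<in> R"
begin

lemmas SE = mid_closed[OF S]

definition M :: "'a set" where "M = S \<inter> nV 1"
definition E :: "'a set" where "E = {x \<in> carrier K. \<forall>w\<in>M. x \<otimes> w \<in> M}"

lemma M_closed: "x \<in> M \<Longrightarrow> x \<in> S" "x \<in> M \<Longrightarrow> x \<in> nV 1" "x \<in> M \<Longrightarrow> x \<in> carrier K"
  "x \<in> M \<Longrightarrow> y \<in> M \<Longrightarrow> x \<oplus> y \<in> M" "x \<in> M \<Longrightarrow> y \<in> M \<Longrightarrow> x \<ominus> y \<in> M"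
  "s \<in> S \<Longrightarrow> x \<in> M \<Longrightarrow> s \<otimes> x \<in> M" "t \<in> M"
  unfolding M_def using SE nV_add nV_minus nV_mult by auto

lemma cK [simp]: "c \<in> carrier K" using c RE by blast

lemma E_K [simp]: "x \<in> E \<Longrightarrow> x \<in> carrier K" unfolding E_def by blast
lemma E_M: "x \<in> E \<Longrightarrow> w \<in> M \<Longrightarrow> x \<otimes> w \<in> M" unfolding E_def by blast
lemma E_I: "x \<in> carrier K \<Longrightarrow> (\<And>w. w \<in> M \<Longrightarrow> x \<otimes> w \<in> M) \<Longrightarrow> x \<in> E" unfolding E_def by blast
lemma E_M': "x \<in> E \<Longrightarrow> w \<in> M \<Longrightarrow> w \<otimes> x \<in> M" using E_M[of x w] M_closed(3) by (simp add: m_comm)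
lemma S_E: "x \<in> S \<Longrightarrow> x \<in> E" using E_I M_closed(6) SE(3) by blast

lemma E_pow_t: "x \<in> E \<Longrightarrow> t \<otimes> x [^] (k::nat) \<in> M"
proof (induct k)
  case 0
  then show ?case using M_closed(7) by simp
next
  case (Suc k)
  then have "t \<otimes> x [^] k \<in> M" by blast
  then have "x \<otimes> (t \<otimes> x [^] k) \<in> M" using Suc(2) E_M by blast
  moreover have "x \<otimes> (t \<otimes> x [^] k) = t \<otimes> x [^] Suc k" using Suc(2) by (simp add: m_ac)
  ultimately show ?case by simp
qed

text \<open>All powers of \<open>x\<close> have the common denominator \<open>t\<close>, and
  \<open>V\<close> is completely integrally closed.\<close>

lemma E_V: "x \<in> E \<Longrightarrow> x \<in> V"
proof -
  assume x: "x \<in> E"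
  have p: "t \<otimes> x [^] k \<in> V" for k :: nat using nV_V[OF M_closed(2)[OF E_pow_t[OF x]]] .
  have tx: "t \<otimes> x \<in> V" using p[of 1] by (simp only: nat_pow_eone E_K[OF x])
  show "x \<in> V" by (rule V_almost_closed[OF tV t_nz E_K[OF x] tV t_nz tx p])
qed

lemma E_mid: "mid E"
  unfolding mid_def
proof (intro conjI subsetI)
  show "subring E K"
  proof (rule subringI)
    show "E \<subseteq> carrier K" by auto
    show "\<one> \<in> E" using S_E SE by blast
    show "\<ominus> x \<in> E" if "x \<in> E" for x
    proof -
      have "\<ominus> x \<otimes> w \<in> M" if w: "w \<in> M" for w
      proof -
        have "\<ominus> x \<otimes> w = \<zero> \<ominus> x \<otimes> w" using \<open>x \<in> E\<close> M_closed(3)[OF w] by (simp add: l_minus minus_eq)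
        moreover have "\<zero> \<in> M" using SE(4) by (simp add: M_def)
        ultimately show ?thesis using M_closed(5) E_M[OF \<open>x \<in> E\<close> w] by simp
      qed
      then show ?thesis using E_I that by simp
    qed
    show "x \<otimes> y \<in> E" if "x \<in> E" "y \<in> E" for x y
    proof (rule E_I)
      show "x \<otimes> y \<in> carrier K" using that by simp
      fix w assume w: "w \<in> M"
      have "x \<otimes> (y \<otimes> w) \<in> M" using E_M that w by blast
      then show "x \<otimes> y \<otimes> w \<in> M" using that M_closed(3)[OF w] by (simp add: m_assoc)
    qed
    show "x \<oplus> y \<in> E" if "x \<in> E" "y \<in> E" for x y
    proof -
      have "(x \<oplus> y) \<otimes> w \<in> M" if w: "w \<in> M" for w
        using \<open>x \<in> E\<close> \<open>y \<in> E\<close> M_closed(3)[OF w] E_M[OF _ w] M_closed(4) by (simp add: l_distr)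
      then show ?thesis using E_I that by simp
    qed
  qed
  show "x \<in> E" if "x \<in> A" for x using that S_E SE by blast
  show "x \<in> V" if "x \<in> E" for x using that by (rule E_V)
qed

lemmas EE = mid_closed[OF E_mid]

text \<open>Stability is applied to U = S + Sb, for \<open>b\<close> outside \<open>S\<close>. It
  gives Uy inside (U : U), and (U : U) inside \<open>U\<close> because \<one> is in
  \<open>U\<close>. Either (U : U) has an element outside \<open>S\<close>, which yields the
  relation, or Uy lies in \<open>S\<close>, which forces U = S.\<close>

lemma E_quadratic:
  assumes b: "b \<in> E"
  shows "\<exists>s\<in>S. \<exists>s'\<in>S. b \<otimes> b = s \<oplus> s' \<otimes> b"
proof (cases "b \<in> S")
  case True
  then have "b \<otimes> b = b \<otimes> b \<oplus> \<zero> \<otimes> b" using SE(3) by simp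
  then show ?thesis using True SE(4,8) by blast
next
  case bS: False
  define U where "U = {s \<oplus> s' \<otimes> b |s s'. s \<in> S \<and> s' \<in> S}"
  have bK: "b \<in> carrier K" using b by simp
  have UI: "s \<oplus> s' \<otimes> b \<in> U" if "s \<in> S" "s' \<in> S" for s s' using that by (auto simp: U_def)
  have SU: "s \<in> U" if "s \<in> S" for s
    using UI[OF that SE(4)] that SE(3) bK by simp
  have bU: "b \<in> U" using UI[OF SE(4,5)] bK by simp
  have UE: "x \<in> E" if "x \<in> U" for x
    using that S_E b EE(7,8) by (auto simp: U_def)
  have Sx: "r \<otimes> x \<in> U" if r: "r \<in> S" and x: "x \<in> U" for r x
  proof -
    obtain s s' where s: "s \<in> S" "s' \<in> S" "x = s \<oplus> s' \<otimes> b" using x by (auto simp: U_def)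
    then have "r \<otimes> x = r \<otimes> s \<oplus> (r \<otimes> s') \<otimes> b" using r bK SE(3) by (simp add: r_distr m_assoc)
    then show ?thesis using UI r s SE(8) by simp
  qed
  have Uadd: "x \<oplus> y \<in> U" if x: "x \<in> U" and y: "y \<in> U" for x y
  proof -
    obtain s s' r r' where s: "s \<in> S" "s' \<in> S" "x = s \<oplus> s' \<otimes> b" "r \<in> S" "r' \<in> S" "y = r \<oplus> r' \<otimes> b"
      using x y unfolding U_def by blast
    have K: "s \<in> carrier K" "s' \<in> carrier K" "r \<in> carrier K" "r' \<in> carrier K" using s SE(3) by auto
    have "(s \<oplus> s' \<otimes> b) \<oplus> (r \<oplus> r' \<otimes> b) = (s \<oplus> r) \<oplus> (s' \<oplus> r') \<otimes> b"
      by (use K bK in algebra)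
    then show ?thesis using UI[of "s \<oplus> r" "s' \<oplus> r'"] s SE(7) by simp
  qed
  have "\<exists>u\<in>U. \<exists>y\<in>carrier K. (\<forall>z\<in>U. \<forall>w\<in>U. y \<otimes> (z \<otimes> w) \<in> U) \<and> u \<otimes> y \<notin> nV 1"
  proof (rule fractional_stable[of U "c \<otimes> t" b])
    show "U \<subseteq> carrier K" using UE by auto
    show "c \<otimes> t \<in> R" using c RE by simp
    show "c \<otimes> t \<noteq> \<zero>" using c t_nz integral[of c t] by auto
    show "b \<noteq> \<zero>" using bS SE(4) by blast
    fix x assume "x \<in> U"
    then have "x \<in> E" by (rule UE)
    then have "x \<otimes> t \<in> M" using E_M M_closed(7) by blast
    then have "c \<otimes> (x \<otimes> t) \<in> R" using c(3) M_closed(1) by blast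
    then show "c \<otimes> t \<otimes> x \<in> R" using \<open>x \<in> E\<close> by (simp add: m_ac)
  qed (use Uadd Sx RS bU in auto)
  then obtain u y where u: "u \<in> U" "y \<in> carrier K" "\<And>z w. z \<in> U \<Longrightarrow> w \<in> U \<Longrightarrow> y \<otimes> (z \<otimes> w) \<in> U" "u \<otimes> y \<notin> nV 1"
    by blast
  have uK: "u \<in> carrier K" using UE u by auto
  \<comment> \<open>For e = s + s'b in (U : U) but not in \<open>S\<close>, the coefficient s' is a
    unit, as otherwise s'b would lie in \<open>M\<close>. Then b^2 is a combination of eb and sb,
    which are both in \<open>U\<close>.\<close>
  have done': "b \<otimes> b \<in> U" if e: "e \<in> U" "e \<notin> S" "\<And>z. z \<in> U \<Longrightarrow> e \<otimes> z \<in> U" for e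
  proof -
    obtain s s' where s: "s \<in> S" "s' \<in> S" "e = s \<oplus> s' \<otimes> b" using e(1) by (auto simp: U_def)
    have "s' \<notin> nV 1"
    proof
      assume "s' \<in> nV 1"
      then have "s' \<otimes> b \<in> M" using s E_M'[OF b] by (simp add: M_def)
      then show False using e(2) s M_closed(1) SE(7) by auto
    qed
    then have inv: "inv s' \<in> S" "s' \<otimes> inv s' = \<one>" "inv s' \<in> carrier K"
      using S_local s V_unit[of s'] SE(2) by (auto simp: vlocal_def)
    define v where "v = inv s'"
    have K: "s \<in> carrier K" "s' \<in> carrier K" "v \<in> carrier K" using s SE inv by (auto simp: v_def)
    have "v \<otimes> (e \<otimes> b) \<in> U" "v \<otimes> s \<otimes> b \<in> U"
      using Sx[OF inv(1) e(3)[OF bU]] Sx[of "v \<otimes> s" b] inv s SE(8) bU by (auto simp: v_def)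
    then have "v \<otimes> (e \<otimes> b) \<oplus> (\<ominus> \<one>) \<otimes> (v \<otimes> s \<otimes> b) \<in> U" using Uadd Sx SE(5,9) by simp
    moreover have "v \<otimes> (e \<otimes> b) \<oplus> (\<ominus> \<one>) \<otimes> (v \<otimes> s \<otimes> b) = (s' \<otimes> v) \<otimes> (b \<otimes> b)"
      unfolding s(3) by (use K bK in algebra)
    ultimately show ?thesis using inv(2) bK by (simp add: v_def)
  qed
  define e where "e = u \<otimes> y"
  have eU: "e \<otimes> z \<in> U" if z: "z \<in> U" for z
  proof -
    have "e \<otimes> z = y \<otimes> (u \<otimes> z)" unfolding e_def using u(2) uK UE[OF z] by (simp add: m_ac)
    then show ?thesis using u(3)[OF u(1) z] by simp
  qed
  have oneU: "\<one> \<in> U" using SU SE by blast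
  have e1: "e \<in> U" using eU[OF oneU] u(2) uK by (simp add: e_def)
  have "b \<otimes> b \<in> U"
  proof (cases "e \<in> S")
    case False
    then show ?thesis using done' e1 eU by blast
  next
    case True
    show ?thesis
    proof (cases "\<forall>w\<in>U. y \<otimes> w \<in> S")
      case False
      then obtain w where w: "w \<in> U" "y \<otimes> w \<notin> S" by blast
      show ?thesis
      proof (rule done'[OF _ w(2)])
        show "y \<otimes> w \<in> U" using u(3)[OF oneU w(1)] UE[OF w(1)] by simp
        fix z assume "z \<in> U"
        then show "y \<otimes> w \<otimes> z \<in> U" using u(3)[OF w(1), of z] u(2) UE w by (simp add: m_assoc)
      qed
    next
      \<comment> \<open>Now Uy lies in \<open>S\<close> and uy is a unit of \<open>S\<close>, so U =
        uS. From \<one> in \<open>U\<close> it follows that \<open>u\<close> is a unit of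
        \<open>S\<close>, hence U = S, contrary to the choice of \<open>b\<close>.\<close>
      case yw: True
      have inv: "inv e \<in> S" "e \<otimes> inv e = \<one>" "inv e \<in> carrier K"
        using S_local True u(4) V_unit[of e] SE(2) unfolding e_def vlocal_def by auto
      have rep: "w = u \<otimes> (inv e \<otimes> (y \<otimes> w))" if w: "w \<in> U" for w
      proof -
        define v where "v = inv e"
        have K: "w \<in> carrier K" "v \<in> carrier K" "u \<in> carrier K" "y \<in> carrier K"
          using UE[OF w] inv uK u by (simp_all add: v_def)
        have "u \<otimes> (v \<otimes> (y \<otimes> w)) = (u \<otimes> y \<otimes> v) \<otimes> w" by (use K in algebra)
        then show ?thesis using inv(2) K by (simp add: v_def e_def)
      qed
      have sS: "inv e \<otimes> (y \<otimes> w) \<in> S" if "w \<in> U" for w using yw that inv SE(8) by blast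
      define s1 where "s1 = inv e \<otimes> (y \<otimes> \<one>)"
      have s1: "s1 \<in> S" "\<one> = u \<otimes> s1" using rep[OF oneU] sS[OF oneU] by (auto simp: s1_def)
      have "s1 \<notin> nV 1"
      proof
        assume "s1 \<in> nV 1"
        then have "u \<otimes> s1 \<in> nV 1" using nV_mult[of u s1 1] UE[OF u(1)] E_V by blast
        then show False using s1(2)[symmetric] by simp
      qed
      then have "inv s1 \<in> S" using S_local s1 by (auto simp: vlocal_def)
      moreover have "inv s1 = u"
        using comm_inv_char[of s1 u] s1 SE(3) uK m_comm[of u s1] by simp
      ultimately have "u \<in> S" by simp
      then have "b \<in> S" using rep[OF bU] sS[OF bU] SE(8)[of u "inv e \<otimes> (y \<otimes> b)"] by simp
      then show ?thesis using bS by blast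
    qed
  qed
  then show ?thesis by (auto simp: U_def)
qed

text \<open>Modulo \<open>M\<close>, the ring \<open>E\<close> is an algebra over the field S/M in
  which every element satisfies a quadratic equation. If e^2 were nonzero there, a multiple of
  \<open>e\<close> would be a nonzero idempotent f; but the quadratic equation of x + f, with x^2 =
  0, forces f = 0 or x = 0.\<close>

lemma nilpotent_dichotomy:
  assumes x: "x \<in> E" "x \<in> nV 1" "x \<notin> M" "x \<otimes> x \<in> M" and e: "e \<in> E" "e \<in> nV 1"
  shows "e \<otimes> e \<in> M"
proof (rule ccontr)
  assume ee: "e \<otimes> e \<notin> M"
  have red: "b \<otimes> b \<ominus> s' \<otimes> b \<in> M" if b: "b \<in> E" "b \<in> nV 1" and s: "s \<in> S" "s' \<in> S" "b \<otimes> b = s \<oplus> s' \<otimes> b" for b s s'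
  proof -
    have K: "b \<in> carrier K" "s \<in> carrier K" "s' \<in> carrier K" using b s SE by auto
    have "s \<oplus> s' \<otimes> b \<ominus> s' \<otimes> b = s" by (use K in algebra)
    moreover have "b \<otimes> b \<ominus> s' \<otimes> b \<in> nV 1"
      by (rule nV_minus[OF nV_mult[OF E_V[OF b(1)] b(2)] nV_mult[OF SE(2)[OF s(2)] b(2)]])
    ultimately show ?thesis using s by (simp add: M_def)
  qed
  obtain s s' where s: "s \<in> S" "s' \<in> S" "e \<otimes> e = s \<oplus> s' \<otimes> e" using E_quadratic[OF e(1)] by blast
  have m0: "e \<otimes> e \<ominus> s' \<otimes> e \<in> M" by (rule red[OF e s])
  have eK: "e \<in> carrier K" "s' \<in> carrier K" using e s SE by auto
  have s'u: "s' \<notin> nV 1"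
  proof
    assume "s' \<in> nV 1"
    then have "s' \<otimes> e \<in> M" using s E_M'[OF e(1)] by (simp add: M_def)
    then have "(e \<otimes> e \<ominus> s' \<otimes> e) \<oplus> s' \<otimes> e \<in> M" using m0 M_closed(4) by blast
    moreover have "(e \<otimes> e \<ominus> s' \<otimes> e) \<oplus> s' \<otimes> e = e \<otimes> e" by (use eK in algebra)
    ultimately show False using ee by simp
  qed
  then have inv: "inv s' \<in> S" "s' \<otimes> inv s' = \<one>" "inv s' \<in> carrier K"
    using S_local s V_unit[of s'] SE(2) by (auto simp: vlocal_def)
  define v where "v = inv s'"
  have vK: "v \<in> carrier K" "v \<in> S" using inv by (auto simp: v_def)
  \<comment> \<open>Since e^2 and s'e agree modulo \<open>M\<close> and s' is a unit, e/s' is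
    idempotent modulo \<open>M\<close>.\<close>
  define f where "f = v \<otimes> e"
  have fE: "f \<in> E" "f \<in> nV 1" "f \<in> carrier K" using e vK S_E EE(8) nV_mult SE(2) by (auto simp: f_def)
  have "v \<otimes> v \<otimes> (e \<otimes> e \<ominus> s' \<otimes> e) \<in> M" using m0 M_closed(6) vK SE(8) by blast
  moreover have "v \<otimes> v \<otimes> (e \<otimes> e \<ominus> s' \<otimes> e) = f \<otimes> f \<ominus> (s' \<otimes> v) \<otimes> f"
    unfolding f_def by (use eK vK in algebra)
  ultimately have m1: "f \<otimes> f \<ominus> f \<in> M" using inv(2) fE(3) by (simp add: v_def)
  have fM: "f \<notin> M"
  proof
    assume "f \<in> M"
    then have "s' \<otimes> f \<in> M" using M_closed(6) s by blast
    moreover have "s' \<otimes> f = (s' \<otimes> v) \<otimes> e" unfolding f_def using eK vK by (simp add: m_assoc)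
    ultimately have "e \<in> M" using inv(2) eK by (simp add: v_def)
    then show False using ee E_M e by blast
  qed
  define xf where "xf = x \<oplus> f"
  have xfE: "xf \<in> E" "xf \<in> nV 1" using x fE EE(7) nV_add by (auto simp: xf_def)
  obtain a0 a where a: "a0 \<in> S" "a \<in> S" "xf \<otimes> xf = a0 \<oplus> a \<otimes> xf" using E_quadratic[OF xfE(1)] by blast
  have sig: "(x \<oplus> f) \<otimes> (x \<oplus> f) \<ominus> a \<otimes> (x \<oplus> f) \<in> M" using red[OF xfE a] by (simp add: xf_def)
  have K: "x \<in> carrier K" "f \<in> carrier K" "a \<in> carrier K" using x fE a SE by auto
  have aE: "a \<in> E" using a S_E by blast
  have fin: "f \<in> M" if "f \<oplus> w \<in> M" "w \<in> M" for w
  proof -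
    have wK: "w \<in> carrier K" using that M_closed by blast
    have "(f \<oplus> w) \<ominus> w = f" by (use K wK in algebra)
    then show ?thesis using M_closed(5)[OF that] by simp
  qed
  \<comment> \<open>The relation (x + f)^2 = a(x + f), simplified modulo \<open>M\<close> by x^2 = 0
    and f^2 = f.\<close>
  define D1 where "D1 = x \<otimes> f \<oplus> x \<otimes> f \<oplus> f \<ominus> a \<otimes> x \<ominus> a \<otimes> f"
  have D1M: "D1 \<in> M"
  proof -
    have "((x \<oplus> f) \<otimes> (x \<oplus> f) \<ominus> a \<otimes> (x \<oplus> f)) \<ominus> x \<otimes> x \<ominus> (f \<otimes> f \<ominus> f) \<in> M"
      by (intro M_closed(5) sig x m1)
    moreover have "((x \<oplus> f) \<otimes> (x \<oplus> f) \<ominus> a \<otimes> (x \<oplus> f)) \<ominus> x \<otimes> x \<ominus> (f \<otimes> f \<ominus> f) = D1"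
      unfolding D1_def by (use K in algebra)
    ultimately show ?thesis by simp
  qed
  have D1K: "D1 \<in> carrier K" using D1M M_closed by blast
  \<comment> \<open>Multiply \<open>D1\<close> by 1 - f, which kills every term containing f: only
    -ax(1 - f) survives.\<close>
  have D3: "a \<otimes> (x \<otimes> f \<ominus> x) \<in> M"
  proof -
    have "D1 \<ominus> f \<otimes> D1 \<oplus> ((x \<oplus> x \<oplus> \<one>) \<ominus> a) \<otimes> (f \<otimes> f \<ominus> f) \<in> M"
      by (intro M_closed(4,5) E_M D1M m1 fE EE(5,7,10) aE x)
    moreover have "D1 \<ominus> f \<otimes> D1 \<oplus> ((x \<oplus> x \<oplus> \<one>) \<ominus> a) \<otimes> (f \<otimes> f \<ominus> f) = a \<otimes> (x \<otimes> f \<ominus> x)"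
    proof -
      define y q where "y = x \<oplus> x \<oplus> \<one> \<ominus> a" and "q = x \<otimes> a"
      have yq: "y \<in> carrier K" "q \<in> carrier K" using K by (simp_all add: y_def q_def)
      have D1': "D1 = y \<otimes> f \<ominus> q" unfolding D1_def y_def q_def by (use K in algebra)
      have "D1 \<ominus> f \<otimes> D1 \<oplus> y \<otimes> (f \<otimes> f \<ominus> f) = q \<otimes> f \<ominus> q"
        unfolding D1' by (use K yq in algebra)
      also have "\<dots> = a \<otimes> (x \<otimes> f \<ominus> x)" unfolding q_def by (use K in algebra)
      finally show ?thesis by (simp add: y_def)
    qed
    ultimately show ?thesis by simp
  qed
  show False
  proof (cases "a \<in> nV 1")
    case True
    then have aM: "a \<in> M" using a by (simp add: M_def)
    \<comment> \<open>For a = 0 modulo \<open>M\<close> the relation reads (1 + 2x)f = 0, and 1 - 2x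
      is the inverse of 1 + 2x modulo x^2.\<close>
    have "(\<one> \<ominus> (x \<oplus> x)) \<otimes> (D1 \<oplus> x \<otimes> a \<oplus> f \<otimes> a) \<oplus> (f \<oplus> f \<oplus> f \<oplus> f) \<otimes> (x \<otimes> x) \<in> M"
      by (intro M_closed(4,5) E_M D1M fE EE(5,7,10) aM x)
    moreover have "(\<one> \<ominus> (x \<oplus> x)) \<otimes> (D1 \<oplus> x \<otimes> a \<oplus> f \<otimes> a) \<oplus> (f \<oplus> f \<oplus> f \<oplus> f) \<otimes> (x \<otimes> x) = f"
      unfolding D1_def by (use K in algebra)
    ultimately show False using fM K by simp
  next
    case False
    then have ai: "inv a \<in> S" "a \<otimes> inv a = \<one>" "inv a \<in> carrier K"
      using S_local a V_unit[of a] SE(2) by (auto simp: vlocal_def)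
    define i where "i = inv a"
    have iK: "i \<in> carrier K" using ai by (simp add: i_def)
    have "i \<otimes> (a \<otimes> (x \<otimes> f \<ominus> x)) \<in> M" using D3 M_closed(6) ai by (simp add: i_def)
    moreover have "i \<otimes> (a \<otimes> (x \<otimes> f \<ominus> x)) = (a \<otimes> i) \<otimes> (x \<otimes> f \<ominus> x)"
      by (use K iK in algebra)
    ultimately have D4: "x \<otimes> f \<ominus> x \<in> M" using ai(2) K by (simp add: i_def)
    \<comment> \<open>With xf = x the relation becomes \<beta> f + (1 + \<beta>) x = 0 modulo
      \<open>M\<close>. If \<beta> is a unit, f is a multiple of x, so f = f^2 = 0; if \<beta> is in
      \<open>M\<close>, then x = 0.\<close>
    define \<beta> where "\<beta> = \<one> \<ominus> a"
    have bS: "\<beta> \<in> S" "\<beta> \<in> E" "\<beta> \<in> carrier K" using a SE(5,10) S_E by (auto simp: \<beta>_def)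
    have P: "\<beta> \<otimes> f \<oplus> (\<one> \<oplus> \<beta>) \<otimes> x \<in> M"
    proof -
      have "D1 \<ominus> (x \<otimes> f \<ominus> x) \<ominus> (x \<otimes> f \<ominus> x) \<in> M" by (intro M_closed(5) D1M D4)
      moreover have "D1 \<ominus> (x \<otimes> f \<ominus> x) \<ominus> (x \<otimes> f \<ominus> x) = \<beta> \<otimes> f \<oplus> (\<one> \<oplus> \<beta>) \<otimes> x"
        unfolding D1_def \<beta>_def by (use K in algebra)
      ultimately show ?thesis by simp
    qed
    have "\<beta> \<in> nV 1"
    proof (rule ccontr)
      assume nb: "\<beta> \<notin> nV 1"
      then have bi: "inv \<beta> \<in> S" "\<beta> \<otimes> inv \<beta> = \<one>" "inv \<beta> \<in> carrier K"
        using S_local bS V_unit[of \<beta>] SE(2) by (auto simp: vlocal_def)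
      define j where "j = inv \<beta>"
      have j: "j \<in> S" "j \<in> carrier K" "j \<in> E" "\<beta> \<otimes> j = \<one>" using bi S_E by (auto simp: j_def)
      define g where "g = \<one> \<oplus> \<beta>"
      have g: "g \<in> E" "g \<in> carrier K" using bS EE(5,7) by (auto simp: g_def)
      have "j \<otimes> j \<otimes> ((\<beta> \<otimes> f \<ominus> g \<otimes> x) \<otimes> (\<beta> \<otimes> f \<oplus> g \<otimes> x) \<oplus> g \<otimes> g \<otimes> (x \<otimes> x)) \<in> M"
        by (intro M_closed(4) E_M EE(8,10) P[folded g_def] fE g bS x j)
      moreover have "j \<otimes> j \<otimes> ((\<beta> \<otimes> f \<ominus> g \<otimes> x) \<otimes> (\<beta> \<otimes> f \<oplus> g \<otimes> x) \<oplus> g \<otimes> g \<otimes> (x \<otimes> x))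
          = (\<beta> \<otimes> j) \<otimes> (\<beta> \<otimes> j) \<otimes> (f \<otimes> f)"
        by (use K j(2) bS(3) g(2) in algebra)
      ultimately have "f \<otimes> f \<in> M" using j K by simp
      then have "f \<otimes> f \<ominus> (f \<otimes> f \<ominus> f) \<in> M" using m1 M_closed(5) by blast
      moreover have "f \<otimes> f \<ominus> (f \<otimes> f \<ominus> f) = f" by (use K in algebra)
      ultimately show False using fM K by simp
    qed
    then have bM: "\<beta> \<in> M" using bS by (simp add: M_def)
    have "(\<beta> \<otimes> f \<oplus> (\<one> \<oplus> \<beta>) \<otimes> x) \<ominus> f \<otimes> \<beta> \<ominus> x \<otimes> \<beta> \<in> M"
      by (intro M_closed(5) P E_M fE x bM)
    moreover have "(\<beta> \<otimes> f \<oplus> (\<one> \<oplus> \<beta>) \<otimes> x) \<ominus> f \<otimes> \<beta> \<ominus> x \<otimes> \<beta> = x"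
      by (use K bS in algebra)
    ultimately show False using x K by simp
  qed
qed


text \<open>If \<open>E\<close> modulo \<open>M\<close> is reduced, then \<open>E\<close> is the integral closure of \<open>R\<close>: multiplying an
  integral \<open>y \<notin> E\<close> by suitable elements of \<open>M\<close> gives an integral \<open>z \<notin> E\<close> with \<open>M z \<subseteq> E\<close>;
  for \<open>w \<in> M\<close> some power of \<open>w z\<close> lies in \<open>M\<close>, hence \<open>w z \<in> M\<close> and so \<open>z \<in> E\<close>.\<close>

lemma nilpotent_exists: "\<exists>x\<in>E. x \<in> nV 1 \<and> x \<notin> M \<and> x \<otimes> x \<in> M \<or> (\<forall>e\<in>E. e \<in> nV 1 \<longrightarrow> e \<in> M)"
proof (rule ccontr)
  assume "\<not> ?thesis"
  then have red: "\<And>x. x \<in> E \<Longrightarrow> x \<in> nV 1 \<Longrightarrow> x \<otimes> x \<in> M \<Longrightarrow> x \<in> M" using EE(5) by blast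
  have red_pow: "x \<in> M" if x: "x \<in> E" "x \<in> nV 1" and k: "x [^] (k::nat) \<in> M" for x k
  proof -
    have K: "x \<in> carrier K" using x by simp
    \<comment> \<open>Repeated square roots lower the exponent 2^j i to i. Since 2^k exceeds
      \<open>k\<close>, the power of \<open>x\<close> with this exponent lies in \<open>M\<close> as
      well, and one descends to the exponent 1.\<close>
    have "x [^] (2 ^ j * i) \<in> M \<Longrightarrow> i \<ge> 1 \<Longrightarrow> x [^] i \<in> M" for i j :: nat
    proof (induct j)
      case (Suc j)
      let ?z = "x [^] (2 ^ j * i)"
      have e: "2 ^ Suc j * i = 2 ^ j * i + 2 ^ j * i" by simp
      have "?z \<otimes> ?z = x [^] (2 ^ Suc j * i)" unfolding e using K by (simp only: nat_pow_mult)
      then have zz: "?z \<otimes> ?z \<in> M" using Suc(2) by simp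
      have "?z \<in> nV 1" using nV1_prime[of ?z ?z] zz M_closed(2) EE(2,11)[OF x(1)] E_V by blast
      then have "?z \<in> M" using red[of ?z] EE(11)[OF x(1)] zz by blast
      then show ?case using Suc by blast
    qed simp
    moreover have "x [^] ((2::nat) ^ k * 1) \<in> M"
    proof -
      have "(2::nat) ^ k \<ge> k" using less_exp[of k] by simp
      then obtain j where j: "(2::nat) ^ k * 1 = j + k" by (metis add.commute le_Suc_ex mult.right_neutral)
      have "x [^] j \<otimes> x [^] k \<in> M" using E_M[OF EE(11)[OF x(1)] k] .
      then show ?thesis unfolding j using K by (simp add: nat_pow_mult)
    qed
    ultimately have "x [^] (1::nat) \<in> M" by blast
    then show ?thesis using K by simp
  qed
  have ME: "w \<otimes> z \<in> E" if "w \<in> M" "z \<in> E" for w z using that E_M' S_E M_closed(1) by blast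
  have integral_E: "y \<in> E" if y: "y \<in> integral_closure K R (quot_field K R)" for y
  proof (rule ccontr)
    assume yE: "y \<notin> E"
    obtain d where d: "d \<in> R" "d \<noteq> \<zero>" "\<And>k::nat. d \<otimes> y [^] k \<in> R" using integral_imp_almost[OF R y] by blast
    have yK: "y \<in> carrier K"
      using y quot_field_E[OF R, of y thesis for thesis] by (auto simp: integral_closure_def)
    have dK: "d \<in> carrier K" using d RE(3) by blast
    have dy: "d \<otimes> y \<in> R" using d(3)[of 1] yK by simp
    have pw: "\<exists>N. \<exists>r\<in>R. w [^] (N::nat) = d \<otimes> r" if w: "w \<in> M" for w
    proof -
      obtain k where k: "k \<ge> 1" "w [^] (k::nat) \<in> R" using S_root w by (auto simp: M_def)
      then obtain j where j: "k = Suc j" by (cases k) auto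
      have "w [^] k \<in> nV 1" unfolding j using nV_mult[of "w [^] j" w 1] w M_closed nV_V by simp
      then obtain N r where "r \<in> R" "(w [^] k) [^] (N::nat) = d \<otimes> r" using R_power[OF d(1,2) k(2)] by blast
      then show ?thesis using M_closed(3)[OF w] by (auto simp: nat_pow_pow)
    qed
    \<comment> \<open>\<open>M\<close> scaled by \<open>c\<close> into \<open>R\<close>, where the
      Noetherian property provides finitely many generators; dividing them by \<open>c\<close> gives
      \<open>G\<close>.\<close>
    define cM where "cM = (\<lambda>w. c \<otimes> w) ` M"
    have cI: "ideal cM (sub K R)"
      unfolding ideal_sub_iff[OF mid_subring[OF R]]
    proof (intro conjI ballI)
      show "cM \<subseteq> R" using c(3) M_closed(1) by (auto simp: cM_def)
      have "\<zero> \<in> M" using SE(4) by (simp add: M_def)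
      then show "\<zero> \<in> cM" unfolding cM_def by (intro image_eqI[of _ _ \<zero>]) auto
    next
      fix u v assume "u \<in> cM" "v \<in> cM"
      then obtain a b where "a \<in> M" "b \<in> M" "u = c \<otimes> a" "v = c \<otimes> b" unfolding cM_def by blast
      then have "u \<oplus> v = c \<otimes> (a \<oplus> b)" "a \<oplus> b \<in> M" using M_closed(3,4) by (simp_all add: r_distr)
      then show "u \<oplus> v \<in> cM" unfolding cM_def by blast
    next
      fix r u assume r: "r \<in> R" and "u \<in> cM"
      then obtain a where a: "a \<in> M" "u = c \<otimes> a" unfolding cM_def by blast
      have rS: "r \<in> S" using r RS by blast
      have "r \<otimes> u = c \<otimes> (r \<otimes> a)" using a M_closed(3) RE(3)[OF r] by (simp add: m_lcomm)
      moreover have "r \<otimes> a \<in> M" by (rule M_closed(6)[OF rS a(1)])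
      ultimately show "r \<otimes> u \<in> cM" unfolding cM_def by blast
    qed
    then obtain G' where G': "G' \<subseteq> R" "finite G'" "cM = Idl\<^bsub>sub K R\<^esub> G'"
      using noetherian_ring.finetely_gen[OF R_noeth cI] by auto
    have rR: "ring (sub K R)" by (rule subring_is_ring[OF mid_subring[OF R]])
    have "G' \<subseteq> cM" using ring.genideal_self[OF rR, of G'] G' by simp
    then obtain G where G: "G \<subseteq> M" "finite G" "G' = (\<lambda>w. c \<otimes> w) ` G"
      unfolding cM_def using finite_subset_image[OF G'(2)] by blast
    \<comment> \<open>The \<open>w\<close> in \<open>M\<close> with wz in \<open>E\<close> form,
      after scaling by \<open>c\<close>, an ideal of \<open>R\<close>; so it suffices to test the
      generators \<open>G\<close>.\<close>
    have gen: "w \<otimes> z \<in> E" if zK: "z \<in> carrier K" and Gz: "\<And>g. g \<in> G \<Longrightarrow> g \<otimes> z \<in> E" and w: "w \<in> M" for z w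
    proof -
      define J where "J = {x \<in> R. \<exists>w\<in>M. x = c \<otimes> w \<and> w \<otimes> z \<in> E}"
      have "ideal J (sub K R)"
        unfolding ideal_sub_iff[OF mid_subring[OF R]]
      proof (intro conjI ballI)
        show "J \<subseteq> R" by (auto simp: J_def)
        have "\<zero> \<in> M" using SE(4) by (simp add: M_def)
        then show "\<zero> \<in> J" unfolding J_def using zK EE(4) RE(4) by (intro CollectI conjI bexI[of _ \<zero>]) auto
      next
        fix u v assume "u \<in> J" "v \<in> J"
        then obtain a b where ab: "a \<in> M" "b \<in> M" "u = c \<otimes> a" "v = c \<otimes> b" "a \<otimes> z \<in> E" "b \<otimes> z \<in> E" "u \<in> R" "v \<in> R"
          unfolding J_def by blast
        then have "u \<oplus> v = c \<otimes> (a \<oplus> b)" "a \<oplus> b \<in> M" "(a \<oplus> b) \<otimes> z \<in> E" "u \<oplus> v \<in> R"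
          using M_closed(3,4) zK EE(7) RE(7) by (simp_all add: r_distr l_distr)
        then show "u \<oplus> v \<in> J" unfolding J_def by blast
      next
        fix r u assume r: "r \<in> R" and "u \<in> J"
        then obtain a where a: "a \<in> M" "u = c \<otimes> a" "a \<otimes> z \<in> E" "u \<in> R" unfolding J_def by blast
        have rS: "r \<in> S" using r RS by blast
        have "r \<otimes> u = c \<otimes> (r \<otimes> a)" using a M_closed(3) RE(3)[OF r] by (simp add: m_lcomm)
        moreover have "r \<otimes> a \<otimes> z \<in> E" using EE(8)[OF S_E[OF rS] a(3)] M_closed(3)[OF a(1)] RE(3)[OF r] zK by (simp add: m_assoc)
        moreover have "r \<otimes> a \<in> M" by (rule M_closed(6)[OF rS a(1)])
        moreover have "r \<otimes> u \<in> R" using RE(8)[OF r a(4)] .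
        ultimately show "r \<otimes> u \<in> J" unfolding J_def by blast
      qed
      moreover have "G' \<subseteq> J" using G Gz c(3) M_closed(1) unfolding J_def by blast
      ultimately have "cM \<subseteq> J" using ring.genideal_minimal[OF rR] G'(3) by simp
      then obtain w' where w': "w' \<in> M" "c \<otimes> w = c \<otimes> w'" "w' \<otimes> z \<in> E" using w unfolding cM_def J_def by blast
      have "w = w'" by (rule cancel[OF _ _ _ _ w'(2)]) (use c w w' M_closed(3) in auto)
      then show ?thesis using w' by simp
    qed
    \<comment> \<open>One generator g after the other is treated: the current multiple of
      \<open>y\<close> is multiplied by the last power of g that keeps it outside \<open>E\<close>.
      There is such a power because some power of g is divisible by the denominator
      \<open>d\<close>.\<close>
    have "\<exists>\<mu>\<in>S. \<mu> \<otimes> y \<notin> E \<and> (\<forall>g\<in>G0. g \<otimes> (\<mu> \<otimes> y) \<in> E)" if "finite G0" "G0 \<subseteq> M" for G0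
      using that
    proof (induct G0)
      case empty
      then show ?case using yE yK SE(5) by (intro bexI[of _ \<one>]) auto
    next
      case (insert g G0)
      then obtain \<mu> where mu: "\<mu> \<in> S" "\<mu> \<otimes> y \<notin> E" "\<forall>h\<in>G0. h \<otimes> (\<mu> \<otimes> y) \<in> E" by auto
      have gM: "g \<in> M" using insert by simp
      have muK: "\<mu> \<in> carrier K" "g \<in> carrier K" using mu(1) gM SE(3) M_closed(3) by auto
      obtain N r where r: "r \<in> R" "g [^] (N::nat) = d \<otimes> r" using pw[OF gM] by blast
      have rS: "r \<in> S" "d \<otimes> y \<in> S" using r(1) dy RS by auto
      have "g [^] N \<otimes> (\<mu> \<otimes> y) = r \<otimes> \<mu> \<otimes> (d \<otimes> y)" unfolding r(2)
        using RE(3)[OF r(1)] dK yK muK by (simp add: m_ac)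
      moreover have "r \<otimes> \<mu> \<otimes> (d \<otimes> y) \<in> E" using S_E SE(8) rS mu(1) by blast
      ultimately have "g [^] N \<otimes> (\<mu> \<otimes> y) \<in> E" by (simp only:)
      then have ex: "\<exists>N. g [^] (N::nat) \<otimes> (\<mu> \<otimes> y) \<in> E" by (rule exI)
      define N0 where "N0 = (LEAST N. g [^] (N::nat) \<otimes> (\<mu> \<otimes> y) \<in> E)"
      have N0: "g [^] N0 \<otimes> (\<mu> \<otimes> y) \<in> E" unfolding N0_def by (rule LeastI_ex[OF ex])
      have "N0 \<noteq> 0"
      proof
        assume "N0 = 0"
        then show False using N0 mu(2) muK yK by simp
      qed
      then obtain j where j: "N0 = Suc j" by (cases N0) auto
      have nj: "g [^] j \<otimes> (\<mu> \<otimes> y) \<notin> E"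
        using not_less_Least[of j "\<lambda>N. g [^] (N::nat) \<otimes> (\<mu> \<otimes> y) \<in> E"] j unfolding N0_def by simp
      let ?\<nu> = "g [^] j \<otimes> \<mu>"
      have nuS: "?\<nu> \<in> S" using SE(8,11) mu(1) M_closed(1)[OF gM] by blast
      have e1: "?\<nu> \<otimes> y = g [^] j \<otimes> (\<mu> \<otimes> y)" using muK yK by (simp add: m_assoc)
      have e2: "g \<otimes> (?\<nu> \<otimes> y) = g [^] N0 \<otimes> (\<mu> \<otimes> y)" unfolding j using muK yK by (simp add: m_ac)
      have e3: "h \<otimes> (?\<nu> \<otimes> y) \<in> E" if h: "h \<in> G0" for h
      proof -
        have hK: "h \<in> carrier K" using h insert(4) M_closed(3) by blast
        have "h \<otimes> (?\<nu> \<otimes> y) = g [^] j \<otimes> (h \<otimes> (\<mu> \<otimes> y))" using muK yK hK by (simp add: m_ac)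
        moreover have "g [^] j \<otimes> (h \<otimes> (\<mu> \<otimes> y)) \<in> E"
          using EE(8,11) S_E[OF M_closed(1)[OF gM]] mu(3) h by blast
        ultimately show ?thesis by simp
      qed
      show ?case
        by (rule bexI[OF _ nuS]) (use nj e1 e2 e3 N0 in auto)
    qed
    then obtain \<mu> where mu: "\<mu> \<in> S" "\<mu> \<otimes> y \<notin> E" "\<forall>g\<in>G. g \<otimes> (\<mu> \<otimes> y) \<in> E" using G by blast
    define z where "z = \<mu> \<otimes> y"
    have muK: "\<mu> \<in> carrier K" "z \<in> carrier K" using mu(1) SE(3) yK by (auto simp: z_def)
    have "w \<otimes> z \<in> M" if w: "w \<in> M" for w
    proof -
      have sE: "w \<otimes> z \<in> E" by (rule gen[OF muK(2) _ w]) (use mu z_def in auto)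
      have wK: "w \<in> carrier K" by (rule M_closed(3)[OF w])
      obtain N r where r: "r \<in> R" "w [^] (N::nat) = d \<otimes> r" using pw[OF w] by blast
      \<comment> \<open>w^N absorbs the denominator \<open>d\<close> of y^n, and the extra factor
        \<open>w\<close> moves the product from \<open>S\<close> into \<open>M\<close>.\<close>
      define n where "n = Suc N"
      have "(w \<otimes> z) [^] n = w [^] n \<otimes> z [^] n" using wK muK by (simp add: nat_pow_distrib)
      also have "z [^] n = \<mu> [^] n \<otimes> y [^] n" unfolding z_def by (rule nat_pow_distrib) (use muK yK in simp_all)
      also have "w [^] n = w [^] N \<otimes> w" by (simp add: n_def)
      also have "w [^] N \<otimes> w \<otimes> (\<mu> [^] n \<otimes> y [^] n) = (r \<otimes> \<mu> [^] n \<otimes> (d \<otimes> y [^] n)) \<otimes> w"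
      proof -
        define p q where "p = \<mu> [^] n" and "q = y [^] n"
        have K: "p \<in> carrier K" "q \<in> carrier K" "r \<in> carrier K" using muK yK RE(3)[OF r(1)] by (auto simp: p_def q_def)
        have "d \<otimes> r \<otimes> w \<otimes> (p \<otimes> q) = (r \<otimes> p \<otimes> (d \<otimes> q)) \<otimes> w"
          by (use K dK wK in algebra)
        then show ?thesis unfolding r(2) p_def q_def .
      qed
      also have "\<dots> \<in> M"
      proof (rule M_closed(6)[OF _ w])
        have "r \<in> S" "d \<otimes> y [^] n \<in> S" using r(1) d(3)[of n] RS by auto
        then show "r \<otimes> \<mu> [^] n \<otimes> (d \<otimes> y [^] n) \<in> S" using SE(8,11) mu(1) by blast
      qed
      finally have sn: "(w \<otimes> z) [^] n \<in> M" .
      then have "w \<otimes> z \<in> nV 1" using nV1_pow[of "w \<otimes> z" n] E_V[OF sE] M_closed(2) by blast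
      then show ?thesis using red_pow[OF sE _ sn] by blast
    qed
    then have "z \<in> E" using E_I[OF muK(2)] m_comm[OF muK(2)] M_closed(3) by simp
    then show False using mu(2) by (simp add: z_def)
  qed
  have ct: "c \<otimes> t \<in> R" "c \<otimes> t \<noteq> \<zero>" using c RE(6,8) t_nz integral[of c t] by auto
  have cE: "c \<otimes> t \<otimes> x \<in> R" if x: "x \<in> E" for x
  proof -
    have "x \<otimes> t \<in> S" using E_M[OF x M_closed(7)] M_closed(1) by blast
    then have "c \<otimes> (x \<otimes> t) \<in> R" by (rule c(3))
    moreover have "c \<otimes> (x \<otimes> t) = c \<otimes> t \<otimes> x" using x by (simp add: m_ac)
    ultimately show ?thesis by simp
  qed
  have "integral_closure K R (quot_field K R) = E"
  proof
    show "integral_closure K R (quot_field K R) \<subseteq> E" using integral_E by blast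
    show "E \<subseteq> integral_closure K R (quot_field K R)"
    proof
      fix x assume x: "x \<in> E"
      have "c \<otimes> t \<otimes> x [^] k \<in> R" for k :: nat by (rule cE[OF EE(11)[OF x]])
      then show "x \<in> integral_closure K R (quot_field K R)"
        using almost_imp_integral[OF R R_noeth E_K[OF x] ct] by blast
    qed
  qed
  moreover have "finitely_generated_module (sub K R) (restrict_scalars (\<lambda>a. a) (sub K E))"
    by (rule finite_moduleI[OF R R_noeth mid_subring[OF E_mid] _ ct cE]) (use EE(8) S_E RS in blast)
  ultimately show False using R_bad by (simp add: finite_normalization_def)
qed

lemma square_in_M: "e \<in> E \<Longrightarrow> e \<in> nV 1 \<Longrightarrow> e \<otimes> e \<in> M"
proof -
  assume e: "e \<in> E" "e \<in> nV 1"
  from nilpotent_exists obtain x where x: "x \<in> E"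
    "x \<in> nV 1 \<and> x \<notin> M \<and> x \<otimes> x \<in> M \<or> (\<forall>e\<in>E. e \<in> nV 1 \<longrightarrow> e \<in> M)" by blast
  from x(2) show "e \<otimes> e \<in> M"
  proof
    assume "x \<in> nV 1 \<and> x \<notin> M \<and> x \<otimes> x \<in> M"
    then show ?thesis using nilpotent_dichotomy[OF x(1) _ _ _ e] by blast
  next
    assume "\<forall>e\<in>E. e \<in> nV 1 \<longrightarrow> e \<in> M"
    then show ?thesis using e E_M by blast
  qed
qed

text \<open>Squaring brings an element of \<open>E\<close> in \<open>nV 1\<close> back into
  \<open>M\<close>, where \<open>S_root\<close> applies. Thus the root property, on which locality
  rests, passes from one ring of the tower to the next.\<close>

lemma E_root: "e \<in> E \<Longrightarrow> e \<in> nV 1 \<Longrightarrow> \<exists>k\<ge>(1::nat). e [^] k \<in> R"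
proof -
  assume e: "e \<in> E" "e \<in> nV 1"
  then have "e \<otimes> e \<in> S" "e \<otimes> e \<in> nV 1" using square_in_M M_closed by blast+
  then obtain k where k: "k \<ge> 1" "(e \<otimes> e) [^] (k::nat) \<in> R" using S_root by blast
  have "e [^] (2 * k) = (e [^] (2::nat)) [^] k" using e by (simp add: nat_pow_pow)
  also have "e [^] (2::nat) = e \<otimes> e" using e by (simp add: numeral_2_eq_2)
  finally show ?thesis using k by (intro exI[of _ "2 * k"]) simp
qed

lemma E_local: "vlocal E"
proof -
  have "R \<subseteq> E" using RS S_E by blast
  then show ?thesis
    unfolding vlocal_def using inverse_of_root[OF R R_local E_mid _ _ _ E_root] by blast
qed

text \<open>Stability of \<open>M\<close> gives u in \<open>M\<close> with My inside
  \<open>E\<close> and uy a unit of the local ring \<open>E\<close>, hence M = uE. Now t = ue for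
  some e in \<open>E\<close>; as u lies in tV, this e is a unit of \<open>V\<close> and so of
  \<open>E\<close>, and u may be replaced by \<open>t\<close>.\<close>

lemma M_eq_tE: "w \<in> M \<Longrightarrow> \<exists>e\<in>E. w = t \<otimes> e"
proof -
  assume w: "w \<in> M"
  have "\<exists>u\<in>M. \<exists>y\<in>carrier K. (\<forall>z\<in>M. \<forall>w\<in>M. y \<otimes> (z \<otimes> w) \<in> M) \<and> u \<otimes> y \<notin> nV 1"
    by (rule fractional_stable[of M c t]) (use M_closed RS c t_nz in \<open>auto simp: subset_iff\<close>)
  then obtain u y where u: "u \<in> M" "y \<in> carrier K" "\<And>z w. z \<in> M \<Longrightarrow> w \<in> M \<Longrightarrow> y \<otimes> (z \<otimes> w) \<in> M" "u \<otimes> y \<notin> nV 1"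
    by blast
  have uK: "u \<in> carrier K" by (rule M_closed(3)[OF u(1)])
  have yE: "z \<otimes> y \<in> E" if z: "z \<in> M" for z
  proof (rule E_I)
    show "z \<otimes> y \<in> carrier K" using M_closed(3)[OF z] u by simp
    fix w assume w: "w \<in> M"
    have "z \<otimes> y \<otimes> w = y \<otimes> (z \<otimes> w)" using M_closed(3)[OF z] M_closed(3)[OF w] u(2) by (simp add: m_ac)
    then show "z \<otimes> y \<otimes> w \<in> M" using u(3)[OF z w] by simp
  qed
  define v where "v = inv (u \<otimes> y)"
  have v: "v \<in> E" "(u \<otimes> y) \<otimes> v = \<one>" "v \<in> carrier K"
    using E_local yE[OF u(1)] u(4) V_unit[OF E_V[OF yE[OF u(1)]] u(4)] by (auto simp: v_def vlocal_def)
  have rep: "\<exists>e\<in>E. z = u \<otimes> e" if z: "z \<in> M" for z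
  proof -
    have zK: "z \<in> carrier K" by (rule M_closed(3)[OF z])
    note yK = u(2)
    note vK = v(3)
    have "u \<otimes> (z \<otimes> y \<otimes> v) = ((u \<otimes> y) \<otimes> v) \<otimes> z" by (use zK uK yK vK in algebra)
    then have "z = u \<otimes> (z \<otimes> y \<otimes> v)" using v(2) zK by simp
    moreover have "z \<otimes> y \<otimes> v \<in> E" using yE[OF z] v(1) EE(8) by blast
    ultimately show ?thesis by blast
  qed
  obtain e where e: "e \<in> E" "t = u \<otimes> e" using rep[OF M_closed(7)] by blast
  obtain u' where u': "u' \<in> V" "u = t \<otimes> u'" using M_closed(2)[OF u(1)] nV1_E by blast
  have en: "e \<notin> nV 1"
  proof
    assume "e \<in> nV 1"
    then have ue: "u' \<otimes> e \<in> nV 1" using nV_mult u' by blast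
    have "t \<otimes> (u' \<otimes> e) = u \<otimes> e" unfolding u'(2) using u'(1) E_K[OF e(1)] by (simp add: m_assoc)
    also have "u \<otimes> e = t \<otimes> \<one>" unfolding e(2)[symmetric] by simp
    finally have "u' \<otimes> e = \<one>" by (rule cancel[rotated 4]) (use t_nz E_K[OF e(1)] u'(1) in simp_all)
    then show False using ue by simp
  qed
  then have ie: "inv e \<in> E" "e \<otimes> inv e = \<one>" "inv e \<in> carrier K"
    using E_local e(1) en V_unit[OF E_V[OF e(1)]] by (auto simp: vlocal_def)
  obtain f where f: "f \<in> E" "w = u \<otimes> f" using rep[OF w] by blast
  define i where "i = inv e"
  have K: "u \<in> carrier K" "e \<in> carrier K" "i \<in> carrier K" "f \<in> carrier K" using uK E_K[OF e(1)] ie(3) E_K[OF f(1)] by (simp_all add: i_def)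
  have "(u \<otimes> e) \<otimes> (i \<otimes> f) = u \<otimes> ((e \<otimes> i) \<otimes> f)" by (use K in algebra)
  then have "w = t \<otimes> (i \<otimes> f)" using ie(2) f(2) K e(2)[symmetric] by (simp add: i_def)
  moreover have "i \<otimes> f \<in> E" using ie f EE(8) by (simp add: i_def)
  ultimately show ?thesis by blast
qed

end

section \<open>The tower exhausting \<open>V\<close> and the quadraticity of
  \<open>R\<close>\<close>

context stable_mid
begin

definition tower :: "nat \<Rightarrow> 'a set" where "tower n = {x \<in> V. t [^] n \<otimes> x \<in> R}"

lemma tower_good:
  "mid (tower n) \<and> R \<subseteq> tower n \<and> vlocal (tower n) \<and> (\<forall>b\<in>tower n. b \<in> nV 1 \<longrightarrow> (\<exists>k\<ge>(1::nat). b [^] k \<in> R))"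
proof (induct n)
  case 0
  have "tower 0 = R" using RE(2,3) by (auto simp: tower_def)
  then show ?case using R R_local RE(3) by (auto intro!: exI[of _ 1])
next
  case (Suc n)
  interpret S: stable_step K A V t R "tower n" "t [^] n"
  proof
    show "mid (tower n)" "R \<subseteq> tower n" "vlocal (tower n)" using Suc by auto
    show "t [^] n \<in> R" using RE(6,11) by blast
    show "\<And>x. x \<in> tower n \<Longrightarrow> t [^] n \<otimes> x \<in> R" by (simp add: tower_def)
    show "\<And>b. b \<in> tower n \<Longrightarrow> b \<in> nV 1 \<Longrightarrow> \<exists>k\<ge>1. b [^] (k::nat) \<in> R" using Suc by blast
  qed simp
  have "tower (Suc n) = S.E"
  proof
    \<comment> \<open>For x in the next ring, tx lies in the present one and in \<open>nV 1\<close>,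
      hence in its maximal ideal M = tE; cancelling \<open>t\<close> puts x into E.\<close>
    show "tower (Suc n) \<subseteq> S.E"
    proof
      fix x assume "x \<in> tower (Suc n)"
      then have x: "x \<in> V" "t [^] n \<otimes> (t \<otimes> x) \<in> R" by (auto simp: tower_def m_assoc)
      have "t \<otimes> x \<in> tower n" using x by (simp add: tower_def)
      then have "t \<otimes> x \<in> S.M" unfolding S.M_def using nV1_I[OF x(1)] by blast
      then obtain e where e: "e \<in> S.E" "t \<otimes> x = t \<otimes> e" using S.M_eq_tE by blast
      have "x = e" by (rule cancel[OF _ _ _ _ e(2)]) (use t_nz x e in simp_all)
      then show "x \<in> S.E" using e by simp
    qed
    show "S.E \<subseteq> tower (Suc n)"
    proof
      fix x assume x: "x \<in> S.E"
      then have "x \<otimes> t \<in> tower n" using S.E_M S.M_closed(1,7) by blast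
      then have "t [^] n \<otimes> (x \<otimes> t) \<in> R" by (simp add: tower_def)
      then show "x \<in> tower (Suc n)" using S.E_V[OF x] by (simp add: tower_def m_ac)
    qed
  qed
  then show ?case using S.E_mid S.E_local S.E_root S.RS S.S_E by auto
qed

text \<open>A denominator of \<open>x\<close> in \<open>A\<close> divides a power of
  \<open>t\<close>, by \<open>R_power\<close>.\<close>

lemma tower_cover: "x \<in> V \<Longrightarrow> \<exists>n. x \<in> tower n"
proof -
  assume x: "x \<in> V"
  obtain a b where b: "a \<in> A" "b \<in> A" "b \<noteq> \<zero>" "b \<otimes> x = a" using V_frac[OF x] by blast
  obtain N r where r: "r \<in> R" "t [^] (N::nat) = b \<otimes> r"
    using R_power[of b t] b RE(1,6) nV_t by (metis One_nat_def)
  have K: "b \<in> carrier K" "r \<in> carrier K" "x \<in> carrier K" using b r x RE by auto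
  have "b \<otimes> r \<otimes> x = r \<otimes> (b \<otimes> x)" by (use K in algebra)
  then have "t [^] N \<otimes> x = r \<otimes> a" unfolding r(2) b(4) .
  then have "x \<in> tower N" using x RE(8)[OF r(1) RE(1)[OF b(1)]] by (simp add: tower_def)
  then show ?thesis by blast
qed

lemma V_root: "b \<in> nV 1 \<Longrightarrow> \<exists>k\<ge>(1::nat). b [^] k \<in> R"
  using tower_cover[OF nV_V] tower_good by blast

text \<open>The ring \<open>tower h\<close> contains \<open>u\<close> and is local. The lemma makes
  it possible to divide by units of \<open>V\<close> at the cost of a known power of
  \<open>t\<close>, without leaving \<open>R\<close>.\<close>

lemma inverse_denominator:
  assumes u: "u \<in> V" "u \<notin> nV 1" "t [^] (h::nat) \<otimes> u \<in> R"
  shows "t [^] h \<otimes> inv u \<in> R"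
proof -
  have "u \<in> tower h" using u by (simp add: tower_def)
  then have "inv u \<in> tower h" using tower_good[of h] u by (auto simp: vlocal_def)
  then show ?thesis by (simp add: tower_def)
qed

text \<open>For U = R + Rx + Ry, the ring E = (U : U) lies between \<open>R\<close> and
  \<open>V\<close> and is local, because every element of \<open>nV 1\<close> has a power in
  \<open>R\<close>. Stability therefore yields u with U = uE. As \<one> is in \<open>U\<close>, u is
  a unit of E; so U = E is a ring and contains xy.\<close>

theorem R_quadratic: "quadratic R"
  unfolding quadratic_def
proof (intro ballI)
  fix x y assume x: "x \<in> V" and y: "y \<in> V"
  have xK: "x \<in> carrier K" "y \<in> carrier K" using x y by auto
  define U where "U = {r \<oplus> s \<otimes> x \<oplus> s' \<otimes> y |r s s'. r \<in> R \<and> s \<in> R \<and> s' \<in> R}"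
  have UI: "r \<oplus> s \<otimes> x \<oplus> s' \<otimes> y \<in> U" if "r \<in> R" "s \<in> R" "s' \<in> R" for r s s' using that unfolding U_def by blast
  have UV: "z \<in> V" if "z \<in> U" for z using that x y RE(2) unfolding U_def by auto
  have UK: "z \<in> carrier K" if "z \<in> U" for z using UV[OF that] by simp
  have RU: "r \<in> U" if "r \<in> R" for r using UI[OF that RE(4,4)] xK RE(3)[OF that] by simp
  have xU: "x \<in> U" "y \<in> U" using UI[OF RE(4,5,4)] UI[OF RE(4,4,5)] xK by simp_all
  have Uadd: "z \<oplus> w \<in> U" if z: "z \<in> U" and w: "w \<in> U" for z w
  proof -
    obtain r s s' where 1: "r \<in> R" "s \<in> R" "s' \<in> R" "z = r \<oplus> s \<otimes> x \<oplus> s' \<otimes> y" using z unfolding U_def by blast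
    obtain p q q' where 2: "p \<in> R" "q \<in> R" "q' \<in> R" "w = p \<oplus> q \<otimes> x \<oplus> q' \<otimes> y" using w unfolding U_def by blast
    have K: "r \<in> carrier K" "s \<in> carrier K" "s' \<in> carrier K" "p \<in> carrier K" "q \<in> carrier K" "q' \<in> carrier K"
      using 1 2 RE(3) by auto
    have "r \<oplus> s \<otimes> x \<oplus> s' \<otimes> y \<oplus> (p \<oplus> q \<otimes> x \<oplus> q' \<otimes> y) = (r \<oplus> p) \<oplus> (s \<oplus> q) \<otimes> x \<oplus> (s' \<oplus> q') \<otimes> y"
      by (use K xK in algebra)
    then show ?thesis using UI[of "r \<oplus> p" "s \<oplus> q" "s' \<oplus> q'"] 1 2 RE(7) by simp
  qed
  have Usm: "a \<otimes> z \<in> U" if a: "a \<in> R" and z: "z \<in> U" for a z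
  proof -
    obtain r s s' where 1: "r \<in> R" "s \<in> R" "s' \<in> R" "z = r \<oplus> s \<otimes> x \<oplus> s' \<otimes> y" using z unfolding U_def by blast
    have K: "r \<in> carrier K" "s \<in> carrier K" "s' \<in> carrier K" "a \<in> carrier K" using 1 a RE(3) by auto
    have "a \<otimes> (r \<oplus> s \<otimes> x \<oplus> s' \<otimes> y) = a \<otimes> r \<oplus> a \<otimes> s \<otimes> x \<oplus> a \<otimes> s' \<otimes> y"
      by (use K xK in algebra)
    then show ?thesis using UI[of "a \<otimes> r" "a \<otimes> s" "a \<otimes> s'"] 1 a RE(8) by simp
  qed
  obtain i j where ij: "x \<in> tower i" "y \<in> tower j" using tower_cover x y by blast
  have dU: "t [^] (i + j) \<otimes> z \<in> R" if z: "z \<in> U" for z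
  proof -
    obtain r s s' where 1: "r \<in> R" "s \<in> R" "s' \<in> R" "z = r \<oplus> s \<otimes> x \<oplus> s' \<otimes> y" using z unfolding U_def by blast
    define p q where "p = t [^] i" and "q = t [^] j"
    have pq: "p \<in> R" "q \<in> R" "p \<otimes> x \<in> R" "q \<otimes> y \<in> R" "t [^] (i + j) = p \<otimes> q"
      using ij RE(6,11) by (auto simp: p_def q_def tower_def nat_pow_mult)
    have K: "r \<in> carrier K" "s \<in> carrier K" "s' \<in> carrier K" "p \<in> carrier K" "q \<in> carrier K" using 1 pq RE(3) by auto
    have "p \<otimes> q \<otimes> (r \<oplus> s \<otimes> x \<oplus> s' \<otimes> y) = p \<otimes> q \<otimes> r \<oplus> q \<otimes> s \<otimes> (p \<otimes> x) \<oplus> p \<otimes> s' \<otimes> (q \<otimes> y)"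
      by (use K xK in algebra)
    then show ?thesis unfolding pq(5) 1(4) using pq 1 RE(7,8) by simp
  qed
  have "\<exists>u\<in>U. \<exists>y\<in>carrier K. (\<forall>z\<in>U. \<forall>w\<in>U. y \<otimes> (z \<otimes> w) \<in> U) \<and> u \<otimes> y \<notin> nV 1"
  proof (rule fractional_stable[of U "t [^] (i + j)" \<one>])
    show "t [^] (i + j) \<in> R" using RE(6,11) by blast
  qed (use UK Uadd Usm dU RU RE(5) in auto)
  then obtain u v where u: "u \<in> U" "v \<in> carrier K" "\<And>z w. z \<in> U \<Longrightarrow> w \<in> U \<Longrightarrow> v \<otimes> (z \<otimes> w) \<in> U" "u \<otimes> v \<notin> nV 1"
    by blast
  define E where "E = {e \<in> carrier K. \<forall>z\<in>U. e \<otimes> z \<in> U}"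
  have EI: "e \<in> E" if "e \<in> carrier K" "\<And>z. z \<in> U \<Longrightarrow> e \<otimes> z \<in> U" for e using that unfolding E_def by blast
  have EU: "e \<otimes> z \<in> U" "e \<in> carrier K" if "e \<in> E" "z \<in> U" for e z using that unfolding E_def by blast+
  have EsubU: "e \<in> U" if "e \<in> E" for e using EU[OF that RU[OF RE(5)]] by simp
  have RsubE: "R \<subseteq> E" using EI Usm RE(3) by blast
  have EK: "e \<in> carrier K" if "e \<in> E" for e using EU(2)[OF that RU[OF RE(5)]] .
  have Emult: "e \<otimes> f \<in> E" if ef: "e \<in> E" "f \<in> E" for e f
  proof (rule EI)
    show "e \<otimes> f \<in> carrier K" using EK ef by simp
    fix z assume z: "z \<in> U"
    have "e \<otimes> (f \<otimes> z) \<in> U" using EU ef z by blast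
    then show "e \<otimes> f \<otimes> z \<in> U" using EK ef UK[OF z] by (simp add: m_assoc)
  qed
  have Eadd: "e \<oplus> f \<in> E" if ef: "e \<in> E" "f \<in> E" for e f
  proof (rule EI)
    show "e \<oplus> f \<in> carrier K" using EK ef by simp
    fix z assume z: "z \<in> U"
    have "e \<otimes> z \<oplus> f \<otimes> z \<in> U" using EU ef z Uadd by blast
    then show "(e \<oplus> f) \<otimes> z \<in> U" using EK ef UK[OF z] by (simp add: l_distr)
  qed
  have mE: "\<ominus> \<one> \<in> E" "\<one> \<in> E" using RsubE RE(5,9) by blast+
  have Ering: "subring E K"
  proof (rule subringI)
    show "E \<subseteq> carrier K" using EK by blast
    show "\<ominus> e \<in> E" if "e \<in> E" for e using Emult[OF mE(1) that] EK[OF that] by (simp add: l_minus)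
  qed (use mE Emult Eadd in auto)
  have Emid: "mid E" unfolding mid_def using Ering RsubE RE(1) EsubU UV by blast
  have Eunit: "inv e \<in> E" if "e \<in> E" "e \<notin> nV 1" for e
    by (rule inverse_of_root[OF R R_local Emid RsubE that V_root])
  have uK: "u \<in> carrier K" using UK u by blast
  have vE: "z \<otimes> v \<in> E" if z: "z \<in> U" for z
  proof (rule EI)
    show "z \<otimes> v \<in> carrier K" using UK[OF z] u by simp
    fix w assume w: "w \<in> U"
    have "z \<otimes> v \<otimes> w = v \<otimes> (z \<otimes> w)" using UK[OF z] UK[OF w] u(2) by (simp add: m_ac)
    then show "z \<otimes> v \<otimes> w \<in> U" using u(3)[OF z w] by simp
  qed
  define i' where "i' = inv (u \<otimes> v)"
  have uvV: "u \<otimes> v \<in> V" using UV EsubU vE u(1) by blast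
  have i': "i' \<in> E" "(u \<otimes> v) \<otimes> i' = \<one>" "i' \<in> carrier K"
    using Eunit[OF vE[OF u(1)] u(4)] V_unit[OF uvV u(4)] by (auto simp: i'_def)
  have rep: "\<exists>e\<in>E. z = u \<otimes> e" if z: "z \<in> U" for z
  proof -
    have zK: "z \<in> carrier K" by (rule UK[OF z])
    note vK = u(2)
    note iK = i'(3)
    have "u \<otimes> (z \<otimes> v \<otimes> i') = ((u \<otimes> v) \<otimes> i') \<otimes> z" by (use zK uK vK iK in algebra)
    then have "z = u \<otimes> (z \<otimes> v \<otimes> i')" using i'(2) zK by simp
    moreover have "z \<otimes> v \<otimes> i' \<in> E" using vE[OF z] i'(1) Emult by blast
    ultimately show ?thesis by blast
  qed
  obtain f where f: "f \<in> E" "\<one> = u \<otimes> f" using rep[OF RU[OF RE(5)]] by blast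
  have "f \<notin> nV 1"
  proof
    assume "f \<in> nV 1"
    then have "u \<otimes> f \<in> nV 1" using nV_mult UV u(1) by blast
    then show False using f(2)[symmetric] by simp
  qed
  then have "inv f \<in> E" by (rule Eunit[OF f(1)])
  moreover have "inv f = u" using comm_inv_char[of f u] f(2)[symmetric] EK[OF f(1)] uK m_comm[of u f] by simp
  ultimately have uE: "u \<in> E" by simp
  have "z \<in> E" if z: "z \<in> U" for z
  proof -
    obtain e where "e \<in> E" "z = u \<otimes> e" using rep[OF z] by blast
    then show ?thesis using Emult[OF uE] by simp
  qed
  then have "x \<otimes> y \<in> U" using EsubU Emult xU by blast
  then show "\<exists>r\<in>R. \<exists>s\<in>R. \<exists>s'\<in>R. x \<otimes> y = r \<oplus> s \<otimes> x \<oplus> s' \<otimes> y" unfolding U_def by blast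
qed

end

section \<open>The Noetherian property from dimension one and tightness\<close>

context tight_pair
begin

text \<open>If no power of \<open>b\<close> lies in cR, an ideal containing cR and maximal among
  those that avoid all powers of \<open>b\<close> is prime. It lies strictly between 0 and the
  maximal ideal, which dimension one excludes.\<close>

lemma krull_power:
  assumes R: "mid R" and loc: "vlocal R" and krull: "krull_dim (sub K R) = 1"
    and c: "c \<in> R" "c \<noteq> \<zero>" and b: "b \<in> R" "b \<in> nV 1"
  shows "\<exists>N::nat. \<exists>r\<in>R. b [^] N = c \<otimes> r"
proof (rule ccontr)
  assume none: "\<not> ?thesis"
  note RE = mid_closed[OF R]
  let ?T = "sub K R"
  have rR: "ring ?T" by (rule subring_is_ring[OF mid_subring[OF R]])
  have dom: "domain ?T" by (rule subring_is_domain[OF mid_subring[OF R]])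
  have cr: "cring ?T" by (rule subring_cring[OF mid_subring[OF R]])
  have cK: "c \<in> carrier K" using c RE by blast
  define D where "D = range (\<lambda>N::nat. b [^] N)"
  define I where "I = (\<lambda>r. c \<otimes> r) ` R"
  have I: "ideal I ?T"
    unfolding ideal_sub_iff[OF mid_subring[OF R]]
  proof (intro conjI ballI)
    show "I \<subseteq> R" using c RE(8) by (auto simp: I_def)
    show "\<zero> \<in> I" unfolding I_def using RE(4) cK by (intro image_eqI[of _ _ \<zero>]) auto
  next
    fix x y assume "x \<in> I" "y \<in> I"
    then obtain p q where "p \<in> R" "q \<in> R" "x = c \<otimes> p" "y = c \<otimes> q" unfolding I_def by blast
    then have "x \<oplus> y = c \<otimes> (p \<oplus> q)" "p \<oplus> q \<in> R" using RE(3,7) cK by (simp_all add: r_distr)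
    then show "x \<oplus> y \<in> I" unfolding I_def by blast
  next
    fix r x assume r: "r \<in> R" and "x \<in> I"
    then obtain p where p: "p \<in> R" "x = c \<otimes> p" unfolding I_def by blast
    have "r \<otimes> x = c \<otimes> (r \<otimes> p)" using p r RE(3) cK by (simp add: m_lcomm)
    then show "r \<otimes> x \<in> I" unfolding I_def using RE(8)[OF r p(1)] by blast
  qed
  have ID: "I \<inter> D = {}"
  proof (rule equals0I)
    fix x assume "x \<in> I \<inter> D"
    then obtain N r where "x = b [^] (N::nat)" "r \<in> R" "x = c \<otimes> r" unfolding I_def D_def by fast
    then have "b [^] N = c \<otimes> r" "r \<in> R" by simp_all
    then show False using none by blast
  qed
  obtain P where P: "ideal P ?T" "I \<subseteq> P" "P \<inter> D = {}"
    "\<And>Q. ideal Q ?T \<Longrightarrow> P \<subseteq> Q \<Longrightarrow> Q \<inter> D = {} \<Longrightarrow> Q = P"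
    by (rule ring.ex_maximal_ideal_avoiding[OF rR I ID]) (rule that)
  note PE = mid_idealD[OF R P(1)]
  have D1: "\<one> \<in> D" unfolding D_def by (intro image_eqI[of _ _ 0]) simp_all
  have bD: "b \<in> D" unfolding D_def using b RE(3) by (intro image_eqI[of _ _ 1]) simp_all
  have ext: "\<exists>N::nat. \<exists>p\<in>P. \<exists>r\<in>R. b [^] N = p \<oplus> r \<otimes> x" if x: "x \<in> R" "x \<notin> P" for x
  proof -
    define Q where "Q = {p \<oplus> r \<otimes> x |p r. p \<in> P \<and> r \<in> R}"
    have xK: "x \<in> carrier K" using x RE by blast
    have QI: "p \<oplus> r \<otimes> x \<in> Q" if "p \<in> P" "r \<in> R" for p r using that unfolding Q_def by blast
    have Q: "ideal Q ?T"
      unfolding ideal_sub_iff[OF mid_subring[OF R]]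
    proof (intro conjI ballI)
      show "Q \<subseteq> R" using PE(1) x RE(7,8) unfolding Q_def by blast
      show "\<zero> \<in> Q" using QI[OF PE(3) RE(4)] xK by simp
    next
      fix u v assume "u \<in> Q" "v \<in> Q"
      then obtain p r q s where u: "p \<in> P" "r \<in> R" "u = p \<oplus> r \<otimes> x" "q \<in> P" "s \<in> R" "v = q \<oplus> s \<otimes> x"
        unfolding Q_def by blast
      have K: "p \<in> carrier K" "r \<in> carrier K" "q \<in> carrier K" "s \<in> carrier K" using u PE(2) RE(3) by auto
      have "p \<oplus> r \<otimes> x \<oplus> (q \<oplus> s \<otimes> x) = (p \<oplus> q) \<oplus> (r \<oplus> s) \<otimes> x"
        by (use K xK in algebra)
      then show "u \<oplus> v \<in> Q" using QI[OF PE(4)[OF u(1,4)] RE(7)[OF u(2,5)]] u(3,6) by simp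
    next
      fix a u assume a: "a \<in> R" and "u \<in> Q"
      then obtain p r where u: "p \<in> P" "r \<in> R" "u = p \<oplus> r \<otimes> x" unfolding Q_def by blast
      have K: "p \<in> carrier K" "r \<in> carrier K" "a \<in> carrier K" using u a PE(2) RE(3) by auto
      have "a \<otimes> (p \<oplus> r \<otimes> x) = a \<otimes> p \<oplus> a \<otimes> r \<otimes> x"
        by (use K xK in algebra)
      then show "a \<otimes> u \<in> Q" using QI[OF PE(5)[OF a u(1)] RE(8)[OF a u(2)]] u(3) by simp
    qed
    have PQ: "P \<subseteq> Q"
    proof
      fix p assume p: "p \<in> P"
      show "p \<in> Q" using QI[OF p RE(4)] xK PE(2)[OF p] by simp
    qed
    have "x \<in> Q" using QI[OF PE(3) RE(5)] xK by simp
    then have "Q \<inter> D \<noteq> {}" using P(4)[OF Q PQ] x(2) by blast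
    then obtain N where "b [^] (N::nat) \<in> Q" unfolding D_def by fast
    then show ?thesis unfolding Q_def by blast
  qed
  have prime: "primeideal P ?T"
  proof (rule primeidealI[OF P(1) cr])
    show "carrier ?T \<noteq> P" using P(3) D1 RE(5) by auto
    fix x y assume xy: "x \<in> carrier ?T" "y \<in> carrier ?T" "x \<otimes>\<^bsub>?T\<^esub> y \<in> P"
    then have xy': "x \<in> R" "y \<in> R" "x \<otimes> y \<in> P" by simp_all
    show "x \<in> P \<or> y \<in> P"
    proof (rule ccontr)
      assume "\<not> (x \<in> P \<or> y \<in> P)"
      then have n: "x \<notin> P" "y \<notin> P" by blast+
      obtain i p r where 1: "p \<in> P" "r \<in> R" "b [^] (i::nat) = p \<oplus> r \<otimes> x"
        using ext[OF xy'(1) n(1)] by blast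
      obtain j q s where 2: "q \<in> P" "s \<in> R" "b [^] (j::nat) = q \<oplus> s \<otimes> y"
        using ext[OF xy'(2) n(2)] by blast
      have K: "p \<in> carrier K" "r \<in> carrier K" "q \<in> carrier K" "s \<in> carrier K" "x \<in> carrier K" "y \<in> carrier K"
        using 1 2 PE(2) RE(3) xy' by auto
      have "b [^] (i + j) = (p \<oplus> r \<otimes> x) \<otimes> (q \<oplus> s \<otimes> y)"
        using 1(3) 2(3) b RE(3) nat_pow_mult[of b i j] by simp
      also have "\<dots> = (q \<oplus> s \<otimes> y) \<otimes> p \<oplus> (r \<otimes> x \<otimes> q \<oplus> r \<otimes> s \<otimes> (x \<otimes> y))"
        by (use K in algebra)
      also have "\<dots> \<in> P"
        by (intro PE(4,5) 1 2 RE(7,8) PE(1) xy')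
      finally have "b [^] (i + j) \<in> P" .
      then show False using P(3) unfolding D_def by blast
    qed
  qed
  have z: "primeideal {\<zero>} ?T" using domain.zeroprimeideal[OF dom] by simp
  have m: "primeideal (R \<inter> nV 1) ?T"
    using cring.maximalideal_prime[OF cr max_ideal_maximal[OF vlocal_quasilocal(1)[OF R loc]]]
      vlocal_quasilocal(2)[OF R loc] by simp
  have "c \<otimes> \<one> \<in> I" unfolding I_def using RE(5) by blast
  then have cP: "c \<in> P" using P(2) cK by auto
  have "{\<zero>} \<subset> P" using cP c(2) PE(3) by blast
  moreover have "P \<subset> R \<inter> nV 1"
  proof -
    have "P \<subseteq> R \<inter> nV 1"
    proof
      fix x assume x: "x \<in> P"
      have xR: "x \<in> R" by (rule PE(1)[OF x])
      have "x \<in> nV 1"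
      proof (rule ccontr)
        assume n: "x \<notin> nV 1"
        then have "inv x \<in> R" using loc xR by (auto simp: vlocal_def)
        then have "x \<otimes> inv x \<in> P" by (rule PE(6)[OF _ x])
        then have "\<one> \<in> P" using V_unit(4)[OF RE(2)[OF xR] n] by simp
        then show False using P(3) D1 by blast
      qed
      then show "x \<in> R \<inter> nV 1" using xR by blast
    qed
    moreover have "b \<notin> P" using P(3) bD by blast
    ultimately show ?thesis using b by blast
  qed
  ultimately show False using krull_dim_eq_1D[OF krull z prime m] by blast
qed

text \<open>A Nakayama argument without finite generation over \<open>A\<close>: the generators of
  the ideal are removed one at a time. For a generator g the decomposition is substituted into the
  cofactor of g until the power of g is divisible by \<open>c\<close>.\<close>

lemma divisible_of_tight:
  assumes R: "mid R" and c: "c \<in> R"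
    and pw: "\<And>g. g \<in> maxA \<Longrightarrow> \<exists>N::nat. \<exists>r\<in>R. g [^] N = c \<otimes> r"
    and G: "finite G" "G \<subseteq> maxA"
    and sum: "\<And>x. x \<in> R \<Longrightarrow> \<exists>a\<in>A. \<exists>r\<in>R. \<exists>h\<in>Idl\<^bsub>sub K R\<^esub> G. x = a \<oplus> c \<otimes> r \<oplus> h"
    and x: "x \<in> R"
  shows "\<exists>a\<in>A. \<exists>r\<in>R. x = a \<oplus> c \<otimes> r"
  using G sum x
proof (induct G arbitrary: x)
  case empty
  note RE = mid_closed[OF R]
  have rR: "ring (sub K R)" by (rule subring_is_ring[OF mid_subring[OF R]])
  have "ideal {\<zero>} (sub K R)"
    unfolding ideal_sub_iff[OF mid_subring[OF R]] using RE(3,4) by auto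
  then have "Idl\<^bsub>sub K R\<^esub> {} \<subseteq> {\<zero>}" using ring.genideal_minimal[OF rR] by blast
  then obtain a r where "a \<in> A" "r \<in> R" "x = a \<oplus> c \<otimes> r \<oplus> \<zero>" using empty(2)[OF empty(3)] by blast
  then show ?case using c RE(3) by auto
next
  case (insert g G)
  note RE = mid_closed[OF R]
  have rR: "ring (sub K R)" by (rule subring_is_ring[OF mid_subring[OF R]])
  have GR: "G \<subseteq> R" using insert(4) RE(1) by (auto simp: maxA_def)
  define H where "H = Idl\<^bsub>sub K R\<^esub> G"
  have H: "ideal H (sub K R)" unfolding H_def using ring.genideal_ideal[OF rR] GR by simp
  note HE = mid_idealD[OF R H]
  have GH: "G \<subseteq> H" unfolding H_def using ring.genideal_self[OF rR] GR by simp
  have g: "g \<in> A" "g \<in> R" "g \<in> carrier K" using insert(4) RE(1) by (auto simp: maxA_def)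
  have cK: "c \<in> carrier K" using c RE by blast
  define Q where "Q = {g \<otimes> r \<oplus> h |r h. r \<in> R \<and> h \<in> H}"
  have QI: "g \<otimes> r \<oplus> h \<in> Q" if "r \<in> R" "h \<in> H" for r h using that unfolding Q_def by blast
  have "ideal Q (sub K R)"
    unfolding ideal_sub_iff[OF mid_subring[OF R]]
  proof (intro conjI ballI)
    show "Q \<subseteq> R" using HE(1) g RE(7,8) unfolding Q_def by blast
    show "\<zero> \<in> Q" using QI[OF RE(4) HE(3)] g by simp
  next
    fix u v assume "u \<in> Q" "v \<in> Q"
    then obtain p r q s where u: "p \<in> H" "r \<in> R" "u = g \<otimes> r \<oplus> p" "q \<in> H" "s \<in> R" "v = g \<otimes> s \<oplus> q"
      unfolding Q_def by blast
    have K: "p \<in> carrier K" "r \<in> carrier K" "q \<in> carrier K" "s \<in> carrier K" "g \<in> carrier K"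
      using u HE(2) RE(3) g by auto
    have "g \<otimes> r \<oplus> p \<oplus> (g \<otimes> s \<oplus> q) = g \<otimes> (r \<oplus> s) \<oplus> (p \<oplus> q)"
      by (use K in algebra)
    then show "u \<oplus> v \<in> Q" using QI[OF RE(7)[OF u(2,5)] HE(4)[OF u(1,4)]] u(3,6) by simp
  next
    fix a u assume a: "a \<in> R" and "u \<in> Q"
    then obtain p r where u: "p \<in> H" "r \<in> R" "u = g \<otimes> r \<oplus> p" unfolding Q_def by blast
    have K: "p \<in> carrier K" "r \<in> carrier K" "a \<in> carrier K" "g \<in> carrier K" using u a HE(2) RE(3) g by auto
    have "a \<otimes> (g \<otimes> r \<oplus> p) = g \<otimes> (a \<otimes> r) \<oplus> a \<otimes> p"
      by (use K in algebra)
    then show "a \<otimes> u \<in> Q" using QI[OF RE(8)[OF a u(2)] HE(5)[OF a u(1)]] u(3) by simp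
  qed
  moreover have "insert g G \<subseteq> Q"
  proof -
    have "g \<in> Q" using QI[OF RE(5) HE(3)] g by simp
    moreover have "h \<in> Q" if "h \<in> G" for h using QI[OF RE(4), of h] that GH HE(2)[of h] g by auto
    ultimately show ?thesis by blast
  qed
  ultimately have IQ: "Idl\<^bsub>sub K R\<^esub> (insert g G) \<subseteq> Q" by (rule ring.genideal_minimal[OF rR])
  have step: "\<exists>a\<in>A. \<exists>r\<in>R. \<exists>s\<in>R. \<exists>h\<in>H. x = a \<oplus> c \<otimes> r \<oplus> (g \<otimes> s \<oplus> h)" if "x \<in> R" for x
    using insert(5)[OF that] IQ unfolding Q_def by blast
  \<comment> \<open>Decomposing the cofactor s of g^k again raises the exponent by one; the other
    terms remain in \<open>A\<close>, cR and \<open>H\<close> because g lies in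
    \<open>A\<close>.\<close>
  have iter: "\<exists>a\<in>A. \<exists>r\<in>R. \<exists>s\<in>R. \<exists>h\<in>H. x = a \<oplus> c \<otimes> r \<oplus> (g [^] k \<otimes> s \<oplus> h)" if x: "x \<in> R" for x and k :: nat
  proof (induct k)
    case 0
    have "x = \<zero> \<oplus> c \<otimes> \<zero> \<oplus> (g [^] (0::nat) \<otimes> x \<oplus> \<zero>)" using x RE(3) cK by simp
    then show ?case using x RE(4) HE(3) A_closed(1) by blast
  next
    case (Suc k)
    obtain a r s h where 1: "a \<in> A" "r \<in> R" "s \<in> R" "h \<in> H" "x = a \<oplus> c \<otimes> r \<oplus> (g [^] k \<otimes> s \<oplus> h)"
      using Suc by blast
    obtain a' r' s' h' where 2: "a' \<in> A" "r' \<in> R" "s' \<in> R" "h' \<in> H" "s = a' \<oplus> c \<otimes> r' \<oplus> (g \<otimes> s' \<oplus> h')"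
      using step[OF 1(3)] by blast
    define w where "w = g [^] k"
    have w: "w \<in> A" "w \<in> R" using g RE(11) by (auto simp: w_def)
    have K: "a \<in> carrier K" "r \<in> carrier K" "h \<in> carrier K" "a' \<in> carrier K" "r' \<in> carrier K"
      "s' \<in> carrier K" "h' \<in> carrier K" "w \<in> carrier K" "g \<in> carrier K"
      using 1 2 w g HE(2) RE(3) by auto
    have "x = (a \<oplus> w \<otimes> a') \<oplus> c \<otimes> (r \<oplus> w \<otimes> r') \<oplus> (w \<otimes> g \<otimes> s' \<oplus> (h \<oplus> w \<otimes> h'))"
      unfolding 1(5) 2(5) w_def[symmetric] by (use K cK in algebra)
    moreover have "a \<oplus> w \<otimes> a' \<in> A" "r \<oplus> w \<otimes> r' \<in> R" "h \<oplus> w \<otimes> h' \<in> H"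
      using 1 2 w RE(7,8) HE(4,5) by simp_all
    moreover have "g [^] Suc k = w \<otimes> g" by (simp add: w_def)
    ultimately show ?case using 2(3) by metis
  qed
  obtain N r' where N: "r' \<in> R" "g [^] (N::nat) = c \<otimes> r'" using pw insert(4) by blast
  have "\<exists>a\<in>A. \<exists>r\<in>R. \<exists>h\<in>H. x = a \<oplus> c \<otimes> r \<oplus> h" if xR: "x \<in> R" for x
  proof -
    obtain a r s h where 1: "a \<in> A" "r \<in> R" "s \<in> R" "h \<in> H" "x = a \<oplus> c \<otimes> r \<oplus> (g [^] N \<otimes> s \<oplus> h)"
      using iter[OF xR] by blast
    have K: "a \<in> carrier K" "r \<in> carrier K" "s \<in> carrier K" "h \<in> carrier K" "r' \<in> carrier K"
      using 1 N HE(2) RE(3) by auto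
    have "x = a \<oplus> c \<otimes> (r \<oplus> r' \<otimes> s) \<oplus> h"
      unfolding 1(5) N(2) by (use K cK in algebra)
    moreover have "r \<oplus> r' \<otimes> s \<in> R" using 1 N RE(7,8) by simp
    ultimately show ?thesis using 1 by blast
  qed
  then show ?case using insert(3)[of x] insert(4,6) unfolding H_def by blast
qed

text \<open>The second conclusion comes first in the proof: R = A + cR follows from tightness and
  dimension one, and only this equality shows that \<open>R\<close> is Noetherian.\<close>

lemma bad_tight_stable_mid:
  assumes AR: "A \<subseteq> R" and RV: "R \<subseteq> V" and bad: "bad_stable_domain K R" and tight: "tightly_dominates K R A"
  shows "stable_mid K A V t R"
    and "\<And>c x. c \<in> R \<Longrightarrow> c \<noteq> \<zero> \<Longrightarrow> x \<in> R \<Longrightarrow> \<exists>a\<in>A. \<exists>r\<in>R. x = a \<oplus> c \<otimes> r"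
proof -
  have sd: "subdomain R K" using bad by (simp add: bad_stable_domain_def)
  have R: "mid R" unfolding mid_def
    using subcring.axioms(1)[OF subdomain.axioms(1)[OF sd]] AR RV by blast
  note RE = mid_closed[OF R]
  let ?T = "sub K R"
  have rR: "ring ?T" by (rule subring_is_ring[OF mid_subring[OF R]])
  define J where "J = Idl\<^bsub>?T\<^esub> maxA"
  have mR: "maxA \<subseteq> carrier ?T" using RE by (auto simp: maxA_def)
  have J: "ideal J ?T" unfolding J_def by (rule ring.genideal_ideal[OF rR mR])
  note JE = mid_idealD[OF R J]
  have ql: "quasilocal ?T" using bad by (simp add: bad_stable_domain_def)
  have ext: "extended_max_ideal K A R = J" by (simp add: extended_max_ideal_def max_ideal_A J_def)
  have bir: "maxA \<subseteq> max_ideal ?T"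
    using tight max_ideal_A(2)
    by (simp add: tightly_dominates_def finitely_dominates_def birationally_dominates_def)
  have RJ: "R = A <+>\<^bsub>K\<^esub> J" using tight unfolding tightly_dominates_def ext by blast
  have mx: "maximalideal (max_ideal ?T) ?T" by (rule max_ideal_maximal[OF ql])
  have mxI: "ideal (max_ideal ?T) ?T" by (rule maximalideal.axioms(1)[OF mx])
  note mE = mid_idealD[OF R mxI]
  have J1: "J \<subseteq> max_ideal ?T" unfolding J_def by (rule ring.genideal_minimal[OF rR mxI bir])
  have J2: "J \<subseteq> R \<inter> nV 1" unfolding J_def
    by (rule ring.genideal_minimal[OF rR mid_nV_ideal[OF R]]) (use RE in \<open>auto simp: maxA_def\<close>)
  have split: "\<exists>a\<in>A. \<exists>j\<in>J. x = a \<oplus> j" if "x \<in> R" for x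
    using that RJ unfolding set_add_def' by blast
  \<comment> \<open>The maximal ideal of \<open>R\<close> is compared with \<open>nV 1\<close>
    through x = a + j, with j in the extension of \<open>maxA\<close>: if \<open>x\<close> is a unit
    of \<open>V\<close>, then \<open>a\<close> is a unit of \<open>A\<close>, and since j lies in
    the maximal ideal of \<open>R\<close>, \<open>x\<close> does not.\<close>
  have loc: "vlocal R"
    unfolding vlocal_def
  proof (intro ballI impI)
    fix x assume x: "x \<in> R" "x \<notin> nV 1"
    have "x \<notin> max_ideal ?T"
    proof
      assume xm: "x \<in> max_ideal ?T"
      obtain a j where a: "a \<in> A" "j \<in> J" "x = a \<oplus> j" using split[OF x(1)] by blast
      have K: "a \<in> carrier K" "j \<in> carrier K" using a JE(2) by auto
      have "a \<notin> nV 1" using x(2) a J2 nV_add by blast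
      then have ia: "inv a \<in> A" "a \<otimes> inv a = \<one>" using vlocal_A a(1) V_unit[of a] A_V by (auto simp: vlocal_def)
      have "x \<ominus> j \<in> max_ideal ?T" by (rule mE(8)[OF xm subsetD[OF J1 a(2)]])
      moreover have "a \<oplus> j \<ominus> j = a" by (use K in algebra)
      ultimately have "a \<in> max_ideal ?T" using a by simp
      then have "a \<otimes> inv a \<in> max_ideal ?T" by (rule mE(6)[OF RE(1)[OF ia(1)]])
      then have "max_ideal ?T = carrier ?T" using ideal.one_imp_carrier[OF mxI] ia(2) by simp
      then show False using maximalideal.I_notcarr[OF mx] by simp
    qed
    then show "inv x \<in> R" by (rule quasilocal_unit(2)[OF mid_subring[OF R] ql x(1)])
  qed
  have pw: "\<exists>N::nat. \<exists>r\<in>R. b [^] N = c \<otimes> r" if "c \<in> R" "c \<noteq> \<zero>" "b \<in> R" "b \<in> nV 1" for c b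
    by (rule krull_power[OF R loc _ that]) (use bad in \<open>simp add: bad_stable_domain_def\<close>)
  have maxA_ideal: "ideal maxA (sub K A)" unfolding maxA_def by (rule mid_nV_ideal[OF mid_A])
  obtain G where G: "G \<subseteq> A" "finite G" "maxA = Idl\<^bsub>sub K A\<^esub> G"
    using noetherian_ring.finetely_gen[OF A_noeth maxA_ideal] by auto
  have rA: "ring (sub K A)" by (rule subring_is_ring[OF A])
  have Gm: "G \<subseteq> maxA" using ring.genideal_self[OF rA, of G] G by simp
  have GR: "G \<subseteq> carrier ?T" using Gm mR by blast
  \<comment> \<open>Finitely many generators of \<open>maxA\<close> over \<open>A\<close> also
    generate its extension to \<open>R\<close>.\<close>
  have "ideal (Idl\<^bsub>?T\<^esub> G \<inter> A) (sub K A)"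
    unfolding ideal_sub_iff[OF A] using mid_idealD[OF R ring.genideal_ideal[OF rR GR]] RE(1) by auto
  moreover have "G \<subseteq> Idl\<^bsub>?T\<^esub> G \<inter> A" using ring.genideal_self[OF rR GR] G(1) by blast
  ultimately have "maxA \<subseteq> Idl\<^bsub>?T\<^esub> G" using ring.genideal_minimal[OF rA] unfolding G(3) by blast
  then have JG: "J \<subseteq> Idl\<^bsub>?T\<^esub> G" unfolding J_def
    by (rule ring.genideal_minimal[OF rR ring.genideal_ideal[OF rR GR]])
  show div: "\<exists>a\<in>A. \<exists>r\<in>R. x = a \<oplus> c \<otimes> r" if c: "c \<in> R" "c \<noteq> \<zero>" and x: "x \<in> R" for c x
  proof (rule divisible_of_tight[OF R c(1) _ G(2) Gm _ x])
    fix g assume "g \<in> maxA"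
    then show "\<exists>N::nat. \<exists>r\<in>R. g [^] N = c \<otimes> r" using pw[OF c, of g] RE(1) by (auto simp: maxA_def)
  next
    fix z assume z: "z \<in> R"
    obtain a j where a: "a \<in> A" "j \<in> J" "z = a \<oplus> j" using split[OF z] by blast
    have "z = a \<oplus> c \<otimes> \<zero> \<oplus> j" using a c RE(3) JE(2) by simp
    then show "\<exists>a\<in>A. \<exists>r\<in>R. \<exists>h\<in>Idl\<^bsub>?T\<^esub> G. z = a \<oplus> c \<otimes> r \<oplus> h" using a JG RE(4) by blast
  qed
  have noeth: "noetherian_ring ?T" by (rule noetherian_of_divisible[OF R div])
  show "stable_mid K A V t R"
  proof (intro stable_mid.intro stable_mid_axioms.intro)
    show "tight_pair K A V t" by (rule tight_pair_axioms)
    fix I assume "ideal I ?T" "I \<noteq> {\<zero>}"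
    then show "stable_ideal ?T I" using bad by (simp add: bad_stable_domain_def stable_domain_def)
  next
    show "\<not> finite_normalization K R" using bad by (simp add: bad_stable_domain_def)
  qed (use R loc pw noeth in auto)
qed

end

section \<open>The completion in terms of Cauchy sequences\<close>

context tight_pair
begin

abbreviation Ahat :: "(nat \<Rightarrow> 'a set) ring" where "Ahat \<equiv> completion (sub K A)"

definition mp :: "nat \<Rightarrow> 'a set" where "mp n = ideal_power (sub K A) maxA n"

lemma rA: "ring (sub K A)" by (rule subring_is_ring[OF A])

lemma maxA_ideal: "ideal maxA (sub K A)"
  unfolding maxA_def by (rule mid_nV_ideal[OF mid_A])

lemma mp_0 [simp]: "mp 0 = A"
  by (simp add: mp_def ideal_power_def ideals_set_def)

lemma mp_Suc: "mp (Suc n) = mp n \<cdot>\<^bsub>sub K A\<^esub> maxA"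
  by (simp add: mp_def ideal_power_def ideals_set_def)

lemma mp_ideal: "ideal (mp n) (sub K A)"
proof (induct n)
  case 0
  show ?case unfolding mp_0 ideal_sub_iff[OF A] by simp
next
  case (Suc n)
  show ?case unfolding mp_Suc by (rule ring.ideal_prod_is_ideal[OF rA Suc maxA_ideal])
qed

lemmas mpE = mid_idealD[OF mid_A mp_ideal]

lemma mp_mult: "x \<in> mp n \<Longrightarrow> y \<in> maxA \<Longrightarrow> x \<otimes> y \<in> mp (Suc n)"
  unfolding mp_Suc using ideal_prod.prod[of x "mp n" y maxA "sub K A"] by simp

lemma mp_Suc_subset: "mp (Suc n) \<subseteq> mp n"
  unfolding mp_Suc using ring.ideal_prod_inter[OF rA mp_ideal maxA_ideal] by blast

lemma mp_mono: "i \<le> j \<Longrightarrow> mp j \<subseteq> mp i"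
  by (induct j rule: dec_induct) (use mp_Suc_subset in blast)+

lemma mp_nV: "x \<in> mp n \<Longrightarrow> x \<in> nV n"
proof (induct n arbitrary: x)
  case 0
  then show ?case using A_V by simp
next
  case (Suc n)
  from Suc(2)[unfolded mp_Suc] show ?case
  proof (induct rule: ideal_prod.induct)
    case (prod i j)
    then have "i \<in> nV n" "j \<in> nV 1" using Suc(1) by (auto simp: maxA_def)
    then show ?case using nV_mult2[of i n j 1] by simp
  next
    case (sum s1 s2)
    then show ?case using nV_add by simp
  qed
qed

lemma maxA_t: "t \<in> maxA" using tA nV_t by (simp add: maxA_def)

lemma mp_tpow: "x \<in> mp j \<Longrightarrow> t [^] i \<otimes> x \<in> mp (i + j)"
proof (induct i)
  case 0
  then show ?case using mpE(2) by simp
next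
  case (Suc i)
  have xK: "x \<in> carrier K" using mpE(2) Suc(2) by blast
  have "(t [^] i \<otimes> x) \<otimes> t \<in> mp (Suc (i + j))" using mp_mult[OF Suc(1)[OF Suc(2)] maxA_t] .
  moreover have "(t [^] i \<otimes> x) \<otimes> t = t [^] Suc i \<otimes> x" using xK by (simp add: m_ac)
  ultimately show ?case by simp
qed

text \<open>Representatives for the coherent families of cosets, one element of \<open>A\<close> for
  each \<open>n\<close>. With them the operations of the completion become termwise operations in
  \<open>K\<close>; \<open>cl\<close> passes back to the cosets.\<close>

definition seqs :: "(nat \<Rightarrow> 'a) set" where
  "seqs = {a. (\<forall>n. a n \<in> A) \<and> (\<forall>n. a (Suc n) \<ominus> a n \<in> mp n)}"

definition cl :: "(nat \<Rightarrow> 'a) \<Rightarrow> nat \<Rightarrow> 'a set" where "cl a = (\<lambda>n. coset (mp n) (a n))"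

lemma seqs_A: "a \<in> seqs \<Longrightarrow> a n \<in> A" unfolding seqs_def by blast
lemma seqs_K: "a \<in> seqs \<Longrightarrow> a n \<in> carrier K" using seqs_A by (rule A_K)
lemma seqs_step: "a \<in> seqs \<Longrightarrow> a (Suc n) \<ominus> a n \<in> mp n" unfolding seqs_def by blast
lemma seqsI: "(\<And>n. a n \<in> A) \<Longrightarrow> (\<And>n. a (Suc n) \<ominus> a n \<in> mp n) \<Longrightarrow> a \<in> seqs"
  unfolding seqs_def by blast
lemma mp_carrier: "mp n \<subseteq> carrier K" using mpE(2) by blast

lemma seqs_diff: "a \<in> seqs \<Longrightarrow> i \<le> j \<Longrightarrow> a j \<ominus> a i \<in> mp i"
proof -
  assume a: "a \<in> seqs" and "i \<le> j"
  from this(2) show ?thesis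
  proof (induct j rule: dec_induct)
    case base
    show ?case using seqs_K[OF a, of i] mpE(3) by (simp add: minus_eq r_neg)
  next
    case (step n)
    have "(a (Suc n) \<ominus> a n) \<oplus> (a n \<ominus> a i) \<in> mp i"
      using mpE(4)[OF subsetD[OF mp_mono[OF step(1)] seqs_step[OF a]] step(3)] .
    moreover have "(a (Suc n) \<ominus> a n) \<oplus> (a n \<ominus> a i) = a (Suc n) \<ominus> a i"
    proof -
      define x y z where "x = a (Suc n)" and "y = a n" and "z = a i"
      have K: "x \<in> carrier K" "y \<in> carrier K" "z \<in> carrier K" using seqs_K[OF a] by (simp_all add: x_def y_def z_def)
      have "(x \<ominus> y) \<oplus> (y \<ominus> z) = x \<ominus> z" by (use K in algebra)
      then show ?thesis by (simp add: x_def y_def z_def)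
    qed
    ultimately show ?case by simp
  qed
qed

lemma seqs_const: "a \<in> A \<Longrightarrow> (\<lambda>_. a) \<in> seqs"
  using mpE(3) by (intro seqsI) (simp_all add: minus_eq r_neg)

lemma seqs_add: "a \<in> seqs \<Longrightarrow> b \<in> seqs \<Longrightarrow> (\<lambda>n. a n \<oplus> b n) \<in> seqs"
proof -
  assume a: "a \<in> seqs" and b: "b \<in> seqs"
  have "a (Suc n) \<oplus> b (Suc n) \<ominus> (a n \<oplus> b n) \<in> mp n" for n
  proof -
    define x y z w where "x = a (Suc n)" and "y = a n" and "z = b (Suc n)" and "w = b n"
    have K: "x \<in> carrier K" "y \<in> carrier K" "z \<in> carrier K" "w \<in> carrier K"
      using seqs_K[OF a] seqs_K[OF b] by (simp_all add: x_def y_def z_def w_def)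
    have "x \<oplus> z \<ominus> (y \<oplus> w) = (x \<ominus> y) \<oplus> (z \<ominus> w)" by (use K in algebra)
    then show ?thesis using mpE(4) seqs_step[OF a] seqs_step[OF b] by (simp add: x_def y_def z_def w_def)
  qed
  then show ?thesis by (intro seqsI) (simp_all add: seqs_A[OF a] seqs_A[OF b])
qed

lemma seqs_mult: "a \<in> seqs \<Longrightarrow> b \<in> seqs \<Longrightarrow> (\<lambda>n. a n \<otimes> b n) \<in> seqs"
proof -
  assume a: "a \<in> seqs" and b: "b \<in> seqs"
  have "a (Suc n) \<otimes> b (Suc n) \<ominus> a n \<otimes> b n \<in> mp n" for n
  proof -
    define x y z w where "x = a (Suc n)" and "y = a n" and "z = b (Suc n)" and "w = b n"
    have K: "x \<in> carrier K" "y \<in> carrier K" "z \<in> carrier K" "w \<in> carrier K"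
      using seqs_K[OF a] seqs_K[OF b] by (simp_all add: x_def y_def z_def w_def)
    have "x \<otimes> z \<ominus> y \<otimes> w = x \<otimes> (z \<ominus> w) \<oplus> w \<otimes> (x \<ominus> y)" by (use K in algebra)
    then show ?thesis using mpE(4,5) seqs_step[OF a] seqs_step[OF b] seqs_A[OF a] seqs_A[OF b]
      by (simp add: x_def y_def z_def w_def)
  qed
  then show ?thesis by (intro seqsI) (simp_all add: seqs_A[OF a] seqs_A[OF b])
qed

lemma seqs_neg: "a \<in> seqs \<Longrightarrow> (\<lambda>n. \<ominus> a n) \<in> seqs"
proof -
  assume a: "a \<in> seqs"
  have "(\<lambda>n. \<ominus> \<one> \<otimes> a n) \<in> seqs" by (rule seqs_mult[OF seqs_const a]) simp
  moreover have "\<ominus> \<one> \<otimes> a n = \<ominus> a n" for n using seqs_K[OF a, of n] by (simp add: l_minus)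
  ultimately show ?thesis by simp
qed

lemma seqs_minus: "a \<in> seqs \<Longrightarrow> b \<in> seqs \<Longrightarrow> (\<lambda>n. a n \<ominus> b n) \<in> seqs"
  unfolding minus_eq by (rule seqs_add[OF _ seqs_neg])

lemma cl_eq_iff: "a \<in> seqs \<Longrightarrow> b \<in> seqs \<Longrightarrow> cl a = cl b \<longleftrightarrow> (\<forall>n. a n \<ominus> b n \<in> mp n)"
  unfolding cl_def fun_eq_iff using coset_eq_iff[OF mid_A mp_ideal seqs_K seqs_K] by blast

lemma coset_self: "x \<in> A \<Longrightarrow> x \<in> coset (mp n) x"
  using mem_coset_iff[OF mp_carrier, of x x n] mpE(3) by (simp add: minus_eq r_neg)

lemma Quot_carrier: "carrier (residue_ring_power (sub K A) n) = {coset (mp n) a |a. a \<in> A}"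
  by (auto simp: residue_ring_power_def FactRing_def A_RCOSETS_def' a_r_coset_sub max_ideal_A mp_def)

text \<open>The inclusion of the coset at \<open>Suc n\<close> in the coset at \<open>n\<close> says
  precisely that chosen representatives differ by an element of \<open>mp n\<close>.\<close>

lemma Ahat_carrier: "carrier Ahat = cl ` seqs"
proof
  show "cl ` seqs \<subseteq> carrier Ahat"
  proof
    fix f assume "f \<in> cl ` seqs"
    then obtain a where a: "a \<in> seqs" "f = cl a" by blast
    have "f (Suc n) \<subseteq> f n" for n
    proof
      fix x assume x: "x \<in> f (Suc n)"
      note sub = mp_carrier
      have xK: "x \<in> carrier K" using x a(2) seqs_K[OF a(1)] sub[of "Suc n"] by (auto simp: cl_def coset_def)
      have "x \<ominus> a (Suc n) \<in> mp (Suc n)"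
        using x mem_coset_iff[OF sub seqs_K[OF a(1)] xK] a(2) by (simp add: cl_def)
      then have "(x \<ominus> a (Suc n)) \<oplus> (a (Suc n) \<ominus> a n) \<in> mp n"
        using mpE(4) mp_Suc_subset seqs_step[OF a(1)] by blast
      moreover have "(x \<ominus> a (Suc n)) \<oplus> (a (Suc n) \<ominus> a n) = x \<ominus> a n"
      proof -
        define y z where "y = a (Suc n)" and "z = a n"
        have K: "y \<in> carrier K" "z \<in> carrier K" using seqs_K[OF a(1)] by (simp_all add: y_def z_def)
        have "(x \<ominus> y) \<oplus> (y \<ominus> z) = x \<ominus> z" by (use K xK in algebra)
        then show ?thesis by (simp add: y_def z_def)
      qed
      ultimately show "x \<in> f n" using mem_coset_iff[OF sub seqs_K[OF a(1)] xK] a(2) by (simp add: cl_def)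
    qed
    moreover have "f n \<in> carrier (residue_ring_power (sub K A) n)" for n
      unfolding Quot_carrier using a(2) seqs_A[OF a(1)] by (auto simp: cl_def)
    ultimately show "f \<in> carrier Ahat" by (simp add: completion_def)
  qed
  show "carrier Ahat \<subseteq> cl ` seqs"
  proof
    fix f assume "f \<in> carrier Ahat"
    then have f: "f n \<in> carrier (residue_ring_power (sub K A) n)" "f (Suc n) \<subseteq> f n" for n
      by (simp_all add: completion_def)
    then have "\<exists>a. a \<in> A \<and> f n = coset (mp n) a" for n unfolding Quot_carrier by blast
    then obtain a where a: "\<And>n. a n \<in> A" "\<And>n. f n = coset (mp n) (a n)" by metis
    have "a (Suc n) \<ominus> a n \<in> mp n" for n
    proof -
      have "a (Suc n) \<in> f n" using f(2)[of n] a coset_self by blast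
      then show ?thesis using mem_coset_iff[OF mp_carrier A_K[OF a(1)] A_K[OF a(1)], of "Suc n" n n] a(2)[of n] by simp
    qed
    then have "a \<in> seqs" using a(1) by (intro seqsI)
    moreover have "f = cl a" using a by (simp add: cl_def fun_eq_iff)
    ultimately show "f \<in> cl ` seqs" by blast
  qed
qed

lemma cl_add: "a \<in> seqs \<Longrightarrow> b \<in> seqs \<Longrightarrow> cl a \<oplus>\<^bsub>Ahat\<^esub> cl b = cl (\<lambda>n. a n \<oplus> b n)"
proof -
  assume a: "a \<in> seqs" and b: "b \<in> seqs"
  interpret N: abelian_subgroup "mp n" "sub K A" for n
    by (rule abelian_subgroupI3[OF ideal.axioms(1)[OF mp_ideal] ring.is_abelian_group[OF rA]])
  show ?thesis
    unfolding cl_def completion_def residue_ring_power_def FactRing_def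
    using N.a_rcos_sum seqs_A[OF a] seqs_A[OF b] by (simp add: a_r_coset_sub max_ideal_A mp_def[symmetric])
qed

lemma cl_mult: "a \<in> seqs \<Longrightarrow> b \<in> seqs \<Longrightarrow> cl a \<otimes>\<^bsub>Ahat\<^esub> cl b = cl (\<lambda>n. a n \<otimes> b n)"
proof -
  assume a: "a \<in> seqs" and b: "b \<in> seqs"
  show ?thesis
    unfolding cl_def completion_def residue_ring_power_def FactRing_def
    using ideal.rcoset_mult_add[OF mp_ideal] seqs_A[OF a] seqs_A[OF b]
    by (simp add: a_r_coset_sub max_ideal_A mp_def[symmetric])
qed

lemma cl_one: "\<one>\<^bsub>Ahat\<^esub> = cl (\<lambda>_. \<one>)"
  by (simp add: cl_def completion_def residue_ring_power_def FactRing_def a_r_coset_sub max_ideal_A mp_def)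

lemma cl_zero: "\<zero>\<^bsub>Ahat\<^esub> = cl (\<lambda>_. \<zero>)"
proof -
  have "coset (mp n) \<zero> = mp n" for n using mpE(2) by (auto simp: coset_def image_def)
  then show ?thesis
    by (simp add: cl_def completion_def residue_ring_power_def FactRing_def max_ideal_A mp_def[symmetric])
qed

lemma to_completion_cl: "to_completion (sub K A) a = cl (\<lambda>_. a)"
  by (simp add: to_completion_def cl_def a_r_coset_sub max_ideal_A mp_def)

lemma Ahat_cases: "x \<in> carrier Ahat \<Longrightarrow> (\<And>a. a \<in> seqs \<Longrightarrow> (\<And>n. a n \<in> carrier K) \<Longrightarrow> x = cl a \<Longrightarrow> thesis) \<Longrightarrow> thesis"
  unfolding Ahat_carrier using seqs_K by blast

lemma cl_closed: "a \<in> seqs \<Longrightarrow> cl a \<in> carrier Ahat"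
  unfolding Ahat_carrier by blast

lemmas cl_simps = cl_add cl_mult cl_one cl_zero cl_closed seqs_add seqs_mult seqs_const

lemma Ahat_cring: "cring Ahat"
proof (rule cringI)
  show "abelian_group Ahat"
  proof (rule abelian_groupI)
    fix x y assume "x \<in> carrier Ahat" "y \<in> carrier Ahat"
    then show "x \<oplus>\<^bsub>Ahat\<^esub> y \<in> carrier Ahat" "x \<oplus>\<^bsub>Ahat\<^esub> y = y \<oplus>\<^bsub>Ahat\<^esub> x"
      by (elim Ahat_cases; simp add: cl_simps a_comm)+
  next
    fix x y z assume "x \<in> carrier Ahat" "y \<in> carrier Ahat" "z \<in> carrier Ahat"
    then show "x \<oplus>\<^bsub>Ahat\<^esub> y \<oplus>\<^bsub>Ahat\<^esub> z = x \<oplus>\<^bsub>Ahat\<^esub> (y \<oplus>\<^bsub>Ahat\<^esub> z)"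
      by (elim Ahat_cases) (simp add: cl_simps a_assoc)
  next
    show "\<zero>\<^bsub>Ahat\<^esub> \<in> carrier Ahat" by (simp add: cl_simps)
    fix x assume "x \<in> carrier Ahat"
    then obtain a where a: "a \<in> seqs" "\<And>n. a n \<in> carrier K" "x = cl a" by (rule Ahat_cases) (rule that)
    then show "\<zero>\<^bsub>Ahat\<^esub> \<oplus>\<^bsub>Ahat\<^esub> x = x" by (simp add: cl_simps)
    have "cl (\<lambda>n. \<ominus> a n) \<oplus>\<^bsub>Ahat\<^esub> x = \<zero>\<^bsub>Ahat\<^esub>" using a by (simp add: cl_simps seqs_neg l_neg)
    then show "\<exists>y\<in>carrier Ahat. y \<oplus>\<^bsub>Ahat\<^esub> x = \<zero>\<^bsub>Ahat\<^esub>" using cl_closed[OF seqs_neg[OF a(1)]] by blast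
  qed
  show "comm_monoid Ahat"
  proof (rule comm_monoidI)
    fix x y assume "x \<in> carrier Ahat" "y \<in> carrier Ahat"
    then show "x \<otimes>\<^bsub>Ahat\<^esub> y \<in> carrier Ahat" "x \<otimes>\<^bsub>Ahat\<^esub> y = y \<otimes>\<^bsub>Ahat\<^esub> x"
      by (elim Ahat_cases; simp add: cl_simps m_comm)+
  next
    fix x y z assume "x \<in> carrier Ahat" "y \<in> carrier Ahat" "z \<in> carrier Ahat"
    then show "x \<otimes>\<^bsub>Ahat\<^esub> y \<otimes>\<^bsub>Ahat\<^esub> z = x \<otimes>\<^bsub>Ahat\<^esub> (y \<otimes>\<^bsub>Ahat\<^esub> z)"
      by (elim Ahat_cases) (simp add: cl_simps m_assoc)
  next
    show "\<one>\<^bsub>Ahat\<^esub> \<in> carrier Ahat" by (simp add: cl_simps)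
    fix x assume "x \<in> carrier Ahat"
    then show "\<one>\<^bsub>Ahat\<^esub> \<otimes>\<^bsub>Ahat\<^esub> x = x" by (elim Ahat_cases) (simp add: cl_simps)
  qed
  fix x y z assume "x \<in> carrier Ahat" "y \<in> carrier Ahat" "z \<in> carrier Ahat"
  then show "(x \<oplus>\<^bsub>Ahat\<^esub> y) \<otimes>\<^bsub>Ahat\<^esub> z = x \<otimes>\<^bsub>Ahat\<^esub> z \<oplus>\<^bsub>Ahat\<^esub> y \<otimes>\<^bsub>Ahat\<^esub> z"
    by (elim Ahat_cases) (simp add: cl_simps l_distr)
qed

section \<open>The completion of \<open>V\<close> and the kernel of the canonical map\<close>

lemma max_ideal_V: "max_ideal (sub K V) = nV 1"
  using vlocal_quasilocal(2)[OF mid_V vlocal_V] nV_V by auto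

lemma ideal_power_V: "ideal_power (sub K V) (max_ideal (sub K V)) n = nV n"
proof (induct n)
  case 0
  show ?case by (simp add: ideal_power_def ideals_set_def)
next
  case (Suc n)
  have e: "ideal_power (sub K V) (max_ideal (sub K V)) (Suc n) = nV n \<cdot>\<^bsub>sub K V\<^esub> nV 1"
    using Suc by (simp add: ideal_power_def ideals_set_def max_ideal_V)
  show ?case
    unfolding e
  proof
    show "nV n \<cdot>\<^bsub>sub K V\<^esub> nV 1 \<subseteq> nV (Suc n)"
    proof
      fix x assume "x \<in> nV n \<cdot>\<^bsub>sub K V\<^esub> nV 1"
      then show "x \<in> nV (Suc n)"
      proof (induct rule: ideal_prod.induct)
        case (prod i j)
        then show ?case using nV_mult2[of i n j 1] by simp
      next
        case (sum s1 s2)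
        then show ?case using nV_add by simp
      qed
    qed
    show "nV (Suc n) \<subseteq> nV n \<cdot>\<^bsub>sub K V\<^esub> nV 1"
    proof
      fix x assume "x \<in> nV (Suc n)"
      then obtain y where y: "y \<in> V" "x = t [^] Suc n \<otimes> y" by (rule nV_E)
      then have x: "x = t [^] n \<otimes>\<^bsub>sub K V\<^esub> (t \<otimes> y)" by (simp add: m_assoc)
      show "x \<in> nV n \<cdot>\<^bsub>sub K V\<^esub> nV 1"
        unfolding x by (rule ideal_prod.prod[OF nV_tpow nV1_I[OF y(1)]])
    qed
  qed
qed

abbreviation PA :: "(nat \<Rightarrow> 'a set) set" where "PA \<equiv> completion_kernel K A V"

text \<open>\<open>a n\<close> is given only modulo \<open>mp n\<close>, which is harmless because
  \<open>mp n\<close> lies in \<open>nV n\<close>.\<close>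

lemma cl_in_P: "a \<in> seqs \<Longrightarrow> cl a \<in> PA \<longleftrightarrow> (\<forall>n. a n \<in> nV n)"
proof -
  assume a: "a \<in> seqs"
  have "nV n <+>\<^bsub>K\<^esub> coset (mp n) (a n) = nV n \<longleftrightarrow> a n \<in> nV n" for n
  proof
    assume e: "nV n <+>\<^bsub>K\<^esub> coset (mp n) (a n) = nV n"
    have "\<zero> \<oplus> a n \<in> nV n <+>\<^bsub>K\<^esub> coset (mp n) (a n)"
      unfolding set_add_def' using nV_zero coset_self[OF seqs_A[OF a], of n n] by blast
    then show "a n \<in> nV n" using e seqs_K[OF a] by simp
  next
    assume an: "a n \<in> nV n"
    show "nV n <+>\<^bsub>K\<^esub> coset (mp n) (a n) = nV n"
    proof
      show "nV n <+>\<^bsub>K\<^esub> coset (mp n) (a n) \<subseteq> nV n"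
        unfolding set_add_def' coset_def using nV_add an mp_nV by auto
      show "nV n \<subseteq> nV n <+>\<^bsub>K\<^esub> coset (mp n) (a n)"
      proof
        fix x assume x: "x \<in> nV n"
        have K: "x \<in> carrier K" "a n \<in> carrier K" using x an by simp_all
        have "x = (x \<ominus> a n) \<oplus> a n" using K by (simp add: minus_eq a_assoc l_neg)
        moreover have "x \<ominus> a n \<in> nV n" by (rule nV_minus[OF x an])
        ultimately show "x \<in> nV n <+>\<^bsub>K\<^esub> coset (mp n) (a n)"
          unfolding set_add_def' using coset_self[OF seqs_A[OF a], of n n] by blast
      qed
    qed
  qed
  then show ?thesis
    using cl_closed[OF a]
    by (simp add: completion_kernel_def a_kernel_def' completion_map_def ideal_power_V fun_eq_iff cl_def)
      (simp add: completion_def residue_ring_power_def FactRing_def ideal_power_V)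
qed

lemma P_carrier: "PA \<subseteq> carrier Ahat"
  unfolding completion_kernel_def a_kernel_def' by blast

text \<open>The successive corrections are of the form t^n b with \<open>b\<close> in
  \<open>A\<close>. They lie in \<open>mp n\<close> because \<open>t\<close> is in
  \<open>maxA\<close>, so an approximation in the topology of \<open>V\<close> converges already in
  the completion of \<open>A\<close>.\<close>

lemma lift:
  assumes x: "x \<in> V"
  obtains a where "a \<in> seqs" "\<And>n. x \<ominus> a n \<in> nV n"
proof -
  have "\<exists>a. \<forall>n. (a n \<in> A \<and> x \<ominus> a n \<in> nV n) \<and> a (Suc n) \<ominus> a n \<in> mp n"
  proof (rule dependent_nat_choice)
    show "\<exists>y. y \<in> A \<and> x \<ominus> y \<in> nV 0" using x by (intro exI[of _ \<zero>]) simp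
    fix y n assume y: "y \<in> A \<and> x \<ominus> y \<in> nV n"
    then obtain z where z: "z \<in> V" "x \<ominus> y = t [^] n \<otimes> z" using nV_E by blast
    obtain b w where b: "b \<in> A" "w \<in> V" "z = b \<oplus> t \<otimes> w" using V_split[OF z(1)] by blast
    define T where "T = t [^] n"
    have K: "x \<in> carrier K" "y \<in> carrier K" "T \<in> carrier K" "b \<in> carrier K" "w \<in> carrier K" "t \<in> carrier K"
      using x y b by (simp_all add: T_def)
    have "x \<ominus> (y \<oplus> T \<otimes> b) = (x \<ominus> y) \<ominus> T \<otimes> b" by (use K in algebra)
    also have "\<dots> = T \<otimes> (b \<oplus> t \<otimes> w) \<ominus> T \<otimes> b" using z b by (simp add: T_def)
    also have "\<dots> = T \<otimes> t \<otimes> w" by (use K in algebra)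
    also have "\<dots> \<in> nV (Suc n)" using nV_I[OF b(2), of "Suc n"] by (simp add: T_def)
    finally have 1: "x \<ominus> (y \<oplus> T \<otimes> b) \<in> nV (Suc n)" .
    have "(y \<oplus> T \<otimes> b) \<ominus> y = T \<otimes> b" by (use K in algebra)
    moreover have "T \<otimes> b \<in> mp n" using mp_tpow[of b 0 n] b by (simp add: T_def)
    ultimately have 2: "(y \<oplus> T \<otimes> b) \<ominus> y \<in> mp n" by simp
    have "y \<oplus> T \<otimes> b \<in> A" using y b tA by (simp add: T_def)
    then show "\<exists>y'. (y' \<in> A \<and> x \<ominus> y' \<in> nV (Suc n)) \<and> y' \<ominus> y \<in> mp n" using 1 2 by blast
  qed
  then obtain a where "\<And>n. a n \<in> A" "\<And>n. x \<ominus> a n \<in> nV n" "\<And>n. a (Suc n) \<ominus> a n \<in> mp n" by blast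
  then show ?thesis using that[of a] seqsI by blast
qed

end

section \<open>Traces of primary ideals\<close>

text \<open>\<open>J\<close> stands for an ideal between \<open>P\<^sup>2\<close> and \<open>P\<close> such that \<open>P\<close> consists of the zero divisors
  modulo \<open>J\<close>, given by the Cauchy sequences representing its elements.\<close>

locale trace = tight_pair +
  fixes J :: "(nat \<Rightarrow> 'a) set"
  assumes J_seqs: "a \<in> J \<Longrightarrow> a \<in> seqs"
    and J_add: "a \<in> J \<Longrightarrow> b \<in> J \<Longrightarrow> (\<lambda>n. a n \<oplus> b n) \<in> J"
    and J_mult: "a \<in> seqs \<Longrightarrow> b \<in> J \<Longrightarrow> (\<lambda>n. a n \<otimes> b n) \<in> J"
    and J_cong: "a \<in> J \<Longrightarrow> b \<in> seqs \<Longrightarrow> (\<And>n. a n \<ominus> b n \<in> mp n) \<Longrightarrow> b \<in> J"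
    and J_P: "a \<in> J \<Longrightarrow> a n \<in> nV n"
    and J_PP: "a \<in> seqs \<Longrightarrow> b \<in> seqs \<Longrightarrow> (\<And>n. a n \<in> nV n) \<Longrightarrow> (\<And>n. b n \<in> nV n) \<Longrightarrow> (\<lambda>n. a n \<otimes> b n) \<in> J"
    and J_prim: "a \<in> seqs \<Longrightarrow> b \<in> seqs \<Longrightarrow> (\<lambda>n. a n \<otimes> b n) \<in> J \<Longrightarrow> a \<notin> J \<Longrightarrow> b n \<in> nV n"
begin

lemma J_zero: "(\<lambda>_. \<zero>) \<in> J"
  using J_PP[OF seqs_const seqs_const, of \<zero> \<zero>] by simp

lemma J_eq: "a \<in> J \<Longrightarrow> (\<And>n. a n = b n) \<Longrightarrow> b \<in> J"
  by (metis ext)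

text \<open>Says that the fraction \<open>x\<close> and the class of \<open>f\<close> modulo
  \<open>J\<close> agree in the total quotient ring. The denominator \<open>b\<close> is cleared so
  that the difference becomes a sequence in \<open>A\<close>. Consequently \<open>T\<close> below is
  the intersection of the quotient field of \<open>A\<close> with the completion modulo
  \<open>J\<close>.\<close>

definition rel :: "'a \<Rightarrow> (nat \<Rightarrow> 'a) \<Rightarrow> bool" where
  "rel x f \<longleftrightarrow> f \<in> seqs \<and> x \<in> carrier K \<and>
    (\<exists>b\<in>A. b \<noteq> \<zero> \<and> b \<otimes> x \<in> A \<and> (\<lambda>n. b \<otimes> (x \<ominus> f n)) \<in> J)"

definition T :: "'a set" where "T = {x. \<exists>f. rel x f}"

lemma relI: "f \<in> seqs \<Longrightarrow> x \<in> carrier K \<Longrightarrow> b \<in> A \<Longrightarrow> b \<noteq> \<zero> \<Longrightarrow> b \<otimes> x \<in> A \<Longrightarrow> (\<lambda>n. b \<otimes> (x \<ominus> f n)) \<in> J \<Longrightarrow> rel x f"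
  unfolding rel_def by blast

lemma relE:
  assumes "rel x f"
  obtains b where "b \<in> A" "b \<noteq> \<zero>" "b \<otimes> x \<in> A" "(\<lambda>n. b \<otimes> (x \<ominus> f n)) \<in> J" "f \<in> seqs"
    "x \<in> carrier K" "\<And>n. f n \<in> carrier K" "b \<in> carrier K"
  using assms seqs_K A_K unfolding rel_def by blast

lemma rel_const: "a \<in> A \<Longrightarrow> rel a (\<lambda>_. a)"
  by (rule relI[of _ _ \<one>]) (simp_all add: seqs_const J_zero minus_eq r_neg)

lemma rel_add:
  assumes "rel x f" "rel y g"
  shows "rel (x \<oplus> y) (\<lambda>n. f n \<oplus> g n)"
proof -
  obtain b where b: "b \<in> A" "b \<noteq> \<zero>" "b \<otimes> x \<in> A" "(\<lambda>n. b \<otimes> (x \<ominus> f n)) \<in> J" "f \<in> seqs"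
    "x \<in> carrier K" "\<And>n. f n \<in> carrier K" "b \<in> carrier K" by (rule relE[OF assms(1)]) (rule that)
  obtain c where c: "c \<in> A" "c \<noteq> \<zero>" "c \<otimes> y \<in> A" "(\<lambda>n. c \<otimes> (y \<ominus> g n)) \<in> J" "g \<in> seqs"
    "y \<in> carrier K" "\<And>n. g n \<in> carrier K" "c \<in> carrier K" by (rule relE[OF assms(2)]) (rule that)
  note K = b(6,8) c(6,8)
  show ?thesis
  proof (rule relI[of _ _ "b \<otimes> c"])
    show "(\<lambda>n. f n \<oplus> g n) \<in> seqs" using b c by (intro seqs_add)
    show "x \<oplus> y \<in> carrier K" "b \<otimes> c \<in> A" using b c by simp_all
    show "b \<otimes> c \<noteq> \<zero>" using b c integral[of b c] by blast
    have "b \<otimes> c \<otimes> (x \<oplus> y) = c \<otimes> (b \<otimes> x) \<oplus> b \<otimes> (c \<otimes> y)" by (use K in algebra)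
    then show "b \<otimes> c \<otimes> (x \<oplus> y) \<in> A" using b c by simp
    have "(\<lambda>n. c \<otimes> (b \<otimes> (x \<ominus> f n)) \<oplus> b \<otimes> (c \<otimes> (y \<ominus> g n))) \<in> J"
      by (intro J_add J_mult seqs_const b c)
    then show "(\<lambda>n. b \<otimes> c \<otimes> (x \<oplus> y \<ominus> (f n \<oplus> g n))) \<in> J"
    proof (rule J_eq)
      fix n
      define p q where "p = f n" and "q = g n"
      have pq: "p \<in> carrier K" "q \<in> carrier K" using b(7) c(7) by (simp_all add: p_def q_def)
      have "c \<otimes> (b \<otimes> (x \<ominus> p)) \<oplus> b \<otimes> (c \<otimes> (y \<ominus> q)) = b \<otimes> c \<otimes> (x \<oplus> y \<ominus> (p \<oplus> q))"
        by (use K pq in algebra)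
      then show "c \<otimes> (b \<otimes> (x \<ominus> f n)) \<oplus> b \<otimes> (c \<otimes> (y \<ominus> g n)) = b \<otimes> c \<otimes> (x \<oplus> y \<ominus> (f n \<oplus> g n))"
        by (simp add: p_def q_def)
    qed
  qed
qed

lemma rel_mult:
  assumes "rel x f" "rel y g"
  shows "rel (x \<otimes> y) (\<lambda>n. f n \<otimes> g n)"
proof -
  obtain b where b: "b \<in> A" "b \<noteq> \<zero>" "b \<otimes> x \<in> A" "(\<lambda>n. b \<otimes> (x \<ominus> f n)) \<in> J" "f \<in> seqs"
    "x \<in> carrier K" "\<And>n. f n \<in> carrier K" "b \<in> carrier K" by (rule relE[OF assms(1)]) (rule that)
  obtain c where c: "c \<in> A" "c \<noteq> \<zero>" "c \<otimes> y \<in> A" "(\<lambda>n. c \<otimes> (y \<ominus> g n)) \<in> J" "g \<in> seqs"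
    "y \<in> carrier K" "\<And>n. g n \<in> carrier K" "c \<in> carrier K" by (rule relE[OF assms(2)]) (rule that)
  note K = b(6,8) c(6,8)
  show ?thesis
  proof (rule relI[of _ _ "b \<otimes> c"])
    show "(\<lambda>n. f n \<otimes> g n) \<in> seqs" using b c by (intro seqs_mult)
    show "x \<otimes> y \<in> carrier K" "b \<otimes> c \<in> A" using b c by simp_all
    show "b \<otimes> c \<noteq> \<zero>" using b c integral[of b c] by blast
    have "b \<otimes> c \<otimes> (x \<otimes> y) = (b \<otimes> x) \<otimes> (c \<otimes> y)" by (use K in algebra)
    then show "b \<otimes> c \<otimes> (x \<otimes> y) \<in> A" using b c by simp
    \<comment> \<open>The product rule bc(xy - fg) = cy b(x - f) + bf c(y - g); here cy lies in
      \<open>A\<close>, so it may multiply an element of \<open>J\<close>.\<close>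
    have "(\<lambda>n. (c \<otimes> y) \<otimes> (b \<otimes> (x \<ominus> f n)) \<oplus> (b \<otimes> f n) \<otimes> (c \<otimes> (y \<ominus> g n))) \<in> J"
      by (intro J_add J_mult seqs_mult seqs_const b c)
    then show "(\<lambda>n. b \<otimes> c \<otimes> (x \<otimes> y \<ominus> f n \<otimes> g n)) \<in> J"
    proof (rule J_eq)
      fix n
      define p q where "p = f n" and "q = g n"
      have pq: "p \<in> carrier K" "q \<in> carrier K" using b(7) c(7) by (simp_all add: p_def q_def)
      have "(c \<otimes> y) \<otimes> (b \<otimes> (x \<ominus> p)) \<oplus> (b \<otimes> p) \<otimes> (c \<otimes> (y \<ominus> q)) = b \<otimes> c \<otimes> (x \<otimes> y \<ominus> p \<otimes> q)"
        by (use K pq in algebra)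
      then show "(c \<otimes> y) \<otimes> (b \<otimes> (x \<ominus> f n)) \<oplus> (b \<otimes> f n) \<otimes> (c \<otimes> (y \<ominus> g n)) = b \<otimes> c \<otimes> (x \<otimes> y \<ominus> f n \<otimes> g n)"
        by (simp add: p_def q_def)
    qed
  qed
qed

lemma rel_V:
  assumes "rel x f"
  shows "x \<in> V" "x \<ominus> f n \<in> nV n"
proof -
  obtain b where b: "b \<in> A" "b \<noteq> \<zero>" "b \<otimes> x \<in> A" "(\<lambda>n. b \<otimes> (x \<ominus> f n)) \<in> J" "f \<in> seqs"
    "x \<in> carrier K" "\<And>n. f n \<in> carrier K" "b \<in> carrier K" by (rule relE[OF assms(1)]) (rule that)
  obtain h u where u: "u \<in> V" "u \<notin> nV 1" "b = t [^] (h::nat) \<otimes> u" using V_dec[OF A_V[OF b(1)] b(2)] .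
  \<comment> \<open>Reading the element of \<open>J\<close> at index h + n makes up for the
    valuation h of \<open>b\<close>.\<close>
  have key: "x \<ominus> f (h + n) \<in> nV n" for n
  proof -
    have "b \<otimes> (x \<ominus> f (h + n)) \<in> nV (h + n)" by (rule J_P[OF b(4)])
    then have "t [^] h \<otimes> (u \<otimes> (x \<ominus> f (h + n))) \<in> nV (h + n)" using u b(6,7) by (simp add: m_assoc)
    then have "u \<otimes> (x \<ominus> f (h + n)) \<in> nV n" by (rule nV_cancel) (use u b(6,7) in simp)
    moreover have "x \<ominus> f (h + n) \<in> carrier K" using b(6,7) by simp
    ultimately show ?thesis using nV_unit_cancel[OF u(1,2)] by blast
  qed
  have eq: "x \<ominus> f n = (x \<ominus> f m) \<oplus> (f m \<ominus> f n)" for m n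
  proof -
    define p q where "p = f n" and "q = f m"
    have pq: "p \<in> carrier K" "q \<in> carrier K" using b(7) by (simp_all add: p_def q_def)
    have "x \<ominus> p = (x \<ominus> q) \<oplus> (q \<ominus> p)" by (use b(6) pq in algebra)
    then show ?thesis by (simp add: p_def q_def)
  qed
  have "(x \<ominus> f h) \<oplus> f h \<in> V" using key[of 0] A_V[OF seqs_A[OF b(5)]] by simp
  moreover have "(x \<ominus> f h) \<oplus> f h = x" using b(6,7) by (simp add: minus_eq a_assoc l_neg)
  ultimately show "x \<in> V" by simp
  show "x \<ominus> f n \<in> nV n"
    unfolding eq[of n "h + n"] by (rule nV_add[OF key mp_nV[OF seqs_diff[OF b(5)]]]) simp
qed

text \<open>Sequences with the same limit in \<open>V\<close> differ by an element of P. This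
  produces the pairs of elements of P to which \<open>J_PP\<close> is applied.\<close>

lemma rel_lift:
  assumes "rel x f" and g: "g \<in> seqs" "\<And>n. x \<ominus> g n \<in> nV n"
  shows "f n \<ominus> g n \<in> nV n"
proof -
  have fK: "f n \<in> carrier K" using assms(1) seqs_K by (auto simp: rel_def)
  define p q where "p = f n" and "q = g n"
  have pq: "p \<in> carrier K" "q \<in> carrier K" "x \<in> carrier K"
    using fK seqs_K[OF g(1)] rel_V(1)[OF assms(1)] by (simp_all add: p_def q_def)
  have "p \<ominus> q = (x \<ominus> q) \<ominus> (x \<ominus> p)" by (use pq in algebra)
  then show ?thesis using nV_minus[OF g(2) rel_V(2)[OF assms(1)]] by (simp add: p_def q_def)
qed

text \<open>Turns a congruence modulo \<open>J\<close> into a division inside the trace. The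
  divisions by powers of \<open>t\<close> and by elements of \<open>A\<close> below go through
  it.\<close>

lemma rel_div:
  assumes "rel p f" and c: "c \<in> A" "c \<noteq> \<zero>" and g: "g \<in> seqs" and J: "(\<lambda>n. f n \<ominus> c \<otimes> g n) \<in> J"
  shows "\<exists>r. p = c \<otimes> r \<and> rel r g"
proof -
  obtain b where b: "b \<in> A" "b \<noteq> \<zero>" "b \<otimes> p \<in> A" "(\<lambda>n. b \<otimes> (p \<ominus> f n)) \<in> J" "f \<in> seqs"
    "p \<in> carrier K" "\<And>n. f n \<in> carrier K" "b \<in> carrier K" by (rule relE[OF assms(1)]) (rule that)
  define r where "r = inv c \<otimes> p"
  have cK: "c \<in> carrier K" "inv c \<in> carrier K" "c \<otimes> inv c = \<one>" using c by simp_all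
  have r: "r \<in> carrier K" using cK b by (simp add: r_def)
  have cr: "p = c \<otimes> r" using cK b by (simp add: r_def m_assoc[symmetric])
  have "rel r g"
  proof (rule relI[OF g r])
    show "b \<otimes> c \<in> A" using b c by simp
    show "b \<otimes> c \<noteq> \<zero>" using b c cK integral[of b c] by blast
    have "b \<otimes> c \<otimes> r = b \<otimes> p" unfolding cr using b(8) cK(1) r by (simp add: m_assoc)
    then show "b \<otimes> c \<otimes> r \<in> A" using b by simp
    have "(\<lambda>n. b \<otimes> (p \<ominus> f n) \<oplus> b \<otimes> (f n \<ominus> c \<otimes> g n)) \<in> J"
      by (intro J_add J_mult seqs_const b J)
    then show "(\<lambda>n. b \<otimes> c \<otimes> (r \<ominus> g n)) \<in> J"
    proof (rule J_eq)
      fix n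
      define x y where "x = f n" and "y = g n"
      have xy: "x \<in> carrier K" "y \<in> carrier K" using b(7) seqs_K[OF g] by (simp_all add: x_def y_def)
      note bK = b(8) cK(1)
      have "b \<otimes> (c \<otimes> r \<ominus> x) \<oplus> b \<otimes> (x \<ominus> c \<otimes> y) = b \<otimes> c \<otimes> (r \<ominus> y)"
        by (use xy r bK in algebra)
      then show "b \<otimes> (p \<ominus> f n) \<oplus> b \<otimes> (f n \<ominus> c \<otimes> g n) = b \<otimes> c \<otimes> (r \<ominus> g n)"
        by (simp add: x_def y_def cr)
    qed
  qed
  then show ?thesis using cr by blast
qed

lemma T_mid: "mid T"
  unfolding mid_def
proof (intro conjI)
  show "subring T K"
  proof (rule subringI)
    show "T \<subseteq> carrier K" unfolding T_def rel_def by blast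
    show "\<one> \<in> T" unfolding T_def using rel_const[of \<one>] by auto
    fix x y assume "x \<in> T" "y \<in> T"
    then show "x \<otimes> y \<in> T" "x \<oplus> y \<in> T" unfolding T_def using rel_add rel_mult by blast+
  next
    fix x assume "x \<in> T"
    then obtain f where f: "rel x f" unfolding T_def by blast
    then have "rel (\<ominus> \<one> \<otimes> x) (\<lambda>n. \<ominus> \<one> \<otimes> f n)" by (intro rel_mult rel_const) simp
    then show "\<ominus> x \<in> T" unfolding T_def using rel_V(1)[OF f] by (auto simp: l_minus)
  qed
  show "A \<subseteq> T" unfolding T_def using rel_const by blast
  show "T \<subseteq> V" unfolding T_def using rel_V(1) by blast
qed

text \<open>A sequence g tending to the inverse of \<open>r\<close> in \<open>V\<close> inverts f
  only modulo P. One Newton step improves this to an inverse modulo P^2, hence modulo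
  \<open>J\<close>.\<close>

lemma T_local: "vlocal T"
  unfolding vlocal_def
proof (intro ballI impI)
  fix r assume "r \<in> T" and n: "r \<notin> nV 1"
  then obtain f where f: "rel r f" unfolding T_def by blast
  obtain b where b: "b \<in> A" "b \<noteq> \<zero>" "b \<otimes> r \<in> A" "(\<lambda>n. b \<otimes> (r \<ominus> f n)) \<in> J" "f \<in> seqs"
    "r \<in> carrier K" "\<And>n. f n \<in> carrier K" "b \<in> carrier K" by (rule relE[OF f]) (rule that)
  have rV: "r \<in> V" by (rule rel_V(1)[OF f])
  define w where "w = inv r"
  have w: "w \<in> V" "r \<otimes> w = \<one>" "w \<in> carrier K" using V_unit[OF rV n] by (simp_all add: w_def)
  obtain g where g: "g \<in> seqs" "\<And>n. w \<ominus> g n \<in> nV n" by (rule lift[OF w(1)]) (rule that)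
  have gK: "g n \<in> carrier K" for n by (rule seqs_K[OF g(1)])
  have s: "(\<lambda>n. f n \<otimes> g n \<ominus> \<one>) \<in> seqs" by (intro seqs_minus seqs_mult seqs_const b g) simp
  have P: "f n \<otimes> g n \<ominus> \<one> \<in> nV n" for n
  proof -
    define x y where "x = f n" and "y = g n"
    have xy: "x \<in> carrier K" "y \<in> carrier K" using b(7) gK by (simp_all add: x_def y_def)
    have "\<ominus> (w \<otimes> (r \<ominus> x) \<oplus> x \<otimes> (w \<ominus> y)) = x \<otimes> y \<ominus> r \<otimes> w"
      by (use xy w(3) b(6) in algebra)
    moreover have "\<ominus> (w \<otimes> (r \<ominus> x) \<oplus> x \<otimes> (w \<ominus> y)) \<in> nV n"
      unfolding x_def y_def
      by (intro nV_neg nV_add nV_mult rel_V(2)[OF f] g(2) w(1) A_V seqs_A[OF b(5)])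
    ultimately show ?thesis using w(2) by (simp add: x_def y_def)
  qed
  \<comment> \<open>The Newton iterate g(2 - fg); it satisfies 1 - fk = (1 - fg)^2.\<close>
  define k where "k n = g n \<oplus> g n \<ominus> f n \<otimes> g n \<otimes> g n" for n
  have k: "k \<in> seqs" "k n \<in> carrier K" for n
  proof -
    show "k \<in> seqs" unfolding k_def by (intro seqs_minus seqs_add seqs_mult b g)
    then show "k n \<in> carrier K" by (rule seqs_K)
  qed
  have 1: "(\<lambda>n. b \<otimes> (\<one> \<ominus> f n \<otimes> k n)) \<in> J"
  proof (rule J_eq[OF J_mult[OF seqs_const[OF b(1)] J_PP[OF s s P P]]])
    fix n
    define x y where "x = f n" and "y = g n"
    have xy: "x \<in> carrier K" "y \<in> carrier K" using b(7) gK by (simp_all add: x_def y_def)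
    have "b \<otimes> ((x \<otimes> y \<ominus> \<one>) \<otimes> (x \<otimes> y \<ominus> \<one>)) = b \<otimes> (\<one> \<ominus> x \<otimes> (y \<oplus> y \<ominus> x \<otimes> y \<otimes> y))"
      by (use xy b(8) in algebra)
    then show "b \<otimes> ((f n \<otimes> g n \<ominus> \<one>) \<otimes> (f n \<otimes> g n \<ominus> \<one>)) = b \<otimes> (\<one> \<ominus> f n \<otimes> k n)"
      by (simp add: x_def y_def k_def)
  qed
  have nk: "(\<lambda>n. \<ominus> k n) \<in> seqs" by (rule seqs_neg[OF k(1)])
  have "rel w k"
  proof (rule relI[OF k(1) w(3) b(3)])
    show "b \<otimes> r \<noteq> \<zero>" using b(2,6,8) V_unit(1)[OF rV n] integral[of b r] by blast
    have "b \<otimes> r \<otimes> w = b" using b(6,8) w by (simp add: m_assoc)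
    then show "b \<otimes> r \<otimes> w \<in> A" using b(1) by simp
    show "(\<lambda>n. b \<otimes> r \<otimes> (w \<ominus> k n)) \<in> J"
    proof (rule J_eq[OF J_add[OF 1 J_mult[OF nk b(4)]]])
      fix n
      define x y where "x = f n" and "y = k n"
      have xy: "x \<in> carrier K" "y \<in> carrier K" using b(7) k(2) by (simp_all add: x_def y_def)
      have "b \<otimes> (r \<otimes> w \<ominus> x \<otimes> y) \<oplus> \<ominus> y \<otimes> (b \<otimes> (r \<ominus> x)) = b \<otimes> r \<otimes> (w \<ominus> y)"
        by (use xy b(6,8) w(3) in algebra)
      then show "b \<otimes> (\<one> \<ominus> f n \<otimes> k n) \<oplus> \<ominus> k n \<otimes> (b \<otimes> (r \<ominus> f n)) = b \<otimes> r \<otimes> (w \<ominus> k n)"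
        using w(2) by (simp add: x_def y_def)
    qed
  qed
  then show "inv r \<in> T" unfolding T_def w_def by blast
qed

lemma lift_tpow:
  assumes "x \<in> nV k"
  obtains h where "h \<in> seqs" "\<And>n. x \<ominus> t [^] k \<otimes> h n \<in> nV n"
proof -
  obtain y where y: "y \<in> V" "x = t [^] k \<otimes> y" using nV_E[OF assms] .
  obtain h where h: "h \<in> seqs" "\<And>n. y \<ominus> h n \<in> nV n" by (rule lift[OF y(1)]) (rule that)
  have "x \<ominus> t [^] k \<otimes> h n \<in> nV n" for n
  proof -
    have "t [^] k \<otimes> (y \<ominus> h n) = x \<ominus> t [^] k \<otimes> h n"
      unfolding y(2) minus_eq using y(1) seqs_K[OF h(1), of n] by (simp add: r_distr r_minus)
    then show ?thesis using nV_mult[OF _ h(2), of "t [^] k" n] by simp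
  qed
  then show ?thesis using that h by blast
qed

lemma T_mult_div:
  assumes p: "p \<in> T" "p \<in> nV k" and q: "q \<in> T" "q \<in> nV k"
  shows "\<exists>r\<in>T. p \<otimes> q = t [^] k \<otimes> r"
proof -
  obtain f g where f: "rel p f" and g: "rel q g" using p q unfolding T_def by blast
  have fs: "f \<in> seqs" "g \<in> seqs" using f g by (auto simp: rel_def)
  obtain f' where f': "f' \<in> seqs" "\<And>n. p \<ominus> t [^] k \<otimes> f' n \<in> nV n" by (rule lift_tpow[OF p(2)]) (rule that)
  obtain g' where g': "g' \<in> seqs" "\<And>n. q \<ominus> t [^] k \<otimes> g' n \<in> nV n" by (rule lift_tpow[OF q(2)]) (rule that)
  define s where "s = t [^] k"
  have s: "s \<in> A" "s \<in> carrier K" "s \<noteq> \<zero>" using tA by (simp_all add: s_def)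
  have tf: "(\<lambda>n. s \<otimes> f' n) \<in> seqs" "(\<lambda>n. s \<otimes> g' n) \<in> seqs" by (intro seqs_mult seqs_const s f' g')+
  have P1: "f n \<ominus> s \<otimes> f' n \<in> nV n" for n by (rule rel_lift[OF f tf(1)]) (use f' s_def in simp)
  have P2: "g n \<ominus> s \<otimes> g' n \<in> nV n" for n by (rule rel_lift[OF g tf(2)]) (use g' s_def in simp)
  have PP: "(\<lambda>n. (f n \<ominus> s \<otimes> f' n) \<otimes> (g n \<ominus> s \<otimes> g' n)) \<in> J"
    by (rule J_PP[OF _ _ P1 P2]) (intro seqs_minus fs tf)+
  \<comment> \<open>Determined by (f - sf')(g - sg') = fg - sh; both factors on the left are in
    P.\<close>
  define h where "h n = f' n \<otimes> g n \<oplus> g' n \<otimes> f n \<ominus> s \<otimes> (f' n \<otimes> g' n)" for n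
  have h: "h \<in> seqs" unfolding h_def by (intro seqs_minus seqs_add seqs_mult seqs_const s fs f' g')
  have "(\<lambda>n. f n \<otimes> g n \<ominus> s \<otimes> h n) \<in> J"
  proof (rule J_eq[OF PP])
    fix n
    define x y x' y' where "x = f n" and "y = g n" and "x' = f' n" and "y' = g' n"
    have K: "x \<in> carrier K" "y \<in> carrier K" "x' \<in> carrier K" "y' \<in> carrier K"
      using seqs_K fs f'(1) g'(1) by (simp_all add: x_def y_def x'_def y'_def)
    have "(x \<ominus> s \<otimes> x') \<otimes> (y \<ominus> s \<otimes> y') = x \<otimes> y \<ominus> s \<otimes> (x' \<otimes> y \<oplus> y' \<otimes> x \<ominus> s \<otimes> (x' \<otimes> y'))"
      by (use K s(2) in algebra)
    then show "(f n \<ominus> s \<otimes> f' n) \<otimes> (g n \<ominus> s \<otimes> g' n) = f n \<otimes> g n \<ominus> s \<otimes> h n"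
      by (simp add: x_def y_def x'_def y'_def h_def)
  qed
  then have "\<exists>r. p \<otimes> q = s \<otimes> r \<and> rel r h" by (rule rel_div[OF rel_mult[OF f g] s(1,3) h])
  then show ?thesis unfolding T_def s_def by blast
qed

text \<open>Write c = t^h u with u a unit of \<open>V\<close>, and let g tend to the inverse of u.
  Then t^h - cg is in P, its square is in \<open>J\<close>, and expanding the square shows that
  \<open>c\<close> divides t^(2h) in \<open>T\<close>.\<close>

lemma T_tpow:
  assumes c: "c \<in> A" "c \<noteq> \<zero>"
  shows "\<exists>N. \<exists>r\<in>T. t [^] (N::nat) = c \<otimes> r"
proof -
  obtain h u where u: "u \<in> V" "u \<notin> nV 1" "c = t [^] (h::nat) \<otimes> u" using V_dec[OF A_V[OF c(1)] c(2)] .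
  obtain g where g: "g \<in> seqs" "\<And>n. inv u \<ominus> g n \<in> nV n" by (rule lift[OF V_unit(2)[OF u(1,2)]]) (rule that)
  define s v where "s = t [^] h" and "v = inv u"
  have s: "s \<in> A" "s \<in> carrier K" using tA by (simp_all add: s_def)
  have v: "v \<in> carrier K" "c \<otimes> v = s" using u V_unit[OF u(1,2)] by (simp_all add: v_def s_def m_assoc)
  have cK: "c \<in> carrier K" using c by simp
  have gK: "g n \<in> carrier K" for n by (rule seqs_K[OF g(1)])
  have P: "s \<ominus> c \<otimes> g n \<in> nV n" for n
  proof -
    have "c \<otimes> (v \<ominus> g n) = s \<ominus> c \<otimes> g n" unfolding minus_eq using v cK gK[of n] by (simp add: r_distr r_minus)
    moreover have "c \<otimes> (v \<ominus> g n) \<in> nV n" unfolding v_def by (rule nV_mult[OF A_V[OF c(1)] g(2)])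
    ultimately show ?thesis by simp
  qed
  have sq: "(\<lambda>n. s \<ominus> c \<otimes> g n) \<in> seqs" by (intro seqs_minus seqs_mult seqs_const s c g)
  define k where "k n = s \<otimes> g n \<oplus> s \<otimes> g n \<ominus> c \<otimes> (g n \<otimes> g n)" for n
  have k: "k \<in> seqs" unfolding k_def by (intro seqs_minus seqs_add seqs_mult seqs_const s c g)
  have J: "(\<lambda>n. s \<otimes> s \<ominus> c \<otimes> k n) \<in> J"
  proof (rule J_eq[OF J_PP[OF sq sq P P]])
    fix n
    define x where "x = g n"
    have x: "x \<in> carrier K" using gK by (simp add: x_def)
    have "(s \<ominus> c \<otimes> x) \<otimes> (s \<ominus> c \<otimes> x) = s \<otimes> s \<ominus> c \<otimes> (s \<otimes> x \<oplus> s \<otimes> x \<ominus> c \<otimes> (x \<otimes> x))"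
      by (use x s(2) cK in algebra)
    then show "(s \<ominus> c \<otimes> g n) \<otimes> (s \<ominus> c \<otimes> g n) = s \<otimes> s \<ominus> c \<otimes> k n" by (simp add: x_def k_def)
  qed
  have ss: "s \<otimes> s \<in> A" using s by simp
  obtain r where "s \<otimes> s = c \<otimes> r" "rel r k" using rel_div[OF rel_const[OF ss] c k J] by blast
  moreover have "s \<otimes> s = t [^] (h + h)" by (simp add: s_def nat_pow_mult)
  ultimately show ?thesis unfolding T_def by auto
qed

end

section \<open>Generators of the maximal ideal and the closures of its powers\<close>

context tight_pair
begin

text \<open>The second factor of a product in \<open>mp (Suc n)\<close> is a combination of
  \<open>S\<close> over \<open>A\<close>; the first factor multiplies its coefficients into
  \<open>mp n\<close>.\<close>

lemma maxA_generators:
  obtains S where "finite S" "S \<subseteq> maxA"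
    "\<And>n x. x \<in> mp (Suc n) \<Longrightarrow> \<exists>c. (\<forall>s\<in>S. c s \<in> mp n) \<and> x = (\<Oplus>s\<in>S. c s \<otimes> s)"
proof -
  obtain S where S: "S \<subseteq> A" "finite S" "maxA = Idl\<^bsub>sub K A\<^esub> S"
    using noetherian_ring.finetely_gen[OF A_noeth maxA_ideal] by auto
  have SK: "s \<in> carrier K" if "s \<in> S" for s using that S(1) by auto
  define F where "F c = (\<Oplus>s\<in>S. c s \<otimes> s)" for c
  have Fadd: "F c \<oplus> F d = F (\<lambda>s. c s \<oplus> d s)" if "c \<in> S \<rightarrow> carrier K" "d \<in> S \<rightarrow> carrier K" for c d
  proof -
    have "F (\<lambda>s. c s \<oplus> d s) = (\<Oplus>s\<in>S. c s \<otimes> s \<oplus> d s \<otimes> s)"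
      unfolding F_def by (rule finsum_cong') (use that SK in \<open>auto simp: l_distr Pi_def\<close>)
    also have "\<dots> = F c \<oplus> F d" unfolding F_def by (rule finsum_addf) (use that SK in \<open>auto simp: Pi_def\<close>)
    finally show ?thesis by simp
  qed
  have Fmult: "a \<otimes> F c = F (\<lambda>s. a \<otimes> c s)" if "a \<in> carrier K" "c \<in> S \<rightarrow> carrier K" for a c
  proof -
    have "a \<otimes> F c = (\<Oplus>s\<in>S. a \<otimes> (c s \<otimes> s))"
      unfolding F_def by (rule finsum_rdistr) (use that SK S in \<open>auto simp: Pi_def\<close>)
    also have "\<dots> = F (\<lambda>s. a \<otimes> c s)"
      unfolding F_def by (rule finsum_cong') (use that SK in \<open>auto simp: m_assoc Pi_def\<close>)
    finally show ?thesis .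
  qed
  have Fsingle: "F (\<lambda>u. if u = s then \<one> else \<zero>) = s" if s: "s \<in> S" for s
  proof -
    have "F (\<lambda>u. if u = s then \<one> else \<zero>) = (\<Oplus>u\<in>S. if s = u then u else \<zero>)"
      unfolding F_def by (rule finsum_cong') (use SK in auto)
    also have "\<dots> = s" by (rule finsum_singleton[OF s S(2)]) (use SK in auto)
    finally show ?thesis .
  qed
  have FA: "F c \<in> A" if "c \<in> S \<rightarrow> A" for c
  proof -
    have "(\<Oplus>s\<in>S'. c s \<otimes> s) \<in> A" if "S' \<subseteq> S" for S'
    proof -
      have "finite S'" using that S(2) finite_subset by blast
      then show ?thesis using that
      proof (induct S')
        case empty
        then show ?case by simp
      next
        case (insert s S')
        have f: "(\<lambda>s. c s \<otimes> s) \<in> S' \<rightarrow> carrier K" "c s \<otimes> s \<in> carrier K" "c s \<in> A" "s \<in> A"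
          using insert \<open>c \<in> S \<rightarrow> A\<close> S(1) by (auto simp: Pi_def subset_iff)
        then show ?case using insert finsum_insert[OF insert(1,2) f(1,2)] by simp
      qed
    qed
    then show ?thesis unfolding F_def by blast
  qed
  define G where "G = {F c |c. c \<in> S \<rightarrow> A}"
  have AK: "c \<in> S \<rightarrow> carrier K" if "c \<in> S \<rightarrow> A" for c using that by (auto simp: Pi_def)
  have GI: "ideal G (sub K A)"
    unfolding ideal_sub_iff[OF A]
  proof (intro conjI ballI)
    show "G \<subseteq> A" unfolding G_def using FA by blast
    have "\<zero> \<otimes> F (\<lambda>_. \<zero>) = F (\<lambda>_. \<zero> \<otimes> \<zero>)" by (rule Fmult) auto
    then have "F (\<lambda>_. \<zero>) = \<zero>" using FA[of "\<lambda>_. \<zero>"] by simp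
    moreover have "(\<lambda>_. \<zero>) \<in> S \<rightarrow> A" by simp
    ultimately show "\<zero> \<in> G" unfolding G_def by (metis (mono_tags, lifting) mem_Collect_eq)
  next
    fix x y assume "x \<in> G" "y \<in> G"
    then obtain c d where c: "c \<in> S \<rightarrow> A" "d \<in> S \<rightarrow> A" "x = F c" "y = F d" unfolding G_def by blast
    have "(\<lambda>s. c s \<oplus> d s) \<in> S \<rightarrow> A" using c by (simp add: Pi_def)
    then show "x \<oplus> y \<in> G" unfolding c(3,4) Fadd[OF AK[OF c(1)] AK[OF c(2)]] G_def by blast
  next
    fix a x assume a: "a \<in> A" and "x \<in> G"
    then obtain c where c: "c \<in> S \<rightarrow> A" "x = F c" unfolding G_def by blast
    have "(\<lambda>s. a \<otimes> c s) \<in> S \<rightarrow> A" using c a by (simp add: Pi_def)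
    then show "a \<otimes> x \<in> G" unfolding c(2) Fmult[OF A_K[OF a] AK[OF c(1)]] G_def by blast
  qed
  have "S \<subseteq> G"
  proof
    fix s assume s: "s \<in> S"
    have m: "(\<lambda>u. if u = s then \<one> else \<zero>) \<in> S \<rightarrow> A" by auto
    show "s \<in> G" unfolding G_def by (rule CollectI, rule exI, rule conjI[OF Fsingle[OF s, symmetric] m])
  qed
  then have mG: "maxA \<subseteq> G" unfolding S(3) by (rule ring.genideal_minimal[OF rA GI])
  have main: "\<exists>c. (\<forall>s\<in>S. c s \<in> mp n) \<and> x = F c" if "x \<in> mp (Suc n)" for n x
    using that[unfolded mp_Suc]
  proof (induct rule: ideal_prod.induct)
    case (prod i j)
    then obtain d where d: "d \<in> S \<rightarrow> A" "j = F d" using mG unfolding G_def by blast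
    have "i \<otimes> F d = F (\<lambda>s. i \<otimes> d s)" by (rule Fmult) (use prod mpE(2) AK d in auto)
    moreover have "i \<otimes> d s \<in> mp n" if "s \<in> S" for s using mpE(6)[of "d s" i n] d prod that by auto
    ultimately show ?case using d(2) by (intro exI[of _ "\<lambda>s. i \<otimes> d s"]) simp
  next
    case (sum x y)
    then obtain c d where c: "\<forall>s\<in>S. c s \<in> mp n" "x = F c" "\<forall>s\<in>S. d s \<in> mp n" "y = F d" by blast
    have "F c \<oplus> F d = F (\<lambda>s. c s \<oplus> d s)" by (rule Fadd) (use c mpE(2) in \<open>auto simp: Pi_def\<close>)
    moreover have "\<forall>s\<in>S. c s \<oplus> d s \<in> mp n" using c mpE(4) by blast
    ultimately show ?case using c(2,4) by (intro exI[of _ "\<lambda>s. c s \<oplus> d s"]) simp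
  qed
  have "S \<subseteq> maxA" using ring.genideal_self[OF rA, of S] S by simp
  then show ?thesis using that[OF S(2)] main unfolding F_def by blast
qed

text \<open>In the completion, the closure of \<open>\<mm>\<^sup>k\<^sup>+\<^sup>1\<close> is the sum of the \<open>s\<close>-multiples of the closure of \<open>\<mm>\<^sup>k\<close>, where
  \<open>s\<close> ranges over generators of \<open>\<mm>\<close>; this is where \<open>A\<close> has to be Noetherian.\<close>

lemma seqs_vanishing:
  assumes TT: "\<And>a b. a \<in> TT \<Longrightarrow> b \<in> TT \<Longrightarrow> (\<lambda>n. a n \<oplus> b n) \<in> TT"
    and cong: "\<And>a b. a \<in> TT \<Longrightarrow> b \<in> seqs \<Longrightarrow> (\<And>n. a n \<ominus> b n \<in> mp n) \<Longrightarrow> b \<in> TT"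
    and zero: "(\<lambda>_. \<zero>) \<in> TT"
    and gen: "\<And>s h. s \<in> maxA \<Longrightarrow> h \<in> seqs \<Longrightarrow> h k \<in> mp k \<Longrightarrow> (\<lambda>n. s \<otimes> h n) \<in> TT"
    and g: "g \<in> seqs" "g (Suc k) \<in> mp (Suc k)"
  shows "g \<in> TT"
proof -
  obtain S where S: "finite S" "S \<subseteq> maxA"
    "\<And>n x. x \<in> mp (Suc n) \<Longrightarrow> \<exists>c. (\<forall>s\<in>S. c s \<in> mp n) \<and> x = (\<Oplus>s\<in>S. c s \<otimes> s)"
    by (rule maxA_generators) (rule that)
  have SK: "s \<in> carrier K" if "s \<in> S" for s using that S(2) by (auto simp: maxA_def)
  define F where "F c = (\<Oplus>s\<in>S. c s \<otimes> s)" for c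
  have Fadd: "F (\<lambda>s. c s \<oplus> d s) = F c \<oplus> F d" if c: "\<And>s. s \<in> S \<Longrightarrow> c s \<in> carrier K" and d: "\<And>s. s \<in> S \<Longrightarrow> d s \<in> carrier K" for c d
  proof -
    have "F (\<lambda>s. c s \<oplus> d s) = (\<Oplus>s\<in>S. c s \<otimes> s \<oplus> d s \<otimes> s)"
      unfolding F_def by (rule finsum_cong') (use c d SK in \<open>auto simp: l_distr Pi_def\<close>)
    also have "\<dots> = F c \<oplus> F d" unfolding F_def by (rule finsum_addf) (use c d SK in \<open>auto simp: Pi_def\<close>)
    finally show ?thesis .
  qed
  have rep: "\<exists>c. (\<forall>s\<in>S. c s \<in> mp n) \<and> x = F c" if "x \<in> mp (Suc n)" for n x
    unfolding F_def by (rule S(3)[OF that])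
  obtain c0 where c0: "\<And>s. s \<in> S \<Longrightarrow> c0 s \<in> mp k" "g (Suc k) = F c0" using rep[OF g(2)] by blast
  have "\<forall>j. \<exists>c. (\<forall>s\<in>S. c s \<in> mp j) \<and> g (Suc (Suc j)) \<ominus> g (Suc j) = F c"
    using rep[OF seqs_step[OF g(1)]] by blast
  then obtain d where d: "\<And>j s. s \<in> S \<Longrightarrow> d j s \<in> mp j" "\<And>j. g (Suc (Suc j)) \<ominus> g (Suc j) = F (d j)" by metis
  \<comment> \<open>\<open>g (Suc k)\<close> and the later differences of \<open>g\<close> are
    combinations of \<open>S\<close> with coefficients in \<open>mp k\<close> and
    \<open>mp j\<close>. Adding up these coefficients separately for each generator gives Cauchy
    sequences.\<close>
  define hh where "hh s = rec_nat (c0 s) (\<lambda>m x. x \<oplus> d (k + m) s)" for s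
  have hh: "hh s 0 = c0 s" "hh s (Suc m) = hh s m \<oplus> d (k + m) s" for s m by (simp_all add: hh_def)
  have hA: "hh s m \<in> A" if s: "s \<in> S" for s m
    by (induct m) (use hh mpE(1)[OF c0(1)[OF s]] mpE(1)[OF d(1)[OF s]] in auto)
  \<comment> \<open>By truncated subtraction, \<open>h s\<close> is constant with value
    \<open>c0 s\<close> up to the index \<open>k\<close>.\<close>
  define h where "h s n = hh s (n - k)" for s n
  have hs: "h s \<in> seqs" if s: "s \<in> S" for s
  proof (rule seqsI)
    show "h s n \<in> A" for n using hA[OF s] by (simp add: h_def)
    fix n
    have K: "h s n \<in> carrier K" using hA[OF s] by (simp add: h_def)
    show "h s (Suc n) \<ominus> h s n \<in> mp n"
    proof (cases "n < k")
      case True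
      then have "h s (Suc n) = h s n" by (simp add: h_def)
      then show ?thesis using K mpE(3) by (simp add: minus_eq r_neg)
    next
      case False
      then have e: "Suc n - k = Suc (n - k)" "k + (n - k) = n" by auto
      have dn: "d n s \<in> mp n" by (rule d(1)[OF s])
      have dK: "d n s \<in> carrier K" by (rule mpE(2)[OF dn])
      have "h s (Suc n) = h s n \<oplus> d n s" unfolding h_def e(1) hh(2) e(2) by simp
      moreover have "h s n \<oplus> d n s \<ominus> h s n = d n s"
      proof -
        define x y where "x = h s n" and "y = d n s"
        have xy: "x \<in> carrier K" "y \<in> carrier K" using K dK by (simp_all add: x_def y_def)
        have "x \<oplus> y \<ominus> x = y" by (use xy in algebra)
        then show ?thesis by (simp add: x_def y_def)
      qed
      ultimately show ?thesis using dn by simp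
    qed
  qed
  have hk: "h s k \<in> mp k" if "s \<in> S" for s using c0(1)[OF that] by (simp add: h_def hh)
  have Fh: "F (\<lambda>s. hh s m) = g (Suc (k + m))" for m
  proof (induct m)
    case 0
    have "F (\<lambda>s. hh s 0) = F c0" by (simp add: hh(1))
    then show ?case using c0(2) by simp
  next
    case (Suc m)
    have "F (\<lambda>s. hh s (Suc m)) = F (\<lambda>s. hh s m) \<oplus> F (d (k + m))"
      unfolding hh(2) by (rule Fadd) (use A_K hA mpE(2) d(1) in blast)+
    also have "\<dots> = g (Suc (k + m)) \<oplus> (g (Suc (Suc (k + m))) \<ominus> g (Suc (k + m)))" unfolding Suc d(2) ..
    also have "\<dots> = g (Suc (Suc (k + m)))"
    proof -
      define x y where "x = g (Suc (k + m))" and "y = g (Suc (Suc (k + m)))"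
      have xy: "x \<in> carrier K" "y \<in> carrier K" using seqs_K[OF g(1)] by (simp_all add: x_def y_def)
      have "x \<oplus> (y \<ominus> x) = y" by (use xy in algebra)
      then show ?thesis by (simp add: x_def y_def)
    qed
    finally show ?case by simp
  qed
  have "(\<lambda>n. \<Oplus>s\<in>S'. h s n \<otimes> s) \<in> TT" if "S' \<subseteq> S" for S'
  proof -
    have "finite S'" using that S(1) finite_subset by blast
    then show ?thesis using that
    proof (induct S')
      case empty
      then show ?case using zero by simp
    next
      case (insert s S')
      have s: "s \<in> S" "s \<in> maxA" using insert(4) S(2) by auto
      have f: "(\<lambda>s. h s n \<otimes> s) \<in> S' \<rightarrow> carrier K" "h s n \<otimes> s \<in> carrier K" for n
        using insert(4) seqs_K[OF hs] SK by auto
      have "(\<lambda>n. s \<otimes> h s n \<oplus> (\<Oplus>s\<in>S'. h s n \<otimes> s)) \<in> TT"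
        by (rule TT[OF gen[OF s(2) hs[OF s(1)] hk[OF s(1)]]]) (use insert in blast)
      moreover have "(\<Oplus>s\<in>insert s S'. h s n \<otimes> s) = s \<otimes> h s n \<oplus> (\<Oplus>s\<in>S'. h s n \<otimes> s)" for n
        using finsum_insert[OF insert(1,2) f] SK[OF s(1)] seqs_K[OF hs[OF s(1)], of n] by (simp add: m_comm)
      ultimately show ?case by simp
    qed
  qed
  from this[OF order_refl] have FT: "(\<lambda>n. F (\<lambda>s. h s n)) \<in> TT" unfolding F_def .
  show ?thesis
  proof (rule cong[OF FT g(1)])
    fix n
    \<comment> \<open>The index of \<open>g\<close> on the right is at least \<open>n\<close>, so
      from \<open>n\<close> on \<open>g\<close> has changed by an element of \<open>mp n\<close>
      only.\<close>
    have e: "F (\<lambda>s. h s n) = g (Suc (k + (n - k)))" unfolding h_def by (rule Fh)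
    show "F (\<lambda>s. h s n) \<ominus> g n \<in> mp n" unfolding e by (rule seqs_diff[OF g(1)]) simp
  qed
qed

end

section \<open>Splitting and quadraticity of the trace\<close>

context trace
begin

text \<open>The sequences representing the ideal generated by \<open>t\<close> and
  \<open>J\<close>.\<close>

definition TT :: "(nat \<Rightarrow> 'a) set" where
  "TT = {g \<in> seqs. \<exists>h\<in>seqs. (\<lambda>n. g n \<ominus> t \<otimes> h n) \<in> J}"

lemma TT_I: "g \<in> seqs \<Longrightarrow> h \<in> seqs \<Longrightarrow> (\<lambda>n. g n \<ominus> t \<otimes> h n) \<in> J \<Longrightarrow> g \<in> TT"
  unfolding TT_def by blast

lemma TT_add: "a \<in> TT \<Longrightarrow> b \<in> TT \<Longrightarrow> (\<lambda>n. a n \<oplus> b n) \<in> TT"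
proof -
  assume "a \<in> TT" "b \<in> TT"
  then obtain h k where h: "a \<in> seqs" "h \<in> seqs" "(\<lambda>n. a n \<ominus> t \<otimes> h n) \<in> J"
    "b \<in> seqs" "k \<in> seqs" "(\<lambda>n. b n \<ominus> t \<otimes> k n) \<in> J" unfolding TT_def by blast
  show ?thesis
  proof (rule TT_I[OF seqs_add[OF h(1,4)] seqs_add[OF h(2,5)]], rule J_eq[OF J_add[OF h(3,6)]])
    fix n
    define x y z w where "x = a n" and "y = h n" and "z = b n" and "w = k n"
    have K: "x \<in> carrier K" "y \<in> carrier K" "z \<in> carrier K" "w \<in> carrier K" "t \<in> carrier K"
      using seqs_K h by (simp_all add: x_def y_def z_def w_def)
    have "x \<ominus> t \<otimes> y \<oplus> (z \<ominus> t \<otimes> w) = x \<oplus> z \<ominus> t \<otimes> (y \<oplus> w)"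
      by (use K in algebra)
    then show "a n \<ominus> t \<otimes> h n \<oplus> (b n \<ominus> t \<otimes> k n) = a n \<oplus> b n \<ominus> t \<otimes> (h n \<oplus> k n)"
      by (simp add: x_def y_def z_def w_def)
  qed
qed

lemma TT_mult: "c \<in> seqs \<Longrightarrow> a \<in> TT \<Longrightarrow> (\<lambda>n. c n \<otimes> a n) \<in> TT"
proof -
  assume c: "c \<in> seqs" and "a \<in> TT"
  then obtain h where h: "a \<in> seqs" "h \<in> seqs" "(\<lambda>n. a n \<ominus> t \<otimes> h n) \<in> J" unfolding TT_def by blast
  show ?thesis
  proof (rule TT_I[OF seqs_mult[OF c h(1)] seqs_mult[OF c h(2)]], rule J_eq[OF J_mult[OF c h(3)]])
    fix n
    define x y z where "x = a n" and "y = h n" and "z = c n"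
    have K: "x \<in> carrier K" "y \<in> carrier K" "z \<in> carrier K" "t \<in> carrier K"
      using seqs_K h c by (simp_all add: x_def y_def z_def)
    have "z \<otimes> (x \<ominus> t \<otimes> y) = z \<otimes> x \<ominus> t \<otimes> (z \<otimes> y)"
      by (use K in algebra)
    then show "c n \<otimes> (a n \<ominus> t \<otimes> h n) = c n \<otimes> a n \<ominus> t \<otimes> (c n \<otimes> h n)"
      by (simp add: x_def y_def z_def)
  qed
qed

lemma TT_cong: "a \<in> TT \<Longrightarrow> b \<in> seqs \<Longrightarrow> (\<And>n. a n \<ominus> b n \<in> mp n) \<Longrightarrow> b \<in> TT"
proof -
  assume "a \<in> TT" and b: "b \<in> seqs" and ab: "\<And>n. a n \<ominus> b n \<in> mp n"
  then obtain h where h: "a \<in> seqs" "h \<in> seqs" "(\<lambda>n. a n \<ominus> t \<otimes> h n) \<in> J" unfolding TT_def by blast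
  have s: "(\<lambda>n. b n \<ominus> t \<otimes> h n) \<in> seqs" by (intro seqs_minus seqs_mult seqs_const b h tA)
  show ?thesis
  proof (rule TT_I[OF b h(2)], rule J_cong[OF h(3) s])
    fix n
    define x y z where "x = a n" and "y = h n" and "z = b n"
    have K: "x \<in> carrier K" "y \<in> carrier K" "z \<in> carrier K" "t \<in> carrier K"
      using seqs_K h b by (simp_all add: x_def y_def z_def)
    have "x \<ominus> t \<otimes> y \<ominus> (z \<ominus> t \<otimes> y) = x \<ominus> z" by (use K in algebra)
    then show "a n \<ominus> t \<otimes> h n \<ominus> (b n \<ominus> t \<otimes> h n) \<in> mp n" using ab[of n] by (simp add: x_def y_def z_def)
  qed
qed

lemma TT_zero: "(\<lambda>_. \<zero>) \<in> TT"
  by (rule TT_I[of _ "\<lambda>_. \<zero>"]) (simp_all add: seqs_const J_zero minus_eq)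

text \<open>Elements x and y of \<open>maxA\<close> are multiples of \<open>t\<close> in
  \<open>V\<close>, hence congruent modulo P to tf and tg in the completion. The product of x - tf
  and y - tg is in \<open>J\<close> and differs from xy by a multiple of \<open>t\<close>.\<close>

lemma TT_square: "x \<in> maxA \<Longrightarrow> y \<in> maxA \<Longrightarrow> (\<lambda>_. x \<otimes> y) \<in> TT"
proof -
  assume x: "x \<in> maxA" and y: "y \<in> maxA"
  have xA: "x \<in> A" "x \<in> nV 1" "y \<in> A" "y \<in> nV 1" using x y by (simp_all add: maxA_def)
  obtain f where f: "f \<in> seqs" "\<And>n. x \<ominus> t [^] (1::nat) \<otimes> f n \<in> nV n" by (rule lift_tpow[OF xA(2)]) (rule that)
  obtain g where g: "g \<in> seqs" "\<And>n. y \<ominus> t [^] (1::nat) \<otimes> g n \<in> nV n" by (rule lift_tpow[OF xA(4)]) (rule that)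
  have P: "x \<ominus> t \<otimes> f n \<in> nV n" "y \<ominus> t \<otimes> g n \<in> nV n" for n using f(2)[of n] g(2)[of n] by simp_all
  have s: "(\<lambda>n. x \<ominus> t \<otimes> f n) \<in> seqs" "(\<lambda>n. y \<ominus> t \<otimes> g n) \<in> seqs"
    by (intro seqs_minus seqs_mult seqs_const f g xA tA)+
  define h where "h n = x \<otimes> g n \<oplus> y \<otimes> f n \<ominus> t \<otimes> (f n \<otimes> g n)" for n
  have h: "h \<in> seqs" unfolding h_def by (intro seqs_minus seqs_add seqs_mult seqs_const f g xA tA)
  show ?thesis
  proof (rule TT_I[OF seqs_const h], use xA in simp, rule J_eq[OF J_PP[OF s P]])
    fix n
    define p q where "p = f n" and "q = g n"
    have K: "p \<in> carrier K" "q \<in> carrier K" "x \<in> carrier K" "y \<in> carrier K" "t \<in> carrier K"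
      using seqs_K f g xA by (simp_all add: p_def q_def)
    have "(x \<ominus> t \<otimes> p) \<otimes> (y \<ominus> t \<otimes> q) = x \<otimes> y \<ominus> t \<otimes> (x \<otimes> q \<oplus> y \<otimes> p \<ominus> t \<otimes> (p \<otimes> q))"
      by (use K in algebra)
    then show "(x \<ominus> t \<otimes> f n) \<otimes> (y \<ominus> t \<otimes> g n) = x \<otimes> y \<ominus> t \<otimes> h n" by (simp add: p_def q_def h_def)
  qed
qed

text \<open>By \<open>seqs_vanishing\<close>, applied once for each of the two factors, an element
  of the closure of the square of \<open>maxA\<close> is a combination of products of two elements
  of \<open>maxA\<close>, and these are covered by \<open>TT_square\<close>.\<close>

lemma TT_vanishing: "g \<in> seqs \<Longrightarrow> g 2 \<in> mp 2 \<Longrightarrow> g \<in> TT"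
proof -
  have s1: "(\<lambda>n. s \<otimes> g n) \<in> TT" if s: "s \<in> maxA" and g: "g \<in> seqs" "g 1 \<in> mp 1" for s g
  proof -
    have sA: "s \<in> A" using s by (simp add: maxA_def)
    \<comment> \<open>The inner application concerns the cofactors of a fixed s in
      \<open>maxA\<close>, so membership in \<open>TT\<close> is tested after multiplication by
      s.\<close>
    define U where "U = {g \<in> seqs. (\<lambda>n. s \<otimes> g n) \<in> TT}"
    have "g \<in> U"
    proof (rule seqs_vanishing[where k = 0])
      fix a b assume "a \<in> U" "b \<in> U"
      then have ab: "a \<in> seqs" "b \<in> seqs" "(\<lambda>n. s \<otimes> a n) \<in> TT" "(\<lambda>n. s \<otimes> b n) \<in> TT" by (simp_all add: U_def)
      have e: "s \<otimes> (a n \<oplus> b n) = s \<otimes> a n \<oplus> s \<otimes> b n" for n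
        using sA seqs_K[OF ab(1)] seqs_K[OF ab(2)] by (simp add: r_distr)
      show "(\<lambda>n. a n \<oplus> b n) \<in> U" unfolding U_def using TT_add[OF ab(3,4)] seqs_add[OF ab(1,2)] by (simp add: e)
    next
      fix a b assume a: "a \<in> U" and b: "b \<in> seqs" and ab: "\<And>n. a n \<ominus> b n \<in> mp n"
      have as: "a \<in> seqs" "(\<lambda>n. s \<otimes> a n) \<in> TT" using a by (simp_all add: U_def)
      have e: "s \<otimes> a n \<ominus> s \<otimes> b n = s \<otimes> (a n \<ominus> b n)" for n
        using sA seqs_K[OF as(1), of n] seqs_K[OF b, of n] by (simp add: minus_eq r_distr r_minus)
      have "(\<lambda>n. s \<otimes> b n) \<in> TT"
        by (rule TT_cong[OF as(2) seqs_mult[OF seqs_const[OF sA] b]]) (simp add: e mpE(5)[OF sA ab])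
      then show "b \<in> U" using b by (simp add: U_def)
    next
      show "(\<lambda>_. \<zero>) \<in> U" using TT_zero seqs_const sA by (simp add: U_def)
    next
      fix s' h assume s': "s' \<in> maxA" and h: "h \<in> seqs"
      have s'A: "s' \<in> A" using s' by (simp add: maxA_def)
      have "(\<lambda>n. h n \<otimes> (s \<otimes> s')) \<in> TT" by (rule TT_mult[OF h TT_square[OF s s']])
      moreover have "h n \<otimes> (s \<otimes> s') = s \<otimes> (s' \<otimes> h n)" for n
        using sA s'A seqs_K[OF h, of n] by (simp add: m_ac)
      ultimately have "(\<lambda>n. s \<otimes> (s' \<otimes> h n)) \<in> TT" by simp
      then show "(\<lambda>n. s' \<otimes> h n) \<in> U" using seqs_mult[OF seqs_const[OF s'A] h] by (simp add: U_def)
    qed (use g in auto)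
    then show ?thesis by (simp add: U_def)
  qed
  assume g: "g \<in> seqs" "g 2 \<in> mp 2"
  show "g \<in> TT"
  proof (rule seqs_vanishing[where k = 1 and TT = TT])
    show "g (Suc 1) \<in> mp (Suc 1)" using g(2) by (simp add: numeral_2_eq_2)
  qed (use g s1 TT_add TT_cong TT_zero in blast)+
qed

text \<open>Every element of the completion is an element of \<open>A\<close> plus one in the
  closure of the square of \<open>maxA\<close>. The latter is a multiple of \<open>t\<close> modulo
  \<open>J\<close>.\<close>

lemma T_split: "r \<in> T \<Longrightarrow> \<exists>a\<in>A. \<exists>r'\<in>T. r = a \<oplus> t \<otimes> r'"
proof -
  assume "r \<in> T"
  then obtain f where f: "rel r f" unfolding T_def by blast
  have fs: "f \<in> seqs" using f by (simp add: rel_def)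
  \<comment> \<open>Truncation at index 2, because products of two elements of \<open>maxA\<close>
    are needed for divisibility by \<open>t\<close>.\<close>
  define a where "a = f 2"
  have a: "a \<in> A" using seqs_A[OF fs] by (simp add: a_def)
  define g where "g n = f n \<oplus> \<ominus> a" for n
  have g: "g \<in> seqs" unfolding g_def by (intro seqs_add seqs_const fs) (use a in simp)
  have "g 2 \<in> mp 2" using a mpE(3) by (simp add: g_def a_def[symmetric] r_neg)
  then have "g \<in> TT" by (rule TT_vanishing[OF g])
  then obtain h where h: "h \<in> seqs" "(\<lambda>n. g n \<ominus> t \<otimes> h n) \<in> J" unfolding TT_def by blast
  have rg: "rel (r \<oplus> \<ominus> a) g" unfolding g_def by (rule rel_add[OF f rel_const]) (use a in simp)
  obtain r' where r': "r \<oplus> \<ominus> a = t \<otimes> r'" "rel r' h" using rel_div[OF rg tA t_nz h] by blast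
  have K: "r \<in> carrier K" "a \<in> carrier K" using rel_V(1)[OF f] a by simp_all
  have "a \<oplus> (r \<oplus> \<ominus> a) = r" by (use K in algebra)
  then have "r = a \<oplus> t \<otimes> r'" using r'(1) by simp
  then show ?thesis using a r'(2) unfolding T_def by blast
qed

lemma T_quadratic: "quadratic T"
  unfolding quadratic_def
proof (intro ballI)
  fix x y assume x: "x \<in> V" and y: "y \<in> V"
  note TE = mid_closed[OF T_mid]
  have den: "\<exists>N. t [^] (N::nat) \<otimes> z \<in> T" if z: "z \<in> V" for z
  proof -
    obtain a b where b: "a \<in> A" "b \<in> A" "b \<noteq> \<zero>" "b \<otimes> z = a" using V_frac[OF z] by blast
    obtain N r where r: "r \<in> T" "t [^] (N::nat) = b \<otimes> r" using T_tpow[OF b(2,3)] by blast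
    have K: "b \<in> carrier K" "r \<in> carrier K" "z \<in> carrier K" using b r z TE(3) by auto
    have "b \<otimes> r \<otimes> z = r \<otimes> (b \<otimes> z)" by (use K in algebra)
    then have "t [^] N \<otimes> z = r \<otimes> a" unfolding r(2) b(4) .
    then have "t [^] N \<otimes> z \<in> T" using TE(8)[OF r(1) TE(1)[OF b(1)]] by simp
    then show ?thesis by blast
  qed
  obtain N1 N2 where N: "t [^] (N1::nat) \<otimes> x \<in> T" "t [^] (N2::nat) \<otimes> y \<in> T" using den x y by blast
  \<comment> \<open>A common exponent that clears both denominators. With approximations modulo t^k,
    the elements t^k(x - c) and t^k(y - d) are in \<open>T\<close> and in \<open>nV (k + k)\<close>,
    so their product can be divided by t^(2k) within \<open>T\<close>.\<close>
  define k where "k = N1 + N2"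
  have tT: "t [^] (i::nat) \<in> T" for i using TE(6,11) by blast
  have xk: "t [^] k \<otimes> x \<in> T"
    using tpow_add[of x N2 N1] TE(8)[OF tT N(1)] x by (simp add: k_def add.commute)
  have yk: "t [^] k \<otimes> y \<in> T" using tpow_add[of y N1 N2] TE(8)[OF tT N(2)] y by (simp add: k_def)
  obtain c where c: "c \<in> A" "x \<ominus> c \<in> nV k" by (rule V_dense[OF x]) (rule that)
  obtain d where d: "d \<in> A" "y \<ominus> d \<in> nV k" by (rule V_dense[OF y]) (rule that)
  have in_T: "t [^] k \<otimes> (z \<ominus> e) \<in> T" "t [^] k \<otimes> (z \<ominus> e) \<in> nV (k + k)"
    if z: "z \<in> V" "t [^] k \<otimes> z \<in> T" and e: "e \<in> A" "z \<ominus> e \<in> nV k" for z e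
  proof -
    have "t [^] k \<otimes> (z \<ominus> e) = t [^] k \<otimes> z \<ominus> t [^] k \<otimes> e" using z e by (simp add: minus_eq r_distr r_minus)
    moreover have "t [^] k \<otimes> e \<in> T" using TE(8)[OF tT TE(1)[OF e(1)]] .
    ultimately show "t [^] k \<otimes> (z \<ominus> e) \<in> T" using TE(10)[OF z(2)] by simp
    show "t [^] k \<otimes> (z \<ominus> e) \<in> nV (k + k)" by (rule nV_tmult[OF e(2)])
  qed
  obtain r where r: "r \<in> T" "(t [^] k \<otimes> (x \<ominus> c)) \<otimes> (t [^] k \<otimes> (y \<ominus> d)) = t [^] (k + k) \<otimes> r"
    using T_mult_div[OF in_T[OF x xk c] in_T[OF y yk d]] by blast
  define s where "s = t [^] k"
  have K: "x \<in> carrier K" "y \<in> carrier K" "c \<in> carrier K" "d \<in> carrier K" "s \<in> carrier K" "r \<in> carrier K"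
    using x y c d r TE(3) by (auto simp: s_def)
  have ss: "t [^] (k + k) = s \<otimes> s" by (simp add: s_def nat_pow_mult)
  have "(s \<otimes> s) \<otimes> ((x \<ominus> c) \<otimes> (y \<ominus> d)) = (s \<otimes> (x \<ominus> c)) \<otimes> (s \<otimes> (y \<ominus> d))"
    by (use K in algebra)
  also have "\<dots> = (s \<otimes> s) \<otimes> r" using r(2) unfolding ss s_def .
  finally have "(x \<ominus> c) \<otimes> (y \<ominus> d) = r"
    by (rule cancel[rotated 4]) (use K tpow_nz[of "k + k"] ss in simp_all)
  then have "(x \<ominus> c) \<otimes> (y \<ominus> d) \<ominus> c \<otimes> d \<oplus> d \<otimes> x \<oplus> c \<otimes> y = (r \<ominus> c \<otimes> d) \<oplus> d \<otimes> x \<oplus> c \<otimes> y" by simp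
  moreover have "(x \<ominus> c) \<otimes> (y \<ominus> d) \<ominus> c \<otimes> d \<oplus> d \<otimes> x \<oplus> c \<otimes> y = x \<otimes> y"
    by (use K in algebra)
  ultimately have e: "x \<otimes> y = (r \<ominus> c \<otimes> d) \<oplus> d \<otimes> x \<oplus> c \<otimes> y" by simp
  have "r \<ominus> c \<otimes> d \<in> T" using TE(10)[OF r(1) TE(8)[OF TE(1)[OF c(1)] TE(1)[OF d(1)]]] .
  then show "\<exists>r\<in>T. \<exists>s\<in>T. \<exists>s'\<in>T. x \<otimes> y = r \<oplus> s \<otimes> x \<oplus> s' \<otimes> y"
    using e TE(1)[OF c(1)] TE(1)[OF d(1)] by blast
qed

theorem T_bad: "T \<noteq> V \<Longrightarrow> bad_noetherian_stable_domain K T"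
  by (rule bad_noetherian_stableI[OF T_mid T_local T_quadratic T_split T_tpow])

theorem T_tight: "tightly_dominates K T A"
  by (rule tightly_dominatesI[OF T_mid T_local T_split])

end

section \<open>Ideals of the completion\<close>

lemma cring_idealI:
  assumes T: "cring T" and sub: "I \<subseteq> carrier T" and zero: "\<zero>\<^bsub>T\<^esub> \<in> I"
    and add: "\<And>x y. x \<in> I \<Longrightarrow> y \<in> I \<Longrightarrow> x \<oplus>\<^bsub>T\<^esub> y \<in> I"
    and mult: "\<And>a x. a \<in> carrier T \<Longrightarrow> x \<in> I \<Longrightarrow> a \<otimes>\<^bsub>T\<^esub> x \<in> I"
  shows "ideal I T"
proof -
  interpret cring T by (rule T)
  show ?thesis
  proof (rule idealI[OF ring_axioms])
    show "subgroup I (add_monoid T)"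
    proof (rule add.subgroupI[OF sub])
      show "I \<noteq> {}" using zero by blast
      show "\<ominus>\<^bsub>T\<^esub> x \<in> I" if x: "x \<in> I" for x
        using mult[of "\<ominus>\<^bsub>T\<^esub> \<one>\<^bsub>T\<^esub>" x] x sub l_minus[of "\<one>\<^bsub>T\<^esub>" x] by auto
    qed (use add in auto)
    fix a x assume a: "a \<in> I" and x: "x \<in> carrier T"
    then show "x \<otimes>\<^bsub>T\<^esub> a \<in> I" "a \<otimes>\<^bsub>T\<^esub> x \<in> I" using mult[OF x a] sub m_comm[of x a] by auto
  qed
qed

section \<open>The kernel, its square and its symbolic square\<close>

context tight_pair
begin

lemma ideal_AhatD:
  assumes I: "ideal I Ahat"
  shows "f \<in> I \<Longrightarrow> f \<in> carrier Ahat" "\<zero>\<^bsub>Ahat\<^esub> \<in> I" "f \<in> I \<Longrightarrow> g \<in> I \<Longrightarrow> f \<oplus>\<^bsub>Ahat\<^esub> g \<in> I"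
    "g \<in> carrier Ahat \<Longrightarrow> f \<in> I \<Longrightarrow> g \<otimes>\<^bsub>Ahat\<^esub> f \<in> I" "f \<in> I \<Longrightarrow> g \<in> carrier Ahat \<Longrightarrow> f \<otimes>\<^bsub>Ahat\<^esub> g \<in> I"
  using ideal.Icarr[OF I] additive_subgroup.zero_closed[OF ideal.axioms(1)[OF I]]
    additive_subgroup.a_closed[OF ideal.axioms(1)[OF I]] ideal.I_l_closed[OF I] ideal.I_r_closed[OF I] by auto

text \<open>The valuation h of \<open>a n\<close> is less than \<open>n\<close>, and all later terms
  agree with \<open>a n\<close> modulo t^n; so the valuation never changes again.\<close>

lemma val_stable:
  assumes a: "a \<in> seqs" and n: "a n \<notin> nV n"
  obtains h where "h < n" "\<And>N. n \<le> N \<Longrightarrow> \<exists>u\<in>V. u \<notin> nV 1 \<and> a N = t [^] (h::nat) \<otimes> u"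
proof -
  have "a n \<in> V" "a n \<noteq> \<zero>" using A_V[OF seqs_A[OF a]] n nV_zero by metis+
  then obtain h u where u: "u \<in> V" "u \<notin> nV 1" "a n = t [^] (h::nat) \<otimes> u" by (rule V_dec)
  have hn: "h < n"
  proof (rule ccontr)
    assume "\<not> h < n"
    then show False using nV_mono[of n h "a n"] nV_I[OF u(1), of h] u(3) n by simp
  qed
  have "\<exists>v\<in>V. v \<notin> nV 1 \<and> a N = t [^] h \<otimes> v" if N: "n \<le> N" for N
  proof -
    have "a N \<ominus> a n \<in> nV n" by (rule mp_nV[OF seqs_diff[OF a N]])
    then obtain y where y: "y \<in> V" "a N \<ominus> a n = t [^] n \<otimes> y" using nV_E by blast
    have e: "t [^] n \<otimes> y = t [^] h \<otimes> (t [^] (n - h) \<otimes> y)" using tpow_add[of y h "n - h"] y hn by simp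
    define z where "z = t [^] (n - h) \<otimes> y"
    have z: "z \<in> nV 1" unfolding z_def by (rule nV_mono[OF _ nV_I[OF y(1)]]) (use hn in simp)
    have K: "a N \<in> carrier K" "a n \<in> carrier K" using seqs_K[OF a] by simp_all
    have "a N = (a N \<ominus> a n) \<oplus> a n" using K by (simp add: minus_eq a_assoc l_neg)
    also have "\<dots> = t [^] h \<otimes> (z \<oplus> u)" unfolding y(2) e z_def[symmetric] unfolding u(3)
      using z u(1) by (simp add: r_distr)
    finally have eq: "a N = t [^] h \<otimes> (z \<oplus> u)" .
    have "z \<oplus> u \<notin> nV 1"
    proof
      assume "z \<oplus> u \<in> nV 1"
      then have "(z \<oplus> u) \<ominus> z \<in> nV 1" by (rule nV_minus[OF _ z])
      moreover have K: "z \<in> carrier K" "u \<in> carrier K" using z u by simp_all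
      have "(z \<oplus> u) \<ominus> z = u" by (use K in algebra)
      ultimately show False using u(2) by simp
    qed
    moreover have "z \<oplus> u \<in> V" using nV_V[OF z] u(1) by simp
    ultimately show ?thesis using eq by blast
  qed
  then show ?thesis using that[OF hn] by blast
qed

lemma P_cases:
  assumes "x \<in> PA"
  obtains a where "a \<in> seqs" "\<And>n. a n \<in> nV n" "x = cl a"
proof -
  obtain a where a: "a \<in> seqs" "x = cl a" by (rule Ahat_cases[OF subsetD[OF P_carrier assms]]) (rule that)
  then show ?thesis using that[of a] assms cl_in_P[OF a(1)] by blast
qed

lemma P_ideal: "ideal PA Ahat"
proof (rule cring_idealI[OF Ahat_cring P_carrier])
  show "\<zero>\<^bsub>Ahat\<^esub> \<in> PA" unfolding cl_zero using cl_in_P[OF seqs_const] by simp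
next
  fix x y assume xy: "x \<in> PA" "y \<in> PA"
  obtain a where a: "a \<in> seqs" "\<And>n. a n \<in> nV n" "x = cl a" by (rule P_cases[OF xy(1)]) (rule that)
  obtain b where b: "b \<in> seqs" "\<And>n. b n \<in> nV n" "y = cl b" by (rule P_cases[OF xy(2)]) (rule that)
  show "x \<oplus>\<^bsub>Ahat\<^esub> y \<in> PA" using a b cl_in_P[OF seqs_add[OF a(1) b(1)]] nV_add by (simp add: cl_simps)
next
  fix x y assume x: "x \<in> carrier Ahat" and y: "y \<in> PA"
  obtain a where a: "a \<in> seqs" "x = cl a" by (rule Ahat_cases[OF x]) (rule that)
  obtain b where b: "b \<in> seqs" "\<And>n. b n \<in> nV n" "y = cl b" by (rule P_cases[OF y]) (rule that)
  show "x \<otimes>\<^bsub>Ahat\<^esub> y \<in> PA" using a b cl_in_P[OF seqs_mult[OF a(1) b(1)]] nV_mult[OF A_V[OF seqs_A[OF a(1)]]] by (simp add: cl_simps)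
qed

lemma P_prime: "f \<in> carrier Ahat \<Longrightarrow> g \<in> carrier Ahat \<Longrightarrow> f \<otimes>\<^bsub>Ahat\<^esub> g \<in> PA \<Longrightarrow> f \<in> PA \<or> g \<in> PA"
proof (rule ccontr)
  assume "f \<in> carrier Ahat" "g \<in> carrier Ahat" and fg: "f \<otimes>\<^bsub>Ahat\<^esub> g \<in> PA" and n: "\<not> (f \<in> PA \<or> g \<in> PA)"
  then obtain a b where ab: "a \<in> seqs" "f = cl a" "b \<in> seqs" "g = cl b" using Ahat_cases by metis
  obtain i where i: "a i \<notin> nV i" using n ab cl_in_P by blast
  obtain j where j: "b j \<notin> nV j" using n ab cl_in_P by blast
  obtain h where h: "h < i" "\<And>N. i \<le> N \<Longrightarrow> \<exists>u\<in>V. u \<notin> nV 1 \<and> a N = t [^] (h::nat) \<otimes> u" by (rule val_stable[OF ab(1) i]) (rule that)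
  obtain k where k: "k < j" "\<And>N. j \<le> N \<Longrightarrow> \<exists>u\<in>V. u \<notin> nV 1 \<and> b N = t [^] (k::nat) \<otimes> u" by (rule val_stable[OF ab(3) j]) (rule that)
  \<comment> \<open>At the index i + j both valuations are stable. The product has valuation h + k
    there, which is less than i + j.\<close>
  obtain u where u: "u \<in> V" "u \<notin> nV 1" "a (i + j) = t [^] h \<otimes> u" using h(2)[of "i + j"] by auto
  obtain v where v: "v \<in> V" "v \<notin> nV 1" "b (i + j) = t [^] k \<otimes> v" using k(2)[of "i + j"] by auto
  have "cl (\<lambda>n. a n \<otimes> b n) \<in> PA" using fg ab by (simp add: cl_simps)
  then have "a (i + j) \<otimes> b (i + j) \<in> nV (i + j)" using cl_in_P[OF seqs_mult[OF ab(1,3)]] by blast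
  moreover have "a (i + j) \<otimes> b (i + j) = t [^] (h + k) \<otimes> (u \<otimes> v)"
    unfolding u(3) v(3) using u(1) v(1) tpow_add[of "u \<otimes> v" h k] by (simp add: m_ac)
  moreover have "u \<otimes> v \<notin> nV 1" using nV1_prime u v by blast
  ultimately have "i + j \<le> h + k" using nV_bound[of "u \<otimes> v" "h + k" "i + j"] u(1) v(1) by simp
  then show False using h(1) k(1) by simp
qed

lemma one_notin_P: "\<one>\<^bsub>Ahat\<^esub> \<notin> PA"
proof
  assume "\<one>\<^bsub>Ahat\<^esub> \<in> PA"
  then have "cl (\<lambda>_. \<one>) \<in> PA" by (simp add: cl_one)
  then have "\<one> \<in> nV 1" using cl_in_P[OF seqs_const[of \<one>]] A_closed by blast
  then show False by simp
qed

lemma P_contraction: "{a \<in> A. to_completion (sub K A) a \<in> PA} = {\<zero>}"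
proof -
  have "to_completion (sub K A) a \<in> PA \<longleftrightarrow> a = \<zero>" if a: "a \<in> A" for a
    unfolding to_completion_cl using cl_in_P[OF seqs_const[OF a]] nV_sep[OF A_V[OF a]] by auto
  then show ?thesis by auto
qed

lemma P_square_I: "f \<in> PA \<Longrightarrow> g \<in> PA \<Longrightarrow> f \<otimes>\<^bsub>Ahat\<^esub> g \<in> ideal_power Ahat PA 2"
proof -
  assume f: "f \<in> PA" and g: "g \<in> PA"
  have fc: "f \<in> carrier Ahat" using f P_carrier by blast
  have r: "ring Ahat" using Ahat_cring by (rule cring.axioms)
  have one: "\<one>\<^bsub>Ahat\<^esub> \<in> carrier Ahat" by (simp add: cl_simps)
  \<comment> \<open>The powers start from the unit ideal, whence the additional factor
    \<open>carrier Ahat\<close>.\<close>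
  have e: "ideal_power Ahat PA 2 = (carrier Ahat \<cdot>\<^bsub>Ahat\<^esub> PA) \<cdot>\<^bsub>Ahat\<^esub> PA"
    by (simp add: ideal_power_def ideals_set_def numeral_2_eq_2)
  have "\<one>\<^bsub>Ahat\<^esub> \<otimes>\<^bsub>Ahat\<^esub> f \<in> carrier Ahat \<cdot>\<^bsub>Ahat\<^esub> PA" by (rule ideal_prod.prod[OF one f])
  then have "f \<in> carrier Ahat \<cdot>\<^bsub>Ahat\<^esub> PA" using monoid.l_one[OF ring.is_monoid[OF r] fc] by simp
  then show ?thesis unfolding e by (rule ideal_prod.prod[OF _ g])
qed

lemma P_square_least:
  assumes J: "ideal I Ahat" and PP: "\<And>f g. f \<in> PA \<Longrightarrow> g \<in> PA \<Longrightarrow> f \<otimes>\<^bsub>Ahat\<^esub> g \<in> I"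
  shows "ideal_power Ahat PA 2 \<subseteq> I"
proof
  note JE = ideal_AhatD[OF J]
  note PE = ideal_AhatD[OF P_ideal]
  have e: "ideal_power Ahat PA 2 = (carrier Ahat \<cdot>\<^bsub>Ahat\<^esub> PA) \<cdot>\<^bsub>Ahat\<^esub> PA"
    by (simp add: ideal_power_def ideals_set_def numeral_2_eq_2)
  have sub: "x \<in> PA" if "x \<in> carrier Ahat \<cdot>\<^bsub>Ahat\<^esub> PA" for x
    using that by (induct rule: ideal_prod.induct) (use PE(3,4) in blast)+
  fix x assume "x \<in> ideal_power Ahat PA 2"
  then show "x \<in> I" unfolding e
    by (induct rule: ideal_prod.induct) (use PP sub JE(3) in blast)+
qed

lemma P_square_ideal: "ideal (ideal_power Ahat PA 2) Ahat"
proof -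
  have r: "ring Ahat" using Ahat_cring by (rule cring.axioms)
  show ?thesis
    using ring.ideal_prod_is_ideal[OF r ring.ideal_prod_is_ideal[OF r ring.oneideal[OF r] P_ideal] P_ideal]
    by (simp add: ideal_power_def ideals_set_def numeral_2_eq_2)
qed

abbreviation SP :: "(nat \<Rightarrow> 'a set) set" where "SP \<equiv> symbolic_power Ahat PA 2"

lemma SP_iff: "x \<in> SP \<longleftrightarrow> x \<in> carrier Ahat \<and> (\<exists>s\<in>carrier Ahat. s \<notin> PA \<and> s \<otimes>\<^bsub>Ahat\<^esub> x \<in> ideal_power Ahat PA 2)"
  by (auto simp: symbolic_power_def)

text \<open>Since the kernel is prime, multipliers outside it are closed under products. This gives
  closure under addition and the last clause, the form in which primary ideals enter
  \<open>trace\<close>.\<close>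

lemma SP_props:
  shows "ideal SP Ahat" "SP \<subseteq> PA" "ideal_power Ahat PA 2 \<subseteq> SP"
    "\<And>f g. f \<in> carrier Ahat \<Longrightarrow> g \<in> carrier Ahat \<Longrightarrow> f \<otimes>\<^bsub>Ahat\<^esub> g \<in> SP \<Longrightarrow> f \<notin> SP \<Longrightarrow> g \<in> PA"
proof -
  let ?B = Ahat
  let ?Q = "ideal_power Ahat PA 2"
  note QE = ideal_AhatD[OF P_square_ideal]
  interpret B: comm_monoid ?B using Ahat_cring by (simp add: cring_def)
  show SPP: "SP \<subseteq> PA"
  proof
    fix x assume "x \<in> SP"
    then obtain s where s: "s \<in> carrier ?B" "s \<notin> PA" "s \<otimes>\<^bsub>?B\<^esub> x \<in> ?Q" "x \<in> carrier ?B" unfolding SP_iff by blast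
    have "?Q \<subseteq> PA" by (rule P_square_least[OF P_ideal]) (use ideal_AhatD[OF P_ideal] in blast)
    then show "x \<in> PA" using P_prime[OF s(1,4)] s(2,3) by blast
  qed
  show QS: "?Q \<subseteq> SP"
  proof
    fix x assume x: "x \<in> ?Q"
    then have xc: "x \<in> carrier ?B" by (rule QE(1))
    then have "\<one>\<^bsub>?B\<^esub> \<otimes>\<^bsub>?B\<^esub> x \<in> ?Q" using x by simp
    then show "x \<in> SP" unfolding SP_iff using xc one_notin_P B.one_closed by blast
  qed
  have prod_notin: "s \<otimes>\<^bsub>?B\<^esub> s' \<notin> PA" if "s \<in> carrier ?B" "s' \<in> carrier ?B" "s \<notin> PA" "s' \<notin> PA" for s s'
    using P_prime that by blast
  show "ideal SP ?B"
  proof (rule cring_idealI[OF Ahat_cring])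
    show "SP \<subseteq> carrier ?B" unfolding SP_iff by (auto simp: symbolic_power_def)
    show "\<zero>\<^bsub>?B\<^esub> \<in> SP" using QS QE(2) by blast
  next
    fix x y assume "x \<in> SP" "y \<in> SP"
    then obtain s s' where s: "s \<in> carrier ?B" "s \<notin> PA" "s \<otimes>\<^bsub>?B\<^esub> x \<in> ?Q" "x \<in> carrier ?B"
      "s' \<in> carrier ?B" "s' \<notin> PA" "s' \<otimes>\<^bsub>?B\<^esub> y \<in> ?Q" "y \<in> carrier ?B" unfolding SP_iff by blast
    have r: "ring ?B" using Ahat_cring by (rule cring.axioms)
    have "(s \<otimes>\<^bsub>?B\<^esub> s') \<otimes>\<^bsub>?B\<^esub> (x \<oplus>\<^bsub>?B\<^esub> y) = s' \<otimes>\<^bsub>?B\<^esub> (s \<otimes>\<^bsub>?B\<^esub> x) \<oplus>\<^bsub>?B\<^esub> s \<otimes>\<^bsub>?B\<^esub> (s' \<otimes>\<^bsub>?B\<^esub> y)"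
      using s ring.ring_simprules(23)[OF r, of x y "s \<otimes>\<^bsub>?B\<^esub> s'"] by (simp add: B.m_ac)
    also have "\<dots> \<in> ?Q" by (intro QE(3,4) s)
    finally have "(s \<otimes>\<^bsub>?B\<^esub> s') \<otimes>\<^bsub>?B\<^esub> (x \<oplus>\<^bsub>?B\<^esub> y) \<in> ?Q" .
    moreover have "x \<oplus>\<^bsub>?B\<^esub> y \<in> carrier ?B" by (rule ring.ring_simprules(1)[OF r s(4,8)])
    ultimately show "x \<oplus>\<^bsub>?B\<^esub> y \<in> SP" unfolding SP_iff using prod_notin[OF s(1,5,2,6)] B.m_closed[OF s(1,5)] by blast
  next
    fix a x assume a: "a \<in> carrier ?B" and "x \<in> SP"
    then obtain s where s: "s \<in> carrier ?B" "s \<notin> PA" "s \<otimes>\<^bsub>?B\<^esub> x \<in> ?Q" "x \<in> carrier ?B" unfolding SP_iff by blast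
    have "s \<otimes>\<^bsub>?B\<^esub> (a \<otimes>\<^bsub>?B\<^esub> x) = a \<otimes>\<^bsub>?B\<^esub> (s \<otimes>\<^bsub>?B\<^esub> x)" using s a by (simp add: B.m_ac)
    then have "s \<otimes>\<^bsub>?B\<^esub> (a \<otimes>\<^bsub>?B\<^esub> x) \<in> ?Q" using QE(4)[OF a s(3)] by simp
    then show "a \<otimes>\<^bsub>?B\<^esub> x \<in> SP" unfolding SP_iff using s(1,2) B.m_closed[OF a s(4)] by blast
  qed
  fix f g assume f: "f \<in> carrier ?B" and g: "g \<in> carrier ?B" and fg: "f \<otimes>\<^bsub>?B\<^esub> g \<in> SP" and nf: "f \<notin> SP"
  show "g \<in> PA"
  proof (rule ccontr)
    assume ng: "g \<notin> PA"
    obtain s where s: "s \<in> carrier ?B" "s \<notin> PA" "s \<otimes>\<^bsub>?B\<^esub> (f \<otimes>\<^bsub>?B\<^esub> g) \<in> ?Q" using fg unfolding SP_iff by blast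
    have "(s \<otimes>\<^bsub>?B\<^esub> g) \<otimes>\<^bsub>?B\<^esub> f = s \<otimes>\<^bsub>?B\<^esub> (f \<otimes>\<^bsub>?B\<^esub> g)" using s f g by (simp add: B.m_ac)
    then have "(s \<otimes>\<^bsub>?B\<^esub> g) \<otimes>\<^bsub>?B\<^esub> f \<in> ?Q" using s(3) by simp
    then have "f \<in> SP" unfolding SP_iff using f prod_notin[OF s(1) g s(2) ng] B.m_closed[OF s(1) g] by blast
    then show False using nf by blast
  qed
qed

section \<open>From ideals of the completion to sequences\<close>

definition reps :: "(nat \<Rightarrow> 'a set) set \<Rightarrow> (nat \<Rightarrow> 'a) set" where
  "reps I = {a \<in> seqs. cl a \<in> I}"

lemma trace_reps:
  assumes J: "ideal I Ahat" and JP: "I \<subseteq> PA" and PP: "ideal_power Ahat PA 2 \<subseteq> I"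
    and prim: "\<And>f g. f \<in> carrier Ahat \<Longrightarrow> g \<in> carrier Ahat \<Longrightarrow> f \<otimes>\<^bsub>Ahat\<^esub> g \<in> I \<Longrightarrow> f \<notin> I \<Longrightarrow> g \<in> PA"
  shows "trace K A V t (reps I)"
proof (intro trace.intro trace_axioms.intro)
  note JE = ideal_AhatD[OF J]
  show "tight_pair K A V t" by (rule tight_pair_axioms)
  show "a \<in> reps I \<Longrightarrow> a \<in> seqs" for a by (simp add: reps_def)
  show "(\<lambda>n. a n \<oplus> b n) \<in> reps I" if "a \<in> reps I" "b \<in> reps I" for a b
    using that JE(3)[of "cl a" "cl b"] by (simp add: reps_def cl_simps)
  show "(\<lambda>n. a n \<otimes> b n) \<in> reps I" if "a \<in> seqs" "b \<in> reps I" for a b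
    using that JE(4)[of "cl a" "cl b"] by (simp add: reps_def cl_simps)
  show "b \<in> reps I" if "a \<in> reps I" "b \<in> seqs" "\<And>n. a n \<ominus> b n \<in> mp n" for a b
    using that cl_eq_iff[of a b] by (simp add: reps_def)
  show "a n \<in> nV n" if "a \<in> reps I" for a n
    using that cl_in_P[of a] JP by (auto simp: reps_def)
  show "(\<lambda>n. a n \<otimes> b n) \<in> reps I"
    if ab: "a \<in> seqs" "b \<in> seqs" "\<And>n. a n \<in> nV n" "\<And>n. b n \<in> nV n" for a b
  proof -
    have "cl a \<otimes>\<^bsub>Ahat\<^esub> cl b \<in> I" using P_square_I[of "cl a" "cl b"] cl_in_P ab PP by blast
    then show ?thesis using ab by (simp add: reps_def cl_simps)
  qed
  show "b n \<in> nV n" if ab: "a \<in> seqs" "b \<in> seqs" "(\<lambda>n. a n \<otimes> b n) \<in> reps I" "a \<notin> reps I" for a b n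
  proof -
    have "cl a \<otimes>\<^bsub>Ahat\<^esub> cl b \<in> I" "cl a \<notin> I" using ab by (simp_all add: reps_def cl_simps)
    then have "cl b \<in> PA" using prim[OF cl_closed[OF ab(1)] cl_closed[OF ab(2)]] by blast
    then show ?thesis using cl_in_P[OF ab(2)] by blast
  qed
qed

text \<open>For x = a/b, membership of \<open>a\<close> in the sum of \<open>I\<close> and the ideal
  generated by \<open>b\<close> means that a - bf = b(x - f) represents an element of
  \<open>I\<close> for some f.\<close>

lemma fraction_trace_reps:
  assumes J: "ideal I Ahat"
  shows "fraction_trace K A I = {x. \<exists>f. f \<in> seqs \<and> x \<in> carrier K \<and>
    (\<exists>b\<in>A. b \<noteq> \<zero> \<and> b \<otimes> x \<in> A \<and> (\<lambda>n. b \<otimes> (x \<ominus> f n)) \<in> reps I)}" (is "_ = ?R")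
proof (intro equalityI subsetI)
  note JE = ideal_AhatD[OF J]
  fix x assume "x \<in> fraction_trace K A I"
  then obtain a b where ab: "x = a \<otimes> inv b" "a \<in> A" "b \<in> A" "b \<noteq> \<zero>" and
    m: "cl (\<lambda>_. a) \<in> PIdl\<^bsub>Ahat\<^esub> (cl (\<lambda>_. b)) <+>\<^bsub>Ahat\<^esub> I"
    unfolding fraction_trace_def to_completion_cl by blast
  have K: "a \<in> carrier K" "b \<in> carrier K" "inv b \<in> carrier K" using ab by simp_all
  have x: "x \<in> carrier K" "b \<otimes> x = a" using ab K by (simp_all add: m_lcomm)
  obtain F G where F: "F \<in> carrier Ahat" "G \<in> I" "cl (\<lambda>_. a) = (F \<otimes>\<^bsub>Ahat\<^esub> cl (\<lambda>_. b)) \<oplus>\<^bsub>Ahat\<^esub> G"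
    using m unfolding set_add_def' cgenideal_def by blast
  obtain f where f: "f \<in> seqs" "F = cl f" by (rule Ahat_cases[OF F(1)]) (rule that)
  obtain g where g: "g \<in> seqs" "G = cl g" by (rule Ahat_cases[OF JE(1)[OF F(2)]]) (rule that)
  have s: "(\<lambda>n. f n \<otimes> b \<oplus> g n) \<in> seqs" by (intro seqs_add seqs_mult seqs_const f g ab)
  have "cl (\<lambda>_. a) = cl (\<lambda>n. f n \<otimes> b \<oplus> g n)" using F(3) f g ab by (simp add: cl_simps)
  then have d: "a \<ominus> (f n \<otimes> b \<oplus> g n) \<in> mp n" for n using cl_eq_iff[OF seqs_const[OF ab(2)] s] by blast
  have fK: "f n \<in> carrier K" "g n \<in> carrier K" for n using seqs_K[OF f(1)] seqs_K[OF g(1)] by auto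
  have s2: "(\<lambda>n. a \<ominus> b \<otimes> f n) \<in> seqs" by (intro seqs_minus seqs_mult seqs_const f ab)
  have "cl (\<lambda>n. a \<ominus> b \<otimes> f n) = cl g"
  proof -
    have "a \<ominus> b \<otimes> f n \<ominus> g n \<in> mp n" for n
    proof -
      define p q where "p = f n" and "q = g n"
      have pq: "p \<in> carrier K" "q \<in> carrier K" using fK by (simp_all add: p_def q_def)
      have "a \<ominus> b \<otimes> p \<ominus> q = a \<ominus> (p \<otimes> b \<oplus> q)" by (use pq K in algebra)
      then show ?thesis using d[of n] by (simp add: p_def q_def)
    qed
    then show ?thesis using cl_eq_iff[OF s2 g(1)] by blast
  qed
  moreover have "(\<lambda>n. a \<ominus> b \<otimes> f n) = (\<lambda>n. b \<otimes> (x \<ominus> f n))"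
    using x fK K by (auto simp: minus_eq r_distr r_minus)
  ultimately have "(\<lambda>n. b \<otimes> (x \<ominus> f n)) \<in> reps I" using s2 F(2) g(2) by (simp add: reps_def)
  then show "x \<in> ?R" using f(1) x ab by blast
next
  fix x assume "x \<in> ?R"
  then obtain f b where f: "f \<in> seqs" "x \<in> carrier K" "b \<in> A" "b \<noteq> \<zero>" "b \<otimes> x \<in> A"
    "(\<lambda>n. b \<otimes> (x \<ominus> f n)) \<in> reps I" by blast
  have bK: "b \<in> carrier K" "inv b \<in> carrier K" using f by simp_all
  have fK: "f n \<in> carrier K" for n by (rule seqs_K[OF f(1)])
  define j where "j n = b \<otimes> (x \<ominus> f n)" for n
  have j: "j \<in> seqs" "cl j \<in> I" using f(6) by (simp_all add: reps_def j_def[abs_def])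
  have "(\<lambda>n. f n \<otimes> b \<oplus> j n) = (\<lambda>_. b \<otimes> x)"
  proof
    fix n
    define p where "p = f n"
    have p: "p \<in> carrier K" using fK by (simp add: p_def)
    have "p \<otimes> b \<oplus> b \<otimes> (x \<ominus> p) = b \<otimes> x" by (use p bK f(2) in algebra)
    then show "f n \<otimes> b \<oplus> j n = b \<otimes> x" by (simp add: p_def j_def)
  qed
  moreover have "cl (\<lambda>n. f n \<otimes> b \<oplus> j n) = (cl f \<otimes>\<^bsub>Ahat\<^esub> cl (\<lambda>_. b)) \<oplus>\<^bsub>Ahat\<^esub> cl j"
    using f j by (simp add: cl_simps)
  ultimately have "cl (\<lambda>_. b \<otimes> x) = (cl f \<otimes>\<^bsub>Ahat\<^esub> cl (\<lambda>_. b)) \<oplus>\<^bsub>Ahat\<^esub> cl j" by simp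
  then have "cl (\<lambda>_. b \<otimes> x) \<in> PIdl\<^bsub>Ahat\<^esub> (cl (\<lambda>_. b)) <+>\<^bsub>Ahat\<^esub> I"
    unfolding set_add_def' cgenideal_def using cl_closed[OF f(1)] j(2) by blast
  moreover have "x = (b \<otimes> x) \<otimes> inv b"
  proof -
    have "(b \<otimes> x) \<otimes> inv b = (b \<otimes> inv b) \<otimes> x" using bK f(2) by (simp only: m_ac m_closed)
    then show ?thesis using f(2,4) bK by simp
  qed
  ultimately show "x \<in> fraction_trace K A I"
    unfolding fraction_trace_def to_completion_cl using f(3,4,5) by blast
qed

theorem fraction_trace_bad:
  assumes J: "ideal I Ahat" and JP: "I \<subseteq> PA" and PP: "ideal_power Ahat PA 2 \<subseteq> I"
    and prim: "\<And>f g. f \<in> carrier Ahat \<Longrightarrow> g \<in> carrier Ahat \<Longrightarrow> f \<otimes>\<^bsub>Ahat\<^esub> g \<in> I \<Longrightarrow> f \<notin> I \<Longrightarrow> g \<in> PA"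
    and ne: "fraction_trace K A I \<noteq> V"
  shows "bad_noetherian_stable_domain K (fraction_trace K A I)" "tightly_dominates K (fraction_trace K A I) A"
proof -
  interpret tr: trace K A V t "reps I" by (rule trace_reps[OF J JP PP prim])
  have "fraction_trace K A I = tr.T" unfolding fraction_trace_reps[OF J] tr.T_def tr.rel_def ..
  then show "bad_noetherian_stable_domain K (fraction_trace K A I)" "tightly_dominates K (fraction_trace K A I) A"
    using tr.T_bad tr.T_tight ne by simp_all
qed

lemma primary_props:
  assumes "P_primary Ahat PA I"
  shows "ideal I Ahat" "I \<subseteq> PA"
    "\<And>f g. f \<in> carrier Ahat \<Longrightarrow> g \<in> carrier Ahat \<Longrightarrow> f \<otimes>\<^bsub>Ahat\<^esub> g \<in> I \<Longrightarrow> f \<notin> I \<Longrightarrow> g \<in> PA"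
proof -
  have p: "primary_ideal Ahat I" and r: "ideal_radical Ahat I = PA" using assms by (simp_all add: P_primary_def)
  show J: "ideal I Ahat" using p by (simp add: primary_ideal_def)
  show "g \<in> PA" if "f \<in> carrier Ahat" "g \<in> carrier Ahat" "f \<otimes>\<^bsub>Ahat\<^esub> g \<in> I" "f \<notin> I" for f g
    using p r that unfolding primary_ideal_def by blast
  show "I \<subseteq> PA"
  proof
    fix x assume x: "x \<in> I"
    have m: "monoid Ahat" using Ahat_cring by (simp add: cring_def comm_monoid_def)
    have xc: "x \<in> carrier Ahat" by (rule ideal_AhatD(1)[OF J x])
    have "x [^]\<^bsub>Ahat\<^esub> (1::nat) \<in> I" using monoid.nat_pow_eone[OF m xc] x by simp
    then show "x \<in> PA" unfolding r[symmetric] ideal_radical_def using xc by blast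
  qed
qed

text \<open>Multipliers outside the prime can be cancelled modulo an ideal primary to it.\<close>

lemma SP_least:
  assumes "P_primary Ahat PA I" "ideal_power Ahat PA 2 \<subseteq> I"
  shows "SP \<subseteq> I"
proof
  fix x assume "x \<in> SP"
  then obtain s where s: "s \<in> carrier Ahat" "s \<notin> PA" "s \<otimes>\<^bsub>Ahat\<^esub> x \<in> I" "x \<in> carrier Ahat"
    unfolding SP_iff using assms(2) by blast
  have "x \<otimes>\<^bsub>Ahat\<^esub> s \<in> I" using s cring.cring_simprules(14)[OF Ahat_cring s(4,1)] by simp
  then show "x \<in> I" using primary_props(3)[OF assms(1) s(4,1)] s(2) by blast
qed

lemma fraction_trace_mono:
  assumes "I \<subseteq> I'" shows "fraction_trace K A I \<subseteq> fraction_trace K A I'"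
proof -
  have "C <+>\<^bsub>Ahat\<^esub> I \<subseteq> C <+>\<^bsub>Ahat\<^esub> I'" for C using assms unfolding set_add_def' by blast
  then show ?thesis unfolding fraction_trace_def by blast
qed

end

section \<open>A tight bad stable ring as a trace\<close>

locale tight_stable = stable_mid +
  assumes R_div: "\<And>c x. c \<in> R \<Longrightarrow> c \<noteq> \<zero> \<Longrightarrow> x \<in> R \<Longrightarrow> \<exists>a\<in>A. \<exists>r\<in>R. x = a \<oplus> c \<otimes> r"
begin

text \<open>This is M^(n+1) for the maximal ideal M of \<open>R\<close>, because quadraticity gives
  M^2 = tM.\<close>

definition tM :: "nat \<Rightarrow> 'a set" where "tM n = {t [^] n \<otimes> w |w. w \<in> R \<and> w \<in> nV 1}"

lemma tM_I: "w \<in> R \<Longrightarrow> w \<in> nV 1 \<Longrightarrow> t [^] n \<otimes> w \<in> tM n" unfolding tM_def by blast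
lemma tM_E: "x \<in> tM n \<Longrightarrow> (\<And>w. w \<in> R \<Longrightarrow> w \<in> nV 1 \<Longrightarrow> x = t [^] n \<otimes> w \<Longrightarrow> thesis) \<Longrightarrow> thesis"
  unfolding tM_def by blast

lemma tM_nV: "x \<in> tM n \<Longrightarrow> x \<in> nV (Suc n)"
  by (erule tM_E) (use nV_tmult[of _ 1 n] in simp)

lemma tM_K: "x \<in> tM n \<Longrightarrow> x \<in> carrier K" by (rule nV_K[OF tM_nV])

lemma tM_0: "x \<in> R \<Longrightarrow> x \<in> nV 1 \<Longrightarrow> x \<in> tM 0" using tM_I[of x 0] RE(3)[of x] by simp

lemma tM_add: "x \<in> tM n \<Longrightarrow> y \<in> tM n \<Longrightarrow> x \<oplus> y \<in> tM n"
proof -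
  assume "x \<in> tM n" "y \<in> tM n"
  then obtain v w where v: "v \<in> R" "v \<in> nV 1" "x = t [^] n \<otimes> v" and w: "w \<in> R" "w \<in> nV 1" "y = t [^] n \<otimes> w"
    by (elim tM_E)
  have "t [^] n \<otimes> (v \<oplus> w) \<in> tM n" by (rule tM_I[OF RE(7)[OF v(1) w(1)] nV_add[OF v(2) w(2)]])
  then show ?thesis using v w RE(3) by (simp add: r_distr)
qed

lemma tM_mult: "r \<in> R \<Longrightarrow> x \<in> tM n \<Longrightarrow> r \<otimes> x \<in> tM n"
proof -
  assume r: "r \<in> R" and "x \<in> tM n"
  then obtain v where v: "v \<in> R" "v \<in> nV 1" "x = t [^] n \<otimes> v" by (elim tM_E)
  have "t [^] n \<otimes> (r \<otimes> v) \<in> tM n" by (rule tM_I[OF RE(8)[OF r v(1)] nV_mult[OF RE(2)[OF r] v(2)]])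
  then show ?thesis using v r RE(3) by (simp add: m_lcomm)
qed

lemma tM_minus: "x \<in> tM n \<Longrightarrow> y \<in> tM n \<Longrightarrow> x \<ominus> y \<in> tM n"
proof -
  assume x: "x \<in> tM n" and y: "y \<in> tM n"
  have "\<ominus> \<one> \<otimes> y \<in> tM n" by (rule tM_mult[OF RE(9)[OF RE(5)] y])
  then show ?thesis using tM_add[OF x] tM_K[OF y] by (simp add: minus_eq l_minus)
qed

text \<open>For v = tp and w = tq in the maximal ideal, the relation for pq gives vw = t(tr + sv +
  s'w), where the bracket is again in the maximal ideal.\<close>

lemma tM_Suc: "x \<in> tM n \<Longrightarrow> w \<in> R \<Longrightarrow> w \<in> nV 1 \<Longrightarrow> x \<otimes> w \<in> tM (Suc n)"
proof -
  assume "x \<in> tM n" and w: "w \<in> R" "w \<in> nV 1"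
  then obtain v where v: "v \<in> R" "v \<in> nV 1" "x = t [^] n \<otimes> v" by (elim tM_E)
  obtain p where p: "p \<in> V" "v = t \<otimes> p" by (rule nV1_E[OF v(2)])
  obtain q where q: "q \<in> V" "w = t \<otimes> q" by (rule nV1_E[OF w(2)])
  obtain r s s' where r: "r \<in> R" "s \<in> R" "s' \<in> R" "p \<otimes> q = r \<oplus> s \<otimes> p \<oplus> s' \<otimes> q"
    using R_quadratic p q unfolding quadratic_def by blast
  define z where "z = t \<otimes> r \<oplus> s \<otimes> v \<oplus> s' \<otimes> w"
  have z: "z \<in> R" "z \<in> nV 1" unfolding z_def
    using r v w RE(2,6,7,8) nV_add nV_mult nV1_I by (simp_all del: One_nat_def)
  have K: "p \<in> carrier K" "q \<in> carrier K" "r \<in> carrier K" "s \<in> carrier K" "s' \<in> carrier K" "t \<in> carrier K"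
    using p q r RE(3) by simp_all
  have "v \<otimes> w = t \<otimes> t \<otimes> (p \<otimes> q)"
    unfolding p(2) q(2) by (use K in algebra)
  also have "\<dots> = t \<otimes> z"
    unfolding r(4) z_def p(2) q(2) by (use K in algebra)
  finally have "v \<otimes> w = t \<otimes> z" .
  then have "x \<otimes> w = t [^] Suc n \<otimes> z" unfolding v(3) using RE(3)[OF v(1)] RE(3)[OF w(1)] RE(3)[OF z(1)]
    by (simp add: m_assoc)
  then show ?thesis using tM_I[OF z, of "Suc n"] by simp
qed

lemma mp_tM: "x \<in> mp (Suc n) \<Longrightarrow> x \<in> tM n"
proof (induct n arbitrary: x)
  case 0
  have "x \<in> A" "x \<in> nV 1" using mpE(1)[OF 0] mp_nV[OF 0] by simp_all
  then show ?case using tM_0 RE(1) by blast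
next
  case (Suc n)
  from Suc(2)[unfolded mp_Suc[of "Suc n"]] show ?case
  proof (induct rule: ideal_prod.induct)
    case (prod i j)
    have "j \<in> R" "j \<in> nV 1" using prod(2) RE(1) by (simp_all add: maxA_def)
    then have "i \<otimes> j \<in> tM (Suc n)" using tM_Suc[OF Suc(1)[OF prod(1)]] by blast
    then show ?case by simp
  next
    case (sum s1 s2)
    then show ?case using tM_add by simp
  qed
qed

text \<open>The sequences representing the kernel of the map from the completion of \<open>A\<close>
  to that of \<open>R\<close>. The index is shifted because \<open>tM n\<close> is the power with
  exponent n + 1.\<close>

definition JS :: "(nat \<Rightarrow> 'a) set" where "JS = {a \<in> seqs. \<forall>n. a (Suc n) \<in> tM n}"

lemma JS_add: "a \<in> JS \<Longrightarrow> b \<in> JS \<Longrightarrow> (\<lambda>n. a n \<oplus> b n) \<in> JS"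
  unfolding JS_def using seqs_add tM_add by simp

lemma JS_mult: "a \<in> seqs \<Longrightarrow> b \<in> JS \<Longrightarrow> (\<lambda>n. a n \<otimes> b n) \<in> JS"
  unfolding JS_def using seqs_mult tM_mult[OF RE(1)[OF seqs_A]] by simp

lemma JS_cong: "a \<in> JS \<Longrightarrow> b \<in> seqs \<Longrightarrow> (\<And>n. a n \<ominus> b n \<in> mp n) \<Longrightarrow> b \<in> JS"
proof -
  assume a: "a \<in> JS" and b: "b \<in> seqs" and ab: "\<And>n. a n \<ominus> b n \<in> mp n"
  have "b (Suc n) \<in> tM n" for n
  proof -
    define p q where "p = a (Suc n)" and "q = b (Suc n)"
    have pq: "p \<in> carrier K" "q \<in> carrier K" using a seqs_K[OF b] seqs_K unfolding JS_def p_def q_def by blast+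
    have "p \<ominus> (p \<ominus> q) \<in> tM n"
      by (rule tM_minus) (use a mp_tM[OF ab[of "Suc n"]] in \<open>simp_all add: JS_def p_def q_def\<close>)
    moreover have "p \<ominus> (p \<ominus> q) = q" by (use pq in algebra)
    ultimately show ?thesis by (simp add: q_def)
  qed
  then show ?thesis using b unfolding JS_def by blast
qed

lemma JS_P: "a \<in> JS \<Longrightarrow> a n \<in> nV n"
proof (cases n)
  case 0
  assume "a \<in> JS"
  then show ?thesis using 0 A_V seqs_A[of a 0] by (simp add: JS_def)
next
  case (Suc m)
  assume "a \<in> JS"
  then show ?thesis using Suc tM_nV[of "a (Suc m)" m] by (simp add: JS_def)
qed

lemma JS_PP:
  assumes a: "a \<in> seqs" "\<And>n. a n \<in> nV n" and b: "b \<in> seqs" "\<And>n. b n \<in> nV n"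
  shows "(\<lambda>n. a n \<otimes> b n) \<in> JS"
proof -
  have "a (Suc n) \<otimes> b (Suc n) \<in> tM n" for n
  proof -
    obtain p where p: "p \<in> V" "a (Suc n) = t [^] Suc n \<otimes> p" by (rule nV_E[OF a(2)])
    obtain q where q: "q \<in> V" "b (Suc n) = t [^] Suc n \<otimes> q" by (rule nV_E[OF b(2)])
    obtain r s s' where r: "r \<in> R" "s \<in> R" "s' \<in> R" "p \<otimes> q = r \<oplus> s \<otimes> p \<oplus> s' \<otimes> q"
      using R_quadratic p q unfolding quadratic_def by blast
    define T where "T = t [^] n"
    have T: "T \<in> R" "t [^] Suc n = T \<otimes> t" using RE(6,11) by (simp_all add: T_def)
    have ab: "T \<otimes> t \<otimes> p \<in> R" "T \<otimes> t \<otimes> q \<in> R"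
      using RE(1)[OF seqs_A[OF a(1), of "Suc n"]] RE(1)[OF seqs_A[OF b(1), of "Suc n"]] p q T(2) by simp_all
    \<comment> \<open>The two terms are t^(n+1) p and t^(n+1) q. One factor t^(n+1) is spent on
      bringing p and q into \<open>R\<close>; of the other, t^n is split off and the remaining
      \<open>t\<close> puts z into the maximal ideal.\<close>
    define z where "z = t \<otimes> (T \<otimes> t \<otimes> r \<oplus> s \<otimes> (T \<otimes> t \<otimes> p) \<oplus> s' \<otimes> (T \<otimes> t \<otimes> q))"
    have zz: "T \<otimes> t \<otimes> r \<oplus> s \<otimes> (T \<otimes> t \<otimes> p) \<oplus> s' \<otimes> (T \<otimes> t \<otimes> q) \<in> R"
      by (intro RE(7,8) r ab T RE(6))
    have z: "z \<in> R" "z \<in> nV 1" unfolding z_def using RE(8)[OF RE(6) zz] nV1_I[OF RE(2)[OF zz]] by blast+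
    have K: "p \<in> carrier K" "q \<in> carrier K" "r \<in> carrier K" "s \<in> carrier K" "s' \<in> carrier K" "t \<in> carrier K" "T \<in> carrier K"
      using p q r T RE(3) by simp_all
    have "(T \<otimes> t \<otimes> p) \<otimes> (T \<otimes> t \<otimes> q) = T \<otimes> t \<otimes> T \<otimes> t \<otimes> (p \<otimes> q)"
      by (use K in algebra)
    also have "\<dots> = T \<otimes> z" unfolding r(4) z_def by (use K in algebra)
    finally have "a (Suc n) \<otimes> b (Suc n) = t [^] n \<otimes> z" unfolding p(2) q(2) T(2) by (simp add: T_def)
    then show ?thesis using tM_I[OF z] by simp
  qed
  then show ?thesis unfolding JS_def using seqs_mult[OF a(1) b(1)] by blast
qed

text \<open>Far out, \<open>b\<close> is t^h u with a fixed exponent h. Multiplying the product by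
  t^h/u, which lies in \<open>R\<close> by \<open>inverse_denominator\<close>, leaves t^(2h) times
  \<open>a\<close>, and the power of \<open>t\<close> is cancelled.\<close>

lemma JS_prim:
  assumes a: "a \<in> seqs" and b: "b \<in> seqs" and ab: "(\<lambda>n. a n \<otimes> b n) \<in> JS" and n0: "b n0 \<notin> nV n0"
  shows "a \<in> JS"
proof -
  obtain h where h: "\<And>N. n0 \<le> N \<Longrightarrow> \<exists>u\<in>V. u \<notin> nV 1 \<and> b N = t [^] (h::nat) \<otimes> u"
    by (rule val_stable[OF b n0]) (rule that)
  have "a (Suc n) \<in> tM n" for n
  proof -
    \<comment> \<open>2h is the exponent to be cancelled, \<open>n0\<close> ensures that the
      valuation of \<open>b\<close> is stable, and the successor is the shift in
      \<open>JS\<close>.\<close>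
    define N where "N = Suc (n + (h + h) + n0)"
    obtain u where u: "u \<in> V" "u \<notin> nV 1" "b N = t [^] h \<otimes> u" using h[of N] by (auto simp: N_def)
    have iu: "inv u \<in> carrier K" "u \<otimes> inv u = \<one>" using V_unit[OF u(1,2)] by simp_all
    have "t [^] h \<otimes> u \<in> R" using RE(1)[OF seqs_A[OF b, of N]] u(3) by simp
    then have ti: "t [^] h \<otimes> inv u \<in> R" by (rule inverse_denominator[OF u(1,2)])
    have "a N \<otimes> b N \<in> tM (n + (h + h) + n0)" using ab unfolding JS_def N_def by simp
    then have "(t [^] h \<otimes> inv u) \<otimes> (a N \<otimes> b N) \<in> tM (n + (h + h) + n0)" by (rule tM_mult[OF ti])
    then obtain w where w: "w \<in> R" "w \<in> nV 1" "(t [^] h \<otimes> inv u) \<otimes> (a N \<otimes> b N) = t [^] (n + (h + h) + n0) \<otimes> w"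
      by (rule tM_E)
    define T p where "T = t [^] h" and "p = a N"
    have K: "T \<in> carrier K" "p \<in> carrier K" "u \<in> carrier K" "inv u \<in> carrier K" "w \<in> carrier K"
      using seqs_K[OF a] u iu RE(3)[OF w(1)] by (simp_all add: T_def p_def)
    have "(T \<otimes> inv u) \<otimes> (p \<otimes> (T \<otimes> u)) = T \<otimes> T \<otimes> (u \<otimes> inv u) \<otimes> p" using K by (simp add: m_ac)
    also have "\<dots> = t [^] (h + h) \<otimes> p" using iu K by (simp add: T_def nat_pow_mult)
    finally have "t [^] (h + h) \<otimes> p = t [^] (n + (h + h) + n0) \<otimes> w"
      using w(3) unfolding u(3) T_def[symmetric] p_def[symmetric] by simp
    moreover have "n + (h + h) + n0 = (h + h) + (n + n0)" by simp
    ultimately have eq: "t [^] (h + h) \<otimes> p = t [^] (h + h) \<otimes> (t [^] (n + n0) \<otimes> w)"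
      using tpow_add[OF K(5), of "h + h" "n + n0"] by simp
    have "p = t [^] (n + n0) \<otimes> w" by (rule cancel[OF _ _ _ _ eq]) (use K in simp_all)
    then have "p = t [^] n \<otimes> (t [^] n0 \<otimes> w)" using tpow_add[OF K(5)] by simp
    moreover have "t [^] n0 \<otimes> w \<in> R" "t [^] n0 \<otimes> w \<in> nV 1"
      using RE(8)[OF RE(11)[OF RE(6)] w(1)] nV_mult[OF V_pow[OF tV] w(2)] by simp_all
    ultimately have pM: "p \<in> tM n" using tM_I by simp
    have "p \<ominus> a (Suc n) \<in> mp (Suc n)" unfolding p_def by (rule seqs_diff[OF a]) (simp add: N_def)
    then have d: "p \<ominus> a (Suc n) \<in> tM n" by (rule mp_tM)
    define q where "q = a (Suc n)"
    have q: "q \<in> carrier K" using seqs_K[OF a] by (simp add: q_def)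
    have "p \<ominus> (p \<ominus> q) \<in> tM n" using tM_minus[OF pM d] by (simp add: q_def)
    moreover have "p \<ominus> (p \<ominus> q) = q" by (use K q in algebra)
    ultimately show ?thesis by (simp add: q_def)
  qed
  then show ?thesis using a unfolding JS_def by blast
qed

definition JR :: "(nat \<Rightarrow> 'a set) set" where "JR = cl ` JS"

lemma cl_in_JR: "a \<in> seqs \<Longrightarrow> cl a \<in> JR \<longleftrightarrow> a \<in> JS"
proof
  assume a: "a \<in> seqs" and "cl a \<in> JR"
  then obtain b where b: "b \<in> JS" "cl a = cl b" unfolding JR_def by blast
  have bs: "b \<in> seqs" using b(1) by (simp add: JS_def)
  have "cl b = cl a" using b(2) by simp
  then have "b n \<ominus> a n \<in> mp n" for n using cl_eq_iff[OF bs a] by blast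
  then show "a \<in> JS" by (rule JS_cong[OF b(1) a])
qed (auto simp: JR_def)

lemma reps_JR: "reps JR = JS"
  using cl_in_JR unfolding reps_def by (auto simp: JS_def)

lemma JR_cases: "x \<in> JR \<Longrightarrow> (\<And>a. a \<in> JS \<Longrightarrow> a \<in> seqs \<Longrightarrow> x = cl a \<Longrightarrow> thesis) \<Longrightarrow> thesis"
  unfolding JR_def JS_def by blast

lemma JR_ideal: "ideal JR Ahat"
proof (rule cring_idealI[OF Ahat_cring])
  show "JR \<subseteq> carrier Ahat" using JR_cases cl_closed by blast
  have "(\<lambda>_. \<zero>) \<in> JS" unfolding JS_def using seqs_const tM_0 tM_I[of \<zero>] RE(4) by auto
  then show "\<zero>\<^bsub>Ahat\<^esub> \<in> JR" unfolding cl_zero JR_def by blast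
next
  fix x y assume x: "x \<in> JR" and y: "y \<in> JR"
  obtain a where a: "a \<in> JS" "a \<in> seqs" "x = cl a" by (rule JR_cases[OF x])
  obtain b where b: "b \<in> JS" "b \<in> seqs" "y = cl b" by (rule JR_cases[OF y])
  show "x \<oplus>\<^bsub>Ahat\<^esub> y \<in> JR" unfolding a(3) b(3) cl_add[OF a(2) b(2)] JR_def using JS_add[OF a(1) b(1)] by blast
next
  fix x y assume x: "x \<in> carrier Ahat" and y: "y \<in> JR"
  obtain a where a: "a \<in> seqs" "x = cl a" by (rule Ahat_cases[OF x]) (rule that)
  obtain b where b: "b \<in> JS" "b \<in> seqs" "y = cl b" by (rule JR_cases[OF y])
  show "x \<otimes>\<^bsub>Ahat\<^esub> y \<in> JR" unfolding a(2) b(3) cl_mult[OF a(1) b(2)] JR_def using JS_mult[OF a(1) b(1)] by blast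
qed

lemma JR_P: "JR \<subseteq> PA"
proof
  fix x assume x: "x \<in> JR"
  obtain a where a: "a \<in> JS" "a \<in> seqs" "x = cl a" by (rule JR_cases[OF x])
  show "x \<in> PA" unfolding a(3) cl_in_P[OF a(2)] using JS_P[OF a(1)] by blast
qed

lemma JR_PP: "f \<in> PA \<Longrightarrow> g \<in> PA \<Longrightarrow> f \<otimes>\<^bsub>Ahat\<^esub> g \<in> JR"
proof -
  assume f: "f \<in> PA" and g: "g \<in> PA"
  obtain a where a: "a \<in> seqs" "\<And>n. a n \<in> nV n" "f = cl a" by (rule P_cases[OF f]) (rule that)
  obtain b where b: "b \<in> seqs" "\<And>n. b n \<in> nV n" "g = cl b" by (rule P_cases[OF g]) (rule that)
  have "(\<lambda>n. a n \<otimes> b n) \<in> JS" by (rule JS_PP[OF a(1,2) b(1,2)])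
  then show ?thesis unfolding a(3) b(3) cl_mult[OF a(1) b(1)] JR_def by blast
qed

lemma JR_square: "ideal_power Ahat PA 2 \<subseteq> JR"
  by (rule P_square_least[OF JR_ideal JR_PP])

text \<open>\<open>JR\<close> lies between the square of the kernel and the kernel itself, which is
  prime; this gives the radical.\<close>

lemma JR_primary: "P_primary Ahat PA JR"
proof -
  have m: "monoid Ahat" using Ahat_cring by (simp add: cring_def comm_monoid_def)
  have rad: "ideal_radical Ahat JR = PA"
  proof (intro equalityI subsetI)
    fix x assume "x \<in> ideal_radical Ahat JR"
    then obtain n :: nat where x: "x \<in> carrier Ahat" "x [^]\<^bsub>Ahat\<^esub> n \<in> JR" unfolding ideal_radical_def by blast
    have "x [^]\<^bsub>Ahat\<^esub> k \<in> PA \<Longrightarrow> x \<in> PA" for k :: nat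
    proof (induct k)
      case 0
      then show ?case using one_notin_P monoid.nat_pow_0[OF m] by simp
    next
      case (Suc k)
      then have "x [^]\<^bsub>Ahat\<^esub> k \<otimes>\<^bsub>Ahat\<^esub> x \<in> PA" using monoid.nat_pow_Suc[OF m] by simp
      then show ?case using P_prime[OF monoid.nat_pow_closed[OF m x(1)] x(1)] Suc(1) by blast
    qed
    then show "x \<in> PA" using x(2) JR_P by blast
  next
    fix x assume x: "x \<in> PA"
    then have xc: "x \<in> carrier Ahat" using P_carrier by blast
    have "x [^]\<^bsub>Ahat\<^esub> (2::nat) = x \<otimes>\<^bsub>Ahat\<^esub> x"
      using monoid.nat_pow_Suc[OF m, of x 1] monoid.nat_pow_eone[OF m xc] by (simp add: numeral_2_eq_2)
    then have "x [^]\<^bsub>Ahat\<^esub> (2::nat) \<in> JR" using JR_PP[OF x x] by simp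
    then show "x \<in> ideal_radical Ahat JR" unfolding ideal_radical_def using xc by blast
  qed
  have "x \<in> JR" if x: "x \<in> carrier Ahat" and y: "y \<in> carrier Ahat" and xy: "x \<otimes>\<^bsub>Ahat\<^esub> y \<in> JR" and n: "y \<notin> PA" for x y
  proof -
    obtain a where a: "a \<in> seqs" "x = cl a" by (rule Ahat_cases[OF x]) (rule that)
    obtain b where b: "b \<in> seqs" "y = cl b" by (rule Ahat_cases[OF y]) (rule that)
    obtain k where k: "b k \<notin> nV k" using n cl_in_P[OF b(1)] b(2) by blast
    have "(\<lambda>n. a n \<otimes> b n) \<in> JS"
      using xy cl_in_JR[OF seqs_mult[OF a(1) b(1)]] unfolding a(2) b(2) cl_mult[OF a(1) b(1)] by blast
    then have "a \<in> JS" by (rule JS_prim[OF a(1) b(1) _ k])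
    then show ?thesis unfolding a(2) JR_def by blast
  qed
  moreover have "JR \<noteq> carrier Ahat" using one_notin_P JR_P monoid.one_closed[OF m] by blast
  ultimately show ?thesis
    unfolding P_primary_def primary_ideal_def rad using JR_ideal by blast
qed

text \<open>The remainder is t^n w with w in the maximal ideal of \<open>R\<close>. Dividing w by
  t^2 rather than by \<open>t\<close> leaves an element of \<open>maxA\<close> and the remainder
  t^(n+1) times an element tr that is again in the maximal ideal.\<close>

lemma approximation:
  assumes x: "x \<in> R"
  obtains f where "f \<in> seqs" "\<And>n. x \<ominus> f (Suc n) \<in> tM n"
proof -
  have t2: "t \<otimes> t \<in> R" "t \<otimes> t \<noteq> \<zero>" using RE(6,8) t_nz integral[of t t] by auto
  have "\<exists>a. \<forall>n. (a n \<in> A \<and> x \<ominus> a n \<in> tM n) \<and> a (Suc n) \<ominus> a n \<in> mp (Suc n)"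
  proof (rule dependent_nat_choice)
    obtain a r where a: "a \<in> A" "r \<in> R" "x = a \<oplus> t \<otimes> r" using R_div[OF RE(6) t_nz x] by blast
    have K: "a \<in> carrier K" "r \<in> carrier K" "t \<in> carrier K" using a RE(3) by simp_all
    have "a \<oplus> t \<otimes> r \<ominus> a = t \<otimes> r" by (use K in algebra)
    moreover have "t \<otimes> r \<in> tM 0" by (rule tM_0[OF RE(8)[OF RE(6) a(2)] nV1_I[OF RE(2)[OF a(2)]]])
    ultimately have "x \<ominus> a \<in> tM 0" using a(3) by simp
    then show "\<exists>y. y \<in> A \<and> x \<ominus> y \<in> tM 0" using a(1) by blast
  next
    fix y n assume y: "y \<in> A \<and> x \<ominus> y \<in> tM n"
    then obtain w where w: "w \<in> R" "w \<in> nV 1" "x \<ominus> y = t [^] n \<otimes> w" using tM_E by blast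
    obtain a r where a: "a \<in> A" "r \<in> R" "w = a \<oplus> t \<otimes> t \<otimes> r" using R_div[OF t2 w(1)] by blast
    define T where "T = t [^] n"
    have K: "x \<in> carrier K" "y \<in> carrier K" "T \<in> carrier K" "a \<in> carrier K" "r \<in> carrier K" "t \<in> carrier K"
      using x y a RE(3) by (simp_all add: T_def)
    have tr: "t \<otimes> r \<in> R" "t \<otimes> r \<in> nV 1" using RE(8)[OF RE(6) a(2)] nV1_I[OF RE(2)[OF a(2)]] by blast+
    have "w \<ominus> t \<otimes> (t \<otimes> r) \<in> nV 1" by (rule nV_minus[OF w(2) nV1_I[OF RE(2)[OF tr(1)]]])
    moreover have "a \<oplus> t \<otimes> t \<otimes> r \<ominus> t \<otimes> (t \<otimes> r) = a" by (use K in algebra)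
    ultimately have "a \<in> maxA" using a(1) unfolding a(3) maxA_def by simp
    then have "\<one> \<otimes> a \<in> mp (Suc 0)" by (intro mp_mult) simp_all
    then have "t [^] n \<otimes> a \<in> mp (Suc n)" using mp_tpow[of a 1 n] K by simp
    moreover have "y \<oplus> T \<otimes> a \<ominus> y = T \<otimes> a" by (use K in algebra)
    ultimately have 1: "y \<oplus> T \<otimes> a \<ominus> y \<in> mp (Suc n)" by (simp add: T_def)
    have "x \<ominus> (y \<oplus> T \<otimes> a) = (x \<ominus> y) \<ominus> T \<otimes> a" by (use K in algebra)
    also have "\<dots> = T \<otimes> (a \<oplus> t \<otimes> t \<otimes> r) \<ominus> T \<otimes> a" using w a by (simp add: T_def)
    also have "\<dots> = T \<otimes> t \<otimes> (t \<otimes> r)" by (use K in algebra)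
    also have "\<dots> \<in> tM (Suc n)" using tM_I[OF tr, of "Suc n"] by (simp add: T_def)
    finally have 2: "x \<ominus> (y \<oplus> T \<otimes> a) \<in> tM (Suc n)" .
    have "y \<oplus> T \<otimes> a \<in> A" using y a tA by (simp add: T_def)
    then show "\<exists>y'. (y' \<in> A \<and> x \<ominus> y' \<in> tM (Suc n)) \<and> y' \<ominus> y \<in> mp (Suc n)" using 1 2 by blast
  qed
  then obtain g where g: "\<And>n. g n \<in> A" "\<And>n. x \<ominus> g n \<in> tM n" "\<And>n. g (Suc n) \<ominus> g n \<in> mp (Suc n)" by blast
  \<comment> \<open>The differences of g at step \<open>n\<close> lie in \<open>mp (Suc n)\<close>,
    so g is shifted by one place; at 0 truncated subtraction repeats the first term.\<close>
  define f where "f n = g (n - 1)" for n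
  have "f \<in> seqs"
  proof (rule seqsI)
    show "f n \<in> A" for n using g(1) by (simp add: f_def)
    show "f (Suc n) \<ominus> f n \<in> mp n" for n using g(1,3) by (cases n) (simp_all add: f_def)
  qed
  moreover have "x \<ominus> f (Suc n) \<in> tM n" for n using g(2) by (simp add: f_def)
  ultimately show ?thesis by (rule that)
qed

text \<open>An element of \<open>R\<close> is approximated by a sequence in \<open>A\<close> modulo
  every \<open>tM n\<close>. Conversely, a denominator \<open>b\<close> divides some t^N in
  \<open>R\<close>, so it can be cancelled once the error has reached t^N R.\<close>

theorem R_eq_trace: "R = fraction_trace K A JR"
  unfolding fraction_trace_reps[OF JR_ideal] reps_JR
proof (intro equalityI subsetI CollectI)
  fix x assume x: "x \<in> R"
  obtain f where f: "f \<in> seqs" "\<And>n. x \<ominus> f (Suc n) \<in> tM n" by (rule approximation[OF x]) (rule that)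
  obtain b where b: "b \<in> A" "b \<noteq> \<zero>" "b \<otimes> x \<in> A" using V_frac[OF RE(2)[OF x]] by blast
  have K: "b \<in> carrier K" "x \<in> carrier K" "\<And>n. f n \<in> carrier K" using b RE(3)[OF x] seqs_K[OF f(1)] by simp_all
  have "(\<lambda>n. b \<otimes> x \<ominus> b \<otimes> f n) \<in> seqs" by (intro seqs_minus seqs_mult seqs_const f b)
  moreover have "(\<lambda>n. b \<otimes> x \<ominus> b \<otimes> f n) = (\<lambda>n. b \<otimes> (x \<ominus> f n))" using K by (auto simp: minus_eq r_distr r_minus)
  ultimately have "(\<lambda>n. b \<otimes> (x \<ominus> f n)) \<in> JS"
    unfolding JS_def using tM_mult[OF RE(1)[OF b(1)] f(2)] by simp
  then show "\<exists>f. f \<in> seqs \<and> x \<in> carrier K \<and> (\<exists>b\<in>A. b \<noteq> \<zero> \<and> b \<otimes> x \<in> A \<and> (\<lambda>n. b \<otimes> (x \<ominus> f n)) \<in> JS)"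
    using f(1) K(2) b by blast
next
  fix x assume "x \<in> {x. \<exists>f. f \<in> seqs \<and> x \<in> carrier K \<and> (\<exists>b\<in>A. b \<noteq> \<zero> \<and> b \<otimes> x \<in> A \<and> (\<lambda>n. b \<otimes> (x \<ominus> f n)) \<in> JS)}"
  then obtain f b where f: "f \<in> seqs" "x \<in> carrier K" "b \<in> A" "b \<noteq> \<zero>" "(\<lambda>n. b \<otimes> (x \<ominus> f n)) \<in> JS" by blast
  obtain N r where r: "r \<in> R" "t [^] (N::nat) = b \<otimes> r"
    using R_power[OF RE(1)[OF f(3)] f(4) RE(6)] nV_t by auto
  have "b \<otimes> (x \<ominus> f (Suc N)) \<in> tM N" using f(5) unfolding JS_def by blast
  then obtain w where w: "w \<in> R" "b \<otimes> (x \<ominus> f (Suc N)) = t [^] N \<otimes> w" by (rule tM_E)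
  define p where "p = f (Suc N)"
  have p: "p \<in> R" using RE(1)[OF seqs_A[OF f(1)]] by (simp add: p_def)
  have K: "b \<in> carrier K" "r \<in> carrier K" "w \<in> carrier K" "p \<in> carrier K" "x \<in> carrier K"
    using f r w p RE(3) by simp_all
  have eq: "b \<otimes> (x \<ominus> p) = b \<otimes> (r \<otimes> w)" using w(2) K unfolding r(2) p_def[symmetric] by (simp add: m_assoc)
  have d: "x \<ominus> p = r \<otimes> w" by (rule cancel[OF _ _ _ _ eq]) (use K f(4) in simp_all)
  have "x = (x \<ominus> p) \<oplus> p" by (use K in algebra)
  then have "x = r \<otimes> w \<oplus> p" using d by simp
  then show "x \<in> R" using RE(7)[OF RE(8)[OF r(1) w(1)] p] by simp
qed

end

section \<open>The main theorem\<close>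

context tight_pair
begin

lemma integral_closure_V: "integral_closure K V (quot_field K V) \<subseteq> V"
proof
  fix x assume x: "x \<in> integral_closure K V (quot_field K V)"
  obtain d where d: "d \<in> V" "d \<noteq> \<zero>" "\<And>k::nat. d \<otimes> x [^] k \<in> V" by (rule integral_imp_almost[OF mid_V x]) (rule that)
  have "x \<in> quot_field K V" using x by (simp add: integral_closure_def)
  then obtain b where b: "b \<in> V" "b \<noteq> \<zero>" "b \<otimes> x \<in> V" "x \<in> carrier K"
    by (rule quot_field_E[OF mid_V]) (rule that)
  show "x \<in> V" by (rule V_almost_closed[OF d(1,2) b(4,1-3) d(3)])
qed

text \<open>By density of \<open>A\<close>, V = A + t^h V = A + cV, where h is the valuation of
  \<open>c\<close>.\<close>

lemma noetherian_V: "noetherian_ring (sub K V)"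
proof (rule noetherian_of_divisible[OF mid_V])
  fix c x assume c: "c \<in> V" "c \<noteq> \<zero>" and x: "x \<in> V"
  obtain h u where u: "u \<in> V" "u \<notin> nV 1" "c = t [^] (h::nat) \<otimes> u" by (rule V_dec[OF c]) (rule that)
  obtain a where a0: "a \<in> A" "x \<ominus> a \<in> nV h" by (rule V_dense[OF x]) (rule that)
  obtain y where y: "y \<in> V" "x \<ominus> a = t [^] h \<otimes> y" by (rule nV_E[OF a0(2)])
  have xa: "x \<in> carrier K" "a \<in> carrier K" using x a0 by simp_all
  have "a \<oplus> (x \<ominus> a) = x" by (use xa in algebra)
  then have a: "a \<in> A" "y \<in> V" "x = a \<oplus> t [^] h \<otimes> y" using a0 y by simp_all
  note iu = V_unit[OF u(1,2)]
  have K: "u \<in> carrier K" "inv u \<in> carrier K" "y \<in> carrier K" "t [^] h \<in> carrier K" using u iu a by simp_all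
  have "c \<otimes> (inv u \<otimes> y) = t [^] h \<otimes> ((u \<otimes> inv u) \<otimes> y)" unfolding u(3) using K by (simp only: m_assoc m_closed)
  then have "c \<otimes> (inv u \<otimes> y) = t [^] h \<otimes> y" using iu K by simp
  moreover have "inv u \<otimes> y \<in> V" using iu a by simp
  ultimately show "\<exists>a\<in>A. \<exists>r\<in>V. x = a \<oplus> c \<otimes> r" using a by metis
qed

text \<open>Ensures that \<open>V\<close> is not bad, which excludes the case R = V for a bad stable
  ring.\<close>

lemma finite_normalization_V: "finite_normalization K V"
proof -
  have "V \<subseteq> integral_closure K V (quot_field K V)"
  proof
    fix x assume x: "x \<in> V"
    show "x \<in> integral_closure K V (quot_field K V)"
      by (rule almost_imp_integral[OF mid_V noetherian_V, of x \<one>]) (use x in simp_all)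
  qed
  then have e: "integral_closure K V (quot_field K V) = V" using integral_closure_V by blast
  show ?thesis
    unfolding finite_normalization_def e
    by (rule finite_moduleI[OF mid_V noetherian_V V, of \<one>]) simp_all
qed

theorem bad_stable_iff_trace:
  assumes RV: "subring R K" "A \<subseteq> R" "R \<subset> V"
  shows "bad_stable_domain K R \<and> tightly_dominates K R A \<longleftrightarrow>
    (\<exists>J. P_primary Ahat PA J \<and> ideal_power Ahat PA 2 \<subseteq> J \<and> R = fraction_trace K A J)"
proof
  assume bt: "bad_stable_domain K R \<and> tightly_dominates K R A"
  have RV': "R \<subseteq> V" using RV(3) by blast
  interpret tight_stable K A V t R
    by (rule tight_stable.intro[OF bad_tight_stable_mid(1)[OF RV(2) RV' conjunct1[OF bt] conjunct2[OF bt]]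
      tight_stable_axioms.intro[OF bad_tight_stable_mid(2)[OF RV(2) RV' conjunct1[OF bt] conjunct2[OF bt]]]])
  show "\<exists>J. P_primary Ahat PA J \<and> ideal_power Ahat PA 2 \<subseteq> J \<and> R = fraction_trace K A J"
    using JR_primary JR_square R_eq_trace by blast
next
  assume "\<exists>J. P_primary Ahat PA J \<and> ideal_power Ahat PA 2 \<subseteq> J \<and> R = fraction_trace K A J"
  then obtain J where J: "P_primary Ahat PA J" "ideal_power Ahat PA 2 \<subseteq> J" "R = fraction_trace K A J" by blast
  have ne: "fraction_trace K A J \<noteq> V" using RV(3) J(3) by blast
  note bad = fraction_trace_bad[OF primary_props(1,2)[OF J(1)] J(2) _ ne]
  have "bad_noetherian_stable_domain K R" "tightly_dominates K R A"
    unfolding J(3) by (rule bad, rule primary_props(3)[OF J(1)], assumption+)+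
  then show "bad_stable_domain K R \<and> tightly_dominates K R A"
    unfolding bad_noetherian_stable_domain_def by blast
qed

theorem bad_stable_contains_trace:
  assumes RV: "A \<subseteq> R" "R \<subseteq> V" and bad: "bad_stable_domain K R" and tight: "tightly_dominates K R A"
  shows "bad_noetherian_stable_domain K (fraction_trace K A SP)" "fraction_trace K A SP \<subseteq> R"
proof -
  interpret tight_stable K A V t R
    by (rule tight_stable.intro[OF bad_tight_stable_mid(1)[OF RV bad tight]
      tight_stable_axioms.intro[OF bad_tight_stable_mid(2)[OF RV bad tight]]])
  show sub: "fraction_trace K A SP \<subseteq> R"
    using fraction_trace_mono[OF SP_least[OF JR_primary JR_square]] R_eq_trace by simp
  \<comment> \<open>The trace is contained in \<open>R\<close>, so if it were \<open>V\<close>, then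
    \<open>R\<close> would be \<open>V\<close>, whose normalization is finite.\<close>
  have ne: "fraction_trace K A SP \<noteq> V"
  proof
    assume "fraction_trace K A SP = V"
    then have "R = V" using sub RV(2) by blast
    then show False using bad finite_normalization_V by (simp add: bad_stable_domain_def)
  qed
  show "bad_noetherian_stable_domain K (fraction_trace K A SP)"
    by (rule fraction_trace_bad(1)[OF SP_props(1-3) _ ne]) (rule SP_props(4))
qed

end

text \<open>If every power of \<open>t\<close> divides \<open>x\<close>, consider the union of the
  ideals (xV : t^h). It is principal, so one exponent h serves for all its elements. Applied to
  x/t^(h+1), this shows that \<open>t\<close> is a unit.\<close>

lemma (in field) principal_valuation:
  assumes V: "subring V R" and princ: "\<And>I. ideal I (sub R V) \<Longrightarrow> \<exists>g\<in>V. \<forall>x. x \<in> I \<longleftrightarrow> (\<exists>w\<in>V. x = g \<otimes> w)"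
    and t: "t \<in> V" "\<And>w. w \<in> V \<Longrightarrow> t \<otimes> w \<noteq> \<one>" and unit: "\<And>x. x \<in> V \<Longrightarrow> (\<exists>w\<in>V. x = t \<otimes> w) \<or> x \<noteq> \<zero> \<and> inv x \<in> V"
    and x: "x \<in> V" "x \<noteq> \<zero>"
  shows "\<exists>h::nat. \<exists>u\<in>V. x = t [^] h \<otimes> u \<and> u \<noteq> \<zero> \<and> inv u \<in> V"
proof (rule ccontr)
  assume none: "\<not> ?thesis"
  note VE = subringE[OF V]
  have VK: "y \<in> carrier R" if "y \<in> V" for y using that VE(1) by blast
  have pw: "t [^] (h::nat) \<in> V" for h by (induct h) (use VE t in simp_all)
  have xd: "\<exists>y\<in>V. x = t [^] h \<otimes> y" for h :: nat
  proof (induct h)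
    case 0
    show ?case using x VK by (intro bexI[of _ x]) simp_all
  next
    case (Suc h)
    then obtain y where y: "y \<in> V" "x = t [^] h \<otimes> y" by blast
    then obtain w where w: "w \<in> V" "y = t \<otimes> w" using unit[OF y(1)] none by blast
    have "x = t [^] Suc h \<otimes> w" unfolding y(2) w(2) using VK[OF w(1)] VK[OF t(1)] by (simp add: m_assoc)
    then show ?case using w(1) by blast
  qed
  define I where "I = {z \<in> V. \<exists>h::nat. \<exists>v\<in>V. t [^] h \<otimes> z = x \<otimes> v}"
  have "ideal I (sub R V)"
    unfolding ideal_sub_iff[OF V]
  proof (intro conjI ballI)
    show "I \<subseteq> V" unfolding I_def by blast
    have "t [^] (0::nat) \<otimes> \<zero> = x \<otimes> \<zero>" using VK[OF x(1)] by simp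
    then show "\<zero> \<in> I" unfolding I_def using VE(2) by blast
  next
    fix y z assume "y \<in> I" "z \<in> I"
    then obtain h k v w where y: "y \<in> V" "v \<in> V" "t [^] (h::nat) \<otimes> y = x \<otimes> v"
      and z: "z \<in> V" "w \<in> V" "t [^] (k::nat) \<otimes> z = x \<otimes> w" unfolding I_def by blast
    define p q where "p = t [^] h" and "q = t [^] k"
    have pq: "p \<in> V" "q \<in> V" "t [^] (h + k) = p \<otimes> q" using pw VK[OF t(1)] by (simp_all add: p_def q_def nat_pow_mult)
    have K: "y \<in> carrier R" "z \<in> carrier R" "v \<in> carrier R" "w \<in> carrier R" "p \<in> carrier R" "q \<in> carrier R" "x \<in> carrier R"
      using y z pq x VK by simp_all
    have "p \<otimes> q \<otimes> (y \<oplus> z) = q \<otimes> (p \<otimes> y) \<oplus> p \<otimes> (q \<otimes> z)" using K by (simp add: r_distr m_ac)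
    also have "\<dots> = q \<otimes> (x \<otimes> v) \<oplus> p \<otimes> (x \<otimes> w)" using y(3) z(3) by (simp add: p_def q_def)
    also have "\<dots> = x \<otimes> (q \<otimes> v \<oplus> p \<otimes> w)" using K by (simp add: r_distr m_ac)
    finally have "t [^] (h + k) \<otimes> (y \<oplus> z) = x \<otimes> (q \<otimes> v \<oplus> p \<otimes> w)" unfolding pq(3) .
    moreover have "q \<otimes> v \<oplus> p \<otimes> w \<in> V" "y \<oplus> z \<in> V" using VE y z pq by simp_all
    ultimately show "y \<oplus> z \<in> I" unfolding I_def by blast
  next
    fix s y assume s: "s \<in> V" and "y \<in> I"
    then obtain h v where y: "y \<in> V" "v \<in> V" "t [^] (h::nat) \<otimes> y = x \<otimes> v" unfolding I_def by blast
    have K: "y \<in> carrier R" "s \<in> carrier R" "v \<in> carrier R" "x \<in> carrier R" "t [^] h \<in> carrier R" using y s x VK pw by simp_all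
    have "t [^] h \<otimes> (s \<otimes> y) = s \<otimes> (t [^] h \<otimes> y)" using K by (simp only: m_ac m_closed)
    also have "\<dots> = x \<otimes> (s \<otimes> v)" unfolding y(3) using K by (simp only: m_ac m_closed)
    finally have "t [^] h \<otimes> (s \<otimes> y) = x \<otimes> (s \<otimes> v)" .
    moreover have "s \<otimes> v \<in> V" "s \<otimes> y \<in> V" using VE s y by simp_all
    ultimately show "s \<otimes> y \<in> I" unfolding I_def by blast
  qed
  then obtain g where g: "g \<in> V" "\<And>z. z \<in> I \<longleftrightarrow> (\<exists>w\<in>V. z = g \<otimes> w)" using princ by blast
  have "g = g \<otimes> \<one>" using VK[OF g(1)] by simp
  then have "g \<in> I" using g(2) VE(3) by blast
  then obtain h v where v: "v \<in> V" "t [^] (h::nat) \<otimes> g = x \<otimes> v" unfolding I_def by blast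
  obtain y where y: "y \<in> V" "x = t [^] Suc h \<otimes> y" using xd by blast
  have "t [^] Suc h \<otimes> y = x \<otimes> \<one>" using y(2) VK[OF x(1)] by simp
  then have "y \<in> I" unfolding I_def using y(1) VE(3) by blast
  then obtain w where w: "w \<in> V" "y = g \<otimes> w" using g(2) by blast
  have K: "x \<in> carrier R" "v \<in> carrier R" "w \<in> carrier R" "t \<in> carrier R" "g \<in> carrier R" "t [^] h \<in> carrier R"
    using x v w t g VK pw by simp_all
  have "x = t \<otimes> (t [^] h \<otimes> g) \<otimes> w" using y(2) w(2) K by (simp add: m_ac)
  also have "\<dots> = x \<otimes> (t \<otimes> (v \<otimes> w))" unfolding v(2) using K by (simp add: m_ac)
  finally have e: "x \<otimes> \<one> = x \<otimes> (t \<otimes> (v \<otimes> w))" using K by simp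
  have "\<one> = t \<otimes> (v \<otimes> w)" by (rule m_lcancel[OF x(2) K(1), THEN iffD1, OF _ _ e]) (use K in simp_all)
  then show False using t(2)[of "v \<otimes> w"] VE(6) v(1) w(1) by metis
qed

text \<open>The uniformizer \<open>t\<close> has to be found in \<open>A\<close>. It is taken in the
  maximal ideal of \<open>A\<close> but outside the square of the maximal ideal of
  \<open>V\<close>.\<close>

lemma (in field) ex_tight_pair:
  assumes sA: "subdomain A R" and sV: "subdomain V R" and loc: "local_noetherian_domain (sub R A)"
    and dvr: "DVR (sub R V)" and tight: "tightly_dominates R V A"
  obtains t where "tight_pair R A V t"
proof -
  let ?T = "sub R V"
  let ?m = "max_ideal (sub R A)"
  let ?n = "max_ideal ?T"
  have A: "subring A R" and V: "subring V R" using sA sV by (auto dest: subdomain.axioms subcring.axioms)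
  note VE = subringE[OF V] and AE = subringE[OF A]
  have VK: "y \<in> carrier R" if "y \<in> V" for y using that VE(1) by blast
  have bir: "birationally_dominates R V A" using tight by (simp add: tightly_dominates_def finitely_dominates_def)
  have AV: "A \<subseteq> V" and qA: "quasilocal (sub R A)" and qV: "quasilocal ?T" and qq: "quot_field R A = quot_field R V"
    and mn: "?m \<subseteq> ?n" using bir by (simp_all add: birationally_dominates_def)
  have rV: "ring ?T" by (rule subring_is_ring[OF V])
  have mA: "ideal ?m (sub R A)" by (rule maximalideal.axioms(1)[OF max_ideal_maximal[OF qA]])
  have nI: "ideal ?n ?T" by (rule maximalideal.axioms(1)[OF max_ideal_maximal[OF qV]])
  note nE = nI[unfolded ideal_sub_iff[OF V]] and mE = mA[unfolded ideal_sub_iff[OF A]]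
  have n1: "\<one> \<notin> ?n"
    using ideal.one_imp_carrier[OF nI] maximalideal.I_notcarr[OF max_ideal_maximal[OF qV]] by auto
  have unitV: "x \<noteq> \<zero>" "inv x \<in> V" if "x \<in> V" "x \<notin> ?n" for x using quasilocal_unit[OF V qV that] by blast+
  have unitA: "x \<noteq> \<zero>" "inv x \<in> A" if "x \<in> A" "x \<notin> ?m" for x using quasilocal_unit[OF A qA that] by blast+
  have princ: "\<exists>g\<in>V. \<forall>x. x \<in> I \<longleftrightarrow> (\<exists>w\<in>V. x = g \<otimes> w)" if I: "ideal I ?T" for I
  proof -
    have pd: "principal_domain ?T" using dvr by (simp add: DVR_def)
    obtain g where g: "g \<in> V" "I = PIdl\<^bsub>?T\<^esub> g" using principal_domain.exists_gen[OF pd I] by auto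
    have c: "w \<otimes> g = g \<otimes> w" if "w \<in> V" for w using m_comm[OF VK[OF that] VK[OF g(1)]] .
    have "x \<in> I \<longleftrightarrow> (\<exists>w\<in>V. x = w \<otimes> g)" for x
      unfolding g(2) cgenideal_def by auto
    then have "x \<in> I \<longleftrightarrow> (\<exists>w\<in>V. x = g \<otimes> w)" for x using c by auto
    then show ?thesis using g(1) by blast
  qed
  obtain p where p: "p \<in> V" "\<And>x. x \<in> ?n \<longleftrightarrow> (\<exists>w\<in>V. x = p \<otimes> w)" using princ[OF nI] by blast
  have "p = p \<otimes> \<one>" using VK[OF p(1)] by simp
  then have pn: "p \<in> ?n" using p VE(3) by blast
  \<comment> \<open>If the generator were zero, every nonzero element of \<open>V\<close> would be a
    unit, but \<open>V\<close> is not a field.\<close>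
  have p0: "p \<noteq> \<zero>"
  proof
    assume "p = \<zero>"
    then have n0: "x = \<zero>" if "x \<in> ?n" for x using that p(2) VK by auto
    have "Units ?T = carrier ?T - {\<zero>\<^bsub>?T\<^esub>}"
    proof (intro equalityI subsetI)
      fix x assume "x \<in> Units ?T"
      then obtain y where "x \<in> V" "y \<in> V" "y \<otimes> x = \<one>" unfolding Units_def by auto
      then show "x \<in> carrier ?T - {\<zero>\<^bsub>?T\<^esub>}" using VK by auto
    next
      fix x assume "x \<in> carrier ?T - {\<zero>\<^bsub>?T\<^esub>}"
      then have x: "x \<in> V" "x \<noteq> \<zero>" by simp_all
      have i: "inv x \<in> V" using unitV(2)[OF x(1)] n0 x(2) by blast
      have "inv x \<otimes> x = \<one>" "x \<otimes> inv x = \<one>" using x VK by simp_all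
      then show "x \<in> Units ?T" unfolding Units_def using x(1) i by auto
    qed
    then have "field ?T" by (rule cring.cring_fieldI[OF subring_cring[OF V]])
    then show False using dvr by (simp add: DVR_def)
  qed
  have decomp: "\<exists>a\<in>A. \<exists>j\<in>extended_max_ideal R A V. x = a \<oplus> j" if "x \<in> V" for x
  proof -
    have "V = A <+>\<^bsub>R\<^esub> extended_max_ideal R A V" using tight unfolding tightly_dominates_def by blast
    then show ?thesis using that unfolding set_add_def' by blast
  qed
  have mV: "?m \<subseteq> carrier ?T" using mE AV by auto
  have ext_min: "extended_max_ideal R A V \<subseteq> I" if "ideal I ?T" "?m \<subseteq> I" for I
    unfolding extended_max_ideal_def by (rule ring.genideal_minimal[OF rV that])
  have ext_n: "extended_max_ideal R A V \<subseteq> ?n" by (rule ext_min[OF nI mn])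
  have ext_I: "ideal (extended_max_ideal R A V) ?T" unfolding extended_max_ideal_def by (rule ring.genideal_ideal[OF rV mV])
  note eE = ext_I[unfolded ideal_sub_iff[OF V]]
  have An: "a \<in> ?m" if "a \<in> A" "a \<in> ?n" for a
  proof (rule ccontr)
    assume "a \<notin> ?m"
    then have i: "a \<noteq> \<zero>" "inv a \<in> V" using unitA[OF that(1)] AV by auto
    have "inv a \<otimes> a \<in> ?n" using nE i(2) that(2) by blast
    then show False using n1 i(1) that(1) AV VK by auto
  qed
  \<comment> \<open>In x = a + j, with j in the extended ideal, \<open>a\<close> is a nonunit of
    \<open>V\<close> and thus lies in the maximal ideal of \<open>A\<close>.\<close>
  have n_ext: "?n \<subseteq> extended_max_ideal R A V"
  proof
    fix x assume x: "x \<in> ?n"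
    then obtain a j where a: "a \<in> A" "j \<in> extended_max_ideal R A V" "x = a \<oplus> j" using decomp nE by blast
    have jn: "j \<in> ?n" using a(2) ext_n by blast
    have K: "a \<in> carrier R" "j \<in> carrier R" using a(1) jn AV nE VK by auto
    have "\<ominus> \<one> \<otimes> j \<in> ?n" using nE jn VE(5)[OF VE(3)] by blast
    then have "x \<oplus> \<ominus> \<one> \<otimes> j \<in> ?n" using nE x by blast
    moreover have "x \<oplus> \<ominus> \<one> \<otimes> j = a" unfolding a(3) using K by (simp add: l_minus a_assoc r_neg)
    ultimately have "a \<in> ?m" using An[OF a(1)] by simp
    then have "a \<in> extended_max_ideal R A V" unfolding extended_max_ideal_def using ring.genideal_self[OF rV mV] by blast
    then show "x \<in> extended_max_ideal R A V" unfolding a(3) using eE a(2) by blast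
  qed
  \<comment> \<open>The square of the maximal ideal of \<open>V\<close>. If it contained the maximal
    ideal of \<open>A\<close>, it would contain the extension and hence \<open>p\<close>, making
    \<open>p\<close> a multiple of itself by a nonunit.\<close>
  define Q where "Q = {p \<otimes> w |w. w \<in> ?n}"
  have Q: "ideal Q ?T"
    unfolding ideal_sub_iff[OF V]
  proof (intro conjI ballI)
    show "Q \<subseteq> V" unfolding Q_def using nE p(1) VE(6) by blast
    have "\<zero> = p \<otimes> \<zero>" using VK[OF p(1)] by simp
    then show "\<zero> \<in> Q" unfolding Q_def using nE by blast
  next
    fix x y assume "x \<in> Q" "y \<in> Q"
    then obtain v w where v: "v \<in> ?n" "w \<in> ?n" "x = p \<otimes> v" "y = p \<otimes> w" unfolding Q_def by blast
    have K: "v \<in> carrier R" "w \<in> carrier R" "p \<in> carrier R" using v nE VK p by auto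
    have "x \<oplus> y = p \<otimes> (v \<oplus> w)" unfolding v(3,4) using K by (simp add: r_distr)
    then show "x \<oplus> y \<in> Q" unfolding Q_def using nE v by blast
  next
    fix s x assume s: "s \<in> V" and "x \<in> Q"
    then obtain v where v: "v \<in> ?n" "x = p \<otimes> v" unfolding Q_def by blast
    have K: "v \<in> carrier R" "s \<in> carrier R" "p \<in> carrier R" using v s nE VK p by auto
    have "s \<otimes> x = p \<otimes> (s \<otimes> v)" unfolding v(2) using K by (simp add: m_lcomm)
    then show "s \<otimes> x \<in> Q" unfolding Q_def using nE v s by blast
  qed
  have "\<not> ?m \<subseteq> Q"
  proof
    assume "?m \<subseteq> Q"
    then have "p \<in> Q" using ext_min[OF Q] n_ext pn by blast
    then obtain w where w: "w \<in> ?n" "p = p \<otimes> w" unfolding Q_def by blast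
    have K: "w \<in> carrier R" "p \<in> carrier R" using w(1) nE VK p by auto
    have e: "p \<otimes> \<one> = p \<otimes> w" using w(2) K by simp
    have "\<one> = w" by (rule m_lcancel[OF p0 K(2), THEN iffD1, OF _ _ e]) (use K in simp_all)
    then show False using n1 w(1) by simp
  qed
  \<comment> \<open>Being outside \<open>Q\<close>, \<open>t\<close> is \<open>p\<close> times a
    unit of \<open>V\<close>, so it generates the same ideal.\<close>
  then obtain t where t: "t \<in> ?m" "t \<notin> Q" by blast
  have tn: "t \<in> ?n" and tA: "t \<in> A" and tV: "t \<in> V" using t mn mE AV by auto
  obtain v where v: "v \<in> V" "t = p \<otimes> v" using tn p(2) by blast
  have vn: "v \<notin> ?n" using t(2) v(2) unfolding Q_def by blast
  have nt: "\<exists>y\<in>V. x = t \<otimes> y" if x: "x \<in> ?n" for x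
  proof -
    obtain w where w: "w \<in> V" "x = p \<otimes> w" using x p(2) by blast
    have K: "w \<in> carrier R" "v \<in> carrier R" "p \<in> carrier R" "inv v \<in> carrier R" using w v p VK unitV[OF v(1) vn] by simp_all
    have "t \<otimes> (inv v \<otimes> w) = p \<otimes> ((v \<otimes> inv v) \<otimes> w)" unfolding v(2) using K by (simp only: m_assoc m_closed)
    also have "\<dots> = x" using K unitV(1)[OF v(1) vn] w(2) by simp
    finally have "x = t \<otimes> (inv v \<otimes> w)" ..
    then show ?thesis using VE(6)[OF unitV(2)[OF v(1) vn] w(1)] by blast
  qed
  have t_nonunit: "t \<otimes> x \<noteq> \<one>" if x: "x \<in> V" for x
  proof
    assume "t \<otimes> x = \<one>"
    then have "x \<otimes> t = \<one>" using m_comm[OF VK[OF x] VK[OF tV]] by simp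
    moreover have "x \<otimes> t \<in> ?n" using nE x tn by blast
    ultimately show False using n1 by simp
  qed
  have "tight_pair R A V t"
  proof (intro tight_pair.intro tight_pair_axioms.intro)
    show "field R" by (rule field_axioms)
    show "subring A R" "subring V R" "A \<subseteq> V" "t \<in> A" by (rule A V AV tA)+
    have "\<zero> \<in> Q" using Q[unfolded ideal_sub_iff[OF V]] by blast
    then show "t \<noteq> \<zero>" using t(2) by blast
    show "t \<otimes> x \<noteq> \<one>" if "x \<in> V" for x by (rule t_nonunit[OF that])
    show "noetherian_ring (sub R A)" using loc by (simp add: local_noetherian_domain_def noetherian_domain_def)
  next
    fix x assume x: "x \<in> V"
    obtain a j where a: "a \<in> A" "j \<in> extended_max_ideal R A V" "x = a \<oplus> j" using decomp[OF x] by blast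
    then show "\<exists>a\<in>A. \<exists>y\<in>V. x = a \<oplus> t \<otimes> y" using nt[of j] ext_n by blast
  next
    fix x assume x: "x \<in> V" "x \<noteq> \<zero>"
    show "\<exists>h::nat. \<exists>u\<in>V. x = t [^] h \<otimes> u \<and> u \<noteq> \<zero> \<and> inv u \<in> V"
    proof (rule principal_valuation[OF V princ tV t_nonunit _ x])
      show "(\<exists>w\<in>V. y = t \<otimes> w) \<or> y \<noteq> \<zero> \<and> inv y \<in> V" if "y \<in> V" for y using nt unitV that by blast
    qed
  next
    fix a assume a: "a \<in> A" "a \<noteq> \<zero>" "inv a \<in> V"
    have "a \<notin> ?m"
    proof
      assume "a \<in> ?m"
      then have "inv a \<otimes> a \<in> ?n" using mn nE a(3) by blast
      then show False using n1 a AV VK by auto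
    qed
    then show "inv a \<in> A" by (rule unitA(2)[OF a(1)])
  next
    fix x assume x: "x \<in> V"
    have "x = x \<otimes> inv \<one>" using VK[OF x] by simp
    then have "x \<in> quot_field R V" unfolding quot_field_def using x VE(3) by fastforce
    then have "x \<in> quot_field R A" using qq by simp
    then obtain a b where ab: "a \<in> A" "b \<in> A" "b \<noteq> \<zero>" "x = a \<otimes> inv b" unfolding quot_field_def by blast
    have K: "a \<in> carrier R" "b \<in> carrier R" "inv b \<in> carrier R" using ab AV VK by auto
    have "b \<otimes> x = a \<otimes> (inv b \<otimes> b)" unfolding ab(4) using K by (simp only: m_ac m_closed)
    then have "b \<otimes> x = a" using K ab(3) by simp
    then show "\<exists>a\<in>A. \<exists>b\<in>A. b \<noteq> \<zero> \<and> b \<otimes> x = a" using ab by blast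
  qed
  then show ?thesis by (rule that)
qed

theorem theorem5p3:
  fixes K :: "('a, 'm) ring_scheme" and A V :: "'a set" and P :: "(nat \<Rightarrow> 'a set) set"
  assumes "field K" and "subdomain A K" and "subdomain V K"
    and "local_noetherian_domain (sub K A)" and "\<not> DVR (sub K A)"
    and "DVR (sub K V)" and "tightly_dominates K V A"
    and P_def: "P = completion_kernel K A V"
  shows "{a \<in> A. to_completion (sub K A) a \<in> P} = {\<zero>\<^bsub>K\<^esub>} \<and>
    (\<forall>R. subring R K \<and> A \<subset> R \<and> R \<subset> V \<longrightarrow>
      (bad_stable_domain K R \<and> tightly_dominates K R A \<longleftrightarrow>
        (\<exists>J. P_primary (completion (sub K A)) P J \<and>
             ideal_power (completion (sub K A)) P 2 \<subseteq> J \<and>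
             R = fraction_trace K A J)) \<and>
      (bad_stable_domain K R \<and> tightly_dominates K R A \<longrightarrow> noetherian_ring (sub K R))) \<and>
    (\<forall>R. A \<subseteq> R \<and> R \<subseteq> V \<and> bad_stable_domain K R \<and> tightly_dominates K R A \<longrightarrow>
      bad_noetherian_stable_domain K
        (fraction_trace K A (symbolic_power (completion (sub K A)) P 2)) \<and>
      fraction_trace K A (symbolic_power (completion (sub K A)) P 2) \<subseteq> R)"
proof -
  obtain t where "tight_pair K A V t"
    by (rule field.ex_tight_pair[OF assms(1-4,6,7)])
  then interpret tight_pair K A V t .
  show ?thesis
    unfolding P_def
  proof (intro conjI allI impI)
    show "{a \<in> A. to_completion (sub K A) a \<in> PA} = {\<zero>\<^bsub>K\<^esub>}" by (rule P_contraction)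
  next
    fix R assume R: "subring R K \<and> A \<subset> R \<and> R \<subset> V"
    show "(bad_stable_domain K R \<and> tightly_dominates K R A) =
      (\<exists>J. P_primary Ahat PA J \<and> ideal_power Ahat PA 2 \<subseteq> J \<and> R = fraction_trace K A J)"
      by (rule bad_stable_iff_trace) (use R in auto)
  next
    fix R assume R: "subring R K \<and> A \<subset> R \<and> R \<subset> V" and b: "bad_stable_domain K R \<and> tightly_dominates K R A"
    then have "stable_mid K A V t R" by (intro bad_tight_stable_mid(1)) auto
    then show "noetherian_ring (sub K R)" by (rule stable_mid.R_noeth)
  next
    fix R assume R: "A \<subseteq> R \<and> R \<subseteq> V \<and> bad_stable_domain K R \<and> tightly_dominates K R A"
    show "bad_noetherian_stable_domain K (fraction_trace K A SP)" "fraction_trace K A SP \<subseteq> R"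
      using bad_stable_contains_trace R by blast+
  qed
qed

end
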